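(* Let $c>3$, let $e$ be a real number, and let $t:\mathbb N\to\mathbb N$ satisfy $t(n)\in\omega(n\log n)$. Let $$\mathcal Y^t_c=\{(\pi,x):\mathrm{CI}^t(\pi,x)\le \mathrm C(\pi)+c\log|\pi x|\},\qquad \mathcal N_e=\{(\pi,x):\mathrm C(\pi,x)\ge \mathrm C(\pi)+e\log|\pi x|\},$$ where $\pi,x$ range over binary strings. If the promise problem $(\mathcal Y^t_c,\mathcal N_e)$ is in $\mathsf{ioBPP}$, then there exists no key-agreement protocol.
   Context: Conventions. $\log$ is base 2, $|z|$ is the length of a string $z$, and "for large $n$" means for all sufficiently large $n$. A pair $(\pi,x)$ of binary strings is represented by the binary string $0\pi_1 0\pi_2\cdots 0\pi_{|\pi|}1x$, so $|(\pi,x)|=2|\pi|+|x|+1$. Protocols. Two randomized algorithms A (Alice) and B (Bob) are given the same input $n\in\mathbb N$. They interact by alternatingly sending a single bit (one is idle while the other computes its reply), and at some point both terminate. The transcript $\pi$ is the string of exchanged bits. Each algorithm also produces a private output string; these are $x$ (Alice) and $y$ (Bob). A protocol is a mapping from $n$ to a random triple $(\pi,x,y)$ generated in this way. It is $t$-time bounded if such A and B exist with runtime $O(t(n))$. A protocol has agreement $\alpha:\mathbb N\to[0,1]$ if for large $n$, $\Pr[x=y]\ge\alpha(n)$. It is $\varepsilon$-secure, for $\varepsilon:\mathbb N\to[0,1]$, if for every probabilistic polynomial time algorithm $E$ and large $n$, $\Pr[E(0^n,\pi)=x]\le\varepsilon(n)$. A key-agreement protocol is a protocol that is $n^{O(1)}$-time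 bounded and that, for all $c>0$, has agreement $1-\frac1{n^c}$ and is $\frac1{n^c}$-secure. Kolmogorov complexity. $\mathrm C(x|y)=\min\{|p|:M(p,y)=x\}$, where $M$ is a fixed machine that minimizes this function up to an additive constant (plain complexity); $\mathrm C(x)$ is the case of empty $y$, and $\mathrm C(\pi,x)$ is the complexity of the pair. Interactive Kolmogorov complexity. Let $U,V$ be deterministic Turing machines, each with private input, work and output tapes, and with a shared communication tape. $U(a)\leftrightarrow V(b)$ denotes the triple $(\pi,x,y)$ obtained as follows: $U$ and $V$ start with $a$ and $b$ on their respective input tapes; they alternatingly compute a single bit and write it on the communication tape; after both halt, $\pi$ is the string of communicated bits and $x,y$ are the contents of the private output tapes of $U$ and $V$. For $t:\mathbb N\to\mathbb N$, $$\mathrm{CI}^t_{U,V}(\pi,x)=\min\{|a|+|b|:(\pi,x,x)=U(a)\leftrightarrow V(b)\},$$ where both $U$ and $V$ are required to terminate after at most $t(|\pi x|)$ steps. The pair $U,V$ is optimal if for every pair $\widetilde U,\widetilde V$ there is a constant $c$ such that for all $\pi,x$ and all $t$ (with values at least 2), $\mathrm{CI}^{c\,t\log t}_{U,V}(\pi,x)\le \mathrm{CI}^t_{\widetilde U,\widetilde V}(\pi,x)+c$. An optimal pair is fixed and $\mathrm{CI}^t$ denotes $\mathrm{CI}^t_{U,V}$ for it. Promise problems. A promise problem is a pair $(\mathcal Y,\mathcal N)$ of sets of strings. It is in $\mathsf{ioBPP}$ if there exist a probabilistic polynomial time algorithm $A$ and infinitely many $n$ such that for all $z\in\mathcal Y\cap\{0,1\}^n$,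 $\Pr[A(z)=\text{"outside }\mathcal N\text{"}]\ge 2/3$, and for all $z\in\mathcal N\cap\{0,1\}^n$, $\Pr[A(z)=\text{"outside }\mathcal Y\text{"}]\ge2/3$. *)

theory Defs
  imports "HOL-Probability.Probability" "HOL-Library.Landau_Symbols"
begin

section \<open>Strings and pairs\<close>

type_synonym bits = "bool list"

definition encode_pair :: "bits \<Rightarrow> bits \<Rightarrow> bits" where
  "encode_pair u v = concat (map (\<lambda>b. [False, b]) u) @ True # v"

lemma length_encode_pair: "length (encode_pair u v) = 2 * length u + length v + 1"
  by (induction u) (simp_all add: encode_pair_def)

lemma encode_pair_inject: "encode_pair u v = encode_pair u' v' \<longleftrightarrow> u = u' \<and> v = v'"
proof (induction u arbitrary: u')
  case Nil
  show ?case by (cases u') (auto simp: encode_pair_def)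
next
  case (Cons b u)
  show ?case
  proof (cases u')
    case Nil
    then show ?thesis by (auto simp: encode_pair_def)
  next
    case (Cons b' w)
    then show ?thesis using Cons.IH[of w] by (auto simp: encode_pair_def)
  qed
qed

section \<open>Turing machines\<close>

text \<open>
  One machine type serves for deterministic, randomized and interactive computation.  A machine has
  a read-only input tape, a communication tape on which it has a reading head of its own, any fixed
  number of read-write work tapes, and a write-only output tape.  All heads move on two-way infinite
  tapes.  States and work symbols are natural numbers below given bounds, with initial state 0,
  halting state 1 and blank work symbol 0; blank cells of the input and communication tapes are read
  as \<^const>\<open>None\<close>.  In every step the transition function is supplied with a fresh coin; a
  deterministic machine ignores it.
\<close>

datatype move = MoveLeft | Stay | MoveRight

fun offset :: "move \<Rightarrow> int" where
  "offset MoveLeft = - 1"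
| "offset Stay = 0"
| "offset MoveRight = 1"

record action =
  next_state :: nat
  input_move :: move
  comm_move :: move
  work_writes :: "(nat \<times> move) list"
  emit :: "bool option"  \<comment> \<open>bit appended to the output tape\<close>
  send :: "bool option"  \<comment> \<open>bit appended to the communication tape\<close>

record tm =
  num_work :: nat
  num_symbols :: nat
  num_states :: nat
  delta :: "nat \<Rightarrow> bool \<Rightarrow> bool option \<Rightarrow> bool option \<Rightarrow> nat list \<Rightarrow> action"
    \<comment> \<open>state, coin, scanned input cell, scanned communication cell, scanned work symbols\<close>

definition wf_tm :: "tm \<Rightarrow> bool" where
  "wf_tm M \<longleftrightarrow> num_states M \<ge> 2 \<and> num_symbols M \<ge> 1 \<and>
     (\<forall>q coin i j ws. q < num_states M \<longrightarrow> length ws = num_work M \<longrightarrow>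
        (\<forall>s\<in>set ws. s < num_symbols M) \<longrightarrow>
        (let act = delta M q coin i j ws in
           next_state act < num_states M \<and> length (work_writes act) = num_work M \<and>
           (\<forall>(s, m)\<in>set (work_writes act). s < num_symbols M)))"

definition deterministic :: "tm \<Rightarrow> bool" where
  "deterministic M \<longleftrightarrow> (\<forall>q i j ws. delta M q True i j ws = delta M q False i j ws)"

record conf =
  state :: nat
  input_pos :: int
  comm_pos :: int
  work :: "((int \<Rightarrow> nat) \<times> int) list"
  out_tape :: bits
  steps :: nat

definition init_conf :: "tm \<Rightarrow> conf" where
  "init_conf M = \<lparr>state = 0, input_pos = 0, comm_pos = 0,
     work = replicate (num_work M) (\<lambda>_. 0, 0), out_tape = [], steps = 0\<rparr>"

definition halted :: "conf \<Rightarrow> bool" where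
  "halted cf \<longleftrightarrow> state cf = 1"

definition cell :: "bits \<Rightarrow> int \<Rightarrow> bool option" where
  "cell w i = (if 0 \<le> i \<and> i < int (length w) then Some (w ! nat i) else None)"

definition current_action :: "tm \<Rightarrow> (nat \<Rightarrow> bool) \<Rightarrow> bits \<Rightarrow> bits \<Rightarrow> conf \<Rightarrow> action" where
  "current_action M coins w \<pi> cf =
     delta M (state cf) (coins (steps cf)) (cell w (input_pos cf)) (cell \<pi> (comm_pos cf))
       (map (\<lambda>(tp, i). tp i) (work cf))"

definition perform :: "action \<Rightarrow> conf \<Rightarrow> conf" where
  "perform act cf = \<lparr>
     state = next_state act,
     input_pos = input_pos cf + offset (input_move act),
     comm_pos = comm_pos cf + offset (comm_move act),
     work = map2 (\<lambda>(s, m) (tp, i). (tp(i := s), i + offset m)) (work_writes act) (work cf),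
     out_tape = out_tape cf @ (case emit act of None \<Rightarrow> [] | Some b \<Rightarrow> [b]),
     steps = Suc (steps cf)\<rparr>"

subsection \<open>Stand-alone computation\<close>

text \<open>The communication tape stays blank, and bits sent are lost.\<close>

definition solo_step :: "tm \<Rightarrow> (nat \<Rightarrow> bool) \<Rightarrow> bits \<Rightarrow> conf \<Rightarrow> conf" where
  "solo_step M coins w cf =
     (if halted cf then cf else perform (current_action M coins w [] cf) cf)"

definition runs :: "tm \<Rightarrow> (nat \<Rightarrow> bool) \<Rightarrow> bits \<Rightarrow> nat \<Rightarrow> bits \<Rightarrow> bool" where
  "runs M coins w T z \<longleftrightarrow>
     (let cf = (solo_step M coins w ^^ T) (init_conf M) in halted cf \<and> out_tape cf = z)"

text \<open>Used for deterministic machines only, so the choice of the coins is immaterial.\<close>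

definition computes :: "tm \<Rightarrow> bits \<Rightarrow> bits \<Rightarrow> bool" where
  "computes M w z \<longleftrightarrow> (\<exists>T. runs M (\<lambda>_. False) w T z)"

subsection \<open>Interaction of two machines\<close>

text \<open>
  The first machine moves first.  Sending a bit appends it to the shared communication tape and
  passes the turn to the other machine.  Once a machine has halted, the communication is over: the
  other one resumes if it was waiting for a reply, and has to halt without sending any further bit
  (otherwise the interaction blocks and yields no result).  Since a waiting machine is idle, the
  field \<^const>\<open>steps\<close> counts only a machine's own steps.
\<close>

type_synonym joint_conf = "bool \<times> bits \<times> conf \<times> conf"

fun joint_step ::
  "tm \<Rightarrow> tm \<Rightarrow> bits \<Rightarrow> bits \<Rightarrow> (nat \<Rightarrow> bool) \<Rightarrow> (nat \<Rightarrow> bool) \<Rightarrow> joint_conf \<Rightarrow> joint_conf" where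
  "joint_step U V a b r s (first, \<pi>, u, v) =
     (if halted u \<and> halted v then (first, \<pi>, u, v)
      else if halted v \<or> (first \<and> \<not> halted u) then
        (let act = current_action U r a \<pi> u in
           case send act of
             None \<Rightarrow> (first, \<pi>, perform act u, v)
           | Some m \<Rightarrow> if halted v then (first, \<pi>, u, v)
                       else (False, \<pi> @ [m], perform act u, v))
      else
        (let act = current_action V s b \<pi> v in
           case send act of
             None \<Rightarrow> (first, \<pi>, u, perform act v)
           | Some m \<Rightarrow> if halted u then (first, \<pi>, u, v)
                       else (True, \<pi> @ [m], u, perform act v)))"

fun interaction ::
  "tm \<Rightarrow> tm \<Rightarrow> bits \<Rightarrow> bits \<Rightarrow> (nat \<Rightarrow> bool) \<Rightarrow> (nat \<Rightarrow> bool) \<Rightarrow> real \<Rightarrow> bits \<times> bits \<times> bits \<Rightarrow> bool"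
where
  "interaction U V a b r s T (\<pi>, x, y) \<longleftrightarrow>
     (\<exists>k first u v. (joint_step U V a b r s ^^ k) (True, [], init_conf U, init_conf V)
                      = (first, \<pi>, u, v) \<and>
        halted u \<and> halted v \<and> real (steps u) \<le> T \<and> real (steps v) \<le> T \<and>
        out_tape u = x \<and> out_tape v = y)"

section \<open>Kolmogorov complexity\<close>

text \<open>Minima are infima in the extended naturals, hence infinite over the empty set.\<close>

definition C_cond :: "tm \<Rightarrow> bits \<Rightarrow> bits \<Rightarrow> enat" where
  "C_cond M x y = Inf {enat (length p) |p. computes M (encode_pair p y) x}"

definition optimal_machine :: "tm \<Rightarrow> bool" where
  "optimal_machine M \<longleftrightarrow> wf_tm M \<and> deterministic M \<and>
     (\<forall>M'. wf_tm M' \<longrightarrow> deterministic M' \<longrightarrow>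
        (\<exists>c::nat. \<forall>x y. C_cond M x y \<le> C_cond M' x y + enat c))"

abbreviation C_plain :: "tm \<Rightarrow> bits \<Rightarrow> enat" where
  "C_plain M x \<equiv> C_cond M x []"

text \<open>
  The time bound is real-valued so that bounds such as \<open>c t log t\<close> need no rounding.  As in
  \<^const>\<open>computes\<close>, the coins are immaterial.
\<close>

definition CI :: "tm \<Rightarrow> tm \<Rightarrow> (nat \<Rightarrow> real) \<Rightarrow> bits \<Rightarrow> bits \<Rightarrow> enat" where
  "CI U V T \<pi> x = Inf {enat (length a + length b) |a b.
     interaction U V a b (\<lambda>_. False) (\<lambda>_. False) (T (length (\<pi> @ x))) (\<pi>, x, x)}"

definition optimal_pair :: "tm \<Rightarrow> tm \<Rightarrow> bool" where
  "optimal_pair U V \<longleftrightarrow> wf_tm U \<and> deterministic U \<and> wf_tm V \<and> deterministic V \<and>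
     (\<forall>U' V'. wf_tm U' \<longrightarrow> deterministic U' \<longrightarrow> wf_tm V' \<longrightarrow> deterministic V' \<longrightarrow>
        (\<exists>c::nat. \<forall>\<pi> x. \<forall>t::nat \<Rightarrow> nat. (\<forall>n. t n \<ge> 2) \<longrightarrow>
           CI U V (\<lambda>n. real c * real (t n) * log 2 (real (t n))) \<pi> x
             \<le> CI U' V' (\<lambda>n. real (t n)) \<pi> x + enat c))"

section \<open>Probabilistic polynomial time\<close>

definition coin_flips :: "nat \<Rightarrow> bits pmf" where
  "coin_flips m = pmf_of_set {r. length r = m}"

text \<open>
  A randomized algorithm is represented by the map from inputs to output distributions that it
  induces.  The time bound holds for every outcome of the coins, so a machine bounded by \<open>T\<close> uses
  at most the first \<open>T\<close> coins.
\<close>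

definition ppt :: "(bits \<Rightarrow> bits pmf) \<Rightarrow> bool" where
  "ppt A \<longleftrightarrow> (\<exists>M (T::nat \<Rightarrow> nat) k::nat. wf_tm M \<and>
     (\<lambda>n. real (T n)) \<in> O(\<lambda>n. real n ^ k) \<and>
     (\<forall>w. \<exists>F. (\<forall>r. length r = T (length w) \<longrightarrow> runs M ((!) r) w (T (length w)) (F r)) \<and>
              A w = map_pmf F (coin_flips (T (length w)))))"

text \<open>
  A promise problem is a pair of sets of strings.  The answer \<^term>\<open>[True]\<close> stands for ``outside the
  second set'' and \<^term>\<open>[False]\<close> for ``outside the first set''.
\<close>

definition ioBPP :: "(bits set \<times> bits set) set" where
  "ioBPP = {(Y, N). \<exists>A. ppt A \<and> (\<exists>\<^sub>\<infinity> n.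
     (\<forall>z\<in>Y. length z = n \<longrightarrow> pmf (A z) [True] \<ge> 2 / 3) \<and>
     (\<forall>z\<in>N. length z = n \<longrightarrow> pmf (A z) [False] \<ge> 2 / 3))}"

section \<open>Key agreement\<close>

text \<open>A protocol maps \<open>n\<close> to the distribution of (transcript, Alice's output, Bob's output).\<close>

type_synonym protocol = "nat \<Rightarrow> (bits \<times> bits \<times> bits) pmf"

definition time_bounded :: "(nat \<Rightarrow> nat) \<Rightarrow> protocol \<Rightarrow> bool" where
  "time_bounded t P \<longleftrightarrow> (\<exists>A B (T::nat \<Rightarrow> nat). wf_tm A \<and> wf_tm B \<and>
     (\<lambda>n. real (T n)) \<in> O(\<lambda>n. real (t n)) \<and>
     (\<forall>n. \<exists>F.
        (\<forall>r s. length r = T n \<longrightarrow> length s = T n \<longrightarrow>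
           interaction A B (replicate n False) (replicate n False) ((!) r) ((!) s)
             (real (T n)) (F (r, s))) \<and>
        P n = map_pmf F (pair_pmf (coin_flips (T n)) (coin_flips (T n)))))"

definition has_agreement :: "(nat \<Rightarrow> real) \<Rightarrow> protocol \<Rightarrow> bool" where
  "has_agreement \<alpha> P \<longleftrightarrow>
     (\<forall>\<^sub>F n in sequentially. measure_pmf.prob (P n) {(\<pi>, x, y). x = y} \<ge> \<alpha> n)"

definition secure :: "(nat \<Rightarrow> real) \<Rightarrow> protocol \<Rightarrow> bool" where
  "secure \<epsilon> P \<longleftrightarrow> (\<forall>E. ppt E \<longrightarrow> (\<forall>\<^sub>F n in sequentially.
     measure_pmf.prob
       (bind_pmf (P n) (\<lambda>(\<pi>, x, y).
          map_pmf (\<lambda>g. (g, x)) (E (encode_pair (replicate n False) \<pi>))))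
       {(g, x). g = x} \<le> \<epsilon> n))"

definition key_agreement :: "protocol \<Rightarrow> bool" where
  "key_agreement P \<longleftrightarrow> (\<exists>k::nat. time_bounded (\<lambda>n. n ^ k) P) \<and>
     (\<forall>c::real. c > 0 \<longrightarrow>
        has_agreement (\<lambda>n. 1 - 1 / real n powr c) P \<and> secure (\<lambda>n. 1 / real n powr c) P)"

section \<open>The promise problem\<close>

definition Y_set :: "tm \<Rightarrow> tm \<Rightarrow> tm \<Rightarrow> (nat \<Rightarrow> nat) \<Rightarrow> real \<Rightarrow> bits set" where
  "Y_set M U V t c = {encode_pair \<pi> x |\<pi> x.
     ereal_of_enat (CI U V (\<lambda>n. real (t n)) \<pi> x)
       \<le> ereal_of_enat (C_plain M \<pi>) + ereal (c * log 2 (real (length (\<pi> @ x))))}"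

definition N_set :: "tm \<Rightarrow> real \<Rightarrow> bits set" where
  "N_set M e = {encode_pair \<pi> x |\<pi> x.
     ereal_of_enat (C_plain M (encode_pair \<pi> x))
       \<ge> ereal_of_enat (C_plain M \<pi>) + ereal (e * log 2 (real (length (\<pi> @ x))))}"

end

theory Submission
 imports Defs
begin

text \<open>
 Fix a key agreement with transcripts \<open>\<pi>\<close> and keys \<open>x\<close>.  Let the parties first send public random
 masks of \<open>W\<close> bits each, cut into rows.  If \<open>(\<pi>, x)\<close> has probability \<open>p\<close>, the coins of each party that
 are compatible with it are hit by the sum of a subset of the first few rows, so each party is described by
 its mask and few selection bits, and the interactive complexity is at most
 \<open>\<lambda> + O(log n)\<close>, \<open>\<lambda> = 2W - log p\<close>.  By counting, the masked transcript \<open>\<pi>'\<close> is mostly not simpler than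
 \<open>\<lambda> - O(log n)\<close>, since most agreeing \<open>x\<close> have constant probability given \<open>\<pi>\<close>.  Hence \<open>(\<pi>', z)\<close> is a yes
 instance for every prefix \<open>z\<close> of \<open>x\<close> padded with zeros.  On the other hand, few \<open>z\<close> lie outside the
 no instances, because a joint simulation of the two parties describes \<open>\<pi>'\<close> by \<open>\<lambda> + O(log n)\<close> bits.
 A majority vote over runs of the given algorithm thus prunes the tree of prefixes to polynomial size while
 keeping the path to \<open>x\<close>, and a search stopped at a random time outputs \<open>x\<close> with inverse polynomial
 probability, contradicting security.
\<close>

section \<open>Interactions split into one run per party\<close>

section \<open>One party against a fixed transcript\<close>

text \<open>The masks solve a coding problem. The coins compatible with a transcript form a set of
  density 2^-s without visible structure; an index into it has the right length s but is too slow to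
  decode, whereas selection bits for public random rows decode at once. The rows are paid for on
  both sides, in the descriptions and in the complexity of the transcript, so their 2W bits cancel.
  The decider is reliable for infinitely many lengths n only; hence the security parameter m is
  derived from n, and masks and padding fill every query up to length exactly n. As n is a large
  power of m, overheads polynomial in m are small powers of n, which is how c > 3 suffices for every
  e. Time is the other obstacle: t need only dominate n log n, and the optimal pair loses a
  logarithm, so the described parties must run in linear time, which requires explicit machines.
  Finally, the attacker computes no parameters. Its coins supply mask, votes and numbers, and
  guessing the numbers costs a polynomial factor since their codes have logarithmic length.\<close>

text \<open>
 The first component counts the bits that are visible when the machine is next on turn: after
 sending a bit it waits for the reply, hence the step by 2.  The truncation at \<^term>\<open>length \<pi>\<close>
 accounts for the last bit, which gets no reply.  A machine may halt while sending only with the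
 very last bit, because the interaction blocks on messages to a halted machine.
\<close>

definition sstep :: "tm \<Rightarrow> (nat \<Rightarrow> bool) \<Rightarrow> bits \<Rightarrow> bits \<Rightarrow> nat \<times> conf \<Rightarrow> nat \<times> conf" where
 "sstep M coins w \<pi> = (\<lambda>(j, cf). if halted cf then (j, cf) else
   let act = current_action M coins w (take j \<pi>) cf in case send act of None \<Rightarrow> (j, perform act cf)
   | Some b \<Rightarrow> if j < length \<pi> \<and> \<pi> ! j = b \<and> (halted (perform act cf) \<longrightarrow> Suc j = length \<pi>)
     then (min (j + 2) (length \<pi>), perform act cf) else (j, cf))"

definition side :: "tm \<Rightarrow> bool \<Rightarrow> bits \<Rightarrow> (nat \<Rightarrow> bool) \<Rightarrow> real \<Rightarrow> bits \<Rightarrow> bits \<Rightarrow> bool" where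
 "side M first w coins T \<pi> x \<longleftrightarrow> (\<exists>k cf.
   (sstep M coins w \<pi> ^^ k) (if first then 0 else min 1 (length \<pi>), init_conf M)
    = (length \<pi>, cf) \<and> halted cf \<and> real (steps cf) \<le> T \<and> out_tape cf = x)"

lemma sstep_halted: "halted cf \<Longrightarrow> (sstep M coins w \<pi> ^^ k) (j, cf) = (j, cf)"
 by (induction k) (simp_all add: sstep_def)

lemma funpow_fixpoint: "f a = a \<Longrightarrow> (f ^^ k) a = a" by (induction k) simp_all

text \<open>The first component of \<open>sstep\<close> for a party once \<open>\<rho>\<close> has
  been exchanged, where \<open>f\<close> tells whether it is on turn: a waiting party is already
  credited with the reply.\<close>

definition vis_at :: "bits \<Rightarrow> bool \<Rightarrow> bits \<Rightarrow> nat" where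
 "vis_at \<pi> f \<rho> = (if f then length \<rho> else min (length \<rho> + 1) (length \<pi>))"

text \<open>Exchanging the machines and the turn flag is a symmetry, so that only moves of the first
  machine have to be analysed.\<close>

lemma joint_step_swap:
 "joint_step V U b a s r (\<not> f, \<rho>, v, u) = (case joint_step U V a b r s (f, \<rho>, u, v) of (f', \<rho>', u', v') \<Rightarrow> (\<not> f', \<rho>', v', u'))"
 by (auto simp: Let_def split: option.split)

lemma length_prefix: "take (length \<rho>) \<pi> = \<rho> \<Longrightarrow> length \<rho> \<le> length \<pi>"
 by (metis length_take min.cobounded1 min.commute)

text \<open>An invariant about the future: the rest of each party's run is checked against the final
  transcript, because \<open>sstep\<close> has to know every bit in advance. It is therefore
  propagated backwards through the joint run.\<close>

definition split_at ::
 "tm \<Rightarrow> tm \<Rightarrow> bits \<Rightarrow> bits \<Rightarrow> (nat \<Rightarrow> bool) \<Rightarrow> (nat \<Rightarrow> bool) \<Rightarrow> bits \<Rightarrow> conf \<Rightarrow> conf \<Rightarrow> joint_conf \<Rightarrow> bool" where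
 "split_at U V a b r s \<pi> u' v' = (\<lambda>(f, \<rho>, u, v). take (length \<rho>) \<pi> = \<rho> \<and> (halted u \<or> halted v \<longrightarrow> \<rho> = \<pi>) \<and>
  (\<exists>ka. (sstep U r a \<pi> ^^ ka) (vis_at \<pi> f \<rho>, u) = (length \<pi>, u')) \<and>
  (\<exists>kb. (sstep V s b \<pi> ^^ kb) (vis_at \<pi> (\<not> f) \<rho>, v) = (length \<pi>, v')))"

lemma split_at_swap: "split_at V U b a s r \<pi> v' u' (\<not> f, \<rho>, v, u) \<longleftrightarrow> split_at U V a b r s \<pi> u' v' (f, \<rho>, u, v)"
 by (auto simp: split_at_def)

lemma split_at_step:
 assumes A: "\<not> halted u" "halted v \<or> f" and S: "split_at U V a b r s \<pi> u' v' (joint_step U V a b r s (f, \<rho>, u, v))"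
 shows "split_at U V a b r s \<pi> u' v' (f, \<rho>, u, v)"
proof -
 let ?J = "joint_step U V a b r s"
 define act where "act = current_action U r a \<rho> u"
 show ?thesis
 proof (cases "send act")
  case None
  have "?J (f, \<rho>, u, v) = (f, \<rho>, perform act u, v)" using A None by (auto simp: act_def)
  note ih = S[unfolded this split_at_def prod.case]
  have "vis_at \<pi> f \<rho> = length \<rho>" using A ih by (cases f) (auto simp: vis_at_def)
  then have "sstep U r a \<pi> (vis_at \<pi> f \<rho>, u) = (vis_at \<pi> f \<rho>, perform act u)"
   using A None ih by (simp add: sstep_def act_def)
  then have "\<exists>ka. (sstep U r a \<pi> ^^ ka) (vis_at \<pi> f \<rho>, u) = (length \<pi>, u')"
   using ih by (metis funpow_Suc_right o_apply)
  with ih A show ?thesis unfolding split_at_def by blast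
 next
  case (Some m)
  show ?thesis
  proof (cases "halted v")
   case True
   then have "?J (f, \<rho>, u, v) = (f, \<rho>, u, v)" using A Some by (auto simp: act_def)
   then show ?thesis using S by simp
  next
   case False
   then have f: f using A by simp
   have "?J (f, \<rho>, u, v) = (False, \<rho> @ [m], perform act u, v)" using A False Some by (auto simp: act_def)
   note ih = S[unfolded this split_at_def prod.case]
   have tk: "take (Suc (length \<rho>)) \<pi> = \<rho> @ [m]" using ih by simp
   then have le: "Suc (length \<rho>) \<le> length \<pi>" using length_prefix[of "\<rho> @ [m]" \<pi>] by simp
   have tk': "take (length \<rho>) \<pi> = \<rho>" using arg_cong[OF tk, of "take (length \<rho>)"] by simp
   have m: "\<pi> ! length \<rho> = m" using tk le by (metis lessI nth_append_length nth_take)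
   have "sstep U r a \<pi> (vis_at \<pi> f \<rho>, u) = (vis_at \<pi> False (\<rho> @ [m]), perform act u)"
    using A Some ih f tk' m le by (auto simp: sstep_def act_def vis_at_def)
   then have "\<exists>ka. (sstep U r a \<pi> ^^ ka) (vis_at \<pi> f \<rho>, u) = (length \<pi>, u')"
    using ih by (metis funpow_Suc_right o_apply)
   moreover have "vis_at \<pi> True (\<rho> @ [m]) = vis_at \<pi> (\<not> f) \<rho>" using f le by (simp add: vis_at_def)
   ultimately show ?thesis using ih A False tk' unfolding split_at_def by auto
  qed
 qed
qed

lemma joint_run_sides:
 assumes "(joint_step U V a b r s ^^ k) c = (f', \<pi>, u', v')" "halted u'" "halted v'"
 shows "split_at U V a b r s \<pi> u' v' c" using assms(1)
proof (induction k arbitrary: c)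
 case 0
 then show ?case using assms(2,3) by (auto simp: split_at_def vis_at_def intro!: exI[where x = 0])
next
 case (Suc k)
 let ?J = "joint_step U V a b r s"
 obtain f \<rho> u v where c: "c = (f, \<rho>, u, v)" by (metis surj_pair)
 have IH: "split_at U V a b r s \<pi> u' v' (?J c)" by (rule Suc.IH) (use Suc.prems in \<open>simp add: funpow_swap1\<close>)
 consider (halt) "halted u" "halted v" | (A) "\<not> halted u" "halted v \<or> f" | (B) "\<not> halted v" "halted u \<or> \<not> f" by blast
 then show ?case
 proof cases
  case halt
  then show ?thesis using IH by (simp add: c)
 next
  case A
  then show ?thesis using split_at_step IH unfolding c by blast
 next
  case B
  have "split_at V U b a s r \<pi> v' u' (joint_step V U b a s r (\<not> f, \<rho>, v, u))"
   unfolding joint_step_swap[of V U b a s r f] using IH unfolding c by (auto simp only: split_at_swap split: prod.split)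
  from split_at_step[OF B this] show ?thesis by (simp only: split_at_swap c)
 qed
qed

text \<open>The converse direction, for the party on turn. The other party notices nothing: the bit
  it waits for was already counted, which is the clause on \<open>vis_at\<close> for the negated
  flag.\<close>

lemma side_step:
 assumes k: "(sstep U r a \<pi> ^^ ka) (vis_at \<pi> f \<rho>, u) = (length \<pi>, u')" "halted u'" and A: "\<not> halted u" "halted v \<or> f"
  and \<rho>: "take (length \<rho>) \<pi> = \<rho>" "halted u \<or> halted v \<longrightarrow> \<rho> = \<pi>"
 shows "\<exists>ka'<ka. \<exists>f1 \<rho>1 u1. joint_step U V a b r s (f, \<rho>, u, v) = (f1, \<rho>1, u1, v) \<and>
  (sstep U r a \<pi> ^^ ka') (vis_at \<pi> f1 \<rho>1, u1) = (length \<pi>, u') \<and> vis_at \<pi> (\<not> f1) \<rho>1 = vis_at \<pi> (\<not> f) \<rho> \<and>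
  take (length \<rho>1) \<pi> = \<rho>1 \<and> (halted u1 \<or> halted v \<longrightarrow> \<rho>1 = \<pi>)"
proof -
 define act where "act = current_action U r a \<rho> u"
 have vf: "vis_at \<pi> f \<rho> = length \<rho>" using A \<rho>(2) by (auto simp: vis_at_def)
 obtain ka' where ka: "ka = Suc ka'" using k A by (cases ka) auto
 have rest: "(sstep U r a \<pi> ^^ ka') (sstep U r a \<pi> (length \<rho>, u)) = (length \<pi>, u')"
  using k(1) by (simp add: ka vf funpow_swap1)
 \<comment> \<open>A blocked step would be repeated for ever, whereas this run ends in a halted
   configuration.\<close>
 have moved: "sstep U r a \<pi> (length \<rho>, u) \<noteq> (length \<rho>, u)"
 proof
  assume "sstep U r a \<pi> (length \<rho>, u) = (length \<rho>, u)"
  from funpow_fixpoint[of "sstep U r a \<pi>", OF this, of ka'] rest this have "u = u'" by simp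
  then show False using A k(2) by simp
 qed
 show ?thesis
 proof (cases "send act")
  case None
  have ss: "sstep U r a \<pi> (length \<rho>, u) = (vis_at \<pi> f \<rho>, perform act u)"
   using A None \<rho>(1) vf by (simp add: sstep_def act_def)
  have "halted (perform act u) \<longrightarrow> \<rho> = \<pi>"
   using rest ss sstep_halted vf \<rho>(1) by (metis order_refl prod.inject take_all)
  moreover have "joint_step U V a b r s (f, \<rho>, u, v) = (f, \<rho>, perform act u, v)" using A None by (auto simp: act_def)
  ultimately show ?thesis using rest ss \<rho> ka by (intro exI[of _ ka']) auto
 next
  case (Some m)
  have c: "length \<rho> < length \<pi>" "\<pi> ! length \<rho> = m" "halted (perform act u) \<longrightarrow> Suc (length \<rho>) = length \<pi>"
   using moved A Some \<rho>(1) by (auto simp: sstep_def act_def Let_def split: if_splits)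
  have nv: "\<not> halted v" using \<rho>(2) c by auto
  then have f: f using A by simp
  have tk: "take (length (\<rho> @ [m])) \<pi> = \<rho> @ [m]" using c \<rho>(1) by (simp add: take_Suc_conv_app_nth)
  have ss: "sstep U r a \<pi> (length \<rho>, u) = (vis_at \<pi> False (\<rho> @ [m]), perform act u)"
   using A Some \<rho>(1) c by (auto simp: sstep_def act_def vis_at_def)
  have "vis_at \<pi> (\<not> False) (\<rho> @ [m]) = vis_at \<pi> (\<not> f) \<rho>" using f c by (simp add: vis_at_def)
  moreover have "halted (perform act u) \<longrightarrow> \<rho> @ [m] = \<pi>" using c(3) tk by (metis length_append_singleton order_refl take_all)
  moreover have "joint_step U V a b r s (f, \<rho>, u, v) = (False, \<rho> @ [m], perform act u, v)" using A Some f nv by (auto simp: act_def)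
  ultimately show ?thesis using rest ss tk nv ka by (intro exI[of _ ka'] conjI exI[of _ False] exI[of _ "\<rho> @ [m]"] exI[of _ "perform act u"]) auto
 qed
qed

text \<open>Each joint step uses up at least one remaining step of the party on turn and none of the
  other party's, so the sum of both numbers is the induction measure.\<close>

lemma sides_joint_run:
 assumes "(sstep U r a \<pi> ^^ ka) (vis_at \<pi> f \<rho>, u) = (length \<pi>, u')" "halted u'"
  and "(sstep V s b \<pi> ^^ kb) (vis_at \<pi> (\<not> f) \<rho>, v) = (length \<pi>, v')" "halted v'"
  and "take (length \<rho>) \<pi> = \<rho>" "halted u \<or> halted v \<longrightarrow> \<rho> = \<pi>"
 shows "\<exists>k f'. (joint_step U V a b r s ^^ k) (f, \<rho>, u, v) = (f', \<pi>, u', v')" using assms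
proof (induction "ka + kb" arbitrary: ka kb f \<rho> u v rule: less_induct)
 case less
 let ?J = "joint_step U V a b r s"
 have step: ?case if st: "?J (f, \<rho>, u, v) = c" and ex: "\<exists>k f'. (?J ^^ k) c = (f', \<pi>, u', v')" for c
 proof -
  from ex obtain k f' where "(?J ^^ k) c = (f', \<pi>, u', v')" by blast
  then have "(?J ^^ Suc k) (f, \<rho>, u, v) = (f', \<pi>, u', v')"
   by (simp add: funpow_Suc_right st del: funpow.simps joint_step.simps)
  then show ?thesis by blast
 qed
 consider (halt) "halted u" "halted v" | (A) "\<not> halted u" "halted v \<or> f" | (B) "\<not> halted v" "halted u \<or> \<not> f" by blast
 then show ?case
 proof cases
  case halt
  then show ?thesis using less.prems sstep_halted[of u] sstep_halted[of v] by (auto intro!: exI[where x = 0])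
 next
  case A
  obtain ka' f1 \<rho>1 u1 where 1: "ka' < ka" "?J (f, \<rho>, u, v) = (f1, \<rho>1, u1, v)"
   "(sstep U r a \<pi> ^^ ka') (vis_at \<pi> f1 \<rho>1, u1) = (length \<pi>, u')" "vis_at \<pi> (\<not> f1) \<rho>1 = vis_at \<pi> (\<not> f) \<rho>"
   "take (length \<rho>1) \<pi> = \<rho>1" "halted u1 \<or> halted v \<longrightarrow> \<rho>1 = \<pi>"
   using side_step[OF less.prems(1,2) A less.prems(5,6), of V b s] by blast
  show ?thesis by (rule step[OF 1(2)], rule less.hyps[of ka' kb]) (use 1 less.prems in simp_all)
 next
  case B
  have "halted v \<or> halted u \<longrightarrow> \<rho> = \<pi>" using less.prems(6) by blast
  from side_step[OF less.prems(3,4) B less.prems(5) this, of U a r] obtain kb' f1 \<rho>1 v1 where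
   1: "kb' < kb" "joint_step V U b a s r (\<not> f, \<rho>, v, u) = (f1, \<rho>1, v1, u)"
   "(sstep V s b \<pi> ^^ kb') (vis_at \<pi> f1 \<rho>1, v1) = (length \<pi>, v')" "vis_at \<pi> (\<not> f1) \<rho>1 = vis_at \<pi> f \<rho>"
   "take (length \<rho>1) \<pi> = \<rho>1" "halted v1 \<or> halted u \<longrightarrow> \<rho>1 = \<pi>" by auto
  have "?J (f, \<rho>, u, v) = (\<not> f1, \<rho>1, u, v1)"
   using joint_step_swap[of U V a b r s "\<not> f" \<rho> u v] 1(2) by (simp del: joint_step.simps)
  from step[OF this] show ?thesis by (rule, intro less.hyps[of ka kb']) (use 1 less.prems in auto)
 qed
qed

text \<open>Source of the rectangle property: for a fixed transcript the outcome is a condition on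
  the first party's input and coins together with one on the second party's, and nothing else links
  them.\<close>

lemma interaction_iff_sides:
 "interaction U V a b r s T (\<pi>, x, y) \<longleftrightarrow> side U True a r T \<pi> x \<and> side V False b s T \<pi> y"
proof
 assume "interaction U V a b r s T (\<pi>, x, y)"
 then obtain k f u v where
  "(joint_step U V a b r s ^^ k) (True, [], init_conf U, init_conf V) = (f, \<pi>, u, v)"
  "halted u" "halted v" "real (steps u) \<le> T" "real (steps v) \<le> T" "out_tape u = x" "out_tape v = y"
  by auto
 from joint_run_sides[OF this(1-3)] this(2-7) show "side U True a r T \<pi> x \<and> side V False b s T \<pi> y"
  by (auto simp: side_def split_at_def vis_at_def)
next
 assume "side U True a r T \<pi> x \<and> side V False b s T \<pi> y"
 then obtain ka u kb v where
  A: "(sstep U r a \<pi> ^^ ka) (vis_at \<pi> True [], init_conf U) = (length \<pi>, u)" "halted u"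
  and B: "(sstep V s b \<pi> ^^ kb) (vis_at \<pi> (\<not> True) [], init_conf V) = (length \<pi>, v)" "halted v"
  and o: "real (steps u) \<le> T" "real (steps v) \<le> T" "out_tape u = x" "out_tape v = y"
  by (auto simp: side_def vis_at_def)
 have "\<not> halted (init_conf U)" "\<not> halted (init_conf V)" by (auto simp: halted_def init_conf_def)
 with sides_joint_run[OF A B] obtain k f' where
  "(joint_step U V a b r s ^^ k) (True, [], init_conf U, init_conf V) = (f', \<pi>, u, v)" by auto
 with o A B show "interaction U V a b r s T (\<pi>, x, y)" by auto
qed

section \<open>A structured language for Turing machines and its compiler\<close>

section \<open>Structured programs and their compilation\<close>

record instr =
 mv_in :: move
 mv_com :: move
 wr :: "nat \<rightharpoonup> nat \<times> move"
 em :: "bool option"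
 sd :: "bool option"

definition nop :: instr where
 "nop = \<lparr>mv_in = Stay, mv_com = Stay, wr = Map.empty, em = None, sd = None\<rparr>"

lemma nop_simps [simp]:
 "mv_in nop = Stay" "mv_com nop = Stay" "wr nop = Map.empty" "em nop = None" "sd nop = None"
 by (simp_all add: nop_def)

text \<open>Arguments: the coin, the scanned input and communication cells, the scanned work symbols.\<close>

type_synonym 'a obs = "bool \<Rightarrow> bool option \<Rightarrow> bool option \<Rightarrow> (nat \<Rightarrow> nat) \<Rightarrow> 'a"

datatype prog =
  Act "instr obs"
 | Seq prog prog (infixr ";;" 60)
 | Cond "bool obs" prog prog
 | Loop "bool obs" prog

primrec psize :: "prog \<Rightarrow> nat" where
 "psize (Act f) = 1"
| "psize (p ;; q) = psize p + psize q"
| "psize (Cond C p q) = Suc (psize p + psize q)"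
| "psize (Loop C p) = Suc (psize p)"

definition to_act :: "nat \<Rightarrow> (nat \<Rightarrow> nat) \<Rightarrow> nat \<Rightarrow> instr \<Rightarrow> action" where
 "to_act k s q ins = \<lparr>next_state = q, input_move = mv_in ins, comm_move = mv_com ins,
   work_writes = map (\<lambda>i. case wr ins i of None \<Rightarrow> (s i, Stay) | Some a \<Rightarrow> a) [0..<k],
   emit = em ins, send = sd ins\<rparr>"

lemma to_act_simps [simp]:
 "next_state (to_act k s q ins) = q" "input_move (to_act k s q ins) = mv_in ins"
 "comm_move (to_act k s q ins) = mv_com ins"
 "work_writes (to_act k s q ins) = map (\<lambda>i. case wr ins i of None \<Rightarrow> (s i, Stay) | Some a \<Rightarrow> a) [0..<k]"
 "emit (to_act k s q ins) = em ins" "send (to_act k s q ins) = sd ins"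
 by (simp_all add: to_act_def)

text \<open>The code of a program occupies the states from \<open>b\<close> on and leaves to state \<open>e\<close>.\<close>

primrec code :: "nat \<Rightarrow> prog \<Rightarrow> nat \<Rightarrow> nat \<Rightarrow> nat \<Rightarrow> action obs" where
 "code k (Act f) b e q c i m s = to_act k s e (f c i m s)"
| "code k (p1 ;; p2) b e q c i m s = (if q < b + psize p1 then code k p1 b (b + psize p1) q c i m s
   else code k p2 (b + psize p1) e q c i m s)"
| "code k (Cond C p1 p2) b e q c i m s =
   (if q = b then to_act k s (if C c i m s then Suc b else Suc b + psize p1) nop
   else if q < Suc b + psize p1 then code k p1 (Suc b) e q c i m s
   else code k p2 (Suc b + psize p1) e q c i m s)"
| "code k (Loop C p) b e q c i m s = (if q = b then to_act k s (if C c i m s then Suc b else e) nop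
   else code k p (Suc b) b q c i m s)"

text \<open>Tapes that do not exist are read as blank, so programs may see a total function;
  \<open>blank_above\<close> is the matching condition on memories.\<close>

definition lookup :: "nat \<Rightarrow> nat list \<Rightarrow> nat \<Rightarrow> nat" where
 "lookup k ws i = (if i < k then ws ! i else 0)"

text \<open>States 0 and 1 are taken by start and halt, so the code begins at 2. The separate exit
  state halts without sending; thus a compiled machine never halts in a sending step, which
  \<open>sstep\<close> would allow for the last bit only. The steps at entry and exit are the
  \<open>+ 2\<close> in the time bounds.\<close>

definition compile :: "nat \<Rightarrow> nat \<Rightarrow> prog \<Rightarrow> tm" where
 "compile k S p = \<lparr>num_work = k, num_symbols = S, num_states = psize p + 3, delta = (\<lambda>q c i m ws.
    if q = 0 then to_act k (lookup k ws) 2 nop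
    else if q = 1 \<or> q = 2 + psize p then to_act k (lookup k ws) 1 nop
    else code k p 2 (2 + psize p) q c i m (lookup k ws))\<rparr>"

primrec okp :: "nat \<Rightarrow> nat \<Rightarrow> prog \<Rightarrow> bool" where
 "okp k S (Act f) \<longleftrightarrow> (\<forall>c i m s. (\<forall>j. s j < S) \<longrightarrow> (\<forall>j a v. wr (f c i m s) j = Some (a, v) \<longrightarrow> j < k \<and> a < S))"
| "okp k S (p ;; q) \<longleftrightarrow> okp k S p \<and> okp k S q"
| "okp k S (Cond C p q) \<longleftrightarrow> okp k S p \<and> okp k S q"
| "okp k S (Loop C p) \<longleftrightarrow> okp k S p"

primrec coinless :: "prog \<Rightarrow> bool" where
 "coinless (Act f) \<longleftrightarrow> f True = f False"
| "coinless (p ;; q) \<longleftrightarrow> coinless p \<and> coinless q"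
| "coinless (Cond C p q) \<longleftrightarrow> C True = C False \<and> coinless p \<and> coinless q"
| "coinless (Loop C p) \<longleftrightarrow> C True = C False \<and> coinless p"

lemma code_next_state:
 "b \<le> q \<Longrightarrow> q < b + psize p \<Longrightarrow> next_state (code k p b e q c i m s) = e \<or>
   (b \<le> next_state (code k p b e q c i m s) \<and> next_state (code k p b e q c i m s) < b + psize p)"
proof (induction p arbitrary: b e)
 case (Seq p1 p2)
 show ?case
 proof (cases "q < b + psize p1")
  case True
  have "psize p2 > 0" by (induction p2) auto
  then show ?thesis using Seq.IH(1)[of b "b + psize p1"] Seq.prems True by auto
 next
  case False
  then show ?thesis using Seq.IH(2)[of "b + psize p1" e] Seq.prems by auto
 qed
next
 case (Cond C p1 p2)
 have pos: "psize p1 > 0" "psize p2 > 0" by (induction p1, auto) (induction p2, auto)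
 consider "q = b" | "Suc b \<le> q" "q < Suc b + psize p1" | "Suc b + psize p1 \<le> q"
  using Cond.prems by linarith
 then show ?case
 proof cases
  case 2
  then show ?thesis using Cond.IH(1)[of "Suc b" e] by auto
 next
  case 3
  then show ?thesis using Cond.IH(2)[of "Suc b + psize p1" e] Cond.prems by auto
 qed (use pos in auto)
next
 case (Loop C p)
 have pos: "psize p > 0" by (induction p) auto
 then show ?case using Loop.IH[of "Suc b" b] Loop.prems by (cases "q = b") auto
qed auto

lemma okp_ActD:
 "okp k S (Act f) \<Longrightarrow> \<forall>j. s j < S \<Longrightarrow> wr (f c i m s) j = Some (a, v) \<Longrightarrow> j < k \<and> a < S"
 unfolding okp.simps by blast

lemma code_writes:
 assumes "okp k S p" "\<forall>j. s j < S"
 shows "length (work_writes (code k p b e q c i m s)) = k \<and>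
  (\<forall>(a, v)\<in>set (work_writes (code k p b e q c i m s)). a < S)" using assms(1)
proof (induction p arbitrary: b e)
 case (Act f)
 have "a < S" if "(case wr (f c i m s) j of None \<Rightarrow> (s j, Stay) | Some y \<Rightarrow> y) = (a, v)" for j a v
  using that assms(2) okp_ActD[OF Act, of s] by (cases "wr (f c i m s) j") auto
 then show ?case by (simp add: split_beta') (metis prod.collapse)
qed (auto simp: assms(2))

lemma wf_compile:
 assumes "okp k S p" "S > 0"
 shows "wf_tm (compile k S p)"
proof -
 have s: "\<forall>j. lookup k ws j < S" if "length ws = k" "\<forall>s\<in>set ws. s < S" for ws
  using that assms(2) by (auto simp: lookup_def)
 have "let act = delta (compile k S p) q coin i j ws in
      next_state act < psize p + 3 \<and> length (work_writes act) = k \<and>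
      (\<forall>(s, m)\<in>set (work_writes act). s < S)"
  if "q < psize p + 3" "length ws = k" "\<forall>s\<in>set ws. s < S" for q coin i j ws
 proof -
  have pos: "psize p > 0" by (induction p) auto
  note s' = s[OF that(2,3)]
  show ?thesis using code_next_state[of 2 q p k "2 + psize p" coin i j "lookup k ws"]
    code_writes[OF assms(1) s', of 2 "2 + psize p" q coin i j] that(1) s' pos
   by (auto simp: compile_def Let_def)
 qed
 then show ?thesis using assms(2) by (auto simp: wf_tm_def compile_def)
qed

lemma code_coinless: "coinless p \<Longrightarrow> code k p b e q True = code k p b e q False"
proof (induction p arbitrary: b e)
qed (auto simp: fun_eq_iff)

lemma deterministic_compile: "coinless p \<Longrightarrow> deterministic (compile k S p)"
 using code_coinless[of p] by (auto simp: deterministic_def compile_def fun_eq_iff)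

subsection \<open>Big-step semantics\<close>

type_synonym tape = "(int \<Rightarrow> nat) \<times> int"

text \<open>\<open>vis\<close> is the first component of \<open>sstep\<close>; it belongs to the
  memory because sending changes it.\<close>

record mem =
 pin :: int
 pcom :: int
 tp :: "nat \<Rightarrow> tape"
 ot :: bits
 vis :: nat

definition rd :: "mem \<Rightarrow> nat \<Rightarrow> nat" where
 "rd m i = fst (tp m i) (snd (tp m i))"

definition write_tape :: "nat \<times> move \<Rightarrow> tape \<Rightarrow> tape" where
 "write_tape a t = ((fst t)(snd t := fst a), snd t + offset (snd a))"

definition exec_instr :: "bits \<Rightarrow> instr \<Rightarrow> mem \<Rightarrow> mem" where
 "exec_instr \<pi> ins m = \<lparr> pin = pin m + offset (mv_in ins), pcom = pcom m + offset (mv_com ins),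
   tp = (\<lambda>i. case wr ins i of None \<Rightarrow> tp m i | Some a \<Rightarrow> write_tape a (tp m i)),
   ot = ot m @ (case em ins of None \<Rightarrow> [] | Some b \<Rightarrow> [b]),
   vis = (case sd ins of None \<Rightarrow> vis m | Some b \<Rightarrow> min (vis m + 2) (length \<pi>))\<rparr>"

definition can_send :: "bits \<Rightarrow> instr \<Rightarrow> mem \<Rightarrow> bool" where
 "can_send \<pi> ins m \<longleftrightarrow> (\<forall>b. sd ins = Some b \<longrightarrow> vis m < length \<pi> \<and> \<pi> ! vis m = b)"

abbreviation observe :: "bits \<Rightarrow> bits \<Rightarrow> mem \<Rightarrow> bool \<Rightarrow> 'a obs \<Rightarrow> 'a" where
 "observe w \<pi> m c f \<equiv> f c (cell w (pin m)) (cell (take (vis m) \<pi>) (pcom m)) (rd m)"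

text \<open>Coins are indexed by elapsed time, so \<open>c\<close> is shifted by the exact time of
  what precedes. Sending a bit that disagrees with the transcript has no derivation.\<close>

inductive exec :: "bits \<Rightarrow> bits \<Rightarrow> (nat \<Rightarrow> bool) \<Rightarrow> prog \<Rightarrow> nat \<Rightarrow> mem \<Rightarrow> mem \<Rightarrow> bool" for w \<pi> where
 exec_Act: "can_send \<pi> (observe w \<pi> m (c 0) f) m \<Longrightarrow>
   exec w \<pi> c (Act f) 1 m (exec_instr \<pi> (observe w \<pi> m (c 0) f) m)"
| exec_Seq: "exec w \<pi> c p t1 m m1 \<Longrightarrow> exec w \<pi> (\<lambda>n. c (t1 + n)) q t2 m1 m2 \<Longrightarrow>
   exec w \<pi> c (p ;; q) (t1 + t2) m m2"
| exec_CondT: "observe w \<pi> m (c 0) C \<Longrightarrow> exec w \<pi> (\<lambda>n. c (Suc n)) p t m m1 \<Longrightarrow>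
   exec w \<pi> c (Cond C p q) (Suc t) m m1"
| exec_CondF: "\<not> observe w \<pi> m (c 0) C \<Longrightarrow> exec w \<pi> (\<lambda>n. c (Suc n)) q t m m1 \<Longrightarrow>
   exec w \<pi> c (Cond C p q) (Suc t) m m1"
| exec_LoopF: "\<not> observe w \<pi> m (c 0) C \<Longrightarrow> exec w \<pi> c (Loop C p) 1 m m"
| exec_LoopT: "observe w \<pi> m (c 0) C \<Longrightarrow> exec w \<pi> (\<lambda>n. c (Suc n)) p t1 m m1 \<Longrightarrow>
   exec w \<pi> (\<lambda>n. c (Suc (t1 + n))) (Loop C p) t2 m1 m2 \<Longrightarrow>
   exec w \<pi> c (Loop C p) (Suc (t1 + t2)) m m2"

definition conf_of :: "nat \<Rightarrow> nat \<Rightarrow> nat \<Rightarrow> mem \<Rightarrow> conf" where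
 "conf_of k q n m = \<lparr>state = q, input_pos = pin m, comm_pos = pcom m,
   work = map (tp m) [0..<k], out_tape = ot m, steps = n\<rparr>"

definition blank_above :: "nat \<Rightarrow> mem \<Rightarrow> bool" where
 "blank_above k m \<longleftrightarrow> (\<forall>i\<ge>k. rd m i = 0)"

definition obeys :: "nat \<Rightarrow> tm \<Rightarrow> nat \<Rightarrow> action obs \<Rightarrow> bool" where
 "obeys k M q act \<longleftrightarrow> (\<forall>c i m ws. length ws = k \<longrightarrow> delta M q c i m ws = act c i m (lookup k ws))"

lemma lookup_conf_of:
 assumes "blank_above k m"
 shows "lookup k (map (\<lambda>(tp, i). tp i) (work (conf_of k q n m))) = rd m"
 using assms by (auto simp: lookup_def conf_of_def rd_def blank_above_def fun_eq_iff split: prod.split)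

lemma perform_conf_of:
 assumes "blank_above k m"
 shows "perform (to_act k (rd m) e ins) (conf_of k q n m) = conf_of k e (Suc n) (exec_instr \<pi> ins m)"
proof -
 have "map2 (\<lambda>(s, m) (tp, i). (tp(i := s), i + offset m))
   (map (\<lambda>i. case wr ins i of None \<Rightarrow> (rd m i, Stay) | Some a \<Rightarrow> a) [0..<k]) (map (tp m) [0..<k])
   = map (\<lambda>i. case wr ins i of None \<Rightarrow> tp m i | Some a \<Rightarrow> write_tape a (tp m i)) [0..<k]"
  by (rule nth_equalityI) (auto simp: write_tape_def rd_def split: option.split prod.split)
 then show ?thesis by (simp add: perform_def conf_of_def exec_instr_def)
qed

lemma sstep_obeys:
 assumes "obeys k M q (\<lambda>c i m s. to_act k s (e c i m s) (f c i m s))" "blank_above k m" "q \<noteq> 1"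
  "coins n = c0" "can_send \<pi> (observe w \<pi> m c0 f) m" "sd (observe w \<pi> m c0 f) \<noteq> None \<Longrightarrow> observe w \<pi> m c0 e \<noteq> 1"
 shows "sstep M coins w \<pi> (vis m, conf_of k q n m) = (vis (exec_instr \<pi> (observe w \<pi> m c0 f) m),
   conf_of k (observe w \<pi> m c0 e) (Suc n) (exec_instr \<pi> (observe w \<pi> m c0 f) m))"
proof -
 let ?cf = "conf_of k q n m"
 let ?s = "map (\<lambda>(tp, i). tp i) (work ?cf)"
 have len: "length ?s = k" by (simp add: conf_of_def)
 have st: "state ?cf = q" "steps ?cf = n" "input_pos ?cf = pin m" "comm_pos ?cf = pcom m"
  by (simp_all add: conf_of_def)
 have ca: "current_action M coins w (take (vis m) \<pi>) ?cf
   = to_act k (rd m) (observe w \<pi> m c0 e) (observe w \<pi> m c0 f)"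
  unfolding current_action_def st assms(4) using assms(1)[unfolded obeys_def, rule_format, OF len]
  by (simp add: lookup_conf_of[OF assms(2)])
 have nh: "\<not> halted ?cf" using assms(3) by (simp add: halted_def conf_of_def)
 show ?thesis
 proof (cases "sd (observe w \<pi> m c0 f)")
  case None
  then show ?thesis using nh
   by (simp add: sstep_def ca Let_def perform_conf_of[OF assms(2), where \<pi> = \<pi>])
     (simp add: exec_instr_def)
 next
  case (Some b)
  then have "\<not> halted (conf_of k (observe w \<pi> m c0 e) (Suc n) (exec_instr \<pi> (observe w \<pi> m c0 f) m))"
   using assms(6) by (simp add: halted_def conf_of_def)
  moreover have "vis m < length \<pi> \<and> \<pi> ! vis m = b" using assms(5) Some by (simp add: can_send_def)
  ultimately show ?thesis using nh Some
   by (simp add: sstep_def ca Let_def perform_conf_of[OF assms(2), where \<pi> = \<pi>])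
     (simp add: exec_instr_def)
 qed
qed

lemma exec_instr_nop [simp]: "exec_instr \<pi> nop m = m" by (cases m) (simp add: exec_instr_def)

definition good :: "nat \<Rightarrow> nat \<Rightarrow> mem \<Rightarrow> bool" where
 "good k S m \<longleftrightarrow> blank_above k m \<and> (\<forall>i x. fst (tp m i) x < S)"

lemma good_exec_instr:
 assumes "good k S m" "okp k S (Act f)"
 shows "good k S (exec_instr \<pi> (observe w \<pi> m c f) m)"
proof -
 have "\<forall>j. rd m j < S" using assms(1) by (simp add: good_def rd_def)
 then have *: "j < k \<and> a < S" if "wr (observe w \<pi> m c f) j = Some (a, v)" for j a v
  using that okp_ActD[OF assms(2)] by blast
 have "fst (tp (exec_instr \<pi> (observe w \<pi> m c f) m) i) x < S" for i x
  using * assms(1) by (auto simp: exec_instr_def good_def write_tape_def split: option.split)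
 moreover have "wr (observe w \<pi> m c f) i = None" if "i \<ge> k" for i
  using *[of i] that by (metis not_less option.exhaust surj_pair)
 then have "blank_above k (exec_instr \<pi> (observe w \<pi> m c f) m)"
  using assms(1) by (simp add: blank_above_def exec_instr_def rd_def good_def)
 ultimately show ?thesis by (simp add: good_def)
qed

text \<open>Stated for code at an arbitrary place \<open>b\<close> inside \<open>M\<close>, with
  \<open>obeys\<close> demanded on that interval of states only, so that the induction passes to
  subprograms.\<close>

lemma exec_code:
 assumes "exec w \<pi> c p t m m'" "okp k S p" "good k S m"
  "\<And>q. b \<le> q \<Longrightarrow> q < b + psize p \<Longrightarrow> obeys k M q (code k p b e q)"
  "2 \<le> b" "2 \<le> e" "\<And>i. coins (n + i) = c i"
 shows "(sstep M coins w \<pi> ^^ t) (vis m, conf_of k b n m) = (vis m', conf_of k e (n + t) m')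
  \<and> good k S m'" using assms
proof (induction arbitrary: b e n rule: exec.induct)
 case (exec_Act m c f)
 have "obeys k M b (\<lambda>c i m s. to_act k s ((\<lambda>_ _ _ _. e) c i m s) (f c i m s))"
  using exec_Act.prems(3)[of b] by (auto simp: obeys_def)
 from sstep_obeys[OF this, of m coins n "c 0" \<pi> w] exec_Act
 show ?case using good_exec_instr[OF exec_Act.prems(2,1)] exec_Act.prems(6)[of 0]
  by (simp add: good_def)
next
 case (exec_Seq c p t1 m m1 q t2 m2)
 have "(sstep M coins w \<pi> ^^ t1) (vis m, conf_of k b n m)
   = (vis m1, conf_of k (b + psize p) (n + t1) m1) \<and> good k S m1"
  by (rule exec_Seq.IH(1)) (use exec_Seq.prems in \<open>auto simp: obeys_def\<close>)
 moreover from this have "(sstep M coins w \<pi> ^^ t2) (vis m1, conf_of k (b + psize p) (n + t1) m1)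
   = (vis m2, conf_of k e (n + t1 + t2) m2) \<and> good k S m2"
  by (intro exec_Seq.IH(2)) (use exec_Seq.prems in \<open>auto simp: obeys_def add.assoc\<close>)
 ultimately have "(sstep M coins w \<pi> ^^ (t2 + t1)) (vis m, conf_of k b n m)
   = (vis m2, conf_of k e (n + t1 + t2) m2) \<and> good k S m2" unfolding funpow_add by simp
 then show ?case by (simp add: ac_simps)
next
 case (exec_CondT m c C p t m1 q)
 have "obeys k M b (\<lambda>c i m s. to_act k s (if C c i m s then Suc b else Suc b + psize p) ((\<lambda>_ _ _ _. nop) c i m s))"
  using exec_CondT.prems(3)[of b] by (auto simp: obeys_def)
 from sstep_obeys[OF this, of m coins n "c 0" \<pi> w] exec_CondT.prems exec_CondT.hyps
 have "sstep M coins w \<pi> (vis m, conf_of k b n m) = (vis m, conf_of k (Suc b) (Suc n) m)"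
  using exec_CondT.prems(6)[of 0] by (simp add: good_def can_send_def)
 moreover have "(sstep M coins w \<pi> ^^ t) (vis m, conf_of k (Suc b) (Suc n) m)
   = (vis m1, conf_of k e (Suc n + t) m1) \<and> good k S m1"
 proof (rule exec_CondT.IH)
  show "coins (Suc n + i) = c (Suc i)" for i using exec_CondT.prems(6)[of "Suc i"] by simp
  show "obeys k M q' (code k p (Suc b) e q')" if "Suc b \<le> q'" "q' < Suc b + psize p" for q'
   using exec_CondT.prems(3)[of q'] that by (auto simp: obeys_def)
 qed (use exec_CondT.prems in auto)
 ultimately show ?case by (simp add: funpow_swap1)
next
 case (exec_CondF m c C q t m1 p)
 have "obeys k M b (\<lambda>c i m s. to_act k s (if C c i m s then Suc b else Suc b + psize p) ((\<lambda>_ _ _ _. nop) c i m s))"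
  using exec_CondF.prems(3)[of b] by (auto simp: obeys_def)
 from sstep_obeys[OF this, of m coins n "c 0" \<pi> w] exec_CondF.prems exec_CondF.hyps
 have "sstep M coins w \<pi> (vis m, conf_of k b n m) = (vis m, conf_of k (Suc b + psize p) (Suc n) m)"
  using exec_CondF.prems(6)[of 0] by (simp add: good_def can_send_def)
 moreover have "(sstep M coins w \<pi> ^^ t) (vis m, conf_of k (Suc b + psize p) (Suc n) m)
   = (vis m1, conf_of k e (Suc n + t) m1) \<and> good k S m1"
 proof (rule exec_CondF.IH)
  show "coins (Suc n + i) = c (Suc i)" for i using exec_CondF.prems(6)[of "Suc i"] by simp
  show "obeys k M q' (code k q (Suc b + psize p) e q')"
   if "Suc b + psize p \<le> q'" "q' < Suc b + psize p + psize q" for q'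
   using exec_CondF.prems(3)[of q'] that by (auto simp: obeys_def)
 qed (use exec_CondF.prems in auto)
 ultimately show ?case by (simp add: funpow_swap1)
next
 case (exec_LoopF m c C p)
 have "obeys k M b (\<lambda>c i m s. to_act k s (if C c i m s then Suc b else e) ((\<lambda>_ _ _ _. nop) c i m s))"
  using exec_LoopF.prems(3)[of b] by (auto simp: obeys_def)
 from sstep_obeys[OF this, of m coins n "c 0" \<pi> w] exec_LoopF.prems exec_LoopF.hyps
 have "sstep M coins w \<pi> (vis m, conf_of k b n m) = (vis m, conf_of k e (Suc n) m)"
  using exec_LoopF.prems(6)[of 0] by (simp add: good_def can_send_def)
 then show ?case using exec_LoopF.prems by simp
next
 case (exec_LoopT m c C p t1 m1 t2 m2)
 have "obeys k M b (\<lambda>c i m s. to_act k s (if C c i m s then Suc b else e) ((\<lambda>_ _ _ _. nop) c i m s))"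
  using exec_LoopT.prems(3)[of b] by (auto simp: obeys_def)
 from sstep_obeys[OF this, of m coins n "c 0" \<pi> w] exec_LoopT.prems exec_LoopT.hyps
 have s1: "sstep M coins w \<pi> (vis m, conf_of k b n m) = (vis m, conf_of k (Suc b) (Suc n) m)"
  using exec_LoopT.prems(6)[of 0] by (simp add: good_def can_send_def)
 have s2: "(sstep M coins w \<pi> ^^ t1) (vis m, conf_of k (Suc b) (Suc n) m)
   = (vis m1, conf_of k b (Suc n + t1) m1) \<and> good k S m1"
 proof (rule exec_LoopT.IH(1))
  show "coins (Suc n + i) = c (Suc i)" for i using exec_LoopT.prems(6)[of "Suc i"] by simp
  show "obeys k M q' (code k p (Suc b) b q')" if "Suc b \<le> q'" "q' < Suc b + psize p" for q'
   using exec_LoopT.prems(3)[of q'] that by (auto simp: obeys_def)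
 qed (use exec_LoopT.prems in auto)
 have s3: "(sstep M coins w \<pi> ^^ t2) (vis m1, conf_of k b (Suc n + t1) m1)
   = (vis m2, conf_of k e (Suc n + t1 + t2) m2) \<and> good k S m2"
 proof (rule exec_LoopT.IH(2))
  show "coins (Suc n + t1 + i) = c (Suc (t1 + i))" for i
   using exec_LoopT.prems(6)[of "Suc (t1 + i)"] by (simp add: ac_simps)
 qed (use exec_LoopT.prems s2 in auto)
 have "(sstep M coins w \<pi> ^^ (t2 + (t1 + 1))) (vis m, conf_of k b n m) = (vis m2, conf_of k e (Suc n + t1 + t2) m2)"
  using s1 s2 s3 by (simp add: funpow_add funpow_swap1)
 then show ?case using s3 by (simp add: ac_simps)
qed

definition start :: "nat \<Rightarrow> mem" where
 "start v = \<lparr>pin = 0, pcom = 0, tp = (\<lambda>_. (\<lambda>_. 0, 0)), ot = [], vis = v\<rparr>"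

lemma exec_compile:
 assumes "exec w \<pi> (\<lambda>n. coins (Suc n)) p t (start v) m'" "okp k S p" "S > 0"
 shows "\<exists>cf. (sstep (compile k S p) coins w \<pi> ^^ (t + 2)) (v, init_conf (compile k S p)) = (vis m', cf)
  \<and> halted cf \<and> steps cf = t + 2 \<and> out_tape cf = ot m'"
proof -
 let ?M = "compile k S p"
 have g: "good k S (start v)" using assms(3) by (simp add: good_def start_def blank_above_def rd_def)
 have i: "init_conf ?M = conf_of k 0 0 (start v)"
  by (simp add: init_conf_def conf_of_def start_def compile_def map_replicate_const)
 have "obeys k ?M 0 (\<lambda>c i m s. to_act k s ((\<lambda>_ _ _ _. 2) c i m s) ((\<lambda>_ _ _ _. nop) c i m s))"
  by (simp add: obeys_def compile_def)
 from sstep_obeys[OF this, of "start v" coins 0 "coins 0" \<pi> w] g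
 have s0: "sstep ?M coins w \<pi> (v, init_conf ?M) = (v, conf_of k 2 1 (start v))"
  by (simp add: good_def can_send_def i start_def)
 have s1: "(sstep ?M coins w \<pi> ^^ t) (vis (start v), conf_of k 2 1 (start v))
   = (vis m', conf_of k (2 + psize p) (1 + t) m') \<and> good k S m'"
  by (rule exec_code[OF assms(1,2) g]) (auto simp: obeys_def compile_def)
 have "obeys k ?M (2 + psize p) (\<lambda>c i m s. to_act k s ((\<lambda>_ _ _ _. 1) c i m s) ((\<lambda>_ _ _ _. nop) c i m s))"
  by (simp add: obeys_def compile_def)
 from sstep_obeys[OF this, of m' coins "1 + t" "coins (1 + t)" \<pi> w] s1
 have s2: "sstep ?M coins w \<pi> (vis m', conf_of k (2 + psize p) (1 + t) m') = (vis m', conf_of k 1 (t + 2) m')"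
  by (simp add: good_def can_send_def)
 have "(sstep ?M coins w \<pi> ^^ (1 + (t + 1))) (v, init_conf ?M) = (vis m', conf_of k 1 (t + 2) m')"
  using s0 s1 s2 unfolding funpow_add by (simp add: start_def)
 then show ?thesis by (intro exI[of _ "conf_of k 1 (t + 2) m'"]) (simp add: halted_def conf_of_def)
qed

lemma exec_side:
 assumes "exec w \<pi> (\<lambda>n. coins (Suc n)) p t (start (if first then 0 else min 1 (length \<pi>))) m'"
  "okp k S p" "S > 0" "vis m' = length \<pi>" "real (t + 2) \<le> T"
 shows "side (compile k S p) first w coins T \<pi> (ot m')"
proof -
 from exec_compile[OF assms(1-3)] obtain cf where
  "(sstep (compile k S p) coins w \<pi> ^^ (t + 2)) (if first then 0 else min 1 (length \<pi>), init_conf (compile k S p)) = (vis m', cf)"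
  "halted cf" "steps cf = t + 2" "out_tape cf = ot m'" by blast
 with assms(4,5) show ?thesis unfolding side_def by (intro exI[of _ "t + 2"] exI[of _ cf]) simp
qed

text \<open>Against the empty transcript nothing can be sent, so the run is a stand-alone one.\<close>

lemma sstep_solo:
 assumes "(sstep M coins w [] ^^ k) (0, cf) = (j, cf')" "halted cf'"
 shows "halted ((solo_step M coins w ^^ k) cf) \<and> (solo_step M coins w ^^ k) cf = cf'" using assms
proof (induction k arbitrary: cf)
 case (Suc k)
 have "sstep M coins w [] (0, cf) = (0, solo_step M coins w cf) \<or> sstep M coins w [] (0, cf) = (0, cf) \<and> \<not> halted cf"
  by (auto simp: sstep_def solo_step_def Let_def split: option.split)
 then show ?case
 proof
  assume "sstep M coins w [] (0, cf) = (0, solo_step M coins w cf)"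
  then show ?thesis using Suc by (simp add: funpow_swap1)
 next
  assume a: "sstep M coins w [] (0, cf) = (0, cf) \<and> \<not> halted cf"
  then have "(sstep M coins w [] ^^ Suc k) (0, cf) = (0, cf)" using funpow_fixpoint by metis
  then show ?thesis using Suc.prems a by auto
 qed
qed simp

lemma solo_step_halted: "halted cf \<Longrightarrow> (solo_step M coins w ^^ k) cf = cf"
 by (rule funpow_fixpoint) (simp add: solo_step_def)

lemma runs_mono: "runs M coins w T z \<Longrightarrow> T \<le> T' \<Longrightarrow> runs M coins w T' z"
 using funpow_add[of "T' - T" T "solo_step M coins w"] solo_step_halted
 by (auto simp: runs_def Let_def)

lemma exec_runs:
 assumes "exec w [] (\<lambda>n. coins (Suc n)) p t (start 0) m'" "okp k S p" "S > 0" "t + 2 \<le> T"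
 shows "runs (compile k S p) coins w T (ot m')"
proof -
 from exec_compile[OF assms(1-3)] obtain cf where
  "(sstep (compile k S p) coins w [] ^^ (t + 2)) (0, init_conf (compile k S p)) = (vis m', cf)"
  "halted cf" "out_tape cf = ot m'" by blast
 from sstep_solo[OF this(1,2)] this(2,3) show ?thesis
  by (intro runs_mono[OF _ assms(4)]) (simp add: runs_def Let_def)
qed

section \<open>Runs of coin-free programs\<close>

text \<open>The time is only bounded, but the final memory must be the same for all coins.\<close>

definition run :: "bits \<Rightarrow> bits \<Rightarrow> prog \<Rightarrow> nat \<Rightarrow> mem \<Rightarrow> mem \<Rightarrow> bool" where
 "run w \<pi> p B m m' \<longleftrightarrow> (\<forall>c. \<exists>t\<le>B. exec w \<pi> c p t m m')"

lemma run_mono: "run w \<pi> p B m m' \<Longrightarrow> B \<le> B' \<Longrightarrow> run w \<pi> p B' m m'"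
 unfolding run_def by (meson le_trans)

lemma run_Act:
 assumes "\<And>c. observe w \<pi> m c f = ins" "can_send \<pi> ins m" "m' = exec_instr \<pi> ins m"
 shows "run w \<pi> (Act f) 1 m m'" unfolding run_def
proof
 fix c
 have "exec w \<pi> c (Act f) 1 m m'" using exec_Act[of \<pi> f c w m] assms by simp
 then show "\<exists>t\<le>1. exec w \<pi> c (Act f) t m m'" by blast
qed

lemma run_Seq:
 assumes "run w \<pi> p B1 m m1" "run w \<pi> q B2 m1 m2"
 shows "run w \<pi> (p ;; q) (B1 + B2) m m2" unfolding run_def
proof
 fix c
 from assms(1) obtain t1 where 1: "t1 \<le> B1" "exec w \<pi> c p t1 m m1" unfolding run_def by blast
 from assms(2) obtain t2 where 2: "t2 \<le> B2" "exec w \<pi> (\<lambda>n. c (t1 + n)) q t2 m1 m2"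
  unfolding run_def by blast
 from exec_Seq[OF 1(2) 2(2)] 1(1) 2(1) show "\<exists>t\<le>B1 + B2. exec w \<pi> c (p ;; q) t m m2"
  by (meson add_mono)
qed

lemma run_CondT:
 assumes "\<And>c. observe w \<pi> m c C" "run w \<pi> p B m m1"
 shows "run w \<pi> (Cond C p q) (Suc B) m m1" unfolding run_def
proof
 fix c
 from assms(2) obtain t where "t \<le> B" "exec w \<pi> (\<lambda>n. c (Suc n)) p t m m1"
  unfolding run_def by blast
 with exec_CondT[where C = C and c = c, OF assms(1)] show "\<exists>t\<le>Suc B. exec w \<pi> c (Cond C p q) t m m1"
  by (meson Suc_le_mono)
qed

lemma run_CondF:
 assumes "\<And>c. \<not> observe w \<pi> m c C" "run w \<pi> q B m m1"
 shows "run w \<pi> (Cond C p q) (Suc B) m m1" unfolding run_def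
proof
 fix c
 from assms(2) obtain t where "t \<le> B" "exec w \<pi> (\<lambda>n. c (Suc n)) q t m m1"
  unfolding run_def by blast
 with exec_CondF[where C = C and c = c, OF assms(1)] show "\<exists>t\<le>Suc B. exec w \<pi> c (Cond C p q) t m m1"
  by (meson Suc_le_mono)
qed

lemma run_LoopF: "(\<And>c. \<not> observe w \<pi> m c C) \<Longrightarrow> run w \<pi> (Loop C p) 1 m m"
 unfolding run_def using exec_LoopF[where C = C] by blast

lemma run_LoopT:
 assumes "\<And>c. observe w \<pi> m c C" "run w \<pi> p B1 m m1" "run w \<pi> (Loop C p) B2 m1 m2"
 shows "run w \<pi> (Loop C p) (Suc (B1 + B2)) m m2" unfolding run_def
proof
 fix c
 from assms(2) obtain t1 where 1: "t1 \<le> B1" "exec w \<pi> (\<lambda>n. c (Suc n)) p t1 m m1"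
  unfolding run_def by blast
 from assms(3) obtain t2 where 2: "t2 \<le> B2" "exec w \<pi> (\<lambda>n. c (Suc (t1 + n))) (Loop C p) t2 m1 m2"
  unfolding run_def by (metis (no_types))
 from exec_LoopT[where C = C and c = c, OF assms(1) 1(2) 2(2)] 1(1) 2(1)
 show "\<exists>t\<le>Suc (B1 + B2). exec w \<pi> c (Loop C p) t m m2" by (meson Suc_le_mono add_mono)
qed

lemma run_for_sum:
 assumes "\<And>i c. i < n \<Longrightarrow> observe w \<pi> (M i) c C" "\<And>i. i < n \<Longrightarrow> run w \<pi> p (B i) (M i) (M (Suc i))"
  and "\<And>c. \<not> observe w \<pi> (M n) c C"
 shows "run w \<pi> (Loop C p) (Suc (\<Sum>i<n. Suc (B i))) (M 0) (M n)" using assms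
proof (induction n arbitrary: M B)
 case 0
 then show ?case using run_LoopF by force
next
 case (Suc n)
 have "run w \<pi> (Loop C p) (Suc (\<Sum>i<n. Suc (B (Suc i)))) (M (Suc 0)) (M (Suc n))"
  by (rule Suc.IH[of "\<lambda>i. M (Suc i)" "\<lambda>i. B (Suc i)"]) (use Suc.prems in auto)
 from run_LoopT[OF Suc.prems(1)[of 0] Suc.prems(2)[of 0] this]
 show ?case by (simp add: sum.lessThan_Suc_shift ac_simps del: sum.lessThan_Suc)
qed

lemma run_for:
 assumes "\<And>i c. i < n \<Longrightarrow> observe w \<pi> (M i) c C" "\<And>i. i < n \<Longrightarrow> run w \<pi> p B (M i) (M (Suc i))"
  and "\<And>c. \<not> observe w \<pi> (M n) c C" "m = M 0" "m' = M n"
 shows "run w \<pi> (Loop C p) (n * Suc B + 1) m m'"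
 using run_for_sum[where M = M and n = n and C = C and B = "\<lambda>_. B", OF assms(1-3)] assms(4,5) by simp

section \<open>Elementary programs\<close>

abbreviation upd :: "nat \<Rightarrow> tape \<Rightarrow> mem \<Rightarrow> mem" where
 "upd v t m \<equiv> m\<lparr>tp := (tp m)(v := t)\<rparr>"

lemma upd_same [simp]: "tp m v = t \<Longrightarrow> upd v t m = m" by (cases m) (auto simp: fun_eq_iff)

text \<open>Normal form of updates: \<^const>\<open>tp\<close> outermost.\<close>

lemma mem_upd_commute [simp]:
 "m\<lparr>tp := t, pin := p\<rparr> = m\<lparr>pin := p, tp := t\<rparr>" "m\<lparr>tp := t, pcom := p\<rparr> = m\<lparr>pcom := p, tp := t\<rparr>"
 "m\<lparr>tp := t, ot := z\<rparr> = m\<lparr>ot := z, tp := t\<rparr>" "m\<lparr>tp := t, vis := j\<rparr> = m\<lparr>vis := j, tp := t\<rparr>"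
 "m\<lparr>pcom := q, pin := p\<rparr> = m\<lparr>pin := p, pcom := q\<rparr>" "m\<lparr>ot := z, pin := p\<rparr> = m\<lparr>pin := p, ot := z\<rparr>"
 "m\<lparr>vis := j, pin := p\<rparr> = m\<lparr>pin := p, vis := j\<rparr>" "m\<lparr>ot := z, pcom := q\<rparr> = m\<lparr>pcom := q, ot := z\<rparr>"
 "m\<lparr>vis := j, pcom := q\<rparr> = m\<lparr>pcom := q, vis := j\<rparr>" "m\<lparr>vis := j, ot := z\<rparr> = m\<lparr>ot := z, vis := j\<rparr>"
 by (simp_all)

definition putf :: "nat \<Rightarrow> nat obs \<Rightarrow> move \<Rightarrow> prog" where
 "putf v f mv = Act (\<lambda>c i m s. nop\<lparr>wr := [v \<mapsto> (f c i m s, mv)]\<rparr>)"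

definition put :: "nat \<Rightarrow> nat \<Rightarrow> move \<Rightarrow> prog" where
 "put v a mv = putf v (\<lambda>_ _ _ _. a) mv"

definition go :: "nat \<Rightarrow> move \<Rightarrow> prog" where
 "go v mv = putf v (\<lambda>c i m s. s v) mv"

definition imove :: "move \<Rightarrow> prog" where
 "imove mv = Act (\<lambda>c i m s. nop\<lparr>mv_in := mv\<rparr>)"

definition emitf :: "bool obs \<Rightarrow> prog" where
 "emitf f = Act (\<lambda>c i m s. nop\<lparr>em := Some (f c i m s)\<rparr>)"

definition skip :: prog where
 "skip = Act (\<lambda>_ _ _ _. nop)"

lemma exec_instr_wr: "exec_instr \<pi> (nop\<lparr>wr := [v \<mapsto> a]\<rparr>) m = upd v (write_tape a (tp m v)) m"
 by (cases m) (auto simp: exec_instr_def fun_eq_iff)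

lemma run_putf:
 assumes "\<And>c. observe w \<pi> m c f = a" "m' = upd v (write_tape (a, mv) (tp m v)) m"
 shows "run w \<pi> (putf v f mv) 1 m m'" unfolding putf_def
 by (rule run_Act[where ins = "nop\<lparr>wr := [v \<mapsto> (a, mv)]\<rparr>"])
   (simp_all add: assms can_send_def exec_instr_wr)

lemma run_put: "run w \<pi> (put v a mv) 1 m (upd v (write_tape (a, mv) (tp m v)) m)"
 unfolding put_def by (rule run_putf) simp_all

lemma write_tape_same [simp]: "write_tape (f i, mv) (f, i) = (f, i + offset mv)"
 by (simp add: write_tape_def)

lemma run_go: "tp m v = (f, i) \<Longrightarrow> run w \<pi> (go v mv) 1 m (upd v (f, i + offset mv) m)"
 unfolding go_def by (rule run_putf[where a = "f i"]) (simp_all add: rd_def)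

lemma run_imove: "run w \<pi> (imove mv) 1 m (m\<lparr>pin := pin m + offset mv\<rparr>)" unfolding imove_def
 by (rule run_Act[where ins = "nop\<lparr>mv_in := mv\<rparr>"]) (auto simp: can_send_def exec_instr_def fun_eq_iff)

lemma run_emitf:
 assumes "\<And>c. observe w \<pi> m c f = b" "m' = m\<lparr>ot := ot m @ [b]\<rparr>"
 shows "run w \<pi> (emitf f) 1 m m'" unfolding emitf_def
 by (rule run_Act[where ins = "nop\<lparr>em := Some b\<rparr>"])
   (auto simp: assms can_send_def exec_instr_def fun_eq_iff)

lemma run_skip: "run w \<pi> skip 1 m m"
 unfolding skip_def by (rule run_Act[where ins = nop]) (auto simp: can_send_def)

lemma okp_elem [simp]:
 "okp k S (putf v f mv) \<longleftrightarrow> (\<forall>c i m s. (\<forall>j. s j < S) \<longrightarrow> v < k \<and> f c i m s < S)"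
 "okp k S (put v a mv) \<longleftrightarrow> (\<forall>s::nat \<Rightarrow> nat. (\<forall>j. s j < S) \<longrightarrow> v < k \<and> a < S)"
 "okp k S (go v mv) \<longleftrightarrow> (\<forall>s. (\<forall>j. s j < S) \<longrightarrow> v < k \<and> s v < S)"
 "okp k S (imove mv)" "okp k S (emitf b)" "okp k S skip"
 by (auto simp: putf_def put_def go_def imove_def emitf_def skip_def)

lemma coinless_elem [simp]:
 "coinless (putf v f mv) \<longleftrightarrow> f True = f False" "coinless (put v a mv)" "coinless (go v mv)"
 "coinless (imove mv)" "coinless (emitf b) \<longleftrightarrow> b True = b False" "coinless skip"
proof -
 have "(\<lambda>i m s. nop\<lparr>wr := [v \<mapsto> (f True i m s, mv)]\<rparr>) = (\<lambda>i m s. nop\<lparr>wr := [v \<mapsto> (f False i m s, mv)]\<rparr>)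
  \<Longrightarrow> f True = f False"
 proof (intro ext)
  fix i m s
  assume "(\<lambda>i m s. nop\<lparr>wr := [v \<mapsto> (f True i m s, mv)]\<rparr>) = (\<lambda>i m s. nop\<lparr>wr := [v \<mapsto> (f False i m s, mv)]\<rparr>)"
  then have "wr (nop\<lparr>wr := [v \<mapsto> (f True i m s, mv)]\<rparr>) v = wr (nop\<lparr>wr := [v \<mapsto> (f False i m s, mv)]\<rparr>) v"
   by metis
  then show "f True i m s = f False i m s" by simp
 qed
 then show "coinless (putf v f mv) \<longleftrightarrow> f True = f False" by (auto simp: putf_def)
 have "(\<lambda>i m s. nop\<lparr>em := Some (b True i m s)\<rparr>) = (\<lambda>i m s. nop\<lparr>em := Some (b False i m s)\<rparr>)
  \<Longrightarrow> b True = b False"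
 proof (intro ext)
  fix i m s
  assume "(\<lambda>i m s. nop\<lparr>em := Some (b True i m s)\<rparr>) = (\<lambda>i m s. nop\<lparr>em := Some (b False i m s)\<rparr>)"
  then have "em (nop\<lparr>em := Some (b True i m s)\<rparr>) = em (nop\<lparr>em := Some (b False i m s)\<rparr>)" by metis
  then show "b True i m s = b False i m s" by simp
 qed
 then show "coinless (emitf b) \<longleftrightarrow> b True = b False" by (auto simp: emitf_def)
qed (auto simp: putf_def put_def go_def imove_def skip_def)

abbreviation nz :: "nat \<Rightarrow> bool obs" where
 "nz v \<equiv> \<lambda>c i m s. s v \<noteq> 0"

abbreviation sees :: "nat \<Rightarrow> nat \<Rightarrow> bool obs" where
 "sees v a \<equiv> \<lambda>c i m s. s v = a"

abbreviation moreinput :: "bool obs" where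
 "moreinput \<equiv> \<lambda>c i m s. i \<noteq> None"

abbreviation unmarked :: "bool obs" where
 "unmarked \<equiv> \<lambda>c i m s. i \<noteq> Some True"

subsection \<open>Scanning a tape\<close>

definition scanr :: "(nat \<Rightarrow> bool) \<Rightarrow> nat \<Rightarrow> prog" where
 "scanr P v = Loop (\<lambda>c i m s. P (s v)) (go v MoveRight)"

definition scanl :: "(nat \<Rightarrow> bool) \<Rightarrow> nat \<Rightarrow> prog" where
 "scanl P v = Loop (\<lambda>c i m s. P (s v)) (go v MoveLeft)"

lemma run_scanr:
 assumes "tp m v = (f, i)" "i \<le> j" "\<And>k. i \<le> k \<Longrightarrow> k < j \<Longrightarrow> P (f k)" "\<not> P (f j)"
 shows "run w \<pi> (scanr P v) (nat (j - i) * 2 + 1) m (upd v (f, j) m)"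
proof -
 let ?M = "\<lambda>n. upd v (f, i + int n) m"
 have step: "run w \<pi> (go v MoveRight) 1 (?M n) (?M (Suc n))" for n
  using run_go[of "?M n" v f "i + int n" w \<pi> MoveRight] by (simp add: ac_simps)
 have "run w \<pi> (scanr P v) (nat (j - i) * Suc 1 + 1) m (upd v (f, j) m)" unfolding scanr_def
  by (rule run_for[where M = ?M and n = "nat (j - i)", OF _ step]) (use assms in \<open>auto simp: rd_def\<close>)
 then show ?thesis by (simp add: mult_2_right)
qed

lemma run_scanl:
 assumes "tp m v = (f, i)" "j \<le> i" "\<And>k. j < k \<Longrightarrow> k \<le> i \<Longrightarrow> P (f k)" "\<not> P (f j)"
 shows "run w \<pi> (scanl P v) (nat (i - j) * 2 + 1) m (upd v (f, j) m)"
proof -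
 let ?M = "\<lambda>n. upd v (f, i - int n) m"
 have step: "run w \<pi> (go v MoveLeft) 1 (?M n) (?M (Suc n))" for n
  using run_go[of "?M n" v f "i - int n" w \<pi> MoveLeft] by (simp add: algebra_simps)
 have "run w \<pi> (scanl P v) (nat (i - j) * Suc 1 + 1) m (upd v (f, j) m)" unfolding scanl_def
  by (rule run_for[where M = ?M and n = "nat (i - j)", OF _ step]) (use assms in \<open>auto simp: rd_def\<close>)
 then show ?thesis by (simp add: mult_2_right)
qed

lemma okp_scan [simp]:
 "okp k S (scanr P v) \<longleftrightarrow> okp k S (go v MoveRight)" "okp k S (scanl P v) \<longleftrightarrow> okp k S (go v MoveLeft)"
 "coinless (scanr P v)" "coinless (scanl P v)" by (simp_all add: scanr_def scanl_def)

subsection \<open>Stacks\<close>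

text \<open>
 A list is stored in the cells from 1 on; as a stack, its last element is the top and the head
 scans it.  Thus a blank tape is the empty stack, and scanning 0 means emptiness.
\<close>

definition cells :: "nat list \<Rightarrow> int \<Rightarrow> nat" where
 "cells ys j = (if 1 \<le> j \<and> j \<le> int (length ys) then ys ! nat (j - 1) else 0)"

definition stk :: "nat list \<Rightarrow> tape" where
 "stk ys = (cells ys, int (length ys))"

lemma stk_Nil: "stk [] = (\<lambda>_. 0, 0)" by (auto simp: stk_def cells_def)

lemma cells_append: "(cells ys)(1 + int (length ys) := a) = cells (ys @ [a])"
 by (auto simp: cells_def nth_append fun_eq_iff)

lemma cells_pop: "(cells (ys @ [a]))(1 + int (length ys) := 0) = cells ys"
 by (auto simp: cells_def nth_append fun_eq_iff)

lemma cells_out [simp]: "cells ys 0 = 0" "cells ys (int (length ys) + 1) = 0" "cells ys (1 + int (length ys)) = 0"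
 by (auto simp: cells_def)

lemma cells_nz: "0 \<notin> set ys \<Longrightarrow> 1 \<le> j \<Longrightarrow> j \<le> int (length ys) \<Longrightarrow> cells ys j \<noteq> 0"
 by (auto simp: cells_def in_set_conv_nth)

definition topsym :: "nat list \<Rightarrow> nat" where
 "topsym ys = (if ys = [] then 0 else last ys)"

lemma topsym_simps [simp]: "topsym [] = 0" "topsym (ys @ [a]) = a" by (auto simp: topsym_def)

lemma rd_stk: "tp m v = stk ys \<Longrightarrow> rd m v = topsym ys"
 by (cases ys rule: rev_cases) (auto simp: rd_def stk_def cells_def)

definition pop :: "nat \<Rightarrow> prog" where
 "pop v = put v 0 MoveLeft"

definition pushf :: "nat \<Rightarrow> nat obs \<Rightarrow> prog" where
 "pushf v f = go v MoveRight ;; putf v f Stay"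

definition push :: "nat \<Rightarrow> nat \<Rightarrow> prog" where
 "push v a = pushf v (\<lambda>_ _ _ _. a)"

lemma run_pop: "tp m v = stk (ys @ [a]) \<Longrightarrow> run w \<pi> (pop v) 1 m (upd v (stk ys) m)"
 using run_put[of w \<pi> v 0 MoveLeft m] by (simp add: pop_def stk_def write_tape_def cells_pop)

lemma run_pushf:
 assumes "tp m v = stk ys"
  "\<And>c t. observe w \<pi> (upd v t m) c f = a"
 shows "run w \<pi> (pushf v f) 2 m (upd v (stk (ys @ [a])) m)"
proof -
 have 1: "run w \<pi> (go v MoveRight) 1 m (upd v (cells ys, int (length ys) + 1) m)"
  using run_go[of m v "cells ys" "int (length ys)" w \<pi> MoveRight] assms(1) by (simp add: stk_def)
 have 2: "run w \<pi> (putf v f Stay) 1 (upd v (cells ys, int (length ys) + 1) m) (upd v (stk (ys @ [a])) m)"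
  by (rule run_putf[where a = a], rule assms(2)) (simp add: write_tape_def stk_def cells_append ac_simps)
 show ?thesis using run_Seq[OF 1 2] by (simp add: pushf_def numeral_2_eq_2)
qed

lemma run_push: "tp m v = stk ys \<Longrightarrow> run w \<pi> (push v a) 2 m (upd v (stk (ys @ [a])) m)"
 unfolding push_def by (rule run_pushf) auto

lemma okp_stack [simp]:
 "okp k S (pop v) \<longleftrightarrow> okp k S (put v 0 MoveLeft)"
 "okp k S (pushf v f) \<longleftrightarrow> okp k S (putf v f Stay)"
 "okp k S (push v a) \<longleftrightarrow> okp k S (put v a Stay)"
 "coinless (pop v)" "coinless (pushf v f) \<longleftrightarrow> f True = f False" "coinless (push v a)"
 by (auto simp: pop_def pushf_def push_def)

text \<open>Tapes have two uses: as a stack the head is on the top, for reading it is on the first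
  entry. \<open>rewind\<close> and \<open>unwind\<close> change between them. The scans stop at
  blanks, hence the later premises that no entry is 0.\<close>

definition rewind :: "nat \<Rightarrow> prog" where
 "rewind v = scanl (\<lambda>a. a \<noteq> 0) v ;; go v MoveRight"

definition unwind :: "nat \<Rightarrow> prog" where
 "unwind v = scanr (\<lambda>a. a \<noteq> 0) v ;; go v MoveLeft"

lemma okp_wind [simp]:
 "okp k S (rewind v) \<longleftrightarrow> okp k S (go v MoveLeft)" "okp k S (unwind v) \<longleftrightarrow> okp k S (go v MoveLeft)"
 "coinless (rewind v)" "coinless (unwind v)" by (auto simp: rewind_def unwind_def)

lemma run_rewind:
 assumes "tp m v = (cells ys, i)" "0 \<le> i" "i \<le> int (length ys)" "0 \<notin> set ys"
 shows "run w \<pi> (rewind v) (2 * length ys + 2) m (upd v (cells ys, 1) m)"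
proof -
 have 1: "run w \<pi> (scanl (\<lambda>a. a \<noteq> 0) v) (nat (i - 0) * 2 + 1) m (upd v (cells ys, 0) m)"
  using assms cells_nz by (intro run_scanl) (auto simp: cells_def)
 have 2: "run w \<pi> (go v MoveRight) 1 (upd v (cells ys, 0) m) (upd v (cells ys, 1) m)"
  using run_go[of "upd v (cells ys, 0) m" v "cells ys" 0 w \<pi> MoveRight] by simp
 show ?thesis unfolding rewind_def by (rule run_mono[OF run_Seq[OF 1 2]]) (use assms in auto)
qed

lemma run_unwind:
 assumes "tp m v = (cells ys, i)" "1 \<le> i" "i \<le> int (length ys) + 1" "0 \<notin> set ys"
 shows "run w \<pi> (unwind v) (2 * length ys + 2) m (upd v (stk ys) m)"
proof -
 have 1: "run w \<pi> (scanr (\<lambda>a. a \<noteq> 0) v) (nat (int (length ys) + 1 - i) * 2 + 1) m (upd v (cells ys, int (length ys) + 1) m)"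
  using assms cells_nz by (intro run_scanr) (auto simp: cells_def)
 have 2: "run w \<pi> (go v MoveLeft) 1 (upd v (cells ys, int (length ys) + 1) m) (upd v (stk ys) m)"
  using run_go[of "upd v (cells ys, int (length ys) + 1) m" v "cells ys" "int (length ys) + 1" w \<pi> MoveLeft]
  by (simp add: stk_def)
 show ?thesis unfolding unwind_def by (rule run_mono[OF run_Seq[OF 1 2]]) (use assms in auto)
qed

subsection \<open>Unary numbers\<close>

definition un :: "nat \<Rightarrow> tape" where
 "un n = stk (replicate n 1)"

lemma un_0: "un 0 = stk []" by (simp add: un_def)

lemma topsym_replicate [simp]: "topsym (replicate n a) = (if n = 0 then 0 else a)"
 by (cases n) (auto simp: topsym_def)

lemma rd_un: "tp m v = un n \<Longrightarrow> rd m v = (if n = 0 then 0 else 1)"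
 unfolding un_def by (drule rd_stk) simp

lemma un_Suc: "un (Suc n) = stk (replicate n 1 @ [1])" by (simp add: un_def replicate_append_same)

lemma run_pop_un: "tp m v = un (Suc n) \<Longrightarrow> run w \<pi> (pop v) 1 m (upd v (un n) m)"
 unfolding un_Suc by (subst un_def) (rule run_pop)

lemma run_push_un: "tp m v = un n \<Longrightarrow> run w \<pi> (push v 1) 2 m (upd v (un (Suc n)) m)"
 unfolding un_Suc by (subst (asm) un_def) (rule run_push)

lemma run_countdown:
 assumes "\<And>i. i \<le> n \<Longrightarrow> tp (M i) v = un (n - i)"
  and "\<And>i. i < n \<Longrightarrow> run w \<pi> p B (upd v (un (n - Suc i)) (M i)) (M (Suc i))"
  and "m = M 0" "m' = M n"
 shows "run w \<pi> (Loop (nz v) (pop v ;; p)) (n * (B + 2) + 1) m m'"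
proof -
 have "run w \<pi> (Loop (nz v) (pop v ;; p)) (n * Suc (1 + B) + 1) m m'"
 proof (rule run_for[where M = M])
  fix i assume i: "i < n"
  then have t: "tp (M i) v = un (Suc (n - Suc i))" using assms(1)[of i] by (simp add: Suc_diff_Suc)
  then show "observe w \<pi> (M i) c (nz v)" for c by (subst rd_un[OF t]) simp
  show "run w \<pi> (pop v ;; p) (1 + B) (M i) (M (Suc i))"
   by (rule run_Seq[OF run_pop_un[OF t] assms(2)[OF i]])
 next
  have t: "tp (M n) v = un 0" using assms(1)[of n] by simp
  show "\<not> observe w \<pi> (M n) c (nz v)" for c by (subst rd_un[OF t]) simp
 qed (use assms in auto)
 then show ?thesis by simp
qed

definition dbl :: "nat \<Rightarrow> nat \<Rightarrow> prog" where
 "dbl v u = Loop (nz v) (pop v ;; push u 1 ;; push u 1) ;; Loop (nz u) (pop u ;; push v 1)"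

lemma run_dbl:
 assumes "tp m v = un n" "tp m u = un 0" "u \<noteq> v"
 shows "run w \<pi> (dbl v u) (14 * n + 2) m (upd v (un (2 * n)) m)"
proof -
 let ?M = "\<lambda>i. m\<lparr>tp := (tp m)(v := un (n - i), u := un (2 * i))\<rparr>"
 have 1: "run w \<pi> (Loop (nz v) (pop v ;; push u 1 ;; push u 1)) (n * (4 + 2) + 1) m (?M n)"
 proof (rule run_countdown[where M = ?M])
  fix i assume "i < n"
  let ?a = "upd v (un (n - Suc i)) (?M i)"
  have a: "run w \<pi> (push u 1) 2 ?a (upd u (un (Suc (2 * i))) ?a)"
   by (rule run_push_un) (use assms in simp)
  have b: "run w \<pi> (push u 1) 2 (upd u (un (Suc (2 * i))) ?a) (upd u (un (Suc (Suc (2 * i)))) (upd u (un (Suc (2 * i))) ?a))"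
   by (rule run_push_un) (use assms in simp)
  have e: "upd u (un (Suc (Suc (2 * i)))) (upd u (un (Suc (2 * i))) ?a) = ?M (Suc i)"
   using assms(3) by (auto simp: fun_eq_iff)
  show "run w \<pi> (push u 1 ;; push u 1) 4 ?a (?M (Suc i))"
   using run_Seq[OF a b] unfolding e by simp
 qed (use assms in \<open>cases m, auto simp: fun_eq_iff\<close>)
 let ?N = "\<lambda>i. m\<lparr>tp := (tp m)(v := un i, u := un (2 * n - i))\<rparr>"
 have 2: "run w \<pi> (Loop (nz u) (pop u ;; push v 1)) (2 * n * (2 + 2) + 1) (?M n) (upd v (un (2 * n)) m)"
 proof (rule run_countdown[where M = ?N])
  fix i assume "i < 2 * n"
  let ?a = "upd u (un (2 * n - Suc i)) (?N i)"
  have a: "run w \<pi> (push v 1) 2 ?a (upd v (un (Suc i)) ?a)"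
   by (rule run_push_un) (use assms in simp)
  have e: "upd v (un (Suc i)) ?a = ?N (Suc i)" using assms(3) by (auto simp: fun_eq_iff)
  show "run w \<pi> (push v 1) 2 ?a (?N (Suc i))" using a unfolding e .
 qed (use assms in \<open>cases m, auto simp: fun_eq_iff\<close>)
 show ?thesis unfolding dbl_def by (rule run_mono[OF run_Seq[OF 1 2]]) simp
qed

subsection \<open>Reading numbers from the input\<close>

text \<open>
 Every binary digit is preceded by \<^term>\<open>True\<close>, and the code ends with \<^term>\<open>False\<close>.
 Since the input of a stand-alone run doubles its bits, the reader takes a stride.
\<close>

fun digits :: "nat \<Rightarrow> bits" where
 "digits n = (if n = 0 then [] else digits (n div 2) @ [True, odd n])"

declare digits.simps [simp del]

definition numcode :: "nat \<Rightarrow> bits" where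
 "numcode n = digits n @ [False]"

definition inpseq :: "bits \<Rightarrow> nat \<Rightarrow> int \<Rightarrow> bits \<Rightarrow> bool" where
 "inpseq w d p ys \<longleftrightarrow> (\<forall>k<length ys. cell w (p + int (d * k)) = Some (ys ! k))"

lemma inpseq_Nil [simp]: "inpseq w d p []" by (simp add: inpseq_def)

lemma inpseq_append:
 "inpseq w d p (xs @ ys) \<longleftrightarrow> inpseq w d p xs \<and> inpseq w d (p + int (d * length xs)) ys"
proof -
 have "(\<forall>k<length xs + length ys. P k) \<longleftrightarrow> (\<forall>k<length xs. P k) \<and> (\<forall>k<length ys. P (length xs + k))" for P
 proof (intro iffI conjI allI impI)
  fix k assume a: "(\<forall>k<length xs. P k) \<and> (\<forall>k<length ys. P (length xs + k))" "k < length xs + length ys"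
  show "P k"
  proof (cases "k < length xs")
   case False
   then obtain k' where "k = length xs + k'" using le_Suc_ex not_less by blast
   then show ?thesis using a by simp
  qed (use a in blast)
 qed auto
 note * = this[of "\<lambda>k. cell w (p + int (d * k)) = Some ((xs @ ys) ! k)"]
 show ?thesis unfolding inpseq_def length_append * by (auto simp: nth_append algebra_simps)
qed

lemma inpseq_Cons [simp]:
 "inpseq w d p (y # ys) \<longleftrightarrow> cell w p = Some y \<and> inpseq w d (p + int d) ys"
 using inpseq_append[of w d p "[y]" ys] by (simp add: inpseq_def)

definition adv :: "nat \<Rightarrow> prog" where
 "adv d = (if d = 1 then imove MoveRight else imove MoveRight ;; imove MoveRight)"

lemma run_adv: "d = 1 \<or> d = 2 \<Longrightarrow> run w \<pi> (adv d) 2 m (m\<lparr>pin := pin m + int d\<rparr>)"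
proof -
 have 1: "run w \<pi> (imove MoveRight) 1 m (m\<lparr>pin := pin m + 1\<rparr>)" for m
  using run_imove[of w \<pi> MoveRight m] by simp
 assume "d = 1 \<or> d = 2"
 then show ?thesis
 proof
  assume "d = 1" then show ?thesis using run_mono[OF 1[of m], of 2] by (simp add: adv_def)
 next
  assume "d = 2" then show ?thesis using run_Seq[OF 1[of m] 1]
   by (simp add: adv_def numeral_2_eq_2 ac_simps)
 qed
qed

abbreviation nextbit :: "bool obs" where
 "nextbit \<equiv> \<lambda>c i m s. i = Some True"

abbreviation numloop :: "nat \<Rightarrow> nat \<Rightarrow> nat \<Rightarrow> prog" where
 "numloop d v u \<equiv> Loop nextbit (adv d ;; dbl v u ;; Cond nextbit (push v 1) skip ;; adv d)"

definition num :: "nat \<Rightarrow> nat \<Rightarrow> nat \<Rightarrow> prog" where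
 "num d v u = numloop d v u ;; adv d"

lemma okp_num [simp]:
 "okp k S (adv d)" "coinless (adv d)" "coinless (num d v u)"
 "1 < S \<Longrightarrow> v < k \<Longrightarrow> u < k \<Longrightarrow> okp k S (num d v u)" by (auto simp: adv_def num_def dbl_def)

text \<open>\<open>digits\<close> recurses at its last digit, while the loop consumes the first one.
  The induction therefore takes the remaining iterations as a premise, in continuation
  style.\<close>

lemma run_digits:
 assumes "tp m v = un 0" "tp m u = un 0" "u \<noteq> v" "d = 1 \<or> d = 2"
  and "inpseq w d (pin m) (digits n)"
  and "run w \<pi> (numloop d v u) B
   (m\<lparr>pin := pin m + int (d * length (digits n)), tp := (tp m)(v := un n)\<rparr>) m'"
 shows "run w \<pi> (numloop d v u) (14 * n + 6 * length (digits n) + B) m m'" using assms(5,6)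
proof (induction n arbitrary: B rule: digits.induct)
 case (1 n)
 show ?case
 proof (cases "n = 0")
  case True
  then have "digits n = []" by (simp add: digits.simps)
  with 1 True assms(1) show ?thesis by (simp add: fun_upd_idem)
 next
  case False
  let ?h = "n div 2"
  have dg: "digits n = digits ?h @ [True, odd n]" using False by (simp add: digits.simps)
  let ?p = "pin m + int (d * length (digits ?h))"
  have c: "inpseq w d (pin m) (digits ?h)" "cell w ?p = Some True" "cell w (?p + int d) = Some (odd n)"
   using 1(2) by (auto simp: dg inpseq_append)
  let ?m1 = "m\<lparr>pin := ?p, tp := (tp m)(v := un ?h)\<rparr>"
  let ?m2 = "m\<lparr>pin := ?p + int d, tp := (tp m)(v := un ?h)\<rparr>"
  let ?m3 = "m\<lparr>pin := ?p + int d, tp := (tp m)(v := un (2 * ?h))\<rparr>"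
  let ?m4 = "m\<lparr>pin := ?p + int d, tp := (tp m)(v := un n)\<rparr>"
  let ?m5 = "m\<lparr>pin := pin m + int (d * length (digits n)), tp := (tp m)(v := un n)\<rparr>"
  have r1: "run w \<pi> (adv d) 2 ?m1 ?m2" using run_adv[OF assms(4), of w \<pi> ?m1] by simp
  have r2: "run w \<pi> (dbl v u) (14 * ?h + 2) ?m2 ?m3"
   using run_dbl[of ?m2 v ?h u w \<pi>] assms by simp
  have r3: "run w \<pi> (Cond nextbit (push v 1) skip) 3 ?m3 ?m4"
  proof (cases "odd n")
   case True
   then have n: "n = Suc (2 * ?h)" by simp
   have "run w \<pi> (push v 1) 2 ?m3 (upd v (un (Suc (2 * ?h))) ?m3)" by (rule run_push_un) simp
   then have "run w \<pi> (push v 1) 2 ?m3 ?m4" using n by simp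
   from run_CondT[where C = nextbit, OF _ this] show ?thesis using True c by simp
  next
   case False
   then have "?m4 = ?m3" by simp
   have "run w \<pi> skip 2 ?m3 ?m3" by (rule run_mono[OF run_skip]) simp
   from run_CondF[where C = nextbit, OF _ this] show ?thesis using False c by simp
  qed
  have r4: "run w \<pi> (adv d) 2 ?m4 ?m5"
   using run_adv[OF assms(4), of w \<pi> ?m4] by (simp add: dg algebra_simps)
  have body: "run w \<pi> (adv d ;; dbl v u ;; Cond nextbit (push v 1) skip ;; adv d)
    (2 + ((14 * ?h + 2) + (3 + 2))) ?m1 ?m5"
   by (rule run_Seq[OF r1 run_Seq[OF r2 run_Seq[OF r3 r4]]])
  have it: "run w \<pi> (numloop d v u) (Suc (2 + ((14 * ?h + 2) + (3 + 2)) + B)) ?m1 m'"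
   by (rule run_LoopT[OF _ body 1(3)]) (use c in simp)
  have "run w \<pi> (numloop d v u)
   (14 * ?h + 6 * length (digits ?h) + (Suc (2 + ((14 * ?h + 2) + (3 + 2)) + B))) m m'"
   by (rule 1(1)[OF False c(1) it])
  then show ?thesis by (rule run_mono) (simp add: dg)
 qed
qed

lemma run_num:
 assumes "tp m v = un 0" "tp m u = un 0" "u \<noteq> v" "d = 1 \<or> d = 2"
  and "inpseq w d (pin m) (numcode n)"
 shows "run w \<pi> (num d v u) (14 * n + 6 * length (numcode n)) m
  (m\<lparr>pin := pin m + int (d * length (numcode n)), tp := (tp m)(v := un n)\<rparr>)"
proof -
 let ?m5 = "m\<lparr>pin := pin m + int (d * length (digits n)), tp := (tp m)(v := un n)\<rparr>"
 have c: "inpseq w d (pin m) (digits n)" "cell w (pin m + int (d * length (digits n))) = Some False"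
  using assms(5) by (auto simp: numcode_def inpseq_append)
 have "run w \<pi> (numloop d v u) 1 ?m5 ?m5" by (rule run_LoopF) (use c(2) in simp)
 from run_digits[OF _ _ assms(3,4) c(1) this] assms(1,2)
 have 1: "run w \<pi> (numloop d v u) (14 * n + 6 * length (digits n) + 1) m ?m5" by simp
 have 2: "run w \<pi> (adv d) 2 ?m5 (m\<lparr>pin := pin m + int (d * length (numcode n)), tp := (tp m)(v := un n)\<rparr>)"
  using run_adv[OF assms(4), of w \<pi> ?m5] by (simp add: numcode_def algebra_simps)
 show ?thesis unfolding num_def by (rule run_mono[OF run_Seq[OF 1 2]]) (simp add: numcode_def)
qed

section \<open>Simulating a machine inside a program\<close>

text \<open>
 The state of the simulated machine is the symbol scanned on tape \<open>off\<close>, its work tapes follow.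
 Work symbols are shifted by one, so that the visited cells form an interval of nonblank cells,
 which can be erased later on; the position of a tape does not matter.
\<close>

definition wrel :: "tape \<Rightarrow> tape \<Rightarrow> bool" where
 "wrel t t' \<longleftrightarrow> (\<exists>d lo hi. snd t' = snd t + d \<and> lo - 1 \<le> snd t' \<and> snd t' \<le> hi + 1 \<and> lo \<le> hi + 1 \<and>
   (\<forall>x. fst t' x = (if lo \<le> x \<and> x \<le> hi then Suc (fst t (x - d)) else 0)) \<and>
   (\<forall>x. \<not> (lo \<le> x \<and> x \<le> hi) \<longrightarrow> fst t (x - d) = 0))"

lemma wrel_scan: "wrel t t' \<Longrightarrow> fst t' (snd t') - 1 = fst t (snd t)"
 unfolding wrel_def by (metis add_diff_cancel_right' diff_0_eq_0 diff_Suc_1)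

lemma wrel_blank: "wrel (\<lambda>_. 0, i) (\<lambda>_. 0, j)"
 unfolding wrel_def by (rule exI[of _ "j - i"], rule exI[of _ j], rule exI[of _ "j - 1"]) auto

lemma wrel_write:
 assumes "wrel t t'"
 shows "wrel (write_tape (a, mv) t) (write_tape (Suc a, mv) t')"
proof -
 obtain d lo hi where *: "snd t' = snd t + d" "lo - 1 \<le> snd t'" "snd t' \<le> hi + 1" "lo \<le> hi + 1"
   "\<And>x. fst t' x = (if lo \<le> x \<and> x \<le> hi then Suc (fst t (x - d)) else 0)"
   "\<And>x. \<not> (lo \<le> x \<and> x \<le> hi) \<Longrightarrow> fst t (x - d) = 0" using assms unfolding wrel_def by blast
 have o: "- 1 \<le> offset mv" "offset mv \<le> 1" by (cases mv; simp)+
 show ?thesis unfolding wrel_def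
 proof (rule exI[of _ d], rule exI[of _ "min lo (snd t')"], rule exI[of _ "max hi (snd t')"], intro conjI allI impI)
  fix x
  show "fst (write_tape (Suc a, mv) t') x =
   (if min lo (snd t') \<le> x \<and> x \<le> max hi (snd t') then Suc (fst (write_tape (a, mv) t) (x - d)) else 0)"
  proof (cases "x = snd t'")
   case True
   then show ?thesis using *(1) by (simp add: write_tape_def)
  next
   case False
   then have "min lo (snd t') \<le> x \<and> x \<le> max hi (snd t') \<longleftrightarrow> lo \<le> x \<and> x \<le> hi"
    using *(2-4) by linarith
   then show ?thesis using False *(1,5) by (simp add: write_tape_def)
  qed
 next
  fix x
  assume "\<not> (min lo (snd t') \<le> x \<and> x \<le> max hi (snd t'))"
  moreover from this have "x \<noteq> snd t'" "\<not> (lo \<le> x \<and> x \<le> hi)" by auto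
  ultimately show "fst (write_tape (a, mv) t) (x - d) = 0"
   using *(1) *(6)[of x] by (simp add: write_tape_def)
 qed (use o * in \<open>auto simp: write_tape_def\<close>)
qed

definition simrel :: "tm \<Rightarrow> nat \<Rightarrow> mem \<Rightarrow> conf \<Rightarrow> bool" where
 "simrel N off m cf \<longleftrightarrow> rd m off = state cf \<and> length (work cf) = num_work N \<and>
   (\<forall>i<num_work N. wrel (work cf ! i) (tp m (Suc off + i)))"

definition simws :: "tm \<Rightarrow> nat \<Rightarrow> (nat \<Rightarrow> nat) \<Rightarrow> nat list" where
 "simws N off s = map (\<lambda>i. s (Suc off + i) - 1) [0..<num_work N]"

lemma simws_simrel: "simrel N off m cf \<Longrightarrow> simws N off (rd m) = map (\<lambda>(tp, i). tp i) (work cf)"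
 using wrel_scan[of "work cf ! i" "tp m (Suc off + i)" for i]
 by (intro nth_equalityI) (auto simp: simrel_def simws_def rd_def split_beta)

text \<open>The minima only matter for scanned symbols that do not arise in simulations.\<close>

definition simwr :: "tm \<Rightarrow> nat \<Rightarrow> action \<Rightarrow> nat \<rightharpoonup> nat \<times> move" where
 "simwr N off act = (\<lambda>j. if j = off then Some (min (next_state act) (num_states N), Stay)
   else if off < j \<and> j \<le> off + num_work N then
    Some (Suc (min (fst (work_writes act ! (j - Suc off))) (num_symbols N)), snd (work_writes act ! (j - Suc off)))
   else None)"

text \<open>A whole step of \<open>N\<close> in one step of the host. \<open>coin\<close>,
  \<open>inp\<close> and \<open>com\<close> tell where the host finds what \<open>N\<close> is
  supposed to see, \<open>ext\<close> what becomes of its action outside its state and work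
  tapes.\<close>

definition simact ::
 "tm \<Rightarrow> nat \<Rightarrow> bool obs \<Rightarrow> bool option obs \<Rightarrow> bool option obs \<Rightarrow> (action \<Rightarrow> instr obs) \<Rightarrow> prog" where
 "simact N off coin inp com ext = Act (\<lambda>c i m s.
   let act = delta N (s off) (coin c i m s) (inp c i m s) (com c i m s) (simws N off s);
    ins = ext act c i m s in ins\<lparr>wr := wr ins ++ simwr N off act\<rparr>)"

definition wfc :: "tm \<Rightarrow> conf \<Rightarrow> bool" where
 "wfc N cf \<longleftrightarrow> state cf < num_states N \<and> length (work cf) = num_work N \<and>
   (\<forall>t\<in>set (work cf). \<forall>x. fst t x < num_symbols N)"

lemma wfc_init: "wf_tm N \<Longrightarrow> wfc N (init_conf N)" by (auto simp: wfc_def init_conf_def wf_tm_def)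

lemma wfc_delta:
 assumes "wf_tm N" "wfc N cf" "act = delta N (state cf) c i j (map (\<lambda>(tp, i). tp i) (work cf))"
 shows "next_state act < num_states N" "length (work_writes act) = num_work N"
  "\<And>k. k < num_work N \<Longrightarrow> fst (work_writes act ! k) < num_symbols N"
proof -
 have "\<forall>s\<in>set (map (\<lambda>(tp, i). tp i) (work cf)). s < num_symbols N"
  using assms(2) by (auto simp: wfc_def)
 moreover have "state cf < num_states N" "length (map (\<lambda>(tp, i). tp i) (work cf)) = num_work N"
  using assms(2) by (simp_all add: wfc_def)
 ultimately have *: "next_state act < num_states N \<and> length (work_writes act) = num_work N \<and>
      (\<forall>(s, m)\<in>set (work_writes act). s < num_symbols N)"
  using assms(1) unfolding wf_tm_def Let_def assms(3) by blast
 then show "next_state act < num_states N" "length (work_writes act) = num_work N" by auto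
 fix k assume "k < num_work N"
 with * have "work_writes act ! k \<in> set (work_writes act)" by auto
 with * show "fst (work_writes act ! k) < num_symbols N" by (auto simp: split_beta)
qed

lemma work_perform:
 assumes "length (work_writes act) = length (work cf)" "k < length (work cf)"
 shows "work (perform act cf) ! k = write_tape (work_writes act ! k) (work cf ! k)"
 using assms by (simp add: perform_def write_tape_def split: prod.split)

lemma wfc_perform:
 assumes "wf_tm N" "wfc N cf" "act = delta N (state cf) c i j (map (\<lambda>(tp, i). tp i) (work cf))"
 shows "wfc N (perform act cf)"
proof -
 note d = wfc_delta[OF assms]
 have l: "length (work (perform act cf)) = num_work N"
  using d(2) assms(2) by (simp add: perform_def wfc_def)
 have "fst (work (perform act cf) ! k) x < num_symbols N" if "k < num_work N" for k x
  using that d assms(2) by (subst work_perform) (auto simp: wfc_def write_tape_def)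
 then have "\<forall>t\<in>set (work (perform act cf)). \<forall>x. fst t x < num_symbols N"
  using l by (metis in_set_conv_nth)
 then show ?thesis using d(1) l by (simp add: wfc_def) (simp add: perform_def)
qed

lemma simrel_step:
 assumes "wf_tm N" "wfc N cf" "simrel N off m cf"
  and act: "act = delta N (state cf) c i j (map (\<lambda>(tp, i). tp i) (work cf))"
  and t: "\<And>k a. simwr N off act k = Some a \<Longrightarrow> tp m' k = write_tape a (tp m k)"
 shows "simrel N off m' (perform act cf)"
proof -
 note d = wfc_delta[OF assms(1,2) act]
 have "simwr N off act off = Some (next_state act, Stay)" using d(1) by (simp add: simwr_def)
 from t[OF this] have "rd m' off = next_state act" by (simp add: rd_def write_tape_def)
 moreover have "length (work (perform act cf)) = num_work N"
  using d(2) assms(2) by (simp add: perform_def wfc_def)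
 moreover have "wrel (work (perform act cf) ! k) (tp m' (Suc off + k))" if "k < num_work N" for k
 proof -
  have "simwr N off act (Suc off + k) = Some (Suc (fst (work_writes act ! k)), snd (work_writes act ! k))"
   using that d(3)[OF that] by (simp add: simwr_def)
  from t[OF this] show ?thesis
   using wrel_write[of "work cf ! k" "tp m (Suc off + k)" "fst (work_writes act ! k)" "snd (work_writes act ! k)"]
    assms(2,3) that d(2) by (simp add: simrel_def work_perform wfc_def)
 qed
 ultimately show ?thesis by (simp add: simrel_def perform_def)
qed

lemma simrel_cong:
 assumes "simrel N off m cf" "\<And>j. off \<le> j \<Longrightarrow> j \<le> off + num_work N \<Longrightarrow> tp m' j = tp m j"
 shows "simrel N off m' cf" using assms by (simp add: simrel_def rd_def)

lemma simrel_init: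
 assumes "tp m off = (f, i)" "f i = 0" "\<And>j. off < j \<Longrightarrow> j \<le> off + num_work N \<Longrightarrow> \<exists>i. tp m j = (\<lambda>_. 0, i)"
 shows "simrel N off m (init_conf N)"
proof -
 have "wrel (\<lambda>_. 0, 0) (tp m (Suc off + k))" if "k < num_work N" for k
  using assms(3)[of "Suc off + k"] that wrel_blank by auto
 then show ?thesis using assms(1,2) by (simp add: simrel_def rd_def init_conf_def)
qed

lemma run_simact:
 assumes "wf_tm N" "wfc N cf" "simrel N off m cf"
  and act: "act = delta N (state cf) c0 i0 j0 (map (\<lambda>(tp, i). tp i) (work cf))"
  and obs: "\<And>c. observe w \<pi> m c coin = c0" "\<And>c. observe w \<pi> m c inp = i0" "\<And>c. observe w \<pi> m c com = j0"
   "\<And>c. observe w \<pi> m c (ext act) = ins"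
  and ins: "can_send \<pi> ins m"
 shows "\<exists>m'. run w \<pi> (simact N off coin inp com ext) 1 m m' \<and>
  simrel N off m' (perform act cf) \<and> wfc N (perform act cf) \<and>
  (\<forall>j. j < off \<or> off + num_work N < j \<longrightarrow> tp m' j = tp (exec_instr \<pi> ins m) j) \<and>
  pin m' = pin m + offset (mv_in ins) \<and> pcom m' = pcom m + offset (mv_com ins) \<and>
  ot m' = ot (exec_instr \<pi> ins m) \<and> vis m' = vis (exec_instr \<pi> ins m) \<and>
  (\<forall>k<num_work N. \<exists>a. tp m' (Suc off + k) = write_tape a (tp m (Suc off + k)))"
proof -
 let ?ins = "ins\<lparr>wr := wr ins ++ simwr N off act\<rparr>"
 let ?m' = "exec_instr \<pi> ?ins m"
 have a: "delta N (rd m off) c0 i0 j0 (simws N off (rd m)) = act"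
  using simws_simrel[OF assms(3)] assms(3) by (simp add: act simrel_def)
 have "run w \<pi> (simact N off coin inp com ext) 1 m ?m'" unfolding simact_def using ins
  by (intro run_Act[where ins = ?ins]) (simp_all add: Let_def obs a can_send_def)
 moreover have "simrel N off ?m' (perform act cf)"
  by (rule simrel_step[OF assms(1-3) act]) (simp add: exec_instr_def)
 moreover have "wfc N (perform act cf)" by (rule wfc_perform[OF assms(1,2) act])
 moreover have "tp ?m' j = tp (exec_instr \<pi> ins m) j" if "j < off \<or> off + num_work N < j" for j
  using that by (auto simp: exec_instr_def simwr_def map_add_def)
 moreover have "\<exists>a. tp ?m' (Suc off + k) = write_tape a (tp m (Suc off + k))" if "k < num_work N" for k
  using that by (auto simp: exec_instr_def simwr_def map_add_def)
 ultimately show ?thesis by (intro exI[of _ ?m']) (simp add: exec_instr_def)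
qed

lemma okp_simact [simp]:
 assumes "off + num_work N < k" "num_states N < S" "Suc (num_symbols N) < S"
  "\<And>act. okp k S (Act (ext act))"
 shows "okp k S (simact N off coin inp com ext)"
proof -
 have "j < k \<and> a < S" if "simwr N off act j = Some (a, v)" for act j a v
  using that assms(1-3) by (auto simp: simwr_def split: if_splits)
 moreover have "j < k \<and> a < S" if "\<forall>j. s j < S" "wr (ext act c i m s) j = Some (a, v)" for act c i m s j a v
  using okp_ActD[OF assms(4) that(1) that(2)] .
 ultimately show ?thesis
  unfolding simact_def okp.simps Let_def by (auto simp: map_add_def split: option.splits)
qed

lemma coinless_simact [simp]:
 "coin True = coin False \<Longrightarrow> inp True = inp False \<Longrightarrow> com True = com False \<Longrightarrow>
  (\<And>act. ext act True = ext act False) \<Longrightarrow> coinless (simact N off coin inp com ext)"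
 by (simp add: simact_def)

definition sym :: "bool \<Rightarrow> nat" where
 "sym b = (if b then 2 else 1)"

lemma sym_simps [simp]: "sym b \<noteq> 0" "0 < sym b" "sym b = 2 \<longleftrightarrow> b" "sym b = Suc 0 \<longleftrightarrow> \<not> b" "sym b < 3"
 by (auto simp: sym_def)

definition bitcell :: "nat \<Rightarrow> bool option" where
 "bitcell a = (if a = 0 then None else Some (a = 2))"

lemma bitcell_sym: "bitcell (cells (map sym w) (1 + p)) = cell w p"
proof (cases "0 \<le> p \<and> p < int (length w)")
 case True
 then have "nat p < length w" by auto
 with True show ?thesis by (auto simp: bitcell_def cells_def cell_def)
qed (auto simp: bitcell_def cells_def cell_def)

lemma un_sym: "un n = stk (map sym (replicate n False))" by (simp add: un_def sym_def)

section \<open>The machines behind the bounds on the two complexities\<close>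

section \<open>The party machine\<close>

abbreviation bitsym :: "nat obs" where
 "bitsym \<equiv> \<lambda>c i m s. sym (i = Some True)"

lemma cells_update: "k < length ys \<Longrightarrow> (cells ys)(1 + int k := a) = cells (ys[k := a])"
 by (auto simp: cells_def fun_eq_iff nth_list_update nat_eq_iff)

lemma cells_nth: "k < length ys \<Longrightarrow> cells ys (1 + int k) = ys ! k" by (simp add: cells_def)

lemma inpseq_self: "inpseq w 1 0 w" by (simp add: inpseq_def cell_def)

lemma inpseq_nth: "inpseq w d p ys \<Longrightarrow> k < length ys \<Longrightarrow> cell w (p + int (d * k)) = Some (ys ! k)"
 by (simp add: inpseq_def)

definition header :: "nat list \<Rightarrow> bits" where
 "header ns = concat (map numcode ns)"

lemma header_simps [simp]: "header [] = []" "header (n # ns) = numcode n @ header ns"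
 by (simp_all add: header_def)

primrec nums :: "nat \<Rightarrow> nat \<Rightarrow> nat list \<Rightarrow> prog" where
 "nums d u [] = skip"
| "nums d u (v # vs) = num d v u ;; nums d u vs"

lemma okp_nums [simp]:
 "coinless (nums d u vs)" "1 < S \<Longrightarrow> u < k \<Longrightarrow> \<forall>v\<in>set vs. v < k \<Longrightarrow> okp k S (nums d u vs)"
 by (induction vs) auto

abbreviation loaded :: "nat list \<Rightarrow> nat list \<Rightarrow> (nat \<Rightarrow> tape) \<Rightarrow> nat \<Rightarrow> tape" where
 "loaded vs ns f \<equiv> \<lambda>j. case map_of (zip vs ns) j of Some n \<Rightarrow> un n | None \<Rightarrow> f j"

lemma run_nums:
 assumes "tp m u = un 0" "\<forall>v\<in>set vs. tp m v = un 0" "distinct (u # vs)" "d = 1 \<or> d = 2"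
  "length ns = length vs" "inpseq w d (pin m) (header ns)"
 shows "run w \<pi> (nums d u vs) (14 * sum_list ns + 6 * length (header ns) + 1) m
  (m\<lparr>pin := pin m + int (d * length (header ns)), tp := loaded vs ns (tp m)\<rparr>)" using assms
proof (induction vs arbitrary: m ns)
 case Nil
 then show ?case using run_skip[of w \<pi> m] by simp
next
 case (Cons v vs)
 then obtain n ns' where ns: "ns = n # ns'" by (cases ns) auto
 let ?m1 = "m\<lparr>pin := pin m + int (d * length (numcode n)), tp := (tp m)(v := un n)\<rparr>"
 have 1: "run w \<pi> (num d v u) (14 * n + 6 * length (numcode n)) m ?m1"
  by (rule run_num) (use Cons.prems in \<open>auto simp: ns inpseq_append\<close>)
 have 2: "run w \<pi> (nums d u vs) (14 * sum_list ns' + 6 * length (header ns') + 1) ?m1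
  (?m1\<lparr>pin := pin ?m1 + int (d * length (header ns')), tp := loaded vs ns' (tp ?m1)\<rparr>)"
  by (rule Cons.IH) (use Cons.prems in \<open>auto simp: ns inpseq_append\<close>)
 have "map_of (zip vs ns') v = None" using Cons.prems(3) by (auto simp: map_of_eq_None_iff dest: set_zip_leftD)
 then have "loaded vs ns' (tp ?m1) = loaded (v # vs) ns (tp m)"
  by (auto simp: ns fun_eq_iff split: option.split)
 then have e: "?m1\<lparr>pin := pin ?m1 + int (d * length (header ns')), tp := loaded vs ns' (tp ?m1)\<rparr>
  = m\<lparr>pin := pin m + int (d * length (header ns)), tp := loaded (v # vs) ns (tp m)\<rparr>"
  by (simp only:) (simp add: ns algebra_simps)
 from run_Seq[OF 1 2] show ?case unfolding e nums.simps by (rule run_mono) (simp add: ns)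
qed

definition readbits :: "nat \<Rightarrow> nat \<Rightarrow> nat \<Rightarrow> prog" where
 "readbits d c v = Loop (nz c) (pop c ;; pushf v bitsym ;; adv d)"

lemma okp_readbits [simp]:
 "2 < S \<Longrightarrow> c < k \<Longrightarrow> v < k \<Longrightarrow> okp k S (readbits d c v)" "coinless (readbits d c v)"
 by (auto simp: readbits_def sym_def)

lemma run_readbits:
 assumes "tp m c = un (length ys)" "tp m v = stk zs" "c \<noteq> v" "d = 1 \<or> d = 2" "inpseq w d (pin m) ys"
 shows "run w \<pi> (readbits d c v) (6 * length ys + 1) m
  (m\<lparr>pin := pin m + int (d * length ys), tp := (tp m)(c := un 0, v := stk (zs @ map sym ys))\<rparr>)"
proof -
 let ?M = "\<lambda>i. m\<lparr>pin := pin m + int (d * i),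
  tp := (tp m)(c := un (length ys - i), v := stk (zs @ map sym (take i ys)))\<rparr>"
 have "run w \<pi> (Loop (nz c) (pop c ;; pushf v bitsym ;; adv d)) (length ys * ((2 + 2) + 2) + 1) m (?M (length ys))"
 proof (rule run_countdown[where M = ?M])
  fix i assume i: "i < length ys"
  let ?a = "upd c (un (length ys - Suc i)) (?M i)"
  let ?b = "upd v (stk ((zs @ map sym (take i ys)) @ [sym (ys ! i)])) ?a"
  have 1: "run w \<pi> (pushf v bitsym) 2 ?a ?b"
  proof (rule run_pushf)
   show "tp ?a v = stk (zs @ map sym (take i ys))" using assms(3) by simp
   show "observe w \<pi> (upd v t ?a) c' bitsym = sym (ys ! i)" for c' t
    using inpseq_nth[OF assms(5) i] by simp
  qed
  have "?b\<lparr>pin := pin ?b + int d\<rparr> = ?M (Suc i)"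
   using i assms(3) by (auto simp: take_Suc_conv_app_nth algebra_simps fun_eq_iff)
  with run_adv[OF assms(4), of w \<pi> ?b] have 2: "run w \<pi> (adv d) 2 ?b (?M (Suc i))" by simp
  show "run w \<pi> (pushf v bitsym ;; adv d) (2 + 2) ?a (?M (Suc i))" by (rule run_Seq[OF 1 2])
 qed (use assms in \<open>cases m, auto simp: fun_eq_iff\<close>)
 then show ?thesis unfolding readbits_def by (rule run_mono[THEN back_subst[of "run w \<pi> _ _ m"]]) simp_all
qed

text \<open>
 Tape 5 moves along with the communication head and carries a mark below the position from which
 on the simulated party may read.
\<close>

definition marks :: "nat \<Rightarrow> tape" where
 "marks h = (\<lambda>x. if 0 \<le> x \<and> x < int h then 1 else 0, int h)"

definition mark :: prog where
 "mark = Act (\<lambda>c i m s. nop\<lparr>mv_com := MoveRight, wr := [5 \<mapsto> (1, MoveRight)]\<rparr>)"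

text \<open>A mask bit is sent and added to the coins in the same step, since the input is read in a
  single pass: \<open>3 - s 1\<close> exchanges the symbols 1 and 2 of a bit.\<close>

definition sendx :: prog where
 "sendx = Act (\<lambda>c i m s. nop\<lparr>mv_in := MoveRight, sd := Some (i = Some True),
   wr := [1 \<mapsto> (if i = Some True \<and> s 2 = 2 then 3 - s 1 else s 1, MoveRight)]\<rparr>)"

definition sendp :: prog where
 "sendp = Act (\<lambda>c i m s. nop\<lparr>mv_in := MoveRight, sd := Some (i = Some True)\<rparr>)"

definition sendrow :: prog where
 "sendrow = Loop (nz 1) (sendx ;; mark ;; mark) ;; go 1 MoveLeft ;; rewind 1"

text \<open>Tape 0 serves as the input of \<open>N\<close>, tape 1 as its coins, and tape 3 counts
  the output bits that may still be written, which cuts the key to a prefix. Marked cells look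
  blank, so \<open>N\<close> takes the end of the masks for the beginning of its communication
  tape.\<close>

definition simparty :: "tm \<Rightarrow> prog" where
 "simparty N = simact N 8 (sees 1 2) (\<lambda>c i m s. bitcell (s 0)) (\<lambda>c i m s. if s 5 = 1 then None else m)
   (\<lambda>act c i m s. \<lparr>mv_in = Stay, mv_com = comm_move act,
    wr = [0 \<mapsto> (s 0, input_move act), 1 \<mapsto> (s 1, MoveRight), 5 \<mapsto> (s 5, comm_move act)] ++
     (if emit act \<noteq> None \<and> s 3 \<noteq> 0 then [3 \<mapsto> (0, MoveLeft)] else Map.empty),
    em = (if s 3 \<noteq> 0 then emit act else None), sd = send act\<rparr>)"

text \<open>The input consists of five numbers, the selection bits, the rows and the rest of the
  mask. A unary number doubles as a string of zeros: tape 0 becomes the input of \<open>N\<close>,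
  and tape 1 the zero vector to which rows are added. The symbol pushed on tape 2 at the outset
  selects the first row in any case; it acts as a uniform translation of the subset sums of the
  others.\<close>

definition party :: "tm \<Rightarrow> prog" where
 "party N = nums 1 7 [0, 1, 6, 3, 4] ;; push 2 2 ;; readbits 1 6 2 ;; rewind 0 ;; rewind 1 ;; rewind 2 ;;
   Loop (nz 2) (sendrow ;; go 2 MoveRight) ;; Loop moreinput (sendp ;; mark ;; mark) ;;
   Loop (\<lambda>c i m s. s 8 \<noteq> 1) (simparty N) ;; Loop (nz 4) (pop 4 ;; emitf (\<lambda>_ _ _ _. False))"

definition party_tm :: "tm \<Rightarrow> tm" where
 "party_tm N = compile (num_work N + 9) (num_states N + num_symbols N + 5) (party N)"

lemma okp_party: "okp (num_work N + 9) (num_states N + num_symbols N + 5) (party N)"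
proof -
 have "okp (num_work N + 9) (num_states N + num_symbols N + 5) (simparty N)"
  unfolding simparty_def by (rule okp_simact) (auto split: if_splits)
 moreover have "3 - s 1 < num_states N + num_symbols N + 5" for s :: "nat \<Rightarrow> nat" by simp
 ultimately show ?thesis
  by (auto simp: party_def sendx_def sendp_def mark_def sendrow_def split: if_splits)
qed

lemma coinless_party: "coinless (party N)"
 by (simp add: party_def sendx_def sendp_def mark_def sendrow_def simparty_def)

lemma wf_party: "wf_tm (party_tm N)" "deterministic (party_tm N)"
 unfolding party_tm_def by (rule wf_compile[OF okp_party], simp) (rule deterministic_compile[OF coinless_party])

text \<open>Marks come in pairs because every round of the mask phase puts one bit of each party on
  the tape.\<close>

lemma run_mark2:
 assumes "tp m 5 = marks h" "pcom m = int h"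
 shows "run w \<pi> (mark ;; mark) 2 m (m\<lparr>pcom := int (h + 2), tp := (tp m)(5 := marks (h + 2))\<rparr>)"
proof -
 have 1: "run w \<pi> mark 1 m (m\<lparr>pcom := int (Suc h), tp := (tp m)(5 := marks (Suc h))\<rparr>)"
  if "tp m 5 = marks h" "pcom m = int h" for m h unfolding mark_def
  by (rule run_Act[where ins = "nop\<lparr>mv_com := MoveRight, wr := [5 \<mapsto> (1, MoveRight)]\<rparr>"])
    (use that in \<open>auto simp: can_send_def exec_instr_def write_tape_def marks_def fun_eq_iff\<close>)
 from run_Seq[OF 1[OF assms] 1[of _ "Suc h"]] show ?thesis by (simp add: numeral_2_eq_2)
qed

definition xorv :: "bool \<Rightarrow> bits \<Rightarrow> bits \<Rightarrow> bits" where
 "xorv f v r = (if f then map2 (\<noteq>) r v else r)"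

text \<open>\<open>v0\<close> will be 0 for the first and 1 for the second party, and
  \<open>h\<close> counts the bits exchanged before this row.\<close>

lemma run_sendrow:
 assumes "tp m 1 = (cells (map sym r), 1)" "length r = T" "length v = T" "inpseq w 1 (pin m) v" "0 < T"
  "rd m 2 = sym f" "tp m 5 = marks h" "pcom m = int h" "vis m = min (v0 + h) (length \<pi>)"
  "\<And>i. i < T \<Longrightarrow> v0 + h + 2 * i < length \<pi> \<and> \<pi> ! (v0 + h + 2 * i) = v ! i"
 shows "run w \<pi> sendrow (6 * T + 4) m
  (m\<lparr>pin := pin m + int T, pcom := int (h + 2 * T), vis := min (v0 + h + 2 * T) (length \<pi>),
   tp := (tp m)(1 := (cells (map sym (xorv f v r)), 1), 5 := marks (h + 2 * T))\<rparr>)"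
proof -
 define r' where "r' = xorv f v r"
 have lr': "length r' = T" using assms(2,3) by (simp add: r'_def xorv_def)
 define mix where "mix i = take i r' @ drop i r" for i
 have lm: "length (mix i) = T" if "i \<le> T" for i using that assms(2) lr' by (simp add: mix_def)
 have mixS: "(mix i)[i := r' ! i] = mix (Suc i)" and mixn: "mix i ! i = r ! i" if "i < T" for i
  using that assms(2) lr'
  by (auto simp: mix_def list_update_append take_Suc_conv_app_nth nth_append simp flip: Cons_nth_drop_Suc)
 let ?M = "\<lambda>i. m\<lparr>pin := pin m + int i, pcom := int (h + 2 * i), vis := min (v0 + h + 2 * i) (length \<pi>),
   tp := (tp m)(1 := (cells (map sym (mix i)), 1 + int i), 5 := marks (h + 2 * i))\<rparr>"
 have loop: "run w \<pi> (Loop (nz 1) (sendx ;; mark ;; mark)) (T * Suc (1 + 2) + 1) m (?M T)"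
 proof (rule run_for[where M = ?M])
  show "m = ?M 0" using assms by (cases m) (auto simp: fun_eq_iff mix_def)
  fix i assume i: "i < T"
  show "observe w \<pi> (?M i) c (nz 1)" for c using i lm[of i] by (simp add: rd_def cells_nth)
  let ?ins = "nop\<lparr>mv_in := MoveRight, sd := Some (v ! i), wr := [1 \<mapsto> (sym (r' ! i), MoveRight)]\<rparr>"
  let ?a = "m\<lparr>pin := pin m + int (Suc i), pcom := int (h + 2 * i), vis := min (v0 + h + 2 * Suc i) (length \<pi>),
   tp := (tp m)(1 := (cells (map sym (mix (Suc i))), 1 + int (Suc i)), 5 := marks (h + 2 * i))\<rparr>"
  have c: "cell w (pin m + int i) = Some (v ! i)"
   using inpseq_nth[OF assms(4), of i] i assms(3) by simp
  have rd1: "rd (?M i) 1 = sym (r ! i)" using i lm[of i] mixn[OF i] by (simp add: rd_def cells_nth)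
  have rd2: "rd (?M i) 2 = sym f" using assms(6) by (simp add: rd_def)
  have 1: "run w \<pi> sendx 1 (?M i) ?a" unfolding sendx_def
  proof (rule run_Act[where ins = ?ins])
   have "(if v ! i \<and> sym f = 2 then 3 - sym (r ! i) else sym (r ! i)) = sym (r' ! i)"
    using i assms(2,3) by (auto simp: r'_def xorv_def sym_def)
   then show "observe w \<pi> (?M i) c' (\<lambda>c i m s. nop\<lparr>mv_in := MoveRight, sd := Some (i = Some True),
     wr := [1 \<mapsto> (if i = Some True \<and> s 2 = 2 then 3 - s 1 else s 1, MoveRight)]\<rparr>) = ?ins" for c'
    using c unfolding rd1 rd2 by simp
   show "can_send \<pi> ?ins (?M i)" using assms(10)[OF i] by (simp add: can_send_def ac_simps)
   have "write_tape (sym (r' ! i), MoveRight) (cells (map sym (mix i)), 1 + int i)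
    = (cells (map sym (mix (Suc i))), 1 + int (Suc i))"
    using i lm[of i] mixS[OF i] by (simp add: write_tape_def cells_update flip: map_update)
   then show "?a = exec_instr \<pi> ?ins (?M i)" by (auto simp: exec_instr_def fun_eq_iff)
  qed
  have 2: "run w \<pi> (mark ;; mark) 2 ?a (?M (Suc i))"
   using run_mark2[of ?a "h + 2 * i" w \<pi>] by (simp add: fun_upd_twist ac_simps)
  show "run w \<pi> (sendx ;; mark ;; mark) (1 + 2) (?M i) (?M (Suc i))" by (rule run_Seq[OF 1 2])
 next
  show "\<not> observe w \<pi> (?M T) c (nz 1)" for c using lm[of T] by (simp add: rd_def cells_def)
 qed simp
 have mT: "mix T = r'" using lr' assms(2) by (simp add: mix_def)
 let ?m1 = "upd 1 (cells (map sym r'), int T) (?M T)"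
 have 2: "run w \<pi> (go 1 MoveLeft) 1 (?M T) ?m1"
  using run_go[of "?M T" 1 "cells (map sym r')" "1 + int T" w \<pi> MoveLeft] by (simp add: mT)
 have 3: "run w \<pi> (rewind 1) (2 * T + 2) ?m1 (upd 1 (cells (map sym r'), 1) ?m1)"
  using run_rewind[of ?m1 1 "map sym r'" "int T" w \<pi>] lr' by (auto simp: image_iff)
 show ?thesis unfolding sendrow_def
  using run_mono[OF run_Seq[OF loop run_Seq[OF 2 3]], of "6 * T + 4"]
  by (simp add: r'_def fun_upd_twist)
qed

definition combine :: "nat \<Rightarrow> bits \<Rightarrow> bits list \<Rightarrow> bits" where
 "combine T fs rws = foldl (\<lambda>r (f, v). xorv f v r) (replicate T False) (zip fs rws)"

lemma length_foldl_xorv: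
 "\<forall>v\<in>set rws. length v = length r \<Longrightarrow>
  length (foldl (\<lambda>r (f, v). xorv f v r) r (zip fs rws)) = length r"
proof (induction fs arbitrary: r rws)
 case (Cons f fs)
 then show ?case by (cases rws) (auto simp: xorv_def)
qed simp

lemma length_combine: "\<forall>v\<in>set rws. length v = T \<Longrightarrow> length (combine T fs rws) = T"
 by (simp add: combine_def length_foldl_xorv)

lemma length_concat_rows: "\<forall>v\<in>set rws. length v = T \<Longrightarrow> length (concat rws) = length rws * T"
 by (induction rws) auto

lemma nth_concat_rows:
 "\<forall>v\<in>set rws. length v = T \<Longrightarrow> i < T \<Longrightarrow> j < length rws \<Longrightarrow> concat rws ! (j * T + i) = rws ! j ! i"
proof (induction rws arbitrary: j)
 case (Cons v rws)
 then show ?case by (cases j) (auto simp: nth_append)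
qed simp

lemma run_rows:
 assumes "tp m 1 = (cells (map sym (replicate T False)), 1)" "tp m 2 = (cells (map sym fs), 1)" "0 < T"
  "length rws = length fs" "\<forall>v\<in>set rws. length v = T" "inpseq w 1 (pin m) (concat rws)"
  "tp m 5 = marks 0" "pcom m = 0" "vis m = min v0 (length \<pi>)"
  "\<And>k. k < length fs * T \<Longrightarrow> v0 + 2 * k < length \<pi> \<and> \<pi> ! (v0 + 2 * k) = concat rws ! k"
 shows "run w \<pi> (Loop (nz 2) (sendrow ;; go 2 MoveRight)) (length fs * (6 * T + 6) + 1) m
  (m\<lparr>pin := pin m + int (length fs * T), pcom := int (2 * (length fs * T)),
   vis := min (v0 + 2 * (length fs * T)) (length \<pi>),
   tp := (tp m)(1 := (cells (map sym (combine T fs rws)), 1), 2 := (cells (map sym fs), 1 + int (length fs)),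
    5 := marks (2 * (length fs * T)))\<rparr>)"
proof -
 define acc where "acc j = combine T (take j fs) (take j rws)" for j
 have lacc: "length (acc j) = T" for j
  unfolding acc_def using assms(5) by (intro length_combine) (auto dest: in_set_takeD)
 have accS: "acc (Suc j) = xorv (fs ! j) (rws ! j) (acc j)" if "j < length fs" for j
  using that assms(4) by (simp add: acc_def combine_def take_Suc_conv_app_nth)
 let ?M = "\<lambda>j. m\<lparr>pin := pin m + int (j * T), pcom := int (2 * (j * T)),
   vis := min (v0 + 2 * (j * T)) (length \<pi>),
   tp := (tp m)(1 := (cells (map sym (acc j)), 1), 2 := (cells (map sym fs), 1 + int j),
    5 := marks (2 * (j * T)))\<rparr>"
 have "run w \<pi> (Loop (nz 2) (sendrow ;; go 2 MoveRight)) (length fs * Suc ((6 * T + 4) + 1) + 1) m (?M (length fs))"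
 proof (rule run_for[where M = ?M])
  show "m = ?M 0" using assms by (cases m) (auto simp: fun_eq_iff acc_def combine_def)
  fix j assume j: "j < length fs"
  show "observe w \<pi> (?M j) c (nz 2)" for c using j by (simp add: rd_def cells_nth)
  have le: "j * T + T \<le> length fs * T"
   using mult_le_mono1[of "Suc j" "length fs" T] j by (simp add: add.commute)
  have inp: "inpseq w 1 (pin m + int (j * T)) (rws ! j)" unfolding inpseq_def
  proof (intro allI impI)
   fix i assume "i < length (rws ! j)"
   then have i: "i < T" using assms(4,5) j by auto
   then have "j * T + i < length (concat rws)"
    using le length_concat_rows[OF assms(5)] assms(4) by simp
   from inpseq_nth[OF assms(6) this] show "cell w (pin m + int (j * T) + int (1 * i)) = Some (rws ! j ! i)"
    using nth_concat_rows[OF assms(5) i] j assms(4) by (simp add: add.assoc)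
  qed
  let ?a = "m\<lparr>pin := pin m + int (j * T) + int T, pcom := int (2 * (j * T) + 2 * T),
   vis := min (v0 + 2 * (j * T) + 2 * T) (length \<pi>),
   tp := (tp m)(1 := (cells (map sym (acc (Suc j))), 1), 2 := (cells (map sym fs), 1 + int j),
    5 := marks (2 * (j * T) + 2 * T))\<rparr>"
  have 1: "run w \<pi> sendrow (6 * T + 4) (?M j) ?a"
  proof -
   have "run w \<pi> sendrow (6 * T + 4) (?M j)
    (?M j\<lparr>pin := pin (?M j) + int T, pcom := int (2 * (j * T) + 2 * T),
     vis := min (v0 + 2 * (j * T) + 2 * T) (length \<pi>),
     tp := (tp (?M j))(1 := (cells (map sym (xorv (fs ! j) (rws ! j) (acc j))), 1), 5 := marks (2 * (j * T) + 2 * T))\<rparr>)"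
   proof (rule run_sendrow)
    show "rd (?M j) 2 = sym (fs ! j)" using j by (simp add: rd_def cells_nth)
    show "length (rws ! j) = T" using assms(4,5) j by auto
    fix i assume i: "i < T"
    then have "j * T + i < length fs * T" using le by simp
    from assms(10)[OF this] show "v0 + 2 * (j * T) + 2 * i < length \<pi> \<and> \<pi> ! (v0 + 2 * (j * T) + 2 * i) = rws ! j ! i"
     using nth_concat_rows[OF assms(5) i, of j] j assms(4) by (simp add: algebra_simps)
   qed (use inp lacc assms(3) in auto)
   then show ?thesis using accS[OF j] by (simp add: fun_upd_twist)
  qed
  have 2: "run w \<pi> (go 2 MoveRight) 1 ?a (?M (Suc j))"
   using run_go[of ?a 2 "cells (map sym fs)" "1 + int j" w \<pi> MoveRight]
   by (simp add: fun_upd_twist algebra_simps)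
  show "run w \<pi> (sendrow ;; go 2 MoveRight) ((6 * T + 4) + 1) (?M j) (?M (Suc j))"
   by (rule run_Seq[OF 1 2])
 next
  show "\<not> observe w \<pi> (?M (length fs)) c (nz 2)" for c by (simp add: rd_def cells_def)
 qed simp
 moreover have "acc (length fs) = combine T fs rws" using assms(4) by (simp add: acc_def)
 ultimately show ?thesis by (simp add: add.commute)
qed

lemma run_sendrest:
 assumes "inpseq w 1 (pin m) us" "cell w (pin m + int (length us)) = None"
  "tp m 5 = marks h" "pcom m = int h" "vis m = min (v0 + h) (length \<pi>)"
  "\<And>i. i < length us \<Longrightarrow> v0 + h + 2 * i < length \<pi> \<and> \<pi> ! (v0 + h + 2 * i) = us ! i"
 shows "run w \<pi> (Loop moreinput (sendp ;; mark ;; mark)) (4 * length us + 1) m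
  (m\<lparr>pin := pin m + int (length us), pcom := int (h + 2 * length us), vis := min (v0 + h + 2 * length us) (length \<pi>),
   tp := (tp m)(5 := marks (h + 2 * length us))\<rparr>)"
proof -
 let ?M = "\<lambda>i. m\<lparr>pin := pin m + int i, pcom := int (h + 2 * i), vis := min (v0 + h + 2 * i) (length \<pi>),
   tp := (tp m)(5 := marks (h + 2 * i))\<rparr>"
 have "run w \<pi> (Loop moreinput (sendp ;; mark ;; mark)) (length us * Suc (1 + 2) + 1) m (?M (length us))"
 proof (rule run_for[where M = ?M])
  show "m = ?M 0" using assms by (cases m) (auto simp: fun_eq_iff)
  fix i assume i: "i < length us"
  have c: "cell w (pin m + int i) = Some (us ! i)" using inpseq_nth[OF assms(1) i] by simp
  then show "observe w \<pi> (?M i) c' moreinput" for c' by simp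
  let ?ins = "nop\<lparr>mv_in := MoveRight, sd := Some (us ! i)\<rparr>"
  let ?a = "m\<lparr>pin := pin m + int (Suc i), pcom := int (h + 2 * i), vis := min (v0 + h + 2 * Suc i) (length \<pi>),
   tp := (tp m)(5 := marks (h + 2 * i))\<rparr>"
  have 1: "run w \<pi> sendp 1 (?M i) ?a" unfolding sendp_def
  proof (rule run_Act[where ins = ?ins])
   show "can_send \<pi> ?ins (?M i)" using assms(6)[OF i] by (simp add: can_send_def ac_simps)
   show "?a = exec_instr \<pi> ?ins (?M i)" by (auto simp: exec_instr_def fun_eq_iff)
  qed (use c in simp)
  have 2: "run w \<pi> (mark ;; mark) 2 ?a (?M (Suc i))"
   using run_mark2[of ?a "h + 2 * i" w \<pi>] by (simp add: ac_simps)
  show "run w \<pi> (sendp ;; mark ;; mark) (1 + 2) (?M i) (?M (Suc i))" by (rule run_Seq[OF 1 2])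
 qed (use assms(2) in auto)
 then show ?thesis by (rule run_mono) simp
qed

text \<open>The host's communication head and its number of visible bits are those of
  \<open>N\<close>, shifted by the two masks.\<close>

definition partyrel :: "tm \<Rightarrow> bits \<Rightarrow> bits \<Rightarrow> nat \<Rightarrow> nat \<Rightarrow> nat \<Rightarrow> mem \<Rightarrow> nat \<Rightarrow> conf \<Rightarrow> bool" where
 "partyrel N inp r i0 p W m j cf \<longleftrightarrow> simrel N 8 m cf \<and> wfc N cf \<and>
   tp m 0 = (cells (map sym inp), 1 + input_pos cf) \<and> tp m 1 = (cells (map sym r), 1 + int (steps cf)) \<and>
   tp m 3 = un (i0 - length (out_tape cf)) \<and> ot m = take i0 (out_tape cf) \<and>
   pcom m = int (2 * W) + comm_pos cf \<and> tp m 5 = (fst (marks (2 * W)), int (2 * W) + comm_pos cf) \<and>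
   vis m = 2 * W + j \<and> tp m 4 = un p"

lemma write_tape_rd: "write_tape (rd m v, mv) (tp m v) = (fst (tp m v), snd (tp m v) + offset mv)"
 by (simp add: write_tape_def rd_def)

lemma write_tape_un: "write_tape (0, MoveLeft) (un (Suc n)) = un n"
 by (simp add: write_tape_def un_def stk_def cells_pop[of "replicate n 1" 1, simplified] replicate_append_same[symmetric])

lemma partyrel_step:
 assumes N: "wf_tm N" and R: "partyrel N inp r i0 p W m j cf" and nh: "\<not> halted cf" and st: "steps cf < length r"
  and ss: "sstep N ((!) r) inp \<pi> (j, cf) = (j2, cf2)" "(j2, cf2) \<noteq> (j, cf)"
  and u: "length u = 2 * W" and j: "j \<le> length \<pi>"
 shows "\<exists>m2. run a (u @ \<pi>) (simparty N) 1 m m2 \<and> partyrel N inp r i0 p W m2 j2 cf2 \<and> steps cf2 = Suc (steps cf) \<and> j2 \<le> length \<pi>"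
proof -
 note R' = R[unfolded partyrel_def]
 define act where "act = current_action N ((!) r) inp (take j \<pi>) cf"
 have cf2: "cf2 = perform act cf"
  and send: "\<And>b. send act = Some b \<Longrightarrow> j < length \<pi> \<and> \<pi> ! j = b"
  and j2: "j2 = (if send act = None then j else min (j + 2) (length \<pi>))"
  using ss nh by (auto simp: sstep_def act_def Let_def split: option.splits if_splits)
 let ?\<pi> = "u @ \<pi>"
 let ?com = "\<lambda>c i m s. if s 5 = 1 then None else m :: bool option"
 let ?ext = "\<lambda>act c i m s. \<lparr>mv_in = Stay, mv_com = comm_move act,
    wr = [0 \<mapsto> (s 0, input_move act), 1 \<mapsto> (s 1, MoveRight), 5 \<mapsto> (s 5, comm_move act)] ++
     (if emit act \<noteq> None \<and> s 3 \<noteq> 0 then [3 \<mapsto> (0, MoveLeft)] else Map.empty),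
    em = (if s 3 \<noteq> 0 then emit act else None), sd = send act\<rparr>"
 have rd3: "rd m 3 = 0 \<longleftrightarrow> i0 \<le> length (out_tape cf)"
  using R' rd_un[of m 3 "i0 - length (out_tape cf)"] by simp
 define ins where "ins = observe a ?\<pi> m True (?ext act)"
 have act: "act = delta N (state cf) (r ! steps cf) (cell inp (input_pos cf)) (cell (take j \<pi>) (comm_pos cf)) (map (\<lambda>(tp, i). tp i) (work cf))"
  by (simp add: act_def current_action_def)
 have wfcf: "wfc N cf" and sr: "simrel N 8 m cf" using R' by simp_all
 have o1: "observe a ?\<pi> m c (sees 1 2) = r ! steps cf" for c
  using R' st by (simp add: rd_def cells_nth)
 have o2: "observe a ?\<pi> m c (\<lambda>c i m s. bitcell (s 0)) = cell inp (input_pos cf)" for c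
  using R' by (simp add: rd_def bitcell_sym)
 have o3: "observe a ?\<pi> m c ?com = cell (take j \<pi>) (comm_pos cf)" for c
 proof -
  have "rd m 5 = (if 0 \<le> pcom m \<and> pcom m < int (2 * W) then 1 else 0)"
   using R' by (simp add: rd_def marks_def)
  moreover have "take (vis m) ?\<pi> = u @ take j \<pi>" using R' u by simp
  ultimately show ?thesis using R' u
   by (auto simp: cell_def nth_append nat_add_distrib nat_mult_distrib)
 qed
 have o4: "observe a ?\<pi> m c (?ext act) = ins" for c by (simp add: ins_def)
 have "can_send ?\<pi> ins m" using R' u send by (auto simp: can_send_def nth_append ins_def)
 then obtain m2 where m2: "run a ?\<pi> (simparty N) 1 m m2"
  "simrel N 8 m2 (perform act cf)" "wfc N (perform act cf)"
  "\<And>j. j < 8 \<Longrightarrow> tp m2 j = tp (exec_instr ?\<pi> ins m) j"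
  "pcom m2 = pcom m + offset (mv_com ins)"
  "ot m2 = ot (exec_instr ?\<pi> ins m)" "vis m2 = vis (exec_instr ?\<pi> ins m)" unfolding simparty_def
  using run_simact[where w = a and coin = "\<lambda>c i m s. s 1 = 2" and inp = "\<lambda>c i m s. bitcell (s 0)"
   and com = ?com and ext = ?ext, OF N wfcf sr act o1 o2 o3 o4] by blast
 note ii = ins_def exec_instr_def
 have t0: "tp m2 0 = (cells (map sym inp), 1 + input_pos (perform act cf))"
  using m2(4)[of 0] R' write_tape_rd[of m 0 "input_move act"] by (simp add: ii perform_def map_add_def)
 have t1: "tp m2 1 = (cells (map sym r), 1 + int (steps (perform act cf)))"
  using m2(4)[of 1] R' write_tape_rd[of m 1 MoveRight] by (simp add: ii perform_def map_add_def)
 have t5: "tp m2 5 = (fst (marks (2 * W)), int (2 * W) + comm_pos (perform act cf))"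
  using m2(4)[of 5] R' write_tape_rd[of m 5 "comm_move act"] by (simp add: ii perform_def map_add_def)
 have t4: "tp m2 4 = un p" using m2(4)[of 4] R' by (simp add: ii map_add_def)
 have t3: "tp m2 3 = un (i0 - length (out_tape (perform act cf)))"
 proof (cases "emit act \<noteq> None \<and> \<not> i0 \<le> length (out_tape cf)")
  case True
  then have "tp m 3 = un (Suc (i0 - Suc (length (out_tape cf))))" using R' by (simp add: Suc_diff_Suc)
  then show ?thesis using m2(4)[of 3] True rd3 write_tape_un
   by (auto simp: ii perform_def map_add_def)
 next
  case False
  then show ?thesis using m2(4)[of 3] R' rd3
   by (cases "emit act") (auto simp: ii perform_def map_add_def)
 qed
 have o: "ot m2 = take i0 (out_tape (perform act cf))"
  using m2(6) R' rd3 by (cases "emit act") (auto simp: ii perform_def)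
 have v: "vis m2 = 2 * W + j2" using m2(7) R' u by (cases "send act") (auto simp: ii j2)
 have "partyrel N inp r i0 p W m2 j2 cf2"
  unfolding partyrel_def cf2 using m2(2,3,5) t0 t1 t3 t4 t5 o v R' by (simp add: perform_def ins_def)
 then show ?thesis using m2(1) j by (intro exI[of _ m2]) (auto simp: cf2 perform_def j2)
qed

text \<open>\<open>K\<close> may exceed the number of effective steps of \<open>N\<close>, because a
  halted configuration repeats; the time is therefore measured by \<open>steps\<close>.\<close>

lemma partyrel_loop:
 assumes N: "wf_tm N" and u: "length u = 2 * W"
  and "(sstep N ((!) r) inp \<pi> ^^ K) (j, cf) = (length \<pi>, cf')" "halted cf'" "steps cf' \<le> length r"
  and "partyrel N inp r i0 p W m j cf" "j \<le> length \<pi>"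
 shows "\<exists>m'. run a (u @ \<pi>) (Loop (\<lambda>c i m s. s 8 \<noteq> 1) (simparty N)) (2 * (steps cf' - steps cf) + 1) m m' \<and>
   partyrel N inp r i0 p W m' (length \<pi>) cf' \<and> steps cf \<le> steps cf'" using assms(3-)
proof (induction K arbitrary: j cf m)
 case 0
 then have eq: "cf = cf'" "j = length \<pi>" by auto
 have "rd m 8 = 1" using 0 by (auto simp: partyrel_def simrel_def halted_def)
 then have "run a (u @ \<pi>) (Loop (\<lambda>c i m s. s 8 \<noteq> 1) (simparty N)) 1 m m" by (intro run_LoopF) simp
 then show ?case using 0 eq by auto
next
 case (Suc K)
 obtain j2 cf2 where ss: "sstep N ((!) r) inp \<pi> (j, cf) = (j2, cf2)" by fastforce
 have rest: "(sstep N ((!) r) inp \<pi> ^^ K) (j2, cf2) = (length \<pi>, cf')"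
  using Suc.prems(1) ss by (simp add: funpow_swap1)
 show ?case
 proof (cases "(j2, cf2) = (j, cf)")
  case True
  then show ?thesis using Suc.IH[OF _ Suc.prems(2-5)] rest by simp
 next
  case False
  then have nh: "\<not> halted cf" using ss by (auto simp: sstep_def)
  have "steps cf2 = Suc (steps cf)"
   using ss nh False by (auto simp: sstep_def Let_def perform_def split: option.splits if_splits)
  have mono: "snd x = (cf::conf) \<Longrightarrow> steps cf \<le> steps (snd ((sstep N ((!) r) inp \<pi> ^^ n) x))" for n x cf
  proof (induction n)
   case (Suc n)
   have "steps (snd y) \<le> steps (snd (sstep N ((!) r) inp \<pi> y))" for y
    by (cases y) (auto simp: sstep_def Let_def perform_def split: option.split)
   from this[of "(sstep N ((!) r) inp \<pi> ^^ n) x"] Suc show ?case by simp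
  qed simp
  from mono[of "(j2, cf2)" cf2 K] rest have le: "steps cf2 \<le> steps cf'" by simp
  then have st: "steps cf < length r" using \<open>steps cf2 = Suc (steps cf)\<close> Suc.prems(3) by simp
  from partyrel_step[OF N Suc.prems(4) nh st ss False u Suc.prems(5), of a] obtain m2 where
   m2: "run a (u @ \<pi>) (simparty N) 1 m m2" "partyrel N inp r i0 p W m2 j2 cf2" "j2 \<le> length \<pi>" by blast
  from Suc.IH[OF rest Suc.prems(2,3) m2(2,3)] obtain m' where
   m': "run a (u @ \<pi>) (Loop (\<lambda>c i m s. s 8 \<noteq> 1) (simparty N)) (2 * (steps cf' - steps cf2) + 1) m2 m'"
   "partyrel N inp r i0 p W m' (length \<pi>) cf'" by blast
  have "rd m 8 \<noteq> 1" using Suc.prems(4) nh by (auto simp: partyrel_def simrel_def halted_def)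
  then have "run a (u @ \<pi>) (Loop (\<lambda>c i m s. s 8 \<noteq> 1) (simparty N)) (Suc (1 + (2 * (steps cf' - steps cf2) + 1))) m m'"
   by (intro run_LoopT[OF _ m2(1) m'(1)]) simp
  then show ?thesis using m'(2) le \<open>steps cf2 = Suc (steps cf)\<close>
   by (intro exI[of _ m']) (auto elim!: run_mono)
 qed
qed

lemma run_emitzeros:
 assumes "tp m v = un n"
 shows "run w \<pi> (Loop (nz v) (pop v ;; emitf (\<lambda>_ _ _ _. False))) (3 * n + 1) m
  (m\<lparr>ot := ot m @ replicate n False, tp := (tp m)(v := un 0)\<rparr>)"
proof -
 let ?M = "\<lambda>i. m\<lparr>ot := ot m @ replicate i False, tp := (tp m)(v := un (n - i))\<rparr>"
 have "run w \<pi> (Loop (nz v) (pop v ;; emitf (\<lambda>_ _ _ _. False))) (n * (1 + 2) + 1) m (?M n)"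
 proof (rule run_countdown[where M = ?M])
  fix i assume "i < n"
  show "run w \<pi> (emitf (\<lambda>_ _ _ _. False)) 1 (upd v (un (n - Suc i)) (?M i)) (?M (Suc i))"
   by (rule run_emitf) (auto simp: replicate_append_same)
 qed (use assms in \<open>cases m, auto simp: fun_eq_iff\<close>)
 from run_mono[OF this, of "3 * n + 1"] show ?thesis by simp
qed

lemma run_exec: "run w \<pi> p B m m' \<Longrightarrow> \<exists>t\<le>B. exec w \<pi> c p t m m'" by (simp add: run_def)

text \<open>The bound is linear in the mask length, as a time t just above n log n requires. Only
  the contribution of the five numbers is quadratic, due to adding up to
  \<open>length fs + 1\<close> rows of length \<open>T\<close>; these numbers will be tiny compared
  with \<open>W\<close>.\<close>

lemma run_party:
 fixes \<pi> u fs rest :: bits and rws :: "bits list" and mm T i0 p :: nat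
 defines "a \<equiv> header [mm, T, length fs, i0, p] @ fs @ concat rws @ rest"
  and "W \<equiv> length (concat rws @ rest)"
 assumes N: "wf_tm N" and T: "0 < T"
  and rws: "length rws = Suc (length fs)" "\<forall>v\<in>set rws. length v = T"
  and u: "length u = 2 * W" "\<And>k. k < W \<Longrightarrow> u ! (2 * k + (if first then 0 else 1)) = (concat rws @ rest) ! k"
  and sd: "side N first (replicate mm False) ((!) (combine T (True # fs) rws)) (real T) \<pi> x"
 shows "side (party_tm N) first a coins
  (real (20 * (mm + T + length fs + i0 + p + 3) ^ 2 + 6 * length a + 4 * W))
  (u @ \<pi>) (take i0 x @ replicate p False)"
proof -
 let ?r = "combine T (True # fs) rws" and ?fs = "True # fs" and ?\<pi> = "u @ \<pi>"
 define v0 :: nat where "v0 = (if first then 0 else 1)"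
 have lenr: "length ?r = T" using rws(2) by (rule length_combine)
 let ?w = "concat rws @ rest"
 have lc: "length (concat rws) = length ?fs * T" using length_concat_rows[OF rws(2)] rws(1) by simp
 have W: "W = length ?fs * T + length rest" using lc by (simp add: W_def)
 have W0: "0 < W" using T by (simp add: W)
 have bits: "v0 + 2 * k < length ?\<pi> \<and> ?\<pi> ! (v0 + 2 * k) = ?w ! k" if "k < W" for k
  using u(1) u(2)[OF that] that by (auto simp: v0_def nth_append add.commute)
 define st where st_def: "st = start (if first then 0 else min 1 (length ?\<pi>))"
 have st: "pin st = 0" "pcom st = 0" "ot st = []" "vis st = min v0 (length ?\<pi>)" "tp st = (\<lambda>_. un 0)"
  using W0 u(1) by (auto simp: st_def start_def v0_def un_0 stk_Nil)
 let ?ns = "[mm, T, length fs, i0, p]"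
 have inp: "inpseq a 1 0 (header ?ns @ fs @ concat rws @ rest)"
  using inpseq_self[of a] by (simp add: a_def)
 define h where "h = int (length (header ?ns))"
 have inp_h: "inpseq a 1 0 (header ?ns)" and inp_fs: "inpseq a 1 h fs"
  and inp_c: "inpseq a 1 (h + int (length fs)) (concat rws)"
  and inp_r: "inpseq a 1 (h + int (length fs) + int (length (concat rws))) rest"
  using inp by (simp_all only: inpseq_append h_def) simp_all
 let ?m1 = "st\<lparr>pin := h, tp := (\<lambda>_. un 0)(0 := un mm, 1 := un T, 6 := un (length fs), 3 := un i0, 4 := un p)\<rparr>"
 have "run a ?\<pi> (nums 1 7 [0, 1, 6, 3, 4]) (14 * sum_list ?ns + 6 * length (header ?ns) + 1) st
  (st\<lparr>pin := pin st + int (1 * length (header ?ns)), tp := loaded [0, 1, 6, 3, 4] ?ns (tp st)\<rparr>)"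
  by (rule run_nums) (use inp_h in \<open>simp_all add: st del: header_simps\<close>)
 then have R1: "run a ?\<pi> (nums 1 7 [0, 1, 6, 3, 4]) (14 * sum_list ?ns + 6 * length (header ?ns) + 1) st ?m1"
  by (rule back_subst[of "run a ?\<pi> _ _ _"]) (simp add: st h_def fun_eq_iff)
 let ?m2 = "?m1\<lparr>tp := (tp ?m1)(2 := stk [2])\<rparr>"
 have R2: "run a ?\<pi> (push 2 2) 2 ?m1 ?m2" using run_push[of ?m1 2 "[]" a ?\<pi> 2] by (simp add: un_0)
 let ?m3 = "st\<lparr>pin := h + int (length fs),
  tp := (\<lambda>_. un 0)(0 := un mm, 1 := un T, 3 := un i0, 4 := un p, 2 := stk (map sym ?fs))\<rparr>"
 have "run a ?\<pi> (readbits 1 6 2) (6 * length fs + 1) ?m2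
  (?m2\<lparr>pin := pin ?m2 + int (1 * length fs), tp := (tp ?m2)(6 := un 0, 2 := stk ([2] @ map sym fs))\<rparr>)"
  by (rule run_readbits) (use inp_fs in auto)
 then have R3: "run a ?\<pi> (readbits 1 6 2) (6 * length fs + 1) ?m2 ?m3"
  by (rule back_subst[of "run a ?\<pi> _ _ _"]) (auto simp: fun_eq_iff sym_def)
 have z: "0 \<notin> set (map sym ys)" for ys by (auto simp: sym_def)
 let ?m4 = "?m3\<lparr>tp := (tp ?m3)(0 := (cells (map sym (replicate mm False)), 1))\<rparr>"
 have R4: "run a ?\<pi> (rewind 0) (2 * mm + 2) ?m3 ?m4"
  using run_rewind[of ?m3 0 "map sym (replicate mm False)" "int mm" a ?\<pi>] z[of "replicate mm False"]
  by (simp add: un_sym stk_def del: map_replicate)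
 let ?m5 = "?m4\<lparr>tp := (tp ?m4)(1 := (cells (map sym (replicate T False)), 1))\<rparr>"
 have R5: "run a ?\<pi> (rewind 1) (2 * T + 2) ?m4 ?m5"
  using run_rewind[of ?m4 1 "map sym (replicate T False)" "int T" a ?\<pi>] z[of "replicate T False"]
  by (simp add: un_sym stk_def del: map_replicate)
 let ?m6 = "?m5\<lparr>tp := (tp ?m5)(2 := (cells (map sym ?fs), 1))\<rparr>"
 have R6: "run a ?\<pi> (rewind 2) (2 * length ?fs + 2) ?m5 ?m6"
  using run_rewind[of ?m5 2 "map sym ?fs" "int (length ?fs)" a ?\<pi>] z[of ?fs]
  by (simp add: stk_def del: list.map)
 define c where "c = length ?fs * T"
 let ?m7 = "?m6\<lparr>pin := h + int (length fs) + int c, pcom := int (2 * c), vis := min (v0 + 2 * c) (length ?\<pi>),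
  tp := (tp ?m6)(1 := (cells (map sym ?r), 1), 2 := (cells (map sym ?fs), 1 + int (length ?fs)), 5 := marks (2 * c))\<rparr>"
 have R7: "run a ?\<pi> (Loop (nz 2) (sendrow ;; go 2 MoveRight)) (length ?fs * (6 * T + 6) + 1) ?m6 ?m7"
 proof -
  have "run a ?\<pi> (Loop (nz 2) (sendrow ;; go 2 MoveRight)) (length ?fs * (6 * T + 6) + 1) ?m6
   (?m6\<lparr>pin := pin ?m6 + int c, pcom := int (2 * c), vis := min (v0 + 2 * c) (length ?\<pi>),
   tp := (tp ?m6)(1 := (cells (map sym ?r), 1), 2 := (cells (map sym ?fs), 1 + int (length ?fs)), 5 := marks (2 * c))\<rparr>)"
   unfolding c_def
  proof (rule run_rows)
   show "tp ?m6 5 = marks 0" by (auto simp: marks_def un_0 stk_Nil)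
   show "v0 + 2 * k < length ?\<pi> \<and> ?\<pi> ! (v0 + 2 * k) = concat rws ! k" if "k < length ?fs * T" for k
    using bits[of k] that lc W by (simp add: nth_append)
  qed (use T rws inp_c st in auto)
  then show ?thesis by simp
 qed
 let ?m8 = "?m7\<lparr>pin := pin ?m7 + int (length rest), pcom := int (2 * W), vis := min (v0 + 2 * W) (length ?\<pi>),
  tp := (tp ?m7)(5 := marks (2 * W))\<rparr>"
 have Wc: "2 * c + 2 * length rest = 2 * W" using W by (simp add: c_def)
 have "run a ?\<pi> (Loop moreinput (sendp ;; mark ;; mark)) (4 * length rest + 1) ?m7
  (?m7\<lparr>pin := pin ?m7 + int (length rest), pcom := int (2 * c + 2 * length rest),
   vis := min (v0 + 2 * c + 2 * length rest) (length ?\<pi>), tp := (tp ?m7)(5 := marks (2 * c + 2 * length rest))\<rparr>)"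
 proof (rule run_sendrest)
  show "cell a (pin ?m7 + int (length rest)) = None"
   using lc by (simp add: cell_def a_def h_def c_def)
  show "v0 + 2 * c + 2 * i < length ?\<pi> \<and> ?\<pi> ! (v0 + 2 * c + 2 * i) = rest ! i" if "i < length rest" for i
   using bits[of "c + i"] that W lc by (simp add: nth_append c_def algebra_simps)
 qed (use inp_r lc in \<open>auto simp: c_def\<close>)
 then have R8: "run a ?\<pi> (Loop moreinput (sendp ;; mark ;; mark)) (4 * length rest + 1) ?m7 ?m8"
  by (simp only: Wc add.assoc)
 obtain K cf where K: "(sstep N ((!) ?r) (replicate mm False) \<pi> ^^ K) (if first then 0 else min 1 (length \<pi>), init_conf N) = (length \<pi>, cf)"
  and cf: "halted cf" "steps cf \<le> T" "out_tape cf = x" using sd unfolding side_def by auto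
 \<comment> \<open>Against \<open>u @ \<pi>\<close> the visible part is \<open>2 * W\<close> bits
   longer than in a fresh run against \<open>\<pi>\<close>; the truncation matters for the second
   party if \<open>\<pi>\<close> is empty.\<close>
 have rel: "partyrel N (replicate mm False) ?r i0 p W ?m8 (if first then 0 else min 1 (length \<pi>)) (init_conf N)"
 proof -
  have "simrel N 8 ?m8 (init_conf N)" by (rule simrel_init) (auto simp: un_0 stk_Nil)
  moreover have "min (v0 + 2 * W) (length ?\<pi>) = 2 * W + (if first then 0 else min 1 (length \<pi>))"
   using u(1) by (auto simp: v0_def min_def)
  ultimately show ?thesis using wfc_init[OF N] st
   by (simp add: partyrel_def init_conf_def marks_def)
 qed
 have stT: "steps cf \<le> length ?r" and jle: "(if first then 0 else min 1 (length \<pi>)) \<le> length \<pi>"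
  using cf(2) lenr by simp_all
 obtain m9 where R9': "run a ?\<pi> (Loop (\<lambda>c i m s. s 8 \<noteq> 1) (simparty N)) (2 * (steps cf - steps (init_conf N)) + 1) ?m8 m9"
  and m9: "partyrel N (replicate mm False) ?r i0 p W m9 (length \<pi>) cf"
  using partyrel_loop[OF N u(1) K cf(1) stT rel jle, of a] by blast
 have R9: "run a ?\<pi> (Loop (\<lambda>c i m s. s 8 \<noteq> 1) (simparty N)) (2 * T + 1) ?m8 m9"
  by (rule run_mono[OF R9']) (use cf(2) in \<open>simp add: init_conf_def\<close>)
 have R10: "run a ?\<pi> (Loop (nz 4) (pop 4 ;; emitf (\<lambda>_ _ _ _. False))) (3 * p + 1) m9
  (m9\<lparr>ot := take i0 x @ replicate p False, tp := (tp m9)(4 := un 0)\<rparr>)"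
  using run_emitzeros[of m9 4 p a ?\<pi>] m9 cf(3) by (simp add: partyrel_def)
 note R = run_Seq[OF R1 run_Seq[OF R2 run_Seq[OF R3 run_Seq[OF R4 run_Seq[OF R5 run_Seq[OF R6
  run_Seq[OF R7 run_Seq[OF R8 run_Seq[OF R9 R10]]]]]]]]]
 let ?X = "mm + T + length fs + i0 + p + 3"
 have "\<exists>t \<le> 14 * (mm + T + length fs + i0 + p) + 6 * length (header ?ns) + (length fs + 1) * (6 * T + 6) +
   (2 * mm + 4 * T + 3 * p + 8 * length fs + 4 * length rest + 25). exec a ?\<pi> (\<lambda>n. coins (Suc n)) (party N) t st
   (m9\<lparr>ot := take i0 x @ replicate p False, tp := (tp m9)(4 := un 0)\<rparr>)"
  by (rule run_exec[OF run_mono[OF R[folded party_def]]]) (simp del: header_simps)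
 then obtain t where t: "exec a ?\<pi> (\<lambda>n. coins (Suc n)) (party N) t st
   (m9\<lparr>ot := take i0 x @ replicate p False, tp := (tp m9)(4 := un 0)\<rparr>)"
  and tB: "t \<le> 14 * (mm + T + length fs + i0 + p) + 6 * length (header ?ns) + (length fs + 1) * (6 * T + 6) +
   (2 * mm + 4 * T + 3 * p + 8 * length fs + 4 * length rest + 25)" by blast
 define X where "X = ?X"
 define H where "H = length (header ?ns)"
 define Q where "Q = (length fs + 1) * (6 * T + 6)"
 have "Q \<le> X * (6 * X)" unfolding Q_def by (intro mult_mono) (auto simp: X_def)
 moreover have "X * 4 \<le> X * X" using T by (intro mult_mono) (auto simp: X_def)
 moreover have "H \<le> length a" "length rest \<le> W" by (auto simp: a_def W_def H_def)
 moreover have "t \<le> 22 * X + 6 * H + Q + 4 * length rest + 25"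
  by (rule order_trans[OF tB[folded Q_def H_def]]) (simp add: X_def)
 moreover have "X \<ge> 4" using T X_def by linarith
 ultimately have "t + 2 \<le> 20 * (X * X) + 6 * length a + 4 * W" by linarith
 then have "real (t + 2) \<le> real (20 * X ^ 2 + 6 * length a + 4 * W)"
  unfolding power2_eq_square of_nat_le_iff .
 moreover have "vis m9 = length ?\<pi>" using m9 u(1) by (simp add: partyrel_def)
 ultimately show ?thesis
  using exec_side[OF t[unfolded st_def] okp_party] unfolding party_tm_def X_def by simp
qed

section \<open>A machine that computes the transcript of an interaction\<close>

lemma encode_pair_Nil: "encode_pair [] v = True # v" by (simp add: encode_pair_def)

lemma encode_pair_Cons: "encode_pair (b # u) v = False # b # encode_pair u v"
 by (simp add: encode_pair_def)

lemma nth_encode_pair: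
 "k < length u \<Longrightarrow> encode_pair u v ! (2 * k) = False"
 "k < length u \<Longrightarrow> encode_pair u v ! Suc (2 * k) = u ! k"
 "encode_pair u v ! (2 * length u) = True"
 "encode_pair u v ! Suc (2 * length u + i) = v ! i"
proof -
 show "k < length u \<Longrightarrow> encode_pair u v ! (2 * k) = False"
  by (induction u arbitrary: k) (auto simp: encode_pair_Cons nth_Cons' less_Suc_eq_0_disj)
 show "k < length u \<Longrightarrow> encode_pair u v ! Suc (2 * k) = u ! k"
  by (induction u arbitrary: k) (auto simp: encode_pair_Cons nth_Cons' less_Suc_eq_0_disj)
 show "encode_pair u v ! (2 * length u) = True"
  by (induction u) (simp_all add: encode_pair_Nil encode_pair_Cons)
 show "encode_pair u v ! Suc (2 * length u + i) = v ! i"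
  by (induction u) (simp_all add: encode_pair_Nil encode_pair_Cons)
qed

lemma cell_nat: "cell w (int k) = (if k < length w then Some (w ! k) else None)"
 by (simp add: cell_def)

lemma cell_encode_pair:
 "k < length u \<Longrightarrow> cell (encode_pair u v) (int (2 * k)) = Some False"
 "k < length u \<Longrightarrow> cell (encode_pair u v) (int (Suc (2 * k))) = Some (u ! k)"
 "cell (encode_pair u v) (int (2 * length u)) = Some True"
 "cell (encode_pair u v) (int (Suc (2 * length u + i))) = cell v (int i)"
 unfolding cell_nat by (auto simp: nth_encode_pair length_encode_pair)

lemma inpseq_encode_pair: "inpseq (encode_pair u v) 2 1 u"
 unfolding inpseq_def using cell_encode_pair(2)[of _ u v] by simp

text \<open>A communication head may move to the left of the tape, so positions carry a sign, which
  is encoded by the symbol used.\<close>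

definition signed :: "int \<Rightarrow> tape" where
 "signed k = stk (replicate (nat \<bar>k\<bar>) (if k > 0 then 2 else 1))"

lemma signed_0: "signed 0 = un 0" by (simp add: signed_def un_def)

lemma rd_signed: "tp m v = signed k \<Longrightarrow> rd m v = (if k > 0 then 2 else if k < 0 then 1 else 0)"
 unfolding signed_def by (drule rd_stk) simp

definition inc :: "nat \<Rightarrow> prog" where
 "inc v = Cond (sees v 1) (pop v) (push v 2)"

definition dec :: "nat \<Rightarrow> prog" where
 "dec v = Cond (sees v 2) (pop v) (push v 1)"

lemma okp_inc [simp]: "2 < S \<Longrightarrow> v < k \<Longrightarrow> okp k S (inc v)" "2 < S \<Longrightarrow> v < k \<Longrightarrow> okp k S (dec v)"
 "coinless (inc v)" "coinless (dec v)" by (auto simp: inc_def dec_def)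

lemma run_inc: "tp m v = signed k \<Longrightarrow> run w \<pi> (inc v) 3 m (upd v (signed (k + 1)) m)"
proof (cases "k < 0")
 case True
 assume t: "tp m v = signed k"
 have s: "signed k = stk (replicate (nat \<bar>k + 1\<bar>) 1 @ [1])"
 proof -
  have "nat \<bar>k\<bar> = Suc (nat \<bar>k + 1\<bar>)" using True by simp
  then show ?thesis using True by (simp add: signed_def replicate_append_same)
 qed
 have "run w \<pi> (pop v) 1 m (upd v (signed (k + 1)) m)"
  using run_pop[of m v "replicate (nat \<bar>k + 1\<bar>) 1" 1 w \<pi>] t s True by (simp add: signed_def)
 then have "run w \<pi> (inc v) (Suc 1) m (upd v (signed (k + 1)) m)"
  unfolding inc_def by (intro run_CondT) (use True rd_signed[OF t] in auto)
 then show ?thesis by (rule run_mono) simp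
next
 case False
 assume t: "tp m v = signed k"
 have s: "signed k = stk (replicate (nat k) 2)" using False by (cases "k = 0") (auto simp: signed_def)
 have "nat \<bar>k + 1\<bar> = Suc (nat k)" using False by simp
 then have s1: "signed (k + 1) = stk (replicate (nat k) 2 @ [2])"
  using False by (simp add: signed_def replicate_append_same)
 have "run w \<pi> (push v 2) 2 m (upd v (signed (k + 1)) m)"
  unfolding s1 by (rule run_push) (simp add: t s)
 then have "run w \<pi> (inc v) (Suc 2) m (upd v (signed (k + 1)) m)"
  unfolding inc_def by (intro run_CondF) (use False rd_signed[OF t] in auto)
 then show ?thesis by (rule run_mono) simp
qed

lemma run_dec: "tp m v = signed k \<Longrightarrow> run w \<pi> (dec v) 3 m (upd v (signed (k - 1)) m)"
proof (cases "k > 0")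
 case True
 assume t: "tp m v = signed k"
 have s: "signed k = stk (replicate (nat (k - 1)) 2 @ [2])"
 proof -
  have "nat \<bar>k\<bar> = Suc (nat (k - 1))" using True by simp
  then show ?thesis using True by (simp add: signed_def replicate_append_same)
 qed
 have s1: "signed (k - 1) = stk (replicate (nat (k - 1)) 2)"
  using True by (cases "k = 1") (auto simp: signed_def)
 have "run w \<pi> (pop v) 1 m (upd v (signed (k - 1)) m)"
  unfolding s1 by (rule run_pop) (simp add: t s)
 then have "run w \<pi> (dec v) (Suc 1) m (upd v (signed (k - 1)) m)"
  unfolding dec_def by (intro run_CondT) (use True rd_signed[OF t] in auto)
 then show ?thesis by (rule run_mono) simp
next
 case False
 assume t: "tp m v = signed k"
 have s: "signed k = stk (replicate (nat \<bar>k\<bar>) 1)" using False by (auto simp: signed_def)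
 have "nat \<bar>k - 1\<bar> = Suc (nat \<bar>k\<bar>)" using False by simp
 then have s1: "signed (k - 1) = stk (replicate (nat \<bar>k\<bar>) 1 @ [1])"
  using False by (simp add: signed_def replicate_append_same)
 have "run w \<pi> (push v 1) 2 m (upd v (signed (k - 1)) m)"
  unfolding s1 by (rule run_push) (simp add: t s)
 then have "run w \<pi> (dec v) (Suc 2) m (upd v (signed (k - 1)) m)"
  unfolding dec_def by (intro run_CondF) (use False rd_signed[OF t] in auto)
 then show ?thesis by (rule run_mono) simp
qed

text \<open>
 Tape 2 holds the transcript so far, tape \<open>D\<close> the position of a party's communication head;
 \<open>fetch\<close> copies the scanned cell to tape 5.
\<close>

definition fetch :: "nat \<Rightarrow> prog" where
 "fetch D = rewind 2 ;; Cond (sees D 1) (put 5 0 Stay)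
   (Loop (nz D) (pop D ;; push 6 1 ;; go 2 MoveRight) ;; putf 5 (\<lambda>c i m s. s 2) Stay ;;
   Loop (nz 6) (pop 6 ;; push D 2 ;; go 2 MoveLeft)) ;; unwind 2"

lemma run_fetch:
 assumes "tp m 2 = stk ys" "0 \<notin> set ys" "tp m D = signed k" "tp m 6 = un 0" "D \<notin> {2, 5, 6}"
 shows "\<exists>B t. run w \<pi> (fetch D) B m (upd 5 t m) \<and> fst t (snd t) = cells ys (1 + k)"
proof -
 let ?m1 = "upd 2 (cells ys, 1) m"
 have r1: "run w \<pi> (rewind 2) (2 * length ys + 2) m ?m1"
  using run_rewind[of m 2 ys "int (length ys)" w \<pi>] assms by (simp add: stk_def)
 have rdD: "rd ?m1 D = (if k > 0 then 2 else if k < 0 then 1 else 0)"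
  using assms by (intro rd_signed) simp
 have r3: "run w \<pi> (unwind 2) (2 * length ys + 2) (m\<lparr>tp := (tp m)(2 := (cells ys, 1), 5 := t)\<rparr>) (upd 5 t m)" for t
  using run_unwind[of "m\<lparr>tp := (tp m)(2 := (cells ys, 1), 5 := t)\<rparr>" 2 ys 1 w \<pi>] assms
  by (simp add: fun_upd_twist[of 5 2] fun_upd_idem)
 show ?thesis
 proof (cases "k < 0")
  case True
  let ?t = "write_tape (0, Stay) (tp m 5)"
  have "run w \<pi> (put 5 0 Stay) 1 ?m1 (m\<lparr>tp := (tp m)(2 := (cells ys, 1), 5 := ?t)\<rparr>)"
   using run_put[of w \<pi> 5 0 Stay ?m1] by simp
  from run_CondT[where C = "\<lambda>c i m s. s D = 1", OF _ this] True rdD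
  have "run w \<pi> (Cond (sees D 1) (put 5 0 Stay) q) 2 ?m1 (m\<lparr>tp := (tp m)(2 := (cells ys, 1), 5 := ?t)\<rparr>)" for q
   by (simp add: numeral_2_eq_2)
  from run_Seq[OF r1 run_Seq[OF this r3]] True show ?thesis unfolding fetch_def
   by (intro exI conjI) (assumption, simp add: write_tape_def cells_def)
 next
  case False
  then obtain n where k: "k = int n" by (metis not_less zero_le_imp_eq_int)
  have sg: "signed (int i) = stk (replicate i 2)" for i by (cases "i = 0") (simp_all add: signed_def)
  let ?t = "write_tape (cells ys (1 + k), Stay) (tp m 5)"
  let ?M = "\<lambda>i. m\<lparr>tp := (tp m)(2 := (cells ys, 1 + int i), D := stk (replicate (n - i) 2), 6 := un i)\<rparr>"
  have a: "run w \<pi> (Loop (nz D) (pop D ;; push 6 1 ;; go 2 MoveRight)) (n * Suc (1 + (2 + 1)) + 1) ?m1 (?M n)"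
  proof (rule run_for[where M = ?M])
   show "?m1 = ?M 0" using assms k sg by (auto simp: fun_eq_iff)
   fix i assume i: "i < n"
   have tD: "tp (?M i) D = stk (replicate (n - Suc i) 2 @ [2])"
    using i assms(5) by (simp add: replicate_append_same flip: replicate_Suc Suc_diff_Suc)
   show "observe w \<pi> (?M i) c (nz D)" for c by (subst rd_stk[OF tD]) simp
   let ?a = "upd D (stk (replicate (n - Suc i) 2)) (?M i)"
   have 1: "run w \<pi> (pop D) 1 (?M i) ?a" by (rule run_pop[OF tD])
   let ?b = "upd 6 (un (Suc i)) ?a"
   have 2: "run w \<pi> (push 6 1) 2 ?a ?b" by (rule run_push_un) (use assms in simp)
   have 3: "run w \<pi> (go 2 MoveRight) 1 ?b (upd 2 (cells ys, 1 + int i + 1) ?b)"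
    using run_go[of ?b 2 "cells ys" "1 + int i" w \<pi> MoveRight] assms by simp
   have "upd 2 (cells ys, 1 + int i + 1) ?b = ?M (Suc i)"
    using assms(5) by (auto simp: fun_eq_iff)
   with run_Seq[OF 1 run_Seq[OF 2 3]]
   show "run w \<pi> (pop D ;; push 6 1 ;; go 2 MoveRight) (1 + (2 + 1)) (?M i) (?M (Suc i))" by simp
  next
   have tD: "tp (?M n) D = stk []" using assms(5) by simp
   show "\<not> observe w \<pi> (?M n) c (nz D)" for c by (subst rd_stk[OF tD]) simp
  qed simp
  let ?c = "upd 5 ?t (?M n)"
  have b: "run w \<pi> (putf 5 (\<lambda>c i m s. s 2) Stay) 1 (?M n) ?c"
   by (rule run_putf[where a = "cells ys (1 + k)"]) (use assms k in \<open>auto simp: rd_def fun_eq_iff\<close>)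
  let ?N = "\<lambda>i. m\<lparr>tp := (tp m)(2 := (cells ys, 1 + int (n - i)), D := stk (replicate i 2), 6 := un (n - i), 5 := ?t)\<rparr>"
  have c: "run w \<pi> (Loop (nz 6) (pop 6 ;; push D 2 ;; go 2 MoveLeft)) (n * ((2 + 1) + 2) + 1) ?c (?N n)"
  proof (rule run_countdown[where M = ?N])
   fix i assume i: "i < n"
   let ?a = "upd 6 (un (n - Suc i)) (?N i)"
   let ?b = "upd D (stk (replicate i 2 @ [2])) ?a"
   have 1: "run w \<pi> (push D 2) 2 ?a ?b" by (rule run_push) (use assms in simp)
   have 2: "run w \<pi> (go 2 MoveLeft) 1 ?b (upd 2 (cells ys, 1 + int (n - i) - 1) ?b)"
    using run_go[of ?b 2 "cells ys" "1 + int (n - i)" w \<pi> MoveLeft] assms by simp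
   have "int (n - i) = 1 + int (n - Suc i)" using i by simp
   then have "upd 2 (cells ys, 1 + int (n - i) - 1) ?b = ?N (Suc i)"
    using assms(5) by (auto simp: fun_eq_iff replicate_append_same)
   with run_Seq[OF 1 2]
   show "run w \<pi> (push D 2 ;; go 2 MoveLeft) (2 + 1) ?a (?N (Suc i))" by simp
  qed (use assms in \<open>auto simp: fun_eq_iff\<close>)
  have "?N n = m\<lparr>tp := (tp m)(2 := (cells ys, 1), 5 := ?t)\<rparr>"
   using assms k sg by (auto simp: fun_eq_iff)
  with run_CondF[where C = "\<lambda>c i m s. s D = 1", OF _ run_Seq[OF a run_Seq[OF b c]]] False rdD
  have "run w \<pi> (Cond (sees D 1) (put 5 0 Stay)
   (Loop (nz D) (pop D ;; push 6 1 ;; go 2 MoveRight) ;; putf 5 (\<lambda>c i m s. s 2) Stay ;;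
   Loop (nz 6) (pop 6 ;; push D 2 ;; go 2 MoveLeft)))
   (Suc ((n * Suc (1 + (2 + 1)) + 1) + (1 + (n * ((2 + 1) + 2) + 1)))) ?m1
   (m\<lparr>tp := (tp m)(2 := (cells ys, 1), 5 := ?t)\<rparr>)" by auto
  from run_Seq[OF r1 run_Seq[OF this r3]] show ?thesis unfolding fetch_def
   by (intro exI conjI) (assumption, simp add: write_tape_def)
 qed
qed

definition movecode :: "move \<Rightarrow> nat" where
 "movecode mv = (case mv of MoveLeft \<Rightarrow> 1 | Stay \<Rightarrow> 0 | MoveRight \<Rightarrow> 2)"

definition bitcode :: "bool option \<Rightarrow> nat" where
 "bitcode b = (case b of None \<Rightarrow> 0 | Some b \<Rightarrow> sym b)"

lemma code_less [simp]: "movecode mv < 3" "bitcode b < 3"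
 by (auto simp: movecode_def bitcode_def sym_def split: move.split option.split)

text \<open>Tape 8 tells whose turn it is, tapes 9 and 10 pass on the head movement and the sent bit.\<close>

definition stepm :: "tm \<Rightarrow> nat \<Rightarrow> nat \<Rightarrow> nat \<Rightarrow> nat \<Rightarrow> prog" where
 "stepm N off inp D tn = fetch D ;;
   simact N off (\<lambda>_ _ _ _. False) (\<lambda>c i m s. bitcell (s inp)) (\<lambda>c i m s. bitcell (s 5))
    (\<lambda>act c i m s. nop\<lparr>wr := [inp \<mapsto> (s inp, input_move act), 9 \<mapsto> (movecode (comm_move act), Stay),
     10 \<mapsto> (bitcode (send act), Stay)]\<rparr>) ;;
   Cond (sees 9 1) (dec D) (Cond (sees 9 2) (inc D) skip) ;;
   Cond (nz 10) (pushf 2 (\<lambda>c i m s. s 10) ;; emitf (sees 10 2) ;; put 8 tn Stay) skip"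

text \<open>Time bounds such as \<open>B\<close> are existential for this machine, as plain
  complexity asks for computability only.\<close>

lemma run_stepm:
 assumes N: "wf_tm N" "wfc N cf" "simrel N off m cf"
  and t: "tp m inp = (cells (map sym a), 1 + input_pos cf)" "tp m 2 = stk (map sym \<rho>)"
   "tp m D = signed (comm_pos cf)" "tp m 6 = un 0"
  and ix: "inp = 0 \<or> inp = 1" "D = 3 \<or> D = 4" "11 \<le> off"
 defines "act \<equiv> current_action N (\<lambda>_. False) a \<rho> cf"
 defines "snt \<equiv> (case send act of None \<Rightarrow> [] | Some b \<Rightarrow> [b])"
 shows "\<exists>B m'. run w [] (stepm N off inp D tn) B m m' \<and> simrel N off m' (perform act cf) \<and>
  wfc N (perform act cf) \<and> tp m' inp = (cells (map sym a), 1 + input_pos (perform act cf)) \<and>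
  tp m' D = signed (comm_pos (perform act cf)) \<and> tp m' 2 = stk (map sym (\<rho> @ snt)) \<and>
  tp m' 6 = un 0 \<and> ot m' = ot m @ snt \<and> rd m' 8 = (if send act = None then rd m 8 else tn) \<and>
  (\<forall>j. j \<notin> {inp, 2, D, 5, 6, 8, 9, 10} \<longrightarrow> j < off \<or> off + num_work N < j \<longrightarrow> tp m' j = tp m j)"
proof -
 have "0 \<notin> set (map sym \<rho>)" by (auto simp: sym_def)
 moreover have "D \<notin> {2, 5, 6}" using ix(2) by auto
 ultimately obtain B1 t5 where f: "run w [] (fetch D) B1 m (upd 5 t5 m)" "fst t5 (snd t5) = cells (map sym \<rho>) (1 + comm_pos cf)"
  using run_fetch[OF t(2) _ t(3,4)] by blast
 let ?m1 = "upd 5 t5 m"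
 let ?ext = "\<lambda>act c i m s. nop\<lparr>wr := [inp \<mapsto> (s inp, input_move act), 9 \<mapsto> (movecode (comm_move act), Stay),
     10 \<mapsto> (bitcode (send act), Stay)]\<rparr>"
 define ins where "ins = observe w [] ?m1 True (?ext act)"
 have act: "act = delta N (state cf) False (cell a (input_pos cf)) (cell \<rho> (comm_pos cf)) (map (\<lambda>(tp, i). tp i) (work cf))"
  by (simp add: act_def current_action_def)
 have sr: "simrel N off ?m1 cf" by (rule simrel_cong[OF N(3)]) (use ix in auto)
 have o1: "observe w [] ?m1 c (\<lambda>_ _ _ _. False) = False" for c by simp
 have "rd ?m1 inp = cells (map sym a) (1 + input_pos cf)" using t ix by (auto simp: rd_def)
 then have o2: "observe w [] ?m1 c (\<lambda>c i m s. bitcell (s inp)) = cell a (input_pos cf)" for c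
  by (simp add: bitcell_sym)
 have "rd ?m1 5 = cells (map sym \<rho>) (1 + comm_pos cf)" using f(2) by (simp add: rd_def)
 then have o3: "observe w [] ?m1 c (\<lambda>c i m s. bitcell (s 5)) = cell \<rho> (comm_pos cf)" for c
  by (simp add: bitcell_sym)
 have o4: "observe w [] ?m1 c (?ext act) = ins" for c by (simp add: ins_def)
 have "can_send [] ins ?m1" by (simp add: ins_def can_send_def)
 then obtain m2 where m2: "run w [] (simact N off (\<lambda>_ _ _ _. False) (\<lambda>c i m s. bitcell (s inp)) (\<lambda>c i m s. bitcell (s 5)) ?ext) 1 ?m1 m2"
  "simrel N off m2 (perform act cf)" "wfc N (perform act cf)"
  "\<And>j. j < off \<or> off + num_work N < j \<Longrightarrow> tp m2 j = tp (exec_instr [] ins ?m1) j"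
  "ot m2 = ot (exec_instr [] ins ?m1)"
  using run_simact[where w = w and coin = "\<lambda>_ _ _ _. False" and inp = "\<lambda>c i m s. bitcell (s inp)"
   and com = "\<lambda>c i m s. bitcell (s 5)" and ext = ?ext, OF N(1,2) sr act o1 o2 o3 o4] by blast
 have fr2: "tp m2 j = tp m j" if "j \<notin> {inp, 5, 9, 10}" "j < off \<or> off + num_work N < j" for j
  using m2(4)[OF that(2)] that(1) by (simp add: exec_instr_def ins_def)
 have i2: "tp m2 inp = (cells (map sym a), 1 + input_pos (perform act cf))"
  using m2(4)[of inp] ix t write_tape_rd[of ?m1 inp "input_move act"]
  by (auto simp: exec_instr_def ins_def perform_def)
 have r9: "rd m2 9 = movecode (comm_move act)"
  using m2(4)[of 9] ix by (auto simp: exec_instr_def ins_def rd_def write_tape_def)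
 have r10: "rd m2 10 = bitcode (send act)"
  using m2(4)[of 10] ix by (auto simp: exec_instr_def ins_def rd_def write_tape_def)
 have t2: "tp m2 2 = stk (map sym \<rho>)" "tp m2 D = signed (comm_pos cf)" "tp m2 6 = un 0" "tp m2 8 = tp m 8"
  using fr2[of 2] fr2[of D] fr2[of 6] fr2[of 8] ix t by auto
 have o2: "ot m2 = ot m" using m2(5) by (simp add: exec_instr_def ins_def)
 let ?m3 = "upd D (signed (comm_pos (perform act cf))) m2"
 have cp: "comm_pos (perform act cf) = comm_pos cf + offset (comm_move act)" by (simp add: perform_def)
 have r3: "run w [] (Cond (sees 9 1) (dec D) (Cond (sees 9 2) (inc D) skip)) 5 m2 ?m3"
 proof (cases "comm_move act")
  case MoveLeft
  have "run w [] (dec D) 3 m2 ?m3" using run_dec[OF t2(2)] by (simp add: cp MoveLeft)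
  then have "run w [] (dec D) 4 m2 ?m3" by (rule run_mono) simp
  then have "run w [] (Cond (sees 9 1) (dec D) (Cond (sees 9 2) (inc D) skip)) (Suc 4) m2 ?m3"
   by (intro run_CondT) (use r9 MoveLeft in \<open>auto simp: movecode_def\<close>)
  then show ?thesis by simp
 next
  case Stay
  have "?m3 = m2" using t2(2) by (simp add: cp Stay)
  then have "run w [] skip 1 m2 ?m3" using run_skip by simp
  then have "run w [] (Cond (sees 9 1) (dec D) (Cond (sees 9 2) (inc D) skip)) (Suc (Suc 1)) m2 ?m3"
   by (intro run_CondF) (use r9 Stay in \<open>auto simp: movecode_def\<close>)
  then show ?thesis by (rule run_mono) simp
 next
  case MoveRight
  have "run w [] (inc D) 3 m2 ?m3" using run_inc[OF t2(2)] by (simp add: cp MoveRight)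
  then have "run w [] (Cond (sees 9 1) (dec D) (Cond (sees 9 2) (inc D) skip)) (Suc (Suc 3)) m2 ?m3"
   by (intro run_CondF run_CondT) (use r9 MoveRight in \<open>auto simp: movecode_def\<close>)
  then show ?thesis by simp
 qed
 have r10': "rd ?m3 10 = bitcode (send act)" using r10 ix by (auto simp: rd_def)
 have m3: "tp ?m3 2 = stk (map sym \<rho>)" using t2 ix by auto
 show ?thesis
 proof (cases "send act")
  case None
  have "run w [] (Cond (nz 10) (pushf 2 (\<lambda>c i m s. s 10) ;; emitf (sees 10 2) ;; put 8 tn Stay) skip) (Suc 1) ?m3 ?m3"
   by (rule run_CondF[OF _ run_skip]) (use r10' None in \<open>simp add: bitcode_def\<close>)
  note r = run_Seq[OF f(1) run_Seq[OF m2(1) run_Seq[OF r3 this]]]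
  have "simrel N off ?m3 (perform act cf)" by (rule simrel_cong[OF m2(2)]) (use ix in auto)
  moreover have "tp ?m3 j = tp m j" if "j \<notin> {inp, 2, D, 5, 6, 8, 9, 10}" "j < off \<or> off + num_work N < j" for j
   using fr2[of j] that by auto
  moreover have "rd ?m3 8 = rd m 8" using t2(4) ix by (auto simp: rd_def)
  moreover have "tp ?m3 6 = un 0" "tp ?m3 inp = (cells (map sym a), 1 + input_pos (perform act cf))"
   using t2 i2 ix by auto
  ultimately show ?thesis unfolding stepm_def
   by (intro exI[of _ "B1 + (1 + (5 + Suc 1))"] exI[of _ ?m3])
     (use r m3 o2 m2(3) None in \<open>simp add: snt_def\<close>)
 next
  case (Some b)
  let ?m4 = "upd 2 (stk (map sym \<rho> @ [sym b])) ?m3"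
  let ?m5 = "?m4\<lparr>ot := ot ?m4 @ [b]\<rparr>"
  let ?m6 = "upd 8 (write_tape (tn, Stay) (tp ?m5 8)) ?m5"
  have "run w [] (pushf 2 (\<lambda>c i m s. s 10)) 2 ?m3 ?m4"
   by (rule run_pushf[OF m3]) (use r10' Some in \<open>simp add: bitcode_def rd_def\<close>)
  moreover have "run w [] (emitf (sees 10 2)) 1 ?m4 ?m5"
   by (rule run_emitf) (use r10' Some in \<open>simp_all add: bitcode_def rd_def\<close>)
  moreover have "run w [] (put 8 tn Stay) 1 ?m5 ?m6" by (rule run_put)
  ultimately have "run w [] (pushf 2 (\<lambda>c i m s. s 10) ;; emitf (sees 10 2) ;; put 8 tn Stay) (2 + (1 + 1)) ?m3 ?m6"
   by (intro run_Seq)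
  then have "run w [] (Cond (nz 10) (pushf 2 (\<lambda>c i m s. s 10) ;; emitf (sees 10 2) ;; put 8 tn Stay) skip)
    (Suc (2 + (1 + 1))) ?m3 ?m6"
   by (intro run_CondT) (use r10' Some in \<open>simp_all add: bitcode_def\<close>)
  note r = run_Seq[OF f(1) run_Seq[OF m2(1) run_Seq[OF r3 this]]]
  have "simrel N off ?m6 (perform act cf)" by (rule simrel_cong[OF m2(2)]) (use ix in auto)
  moreover have "tp ?m6 j = tp m j" if "j \<notin> {inp, 2, D, 5, 6, 8, 9, 10}" "j < off \<or> off + num_work N < j" for j
   using fr2[of j] that by auto
  moreover have "rd ?m6 8 = tn" by (simp add: rd_def write_tape_def)
  moreover have "tp ?m6 6 = un 0" "tp ?m6 inp = (cells (map sym a), 1 + input_pos (perform act cf))"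
   "tp ?m6 D = signed (comm_pos (perform act cf))" "tp ?m6 2 = stk (map sym (\<rho> @ [b]))"
   using t2 i2 ix by auto
  ultimately show ?thesis unfolding stepm_def
   by (intro exI[of _ "B1 + (1 + (5 + Suc (2 + (1 + 1))))"] exI[of _ ?m6])
     (use r o2 m2(3) Some in \<open>simp add: snt_def\<close>)
 qed
qed

abbreviation turn :: "tm \<Rightarrow> tm \<Rightarrow> prog" where
 "turn U V \<equiv> Cond (\<lambda>c i m s. s (12 + num_work U) = 1 \<or> s 8 = 0 \<and> s 11 \<noteq> 1) (stepm U 11 0 3 1) (stepm V (12 + num_work U) 1 4 0)"

abbreviation turns :: "tm \<Rightarrow> tm \<Rightarrow> prog" where
 "turns U V \<equiv> Loop (\<lambda>c i m s. s 11 \<noteq> 1 \<or> s (12 + num_work U) \<noteq> 1) (turn U V)"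

text \<open>A single program describes both inputs: \<open>length a\<close> in self-delimiting form,
  then \<open>a\<close>, then \<open>b\<close>. Its bits are read with stride 2, since
  \<open>encode_pair\<close> puts \<open>False\<close> in front of each. Bits are emitted when they
  are sent, so the output is the transcript.\<close>

definition joint :: "tm \<Rightarrow> tm \<Rightarrow> prog" where
 "joint U V = (let o2 = 12 + num_work U in imove MoveRight ;; num 2 7 6 ;; readbits 2 7 0 ;;
   Loop moreinput (pushf 1 bitsym ;; adv 2) ;; rewind 0 ;; rewind 1 ;;
   Loop (\<lambda>c i m s. s 11 \<noteq> 1 \<or> s o2 \<noteq> 1)
    (Cond (\<lambda>c i m s. s o2 = 1 \<or> s 8 = 0 \<and> s 11 \<noteq> 1) (stepm U 11 0 3 1) (stepm V o2 1 4 0)))"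

definition joint_tm :: "tm \<Rightarrow> tm \<Rightarrow> tm" where
 "joint_tm U V = compile (num_work U + num_work V + 13)
   (num_states U + num_symbols U + num_states V + num_symbols V + 5) (joint U V)"

lemma okp_fetch: "2 < S \<Longrightarrow> 10 < k \<Longrightarrow> D < k \<Longrightarrow> okp k S (fetch D)" by (auto simp: fetch_def)

lemma okp_stepm:
 assumes "off + num_work N < k" "num_states N < S" "Suc (num_symbols N) < S" "4 < S" "tn < 2" "inp < 2" "D < 5" "10 < k"
 shows "okp k S (stepm N off inp D tn)"
proof -
 have "movecode mv < S" "bitcode b < S" for mv b
  using assms(4) code_less(1)[of mv] code_less(2)[of b] by linarith+
 then have "okp k S (simact N off (\<lambda>_ _ _ _. False) (\<lambda>c i m s. bitcell (s inp)) (\<lambda>c i m s. bitcell (s 5))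
    (\<lambda>act c i m s. nop\<lparr>wr := [inp \<mapsto> (s inp, input_move act), 9 \<mapsto> (movecode (comm_move act), Stay),
     10 \<mapsto> (bitcode (send act), Stay)]\<rparr>))"
  using assms by (intro okp_simact) (auto split: if_splits)
 then show ?thesis using assms okp_fetch[of S k D] by (auto simp: stepm_def)
qed

lemma wf_joint: "wf_tm (joint_tm U V)" "deterministic (joint_tm U V)"
proof -
 have "okp (num_work U + num_work V + 13) (num_states U + num_symbols U + num_states V + num_symbols V + 5) (joint U V)"
  by (auto simp: joint_def Let_def sym_def intro!: okp_stepm)
 then show "wf_tm (joint_tm U V)" unfolding joint_tm_def by (rule wf_compile) simp
 have "coinless (joint U V)" by (simp add: joint_def Let_def stepm_def fetch_def)
 then show "deterministic (joint_tm U V)" unfolding joint_tm_def by (rule deterministic_compile)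
qed

definition jrel :: "tm \<Rightarrow> tm \<Rightarrow> bits \<Rightarrow> bits \<Rightarrow> joint_conf \<Rightarrow> mem \<Rightarrow> bool" where
 "jrel U V a b = (\<lambda>(f, \<rho>, u, v) m. wfc U u \<and> simrel U 11 m u \<and> wfc V v \<and> simrel V (12 + num_work U) m v \<and>
   tp m 0 = (cells (map sym a), 1 + input_pos u) \<and> tp m 1 = (cells (map sym b), 1 + input_pos v) \<and>
   tp m 2 = stk (map sym \<rho>) \<and> tp m 3 = signed (comm_pos u) \<and> tp m 4 = signed (comm_pos v) \<and>
   tp m 6 = un 0 \<and> rd m 8 = (if f then 0 else 1) \<and> ot m = \<rho>)"

abbreviation no_coins :: "nat \<Rightarrow> bool" where
 "no_coins \<equiv> \<lambda>_. False"

lemma jrel_step: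
 assumes UV: "wf_tm U" "wf_tm V" and J: "jrel U V a b (f, \<rho>, u, v) m" and nh: "\<not> (halted u \<and> halted v)"
  and moved: "joint_step U V a b no_coins no_coins (f, \<rho>, u, v) = c'" "c' \<noteq> (f, \<rho>, u, v)"
 shows "\<exists>B m'. run w [] (turn U V) B m m' \<and> jrel U V a b c' m'"
proof -
 note R = J[unfolded jrel_def prod.case]
 have hu: "rd m 11 = 1 \<longleftrightarrow> halted u" and hv: "rd m (12 + num_work U) = 1 \<longleftrightarrow> halted v"
  using R by (auto simp: simrel_def halted_def)
 show ?thesis
 proof (cases "halted v \<or> (f \<and> \<not> halted u)")
  case True
  let ?act = "current_action U no_coins a \<rho> u"
  let ?snt = "case send ?act of None \<Rightarrow> [] | Some b \<Rightarrow> [b]"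
  obtain B m' where r: "run w [] (stepm U 11 0 3 1) B m m'"
   and m': "simrel U 11 m' (perform ?act u)" "wfc U (perform ?act u)"
    "tp m' 0 = (cells (map sym a), 1 + input_pos (perform ?act u))"
    "tp m' 3 = signed (comm_pos (perform ?act u))" "tp m' 2 = stk (map sym (\<rho> @ ?snt))"
    "tp m' 6 = un 0" "ot m' = ot m @ ?snt" "rd m' 8 = (if send ?act = None then rd m 8 else 1)"
    and fr: "\<And>j. j \<notin> {0, 2, 3, 5, 6, 8, 9, 10} \<Longrightarrow> j < 11 \<or> 11 + num_work U < j \<Longrightarrow> tp m' j = tp m j"
   using run_stepm[of U u 11 m 0 a \<rho> 3 w 1] UV R by auto
  have "run w [] (turn U V) (Suc B) m m'" by (rule run_CondT[OF _ r]) (use True hu hv R in auto)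
  moreover have "simrel V (12 + num_work U) m' v"
   by (rule simrel_cong[of V "12 + num_work U" m]) (use R fr in auto)
  moreover have "tp m' 1 = tp m 1" "tp m' 4 = tp m 4" using fr by auto
  moreover have "c' = (if send ?act = None then f else False, \<rho> @ ?snt, perform ?act u, v)"
   using moved True nh by (auto simp: Let_def split: option.splits if_splits)
  ultimately show ?thesis using m' R by (intro exI[of _ "Suc B"] exI[of _ m']) (auto simp: jrel_def)
 next
  case False
  let ?act = "current_action V no_coins b \<rho> v"
  let ?snt = "case send ?act of None \<Rightarrow> [] | Some b \<Rightarrow> [b]"
  obtain B m' where r: "run w [] (stepm V (12 + num_work U) 1 4 0) B m m'"
   and m': "simrel V (12 + num_work U) m' (perform ?act v)" "wfc V (perform ?act v)"
    "tp m' 1 = (cells (map sym b), 1 + input_pos (perform ?act v))"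
    "tp m' 4 = signed (comm_pos (perform ?act v))" "tp m' 2 = stk (map sym (\<rho> @ ?snt))"
    "tp m' 6 = un 0" "ot m' = ot m @ ?snt" "rd m' 8 = (if send ?act = None then rd m 8 else 0)"
    and fr: "\<And>j. j \<notin> {1, 2, 4, 5, 6, 8, 9, 10} \<Longrightarrow> j < 12 + num_work U \<or> 12 + num_work U + num_work V < j \<Longrightarrow> tp m' j = tp m j"
   using run_stepm[of V v "12 + num_work U" m 1 b \<rho> 4 w 0] UV R by auto
  have "run w [] (turn U V) (Suc B) m m'" by (rule run_CondF[OF _ r]) (use False hu hv R in auto)
  moreover have "simrel U 11 m' u" by (rule simrel_cong[of U 11 m]) (use R fr in auto)
  moreover have "tp m' 0 = tp m 0" "tp m' 3 = tp m 3" using fr by auto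
  moreover have "c' = (if send ?act = None then f else True, \<rho> @ ?snt, u, perform ?act v)"
   using moved False nh by (auto simp: Let_def split: option.splits if_splits)
  ultimately show ?thesis using m' R by (intro exI[of _ "Suc B"] exI[of _ m']) (auto simp: jrel_def)
 qed
qed

lemma jrel_loop:
 assumes UV: "wf_tm U" "wf_tm V"
  and "(joint_step U V a b no_coins no_coins ^^ k) (f, \<rho>, u, v) = (f', \<pi>, u', v')" "halted u'" "halted v'"
  and "jrel U V a b (f, \<rho>, u, v) m"
 shows "\<exists>B m'. run w [] (turns U V) B m m' \<and> ot m' = \<pi>" using assms(3-)
proof (induction k arbitrary: f \<rho> u v m)
 have hu: "rd m 11 = 1 \<longleftrightarrow> halted u" and hv: "rd m (12 + num_work U) = 1 \<longleftrightarrow> halted v"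
  if "jrel U V a b (f, \<rho>, u, v) m" for f \<rho> u v m
  using that by (auto simp: simrel_def halted_def jrel_def)
 {
  case 0
  then have "run w [] (turns U V) 1 m m" by (intro run_LoopF) (use hu hv in auto)
  moreover have "ot m = \<pi>" using 0 by (auto simp: jrel_def)
  ultimately show ?case by blast
 next
  case (Suc k)
  let ?J = "joint_step U V a b no_coins no_coins"
  have rest: "(?J ^^ k) (?J (f, \<rho>, u, v)) = (f', \<pi>, u', v')"
   using Suc.prems(1) by (simp add: funpow_swap1)
  show ?case
  proof (cases "?J (f, \<rho>, u, v) = (f, \<rho>, u, v)")
   case True
   then show ?thesis using Suc.IH[OF _ Suc.prems(2-4)] rest by simp
  next
   case False
   then have nh: "\<not> (halted u \<and> halted v)" by auto
   obtain f1 \<rho>1 u1 v1 where c: "?J (f, \<rho>, u, v) = (f1, \<rho>1, u1, v1)" by (metis surj_pair)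
   obtain B m1 where 1: "run w [] (turn U V) B m m1" "jrel U V a b (f1, \<rho>1, u1, v1) m1"
    using jrel_step[OF UV Suc.prems(4) nh c] False c by (metis (no_types, lifting))
   from Suc.IH[OF _ Suc.prems(2,3) 1(2)] rest c obtain B' m' where
    2: "run w [] (turns U V) B' m1 m'" "ot m' = \<pi>" by (metis (no_types, lifting))
   have "run w [] (turns U V) (Suc (B + B')) m m'"
    by (rule run_LoopT[OF _ 1(1) 2(1)]) (use nh hu[OF Suc.prems(4)] hv[OF Suc.prems(4)] in auto)
   then show ?thesis using 2(2) by blast
  qed
 }
qed

lemma run_readall:
 assumes "tp m v = stk zs" "d = 1 \<or> d = 2" "inpseq w d (pin m) ys" "cell w (pin m + int (d * length ys)) = None"
 shows "run w \<pi> (Loop moreinput (pushf v bitsym ;; adv d)) (5 * length ys + 1) m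
  (m\<lparr>pin := pin m + int (d * length ys), tp := (tp m)(v := stk (zs @ map sym ys))\<rparr>)"
proof -
 let ?M = "\<lambda>i. m\<lparr>pin := pin m + int (d * i), tp := (tp m)(v := stk (zs @ map sym (take i ys)))\<rparr>"
 have "run w \<pi> (Loop moreinput (pushf v bitsym ;; adv d)) (length ys * Suc (2 + 2) + 1) m (?M (length ys))"
 proof (rule run_for[where M = ?M])
  show "m = ?M 0" using assms(1) by (cases m) (auto simp: fun_eq_iff)
  fix i assume i: "i < length ys"
  have c: "cell w (pin m + int (d * i)) = Some (ys ! i)" using inpseq_nth[OF assms(3) i] .
  then show "observe w \<pi> (?M i) c' moreinput" for c' by simp
  let ?b = "upd v (stk ((zs @ map sym (take i ys)) @ [sym (ys ! i)])) (?M i)"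
  have 1: "run w \<pi> (pushf v bitsym) 2 (?M i) ?b" by (rule run_pushf) (use c in simp_all)
  have "?b\<lparr>pin := pin ?b + int d\<rparr> = ?M (Suc i)"
   using i by (auto simp: take_Suc_conv_app_nth algebra_simps fun_eq_iff)
  with run_adv[OF assms(2), of w \<pi> ?b] have 2: "run w \<pi> (adv d) 2 ?b (?M (Suc i))" by simp
  show "run w \<pi> (pushf v bitsym ;; adv d) (2 + 2) (?M i) (?M (Suc i))" by (rule run_Seq[OF 1 2])
 qed (use assms(4) in auto)
 from run_mono[OF this, of "5 * length ys + 1"] show ?thesis by simp
qed

lemma computes_joint:
 assumes UV: "wf_tm U" "wf_tm V" and I: "interaction U V a b no_coins no_coins T (\<pi>, x, y)"
 shows "computes (joint_tm U V) (encode_pair (numcode (length a) @ a @ b) []) \<pi>"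
proof -
 let ?p = "numcode (length a) @ a @ b"
 let ?w = "encode_pair ?p []"
 have inp: "inpseq ?w 2 1 (numcode (length a))" "inpseq ?w 2 (1 + int (2 * length (numcode (length a)))) a"
  "inpseq ?w 2 (1 + int (2 * length (numcode (length a))) + int (2 * length a)) b"
  using inpseq_encode_pair[of ?p "[]"] by (auto simp: inpseq_append)
 define h where "h = 1 + int (2 * length (numcode (length a)))"
 have st: "pin (start 0) = 0" "ot (start 0) = []" "tp (start 0) = (\<lambda>_. un 0)" "pcom (start 0) = 0"
  by (auto simp: start_def un_0 stk_Nil)
 have r0: "run ?w [] (imove MoveRight) 1 (start 0) (start 0\<lparr>pin := 1\<rparr>)"
  using run_imove[of ?w "[]" MoveRight "start 0"] by (simp add: st)
 let ?m1 = "start 0\<lparr>pin := h, tp := (\<lambda>_. un 0)(7 := un (length a))\<rparr>"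
 have r1: "run ?w [] (num 2 7 6) (14 * length a + 6 * length (numcode (length a))) (start 0\<lparr>pin := 1\<rparr>) ?m1"
  using run_num[of "start 0\<lparr>pin := 1\<rparr>" 7 6 2 ?w "length a" "[]"] inp(1) by (simp add: st h_def)
 let ?m2 = "start 0\<lparr>pin := h + int (2 * length a), tp := (\<lambda>_. un 0)(0 := stk (map sym a))\<rparr>"
 have "run ?w [] (readbits 2 7 0) (6 * length a + 1) ?m1
  (?m1\<lparr>pin := pin ?m1 + int (2 * length a), tp := (tp ?m1)(7 := un 0, 0 := stk ([] @ map sym a))\<rparr>)"
  by (rule run_readbits) (use inp(2) in \<open>auto simp: h_def un_0\<close>)
 then have r2: "run ?w [] (readbits 2 7 0) (6 * length a + 1) ?m1 ?m2"
  by (rule back_subst[of "run ?w [] _ _ _"]) (auto simp: fun_eq_iff)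
 let ?m3 = "?m2\<lparr>pin := pin ?m2 + int (2 * length b), tp := (tp ?m2)(1 := stk ([] @ map sym b))\<rparr>"
 have r3: "run ?w [] (Loop moreinput (pushf 1 bitsym ;; adv 2)) (5 * length b + 1) ?m2 ?m3"
 proof (rule run_readall)
  show "inpseq ?w 2 (pin ?m2) b" using inp(3) by (simp add: h_def)
  show "cell ?w (pin ?m2 + int (2 * length b)) = None"
   using cell_encode_pair(4)[of ?p "[]" 0] by (simp add: h_def cell_def algebra_simps)
 qed (auto simp: un_0)
 have z: "0 \<notin> set (map sym ys)" for ys by (auto simp: sym_def)
 let ?m4 = "upd 0 (cells (map sym a), 1) ?m3"
 have r4: "run ?w [] (rewind 0) (2 * length a + 2) ?m3 ?m4"
  using run_rewind[of ?m3 0 "map sym a" "int (length a)" ?w "[]"] z by (simp add: stk_def)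
 let ?m5 = "upd 1 (cells (map sym b), 1) ?m4"
 have r5: "run ?w [] (rewind 1) (2 * length b + 2) ?m4 ?m5"
  using run_rewind[of ?m4 1 "map sym b" "int (length b)" ?w "[]"] z by (simp add: stk_def)
 have J: "jrel U V a b (True, [], init_conf U, init_conf V) ?m5"
 proof -
  have "simrel U 11 ?m5 (init_conf U)" "simrel V (12 + num_work U) ?m5 (init_conf V)"
   by (rule simrel_init; auto simp: un_0 stk_Nil)+
  then show ?thesis using wfc_init UV st
   by (auto simp: jrel_def init_conf_def signed_0 un_0 rd_def stk_Nil)
 qed
 from I obtain k f u v where
  k: "(joint_step U V a b no_coins no_coins ^^ k) (True, [], init_conf U, init_conf V) = (f, \<pi>, u, v)"
  "halted u" "halted v" by auto
 from jrel_loop[OF UV k J, of ?w] obtain B m' where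
  r6: "run ?w [] (turns U V) B ?m5 m'" and o: "ot m' = \<pi>" by blast
 have ok: "okp (num_work U + num_work V + 13) (num_states U + num_symbols U + num_states V + num_symbols V + 5) (joint U V)"
  by (auto simp: joint_def Let_def sym_def intro!: okp_stepm)
 note R = run_Seq[OF r0 run_Seq[OF r1 run_Seq[OF r2 run_Seq[OF r3 run_Seq[OF r4 run_Seq[OF r5 r6]]]]]]
 obtain t where "exec ?w [] no_coins (joint U V) t (start 0) m'"
  using run_exec[OF R, of no_coins] unfolding joint_def Let_def by blast
 from exec_runs[where coins = no_coins, OF this ok _ order_refl] o
 show ?thesis unfolding computes_def joint_tm_def by (intro exI) simp
qed

section \<open>The attacker as a randomized machine\<close>

section \<open>Clocked randomized machines\<close>

lemma cell_Nil [simp]: "cell [] p = None" by (simp add: cell_def)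

lemma exec_coinless:
 "exec w \<pi> c p t m m' \<Longrightarrow> coinless p \<Longrightarrow> exec w \<pi> c' p t m m'"
proof (induction arbitrary: c' rule: exec.induct)
 case (exec_Act m c f)
 then have "f (c 0) = f (c' 0)" by (cases "c 0"; cases "c' 0") auto
 with exec_Act show ?case using exec.exec_Act[of \<pi> f c' w m] by simp
next
 case (exec_CondT m c C p t m1 q)
 then have "C (c 0) = C (c' 0)" by (cases "c 0"; cases "c' 0") auto
 with exec_CondT show ?case by (intro exec.exec_CondT) auto
next
 case (exec_CondF m c C q t m1 p)
 then have "C (c 0) = C (c' 0)" by (cases "c 0"; cases "c' 0") auto
 with exec_CondF show ?case by (intro exec.exec_CondF) auto
next
 case (exec_LoopF m c C p)
 then have "C (c 0) = C (c' 0)" by (cases "c 0"; cases "c' 0") auto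
 with exec_LoopF show ?case by (intro exec.exec_LoopF) auto
next
 case (exec_LoopT m c C p t1 m1 t2 m2)
 then have "C (c 0) = C (c' 0)" by (cases "c 0"; cases "c' 0") auto
 with exec_LoopT show ?case by (intro exec.exec_LoopT) auto
qed (auto intro: exec.intros)

text \<open>Which coin is read depends on the time, so the time that passes before a coin has to be
  known exactly; for straight-line programs it is the size.\<close>

primrec straight :: "prog \<Rightarrow> bool" where
 "straight (Act f) \<longleftrightarrow> True"
| "straight (p ;; q) \<longleftrightarrow> straight p \<and> straight q"
| "straight (Cond C p q) \<longleftrightarrow> False"
| "straight (Loop C p) \<longleftrightarrow> False"

lemma exec_straight: "exec w \<pi> c p t m m' \<Longrightarrow> straight p \<Longrightarrow> t = psize p"
 by (induction rule: exec.induct) auto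

lemma run_straight: "run w \<pi> p B m m' \<Longrightarrow> straight p \<Longrightarrow> exec w \<pi> c p (psize p) m m'"
 unfolding run_def using exec_straight by metis

subsection \<open>Building a polynomially long clock\<close>

definition rewind_input :: prog where
 "rewind_input = imove MoveLeft ;; Loop moreinput (imove MoveLeft) ;; imove MoveRight"

lemma run_rewind_input:
 assumes "pin m = int (length w)"
 shows "run w \<pi> rewind_input (2 * length w + 3) m (m\<lparr>pin := 0\<rparr>)"
proof -
 have 1: "run w \<pi> (imove MoveLeft) 1 m (m\<lparr>pin := int (length w) - 1\<rparr>)"
  using run_imove[of w \<pi> MoveLeft m] assms by simp
 let ?M = "\<lambda>i. m\<lparr>pin := int (length w) - 1 - int i\<rparr>"
 have 2: "run w \<pi> (Loop moreinput (imove MoveLeft)) (length w * Suc 1 + 1) (m\<lparr>pin := int (length w) - 1\<rparr>) (m\<lparr>pin := -1\<rparr>)"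
 proof (rule run_for[where M = ?M])
  show "run w \<pi> (imove MoveLeft) 1 (?M i) (?M (Suc i))" for i
   using run_imove[of w \<pi> MoveLeft "?M i"] by (simp add: algebra_simps)
 qed (auto simp: cell_def)
 have 3: "run w \<pi> (imove MoveRight) 1 (m\<lparr>pin := -1\<rparr>) (m\<lparr>pin := 0\<rparr>)"
  using run_imove[of w \<pi> MoveRight "m\<lparr>pin := -1\<rparr>"] by simp
 show ?thesis unfolding rewind_input_def by (rule run_mono[OF run_Seq[OF 1 run_Seq[OF 2 3]]]) simp
qed

definition mult_input :: prog where
 "mult_input = Loop (nz 1) (pop 1 ;; Loop moreinput (push 2 1 ;; imove MoveRight) ;; rewind_input) ;;
   Loop (nz 2) (pop 2 ;; push 1 1)"

lemma run_mult_input: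
 assumes "tp m 1 = un n" "tp m 2 = un 0" "pin m = 0"
 shows "run w \<pi> mult_input (n * (10 * length w + 10) + 2) m (upd 1 (un (n * length w)) m)"
proof -
 let ?l = "length w"
 let ?M = "\<lambda>i. m\<lparr>tp := (tp m)(1 := un (n - i), 2 := un (i * ?l))\<rparr>"
 have 1: "run w \<pi> (Loop (nz 1) (pop 1 ;; Loop moreinput (push 2 1 ;; imove MoveRight) ;; rewind_input))
   (n * ((?l * Suc (2 + 1) + 1 + (2 * ?l + 3)) + 2) + 1) m (?M n)"
 proof (rule run_countdown[where M = ?M])
  fix i assume "i < n"
  let ?a = "upd 1 (un (n - Suc i)) (?M i)"
  let ?N = "\<lambda>j. m\<lparr>pin := int j, tp := (tp m)(1 := un (n - Suc i), 2 := un (i * ?l + j))\<rparr>"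
  have a: "run w \<pi> (Loop moreinput (push 2 1 ;; imove MoveRight)) (?l * Suc (2 + 1) + 1) ?a (?N ?l)"
  proof (rule run_for[where M = ?N])
   show "?a = ?N 0" using assms by (cases m) (auto simp: fun_eq_iff)
   fix j
   let ?b = "upd 2 (un (Suc (i * ?l + j))) (?N j)"
   have x: "run w \<pi> (push 2 1) 2 (?N j) ?b" by (rule run_push_un) simp
   have y: "run w \<pi> (imove MoveRight) 1 ?b (?N (Suc j))"
    using run_imove[of w \<pi> MoveRight ?b] by (simp add: algebra_simps)
   show "run w \<pi> (push 2 1 ;; imove MoveRight) (2 + 1) (?N j) (?N (Suc j))" by (rule run_Seq[OF x y])
  qed (auto simp: cell_def)
  have b: "run w \<pi> rewind_input (2 * ?l + 3) (?N ?l) (?M (Suc i))"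
  proof -
   have "?N ?l\<lparr>pin := 0\<rparr> = ?M (Suc i)" using assms(3) by (cases m) (auto simp: fun_eq_iff add.commute)
   with run_rewind_input[of "?N ?l" w \<pi>] show ?thesis by simp
  qed
  show "run w \<pi> (Loop moreinput (push 2 1 ;; imove MoveRight) ;; rewind_input)
   (?l * Suc (2 + 1) + 1 + (2 * ?l + 3)) ?a (?M (Suc i))" by (rule run_Seq[OF a b])
 qed (use assms in \<open>cases m, auto simp: fun_eq_iff\<close>)
 let ?N = "\<lambda>i. m\<lparr>tp := (tp m)(1 := un i, 2 := un (n * ?l - i))\<rparr>"
 have 2: "run w \<pi> (Loop (nz 2) (pop 2 ;; push 1 1)) (n * ?l * (2 + 2) + 1) (?M n) (upd 1 (un (n * ?l)) m)"
 proof (rule run_countdown[where M = ?N])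
  fix i
  let ?a = "upd 2 (un (n * ?l - Suc i)) (?N i)"
  have "run w \<pi> (push 1 1) 2 ?a (upd 1 (un (Suc i)) ?a)" by (rule run_push_un) simp
  moreover have "upd 1 (un (Suc i)) ?a = ?N (Suc i)" by (auto simp: fun_eq_iff)
  ultimately show "run w \<pi> (push 1 1) 2 ?a (?N (Suc i))" by simp
 qed (use assms in \<open>cases m, auto simp: fun_eq_iff\<close>)
 show ?thesis unfolding mult_input_def by (rule run_mono[OF run_Seq[OF 1 2]]) (simp add: algebra_simps)
qed

primrec power_input :: "nat \<Rightarrow> prog" where
 "power_input 0 = push 1 1"
| "power_input (Suc d) = power_input d ;; mult_input"

lemma run_power_input:
 assumes "tp m 1 = un 0" "tp m 2 = un 0" "pin m = 0"
 shows "run w \<pi> (power_input d) (Suc d * ((length w + 1) ^ Suc d * 10 + 2)) m (upd 1 (un (length w ^ d)) m)"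
proof (induction d)
 case 0
 have "run w \<pi> (push 1 1) 2 m (upd 1 (un (Suc 0)) m)" by (rule run_push_un) (use assms in simp)
 then have "run w \<pi> (push 1 1) (Suc 0 * ((length w + 1) ^ Suc 0 * 10 + 2)) m (upd 1 (un (Suc 0)) m)"
  by (rule run_mono) simp
 then show ?case by (simp only: power_input.simps power_0 One_nat_def)
next
 case (Suc d)
 let ?l = "length w"
 have "run w \<pi> mult_input (?l ^ d * (10 * ?l + 10) + 2) (upd 1 (un (?l ^ d)) m) (upd 1 (un (?l ^ Suc d)) m)"
  using run_mult_input[of "upd 1 (un (?l ^ d)) m" "?l ^ d" w \<pi>] assms by (simp add: mult.commute)
 from run_Seq[OF Suc this] have r: "run w \<pi> (power_input (Suc d))
  (Suc d * ((?l + 1) ^ Suc d * 10 + 2) + (?l ^ d * (10 * ?l + 10) + 2)) m (upd 1 (un (?l ^ Suc d)) m)"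
  by simp
 have "?l ^ d * (10 * ?l + 10) \<le> (?l + 1) ^ d * (10 * ?l + 10)"
  by (intro mult_le_mono1 power_mono) auto
 also have "\<dots> = (?l + 1) ^ Suc d * 10" by (simp add: algebra_simps)
 finally have a: "?l ^ d * (10 * ?l + 10) \<le> (?l + 1) ^ Suc d * 10" .
 have b: "(?l + 1) ^ Suc d \<le> (?l + 1) ^ Suc (Suc d)" by (intro power_increasing) auto
 have "Suc d * ((?l + 1) ^ Suc d * 10 + 2) + (?l ^ d * (10 * ?l + 10) + 2)
  \<le> Suc d * ((?l + 1) ^ Suc (Suc d) * 10 + 2) + ((?l + 1) ^ Suc (Suc d) * 10 + 2)"
  using a b by (intro add_mono mult_le_mono2) auto
 also have "\<dots> = Suc (Suc d) * ((?l + 1) ^ Suc (Suc d) * 10 + 2)" by simp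
 finally show ?case using r by (rule run_mono[rotated])
qed

subsection \<open>Writing down coins\<close>

text \<open>Every coin is preceded by the symbol of \<open>False\<close>, which makes the tape the
  beginning of an \<open>encode_pair\<close>.\<close>

definition dump_coin :: prog where
 "dump_coin = (pop 1 ;; push 0 1 ;; go 0 MoveRight) ;; putf 0 (\<lambda>c i m s. sym c) Stay"

lemma exec_dump_coins:
 assumes "tp m 0 = stk zs" "tp m 1 = un n"
 shows "exec w \<pi> c (Loop (nz 1) dump_coin) (6 * n + 1) m
  (m\<lparr>tp := (tp m)(0 := stk (zs @ concat (map (\<lambda>j. [1, sym (c (6 * j + 5))]) [0..<n])), 1 := un 0)\<rparr>)"
 using assms
proof (induction n arbitrary: m zs c)
 case 0
 have "exec w \<pi> c (Loop (nz 1) dump_coin) 1 m m" by (rule exec_LoopF) (use rd_un[OF 0(2)] in simp)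
 then show ?case using 0 by (simp add: fun_upd_idem)
next
 case (Suc n)
 let ?m2 = "upd 1 (un n) m"
 let ?m3 = "upd 0 (stk (zs @ [1])) ?m2"
 let ?m4 = "upd 0 (cells (zs @ [1]), int (length (zs @ [1])) + 1) ?m3"
 let ?m5 = "upd 0 (stk ((zs @ [1]) @ [sym (c 5)])) ?m4"
 have "run w \<pi> (pop 1) 1 m ?m2" by (rule run_pop_un[OF Suc.prems(2)])
 moreover have "run w \<pi> (push 0 1) 2 ?m2 ?m3" by (rule run_push) (use Suc.prems in simp)
 moreover have "run w \<pi> (go 0 MoveRight) 1 ?m3 ?m4"
  using run_go[of ?m3 0 "cells (zs @ [1])" "int (length (zs @ [1]))" w \<pi> MoveRight] by (simp add: stk_def)
 ultimately have r: "run w \<pi> (pop 1 ;; push 0 1 ;; go 0 MoveRight) (1 + (2 + 1)) m ?m4"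
  by (intro run_Seq)
 have s: "straight (pop 1 ;; push 0 1 ;; go 0 MoveRight)"
  "psize (pop 1 ;; push 0 1 ;; go 0 MoveRight) = 4"
  by (simp_all add: pop_def push_def pushf_def put_def putf_def go_def)
 have a: "exec w \<pi> (\<lambda>n. c (Suc n)) (pop 1 ;; push 0 1 ;; go 0 MoveRight) 4 m ?m4"
  using run_straight[OF r s(1)] s(2) by simp
 have b: "exec w \<pi> (\<lambda>n. c (Suc (4 + n))) (putf 0 (\<lambda>c i m s. sym c) Stay) 1 ?m4 ?m5"
 proof -
  have "exec_instr \<pi> (nop\<lparr>wr := [0 \<mapsto> (sym (c 5), Stay)]\<rparr>) ?m4 = ?m5"
   unfolding exec_instr_wr write_tape_def using cells_append[of "zs @ [1]" "sym (c 5)"]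
   by (simp add: stk_def ac_simps)
  then show ?thesis unfolding putf_def
   using exec_Act[of \<pi> "\<lambda>c i m s. nop\<lparr>wr := [0 \<mapsto> (sym c, Stay)]\<rparr>" "\<lambda>n. c (Suc (4 + n))" w ?m4]
   by (simp add: can_send_def)
 qed
 have body: "exec w \<pi> (\<lambda>n. c (Suc n)) dump_coin 5 m ?m5"
  using exec_Seq[OF a b] by (simp add: dump_coin_def)
 have rest: "exec w \<pi> (\<lambda>n. c (Suc (5 + n))) (Loop (nz 1) dump_coin) (6 * n + 1) ?m5
  (?m5\<lparr>tp := (tp ?m5)(0 := stk (((zs @ [1]) @ [sym (c 5)]) @ concat (map (\<lambda>j. [1, sym (c (Suc (5 + (6 * j + 5))))]) [0..<n])), 1 := un 0)\<rparr>)"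
  by (rule Suc.IH) simp_all
 have cc: "concat (map (\<lambda>j. [1, sym (c (6 * j + 5))]) [0..<Suc n])
  = [1, sym (c 5)] @ concat (map (\<lambda>j. [1, sym (c (Suc (5 + (6 * j + 5))))]) [0..<n])"
  by (simp add: upt_conv_Cons map_Suc_upt[symmetric] o_def del: upt_Suc)
 have "exec w \<pi> c (Loop (nz 1) dump_coin) (Suc (5 + (6 * n + 1))) m
  (?m5\<lparr>tp := (tp ?m5)(0 := stk (((zs @ [1]) @ [sym (c 5)]) @ concat (map (\<lambda>j. [1, sym (c (Suc (5 + (6 * j + 5))))]) [0..<n])), 1 := un 0)\<rparr>)"
  by (rule exec_LoopT[OF _ body rest]) (use rd_un[OF Suc.prems(2)] in simp)
 moreover have "(?m5\<lparr>tp := (tp ?m5)(0 := stk (((zs @ [1]) @ [sym (c 5)]) @ concat (map (\<lambda>j. [1, sym (c (Suc (5 + (6 * j + 5))))]) [0..<n])), 1 := un 0)\<rparr>)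
  = m\<lparr>tp := (tp m)(0 := stk (zs @ concat (map (\<lambda>j. [1, sym (c (6 * j + 5))]) [0..<Suc n])), 1 := un 0)\<rparr>"
  unfolding cc by (auto simp: fun_eq_iff)
 moreover have "Suc (5 + (6 * n + 1)) = 6 * Suc n + 1" by simp
 ultimately show ?case by (simp only:)
qed

subsection \<open>Simulation against a clock\<close>

text \<open>\<open>ppt\<close> demands a time bound for all coins, but the simulated machine will be
  known to be fast on some only; tape 1 is the clock that stops the other runs.\<close>

definition simclocked :: "tm \<Rightarrow> prog" where
 "simclocked N = Loop (\<lambda>c i m s. s 3 \<noteq> 1 \<and> s 1 \<noteq> 0)
   (simact N 3 (\<lambda>_ _ _ _. False) (\<lambda>c i m s. bitcell (s 0)) (\<lambda>_ _ _ _. None)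
    (\<lambda>act c i m s. \<lparr>mv_in = Stay, mv_com = Stay, wr = [0 \<mapsto> (s 0, input_move act), 1 \<mapsto> (0, MoveLeft)],
     em = emit act, sd = None\<rparr>))"

lemma run_simclocked:
 assumes N: "wf_tm N"
 shows "wfc N cf \<Longrightarrow> simrel N 3 m cf \<Longrightarrow> tp m 0 = (cells (map sym inp), 1 + input_pos cf) \<Longrightarrow>
  tp m 1 = un q \<Longrightarrow> ot m = out_tape cf \<Longrightarrow> \<exists>m'. run w [] (simclocked N) (2 * q + 1) m m' \<and>
   (\<forall>t\<le>q. halted ((solo_step N no_coins inp ^^ t) cf) \<longrightarrow> ot m' = out_tape ((solo_step N no_coins inp ^^ t) cf))"
proof (induction q arbitrary: m cf)
 case 0
 have "run w [] (simclocked N) 1 m m" unfolding simclocked_def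
  by (rule run_LoopF) (use rd_un[OF 0(4)] in simp)
 then show ?case using 0 by (intro exI[of _ m]) auto
next
 case (Suc q)
 have h: "rd m 3 = 1 \<longleftrightarrow> halted cf" using Suc.prems by (simp add: simrel_def halted_def)
 show ?case
 proof (cases "halted cf")
  case True
  have "run w [] (simclocked N) (2 * Suc q + 1) m m" unfolding simclocked_def
   by (rule run_mono[OF run_LoopF]) (use True h in auto)
  then show ?thesis using Suc.prems True solo_step_halted by (intro exI[of _ m]) auto
 next
  case False
  let ?act = "current_action N no_coins inp [] cf"
  let ?ext = "\<lambda>act c i m s. \<lparr>mv_in = Stay, mv_com = Stay, wr = [0 \<mapsto> (s 0, input_move act), 1 \<mapsto> (0, MoveLeft)],
     em = emit act, sd = None\<rparr>"
  define ins where "ins = observe w [] m True (?ext ?act)"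
  have act: "?act = delta N (state cf) False (cell inp (input_pos cf)) None (map (\<lambda>(tp, i). tp i) (work cf))"
   by (simp add: current_action_def)
  have "rd m 0 = cells (map sym inp) (1 + input_pos cf)" using Suc.prems by (simp add: rd_def)
  then have o2: "observe w [] m c (\<lambda>c i m s. bitcell (s 0)) = cell inp (input_pos cf)" for c
   by (simp add: bitcell_sym)
  have o4: "observe w [] m c (?ext ?act) = ins" for c by (simp add: ins_def)
  have "can_send [] ins m" by (simp add: ins_def can_send_def)
  then obtain m2 where m2: "run w [] (simact N 3 (\<lambda>_ _ _ _. False) (\<lambda>c i m s. bitcell (s 0)) (\<lambda>_ _ _ _. None) ?ext) 1 m m2"
   "simrel N 3 m2 (perform ?act cf)" "wfc N (perform ?act cf)"
   "\<And>j. j < 3 \<Longrightarrow> tp m2 j = tp (exec_instr [] ins m) j" "ot m2 = ot (exec_instr [] ins m)"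
   using run_simact[where w = w and coin = "\<lambda>_ _ _ _. False" and inp = "\<lambda>c i m s. bitcell (s 0)"
    and com = "\<lambda>_ _ _ _. None" and ext = ?ext, OF N Suc.prems(1,2) act refl o2 refl o4] by blast
  have t0: "tp m2 0 = (cells (map sym inp), 1 + input_pos (perform ?act cf))"
   using m2(4)[of 0] Suc.prems write_tape_rd[of m 0 "input_move ?act"]
   by (simp add: exec_instr_def ins_def perform_def)
  have t2: "tp m2 1 = un q"
   using m2(4)[of 1] Suc.prems write_tape_un by (simp add: exec_instr_def ins_def)
  have o: "ot m2 = out_tape (perform ?act cf)"
   using m2(5) Suc.prems by (simp add: exec_instr_def ins_def perform_def)
  from Suc.IH[OF m2(3,2) t0 t2 o] obtain m' where m': "run w [] (simclocked N) (2 * q + 1) m2 m'"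
   "\<And>t. t \<le> q \<Longrightarrow> halted ((solo_step N no_coins inp ^^ t) (perform ?act cf)) \<Longrightarrow>
    ot m' = out_tape ((solo_step N no_coins inp ^^ t) (perform ?act cf))" by blast
  have ss: "solo_step N no_coins inp cf = perform ?act cf" using False by (simp add: solo_step_def)
  have "run w [] (simclocked N) (Suc (1 + (2 * q + 1))) m m'" unfolding simclocked_def
   by (rule run_LoopT[OF _ m2(1) m'(1)[unfolded simclocked_def]]) (use False h rd_un[OF Suc.prems(4)] in simp)
  moreover have "ot m' = out_tape ((solo_step N no_coins inp ^^ t) cf)"
   if "t \<le> Suc q" "halted ((solo_step N no_coins inp ^^ t) cf)" for t
  proof (cases t)
   case 0 then show ?thesis using that False by simp
  next
   case (Suc t')
   then show ?thesis using that m'(2)[of t'] ss by (simp add: funpow_swap1)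
  qed
  ultimately show ?thesis by (intro exI[of _ m']) auto
 qed
qed

abbreviation after_coins :: "tm \<Rightarrow> nat \<Rightarrow> prog" where
 "after_coins N e \<equiv> power_input e ;; push 0 2 ;; Loop moreinput (pushf 0 bitsym ;; adv 1) ;; rewind 0 ;; simclocked N"

definition clocked :: "tm \<Rightarrow> nat \<Rightarrow> nat \<Rightarrow> prog" where
 "clocked N d e = power_input d ;; Loop (nz 1) dump_coin ;; power_input e ;; push 0 2 ;;
   Loop moreinput (pushf 0 bitsym ;; adv 1) ;; rewind 0 ;; simclocked N"

lemma okp_power_input [simp]: "2 < S \<Longrightarrow> 2 < k \<Longrightarrow> okp k S (power_input d)" "coinless (power_input d)"
 by (induction d) (auto simp: mult_input_def rewind_input_def)

lemma okp_clocked: "okp (num_work N + 4) (num_states N + num_symbols N + 5) (clocked N d e)"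
proof -
 have "okp (num_work N + 4) (num_states N + num_symbols N + 5) (simclocked N)"
  unfolding simclocked_def okp.simps by (rule okp_simact) (auto split: if_splits)
 then show ?thesis by (auto simp: clocked_def dump_coin_def sym_def)
qed

lemma sym_encode_pair: "map sym (encode_pair D w) = concat (map (\<lambda>b. [1, sym b]) D) @ 2 # map sym w"
 by (induction D) (auto simp: encode_pair_Nil encode_pair_Cons sym_def)

definition clock_time :: "nat \<Rightarrow> nat \<Rightarrow> nat" where
 "clock_time d l = Suc d * ((l + 1) ^ Suc d * 10 + 2) + 20 * l ^ d + 20 * l + 40"

abbreviation simtime :: "nat \<Rightarrow> nat \<Rightarrow> bits \<Rightarrow> nat" where
 "simtime d e w \<equiv> clock_time d (length w) + clock_time e (length w)"

abbreviation clocked_tm :: "tm \<Rightarrow> nat \<Rightarrow> nat \<Rightarrow> tm" where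
 "clocked_tm N d e \<equiv> compile (num_work N + 4) (num_states N + num_symbols N + 5) (clocked N d e)"

text \<open>Coin \<open>j\<close> is read at \<open>t0 + 6 * j + 6\<close>: one step enters the
  code, \<open>t0\<close> steps compute the number of coins in unary, and a round of six steps reads
  in its last one.\<close>

lemma clocked_output:
 assumes N: "wf_tm N"
 shows "\<exists>t0 G. t0 + 6 * length w ^ d + 6 \<le> (simtime d e w) \<and>
  (\<forall>r. runs (clocked_tm N d e) r w (simtime d e w)
   (G (map (\<lambda>j. r (t0 + 6 * j + 6)) [0..<length w ^ d]))) \<and>
  (\<forall>D t z. length D = length w ^ d \<longrightarrow> t \<le> length w ^ e \<longrightarrow> runs N no_coins (encode_pair D w) t z \<longrightarrow> G D = z)"
proof -
 let ?n = "length w ^ d" and ?q = "length w ^ e"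
 have st: "pin (start 0) = 0" "ot (start 0) = []" "tp (start 0) = (\<lambda>_. un 0)" "pcom (start 0) = 0"
  by (auto simp: start_def un_0 stk_Nil)
 let ?m1 = "upd 1 (un ?n) (start 0)"
 have "run w [] (power_input d) (Suc d * ((length w + 1) ^ Suc d * 10 + 2)) (start 0) ?m1"
  by (rule run_power_input) (simp_all add: st)
 from run_exec[OF this, of no_coins] obtain t0 where
  t0: "t0 \<le> Suc d * ((length w + 1) ^ Suc d * 10 + 2)" "exec w [] no_coins (power_input d) t0 (start 0) ?m1" by blast
 let ?m2 = "\<lambda>D. start 0\<lparr>tp := (\<lambda>_. un 0)(0 := stk (concat (map (\<lambda>b. [1, sym b]) D)))\<rparr>"
 have post: "\<exists>B m'. B \<le> clock_time e (length w) + 10 * ?n \<and>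
   run w [] (after_coins N e) B (?m2 D) m' \<and>
   (\<forall>t z. t \<le> ?q \<longrightarrow> runs N no_coins (encode_pair D w) t z \<longrightarrow> ot m' = z)" if D: "length D = ?n" for D
 proof -
  let ?c = "concat (map (\<lambda>b. [1, sym b]) D)"
  let ?m2' = "upd 1 (un ?q) (?m2 D)"
  have r0: "run w [] (power_input e) (Suc e * ((length w + 1) ^ Suc e * 10 + 2)) (?m2 D) ?m2'"
   by (rule run_power_input) (simp_all add: st)
  let ?m3 = "upd 0 (stk (?c @ [2])) ?m2'"
  have r1: "run w [] (push 0 2) 2 ?m2' ?m3" by (rule run_push) simp
  let ?m4 = "?m3\<lparr>pin := pin ?m3 + int (1 * length w), tp := (tp ?m3)(0 := stk ((?c @ [2]) @ map sym w))\<rparr>"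
  have r2: "run w [] (Loop moreinput (pushf 0 bitsym ;; adv 1)) (5 * length w + 1) ?m3 ?m4"
   by (rule run_readall) (use inpseq_self[of w] in \<open>auto simp: st cell_def\<close>)
  let ?e = "encode_pair D w"
  have e: "(?c @ [2]) @ map sym w = map sym ?e" by (simp add: sym_encode_pair)
  let ?m5 = "upd 0 (cells (map sym ?e), 1) ?m4"
  have z: "0 \<notin> set (map sym ?e)" by (auto simp: sym_def)
  have r3: "run w [] (rewind 0) (2 * length (map sym ?e) + 2) ?m4 ?m5"
  proof (rule run_rewind[where i = "int (length (map sym ?e))"])
   have "tp ?m4 0 = stk (map sym ?e)" unfolding e[symmetric] by simp
   then show "tp ?m4 0 = (cells (map sym ?e), int (length (map sym ?e)))" by (simp only: stk_def)
  qed (use z in simp_all)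
  have "simrel N 3 ?m5 (init_conf N)" by (rule simrel_init) (auto simp: un_0 stk_Nil)
  from run_simclocked[OF N wfc_init[OF N] this, of ?e ?q w] obtain m' where
   r4: "run w [] (simclocked N) (2 * ?q + 1) ?m5 m'" and
   out: "\<And>t. t \<le> ?q \<Longrightarrow> halted ((solo_step N no_coins ?e ^^ t) (init_conf N)) \<Longrightarrow>
    ot m' = out_tape ((solo_step N no_coins ?e ^^ t) (init_conf N))"
   by (auto simp: init_conf_def st)
  have "Suc e * ((length w + 1) ^ Suc e * 10 + 2) + (2 + ((5 * length w + 1) + ((2 * length (map sym ?e) + 2) + (2 * ?q + 1)))) \<le> clock_time e (length w) + 10 * ?n"
   using D by (simp add: length_encode_pair clock_time_def)
  moreover have "\<forall>t z. t \<le> ?q \<longrightarrow> runs N no_coins ?e t z \<longrightarrow> ot m' = z"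
   using out by (auto simp: runs_def Let_def)
  ultimately show ?thesis using run_Seq[OF r0 run_Seq[OF r1 run_Seq[OF r2 run_Seq[OF r3 r4]]]] by blast
 qed
 \<comment> \<open>The final memory has to be a function of the written coins alone, since the
   output distribution is to be an image of theirs.\<close>
 define mf where "mf D = (SOME m'. \<exists>B\<le>clock_time e (length w) + 10 * ?n.
   run w [] (after_coins N e) B (?m2 D) m' \<and>
   (\<forall>t z. t \<le> ?q \<longrightarrow> runs N no_coins (encode_pair D w) t z \<longrightarrow> ot m' = z))" for D
 have mf: "\<exists>B\<le>clock_time e (length w) + 10 * ?n. run w [] (after_coins N e) B (?m2 D) (mf D) \<and>
   (\<forall>t z. t \<le> ?q \<longrightarrow> runs N no_coins (encode_pair D w) t z \<longrightarrow> ot (mf D) = z)" if "length D = ?n" for D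
  unfolding mf_def by (rule someI_ex) (use post[OF that] in blast)
 have "runs (clocked_tm N d e) r w (simtime d e w)
   (ot (mf (map (\<lambda>j. r (t0 + 6 * j + 6)) [0..<?n])))" for r
 proof -
  let ?D = "map (\<lambda>j. r (t0 + 6 * j + 6)) [0..<?n]"
  have a: "exec w [] (\<lambda>n. r (Suc n)) (power_input d) t0 (start 0) ?m1"
   by (rule exec_coinless[OF t0(2)]) simp
  have b: "exec w [] (\<lambda>n. r (Suc (t0 + n))) (Loop (nz 1) dump_coin) (6 * ?n + 1) ?m1 (?m2 ?D)"
  proof -
   have eq: "map (\<lambda>j. [1, sym (r (Suc (t0 + (6 * j + 5))))]) [0..<?n] = map (\<lambda>b. [1, sym b]) ?D"
   proof -
    have "Suc (t0 + (6 * j + 5)) = t0 + 6 * j + 6" for j by simp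
    then show ?thesis by (simp only: map_map o_def)
   qed
   have "exec w [] (\<lambda>n. r (Suc (t0 + n))) (Loop (nz 1) dump_coin) (6 * ?n + 1) ?m1
    (?m1\<lparr>tp := (tp ?m1)(0 := stk ([] @ concat (map (\<lambda>j. [1, sym (r (Suc (t0 + (6 * j + 5))))]) [0..<?n])), 1 := un 0)\<rparr>)"
    by (rule exec_dump_coins) (simp_all add: st un_0)
   moreover have "?m1\<lparr>tp := (tp ?m1)(0 := stk ([] @ X), 1 := un 0)\<rparr>
    = start 0\<lparr>tp := (\<lambda>_. un 0)(0 := stk X)\<rparr>" for X by (auto simp: fun_eq_iff st)
   ultimately show ?thesis by (simp only: eq)
  qed
  obtain B where B: "B \<le> clock_time e (length w) + 10 * ?n"
   "run w [] (after_coins N e) B (?m2 ?D) (mf ?D)" using mf[of ?D] by auto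
  obtain t where t: "t \<le> B" "exec w [] (\<lambda>n. r (Suc (t0 + (6 * ?n + 1 + n))))
   (after_coins N e) t (?m2 ?D) (mf ?D)" using run_exec[OF B(2)] by blast
  have "exec w [] (\<lambda>n. r (Suc n)) (clocked N d e) (t0 + ((6 * ?n + 1) + t)) (start 0) (mf ?D)"
   unfolding clocked_def by (rule exec_Seq[OF a exec_Seq[OF b t(2)]])
  from exec_runs[OF this okp_clocked] show ?thesis
   using t(1) B(1) t0(1) by (simp add: clock_time_def)
 qed
 moreover have "t0 + 6 * ?n + 6 \<le> (simtime d e w)" using t0(1) by (simp add: clock_time_def)
 ultimately show ?thesis using mf by (intro exI[of _ t0] exI[of _ "\<lambda>D. ot (mf D)"]) auto
qed

subsection \<open>The induced output distribution\<close>

text \<open>As a product, the uniform distribution can be restricted to a set of positions and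
  reindexed.\<close>

lemma coin_flips_Pi_pmf:
 "coin_flips T = map_pmf (\<lambda>f. map f [0..<T]) (Pi_pmf {..<T} False (\<lambda>_. pmf_of_set UNIV))"
proof -
 let ?A = "PiE_dflt {..<T} False (\<lambda>_. UNIV :: bool set)"
 have "bij_betw (\<lambda>f. map f [0..<T]) ?A {r. length r = T}"
 proof (rule bij_betwI[where g = "\<lambda>r i. if i < T then r ! i else False"])
  show "(\<lambda>i. if i < T then map f [0..<T] ! i else False) = f" if "f \<in> ?A" for f
   using that by (auto simp: PiE_dflt_def fun_eq_iff)
  show "map (\<lambda>i. if i < T then r ! i else False) [0..<T] = r" if "r \<in> {r. length r = T}" for r
   using that by (auto intro: nth_equalityI)
 qed (auto simp: PiE_dflt_def)
 moreover have "finite ?A" by (intro finite_PiE_dflt) auto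
 moreover have "?A \<noteq> {}" by (auto simp: PiE_dflt_def)
 ultimately have "map_pmf (\<lambda>f. map f [0..<T]) (pmf_of_set ?A) = pmf_of_set {r. length r = T}"
  by (intro map_pmf_of_set_bij_betw)
 then show ?thesis by (simp add: coin_flips_def Pi_pmf_of_set)
qed

lemma coin_flips_select:
 assumes "inj_on idx {..<n}" "\<And>k. k < n \<Longrightarrow> idx k < T"
 shows "map_pmf (\<lambda>r. map (\<lambda>k. r ! idx k) [0..<n]) (coin_flips T) = coin_flips n"
proof -
 let ?c = "\<lambda>_::nat. pmf_of_set (UNIV :: bool set)"
 \<comment> \<open>Indices from \<open>n\<close> on go beyond \<open>T\<close>, hence outside the
   image of \<open>idx\<close>, where the product has its default value.\<close>
 define h where "h x = (if x < n then idx x else T + x)" for x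
 have im: "h ` {..<n} = idx ` {..<n}" by (auto simp: h_def)
 have bij: "bij_betw h {..<n} (idx ` {..<n})"
  using assms(1) unfolding bij_betw_def im by (auto simp: inj_on_def h_def)
 have sub: "idx ` {..<n} \<subseteq> {..<T}" using assms(2) by auto
 have "coin_flips n = map_pmf (\<lambda>f. map f [0..<n]) (map_pmf (\<lambda>g. g \<circ> h) (Pi_pmf (idx ` {..<n}) False ?c))"
  unfolding coin_flips_Pi_pmf[of n] using assms(2) bij
  by (subst Pi_pmf_bij_betw[of "{..<n}" h "idx ` {..<n}"]) (auto simp: h_def, metis not_add_less1)
 also have "\<dots> = map_pmf (\<lambda>f. map (\<lambda>k. f (idx k)) [0..<n]) (Pi_pmf {..<T} False ?c)"
  unfolding Pi_pmf_subset[OF finite_lessThan sub] map_pmf_comp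
  by (intro map_pmf_cong) (auto simp: h_def)
 also have "\<dots> = map_pmf (\<lambda>r. map (\<lambda>k. r ! idx k) [0..<n]) (coin_flips T)"
  unfolding coin_flips_Pi_pmf[of T] map_pmf_comp using assms(2) by (intro map_pmf_cong) auto
 finally show ?thesis ..
qed

lemma clock_time_bound: "(\<lambda>l. real (clock_time d l)) \<in> O(\<lambda>l. real l ^ Suc d)"
proof (rule bigoI)
 let ?K = "real (Suc d * (2 ^ Suc d * 10 + 2) + 80)"
 show "\<forall>\<^sub>F l in sequentially. norm (real (clock_time d l)) \<le> ?K * norm (real l ^ Suc d)"
 proof (rule eventually_sequentiallyI[of 1])
  fix l :: nat assume l: "1 \<le> l"
  have p: "1 \<le> l ^ Suc d" "l ^ d \<le> l ^ Suc d" "l \<le> l ^ Suc d" using l by auto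
  have "(l + 1) ^ Suc d \<le> (2 * l) ^ Suc d" using l by (intro power_mono) auto
  then have "(l + 1) ^ Suc d * 10 + 2 \<le> (2 ^ Suc d * 10 + 2) * l ^ Suc d"
   using p(1) by (simp add: power_mult_distrib algebra_simps del: power_Suc)
  then have "Suc d * ((l + 1) ^ Suc d * 10 + 2) \<le> Suc d * ((2 ^ Suc d * 10 + 2) * l ^ Suc d)"
   by (rule mult_le_mono2)
  then have "clock_time d l \<le> (Suc d * (2 ^ Suc d * 10 + 2) + 80) * l ^ Suc d"
   using p unfolding clock_time_def by (simp add: algebra_simps del: power_Suc)
  then have "real (clock_time d l) \<le> real ((Suc d * (2 ^ Suc d * 10 + 2) + 80) * l ^ Suc d)"
   by (simp only: of_nat_le_iff)
  then show "norm (real (clock_time d l)) \<le> ?K * norm (real l ^ Suc d)"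
   by (simp only: of_nat_mult of_nat_power) simp
 qed
qed

text \<open>Turns a deterministic machine that takes its coins as part of the input into a
  randomized algorithm. Nothing is claimed about coins on which \<open>N\<close> is slow; the search
  will be controlled on useful coins only.\<close>

theorem ppt_clocked:
 assumes N: "wf_tm N"
 shows "\<exists>A. ppt A \<and> (\<forall>w. \<exists>G. A w = map_pmf G (coin_flips (length w ^ d)) \<and>
  (\<forall>D t z. length D = length w ^ d \<longrightarrow> t \<le> length w ^ e \<longrightarrow> runs N no_coins (encode_pair D w) t z \<longrightarrow> G D = z))"
proof -
 let ?M = "clocked_tm N d e"
 obtain t0 G where G: "\<And>w. t0 w + 6 * length w ^ d + 6 \<le> (simtime d e w)"
  "\<And>w r. runs ?M r w (simtime d e w) (G w (map (\<lambda>j. r (t0 w + 6 * j + 6)) [0..<length w ^ d]))"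
  "\<And>w D t z. length D = length w ^ d \<Longrightarrow> t \<le> length w ^ e \<Longrightarrow> runs N no_coins (encode_pair D w) t z \<Longrightarrow> G w D = z"
  using clocked_output[OF N, of _ d e] by metis
 let ?A = "\<lambda>w. map_pmf (G w) (coin_flips (length w ^ d))"
 have sel: "?A w = map_pmf (\<lambda>r. G w (map (\<lambda>j. r ! (t0 w + 6 * j + 6)) [0..<length w ^ d])) (coin_flips (simtime d e w))" for w
 proof -
  have "map_pmf (\<lambda>r. map (\<lambda>j. r ! (t0 w + 6 * j + 6)) [0..<length w ^ d]) (coin_flips (simtime d e w))
   = coin_flips (length w ^ d)"
   by (rule coin_flips_select) (use G(1)[of w] in \<open>auto simp: inj_on_def\<close>)
  then have "?A w = map_pmf (G w) (map_pmf (\<lambda>r. map (\<lambda>j. r ! (t0 w + 6 * j + 6)) [0..<length w ^ d]) (coin_flips (simtime d e w)))"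
   by (simp only:)
  then show ?thesis by (simp only: map_pmf_comp)
 qed
 have "ppt ?A" unfolding ppt_def
 proof (intro exI conjI allI)
  show "wf_tm ?M" by (rule wf_compile[OF okp_clocked]) simp
  show "(\<lambda>n. real (clock_time d n + clock_time e n)) \<in> O(\<lambda>n. real n ^ Suc (d + e))"
  proof -
   have "(\<lambda>n. real n ^ Suc a) \<in> O(\<lambda>n. real n ^ Suc b)" if "a \<le> b" for a b
    by (rule landau_o.bigI[of 1]) (use that in \<open>auto intro!: eventually_sequentiallyI[of 1] power_increasing simp del: power_Suc\<close>)
   then show ?thesis unfolding of_nat_add
    by (intro sum_in_bigo landau_o.big_trans[OF clock_time_bound]) simp_all
  qed
 qed (use G(2) sel in auto)
 then show ?thesis using G(3) by (intro exI[of _ ?A]) blast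
qed

section \<open>Repeated simulation\<close>

text \<open>Unlike in \<open>run_for\<close>, the memory is known only up to \<open>I\<close>, since
  the head positions that simulations leave behind are unspecified.\<close>

lemma run_loop_rel:
 assumes "\<And>i m. i < n \<Longrightarrow> I i m \<Longrightarrow> (\<forall>c. observe w \<pi> m c C) \<and> (\<exists>m'. run w \<pi> p B m m' \<and> I (Suc i) m')"
  and "\<And>m c. I n m \<Longrightarrow> \<not> observe w \<pi> m c C"
 shows "k \<le> n \<Longrightarrow> I (n - k) m \<Longrightarrow> \<exists>m'. run w \<pi> (Loop C p) (k * Suc B + 1) m m' \<and> I n m'"
proof (induction k arbitrary: m)
 case 0
 then have "run w \<pi> (Loop C p) 1 m m" using assms(2) by (intro run_LoopF) auto
 then show ?case using 0 by auto
next
 case (Suc k)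
 then have "n - Suc k < n" by simp
 from assms(1)[OF this Suc.prems(2)] obtain m1 where
  1: "\<And>c. observe w \<pi> m c C" "run w \<pi> p B m m1" "I (Suc (n - Suc k)) m1" by blast
 have "Suc (n - Suc k) = n - k" using Suc.prems by simp
 with Suc.IH[of m1] 1(3) Suc.prems obtain m' where
  2: "run w \<pi> (Loop C p) (k * Suc B + 1) m1 m'" "I n m'" by auto
 from run_LoopT[where C = C, OF 1(1,2) 2(1)] have "run w \<pi> (Loop C p) (Suc k * Suc B + 1) m m'"
  by (rule run_mono) simp
 with 2(2) show ?case by blast
qed

text \<open>Locates everything that a simulation of \<open>s\<close> steps can have written, which
  bounds the time for erasing it.\<close>

definition near :: "tape \<Rightarrow> int \<Rightarrow> nat \<Rightarrow> bool" where
 "near t x0 s \<longleftrightarrow> \<bar>snd t - x0\<bar> \<le> int s \<and> (\<forall>x. \<bar>x - x0\<bar> > int s \<longrightarrow> fst t x = 0)"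

lemma near_write: "near t x0 s \<Longrightarrow> near (write_tape (a, mv) t) x0 (Suc s)"
 by (cases mv) (auto simp: near_def write_tape_def)

text \<open>Erases the interval of nonblank cells around the head.\<close>

definition clean :: "nat \<Rightarrow> prog" where
 "clean v = putf v (\<lambda>c i m s. if s v = 0 then 1 else s v) Stay ;; scanr (\<lambda>a. a \<noteq> 0) v ;; go v MoveLeft ;;
   Loop (nz v) (put v 0 MoveLeft)"

lemma run_clean:
 assumes "wrel t (tp m v)" "near (tp m v) x0 s"
 shows "\<exists>x. run w \<pi> (clean v) (8 * s + 12) m (upd v (\<lambda>_. 0, x) m)"
proof -
 obtain g j where tm: "tp m v = (g, j)" by fastforce
 from assms(1) obtain lo hi where lh: "lo - 1 \<le> j" "j \<le> hi + 1" "lo \<le> hi + 1"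
  "\<And>x. g x \<noteq> 0 \<longleftrightarrow> lo \<le> x \<and> x \<le> hi" unfolding wrel_def tm by auto
 have nr1: "\<bar>j - x0\<bar> \<le> int s" using assms(2) unfolding near_def tm by simp
 have nr2: "\<bar>x - x0\<bar> \<le> int s" if "g x \<noteq> 0" for x
  using assms(2) that unfolding near_def tm by (cases "int s < \<bar>x - x0\<bar>") auto
 note nr = nr1 nr2
 define lo' hi' where "lo' = min lo j" and "hi' = max hi j"
 \<comment> \<open>\<open>wrel\<close> admits a head next to the nonblank interval; a symbol written
   there first makes this cell part of the interval.\<close>
 define g1 where "g1 = g(j := if g j = 0 then 1 else g j)"
 have g1: "g1 x \<noteq> 0 \<longleftrightarrow> lo' \<le> x \<and> x \<le> hi'" for x
 proof (cases "x = j")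
  case False
  then have "lo' \<le> x \<and> x \<le> hi' \<longleftrightarrow> lo \<le> x \<and> x \<le> hi"
   using lh(1-3) unfolding lo'_def hi'_def by linarith
  then show ?thesis using False lh(4)[of x] by (simp add: g1_def)
 qed (simp add: g1_def lo'_def hi'_def)
 have "g1 x \<noteq> 0 \<Longrightarrow> \<bar>x - x0\<bar> \<le> int s" for x using nr by (auto simp: g1_def split: if_splits)
 then have b: "\<bar>lo' - x0\<bar> \<le> int s" "\<bar>hi' - x0\<bar> \<le> int s" using g1 by (auto simp: lo'_def hi'_def)
 have j: "lo' \<le> j" "j \<le> hi'" by (auto simp: lo'_def hi'_def)
 let ?m1 = "upd v (g1, j) m"
 have r1: "run w \<pi> (putf v (\<lambda>c i m s. if s v = 0 then 1 else s v) Stay) 1 m ?m1"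
  by (rule run_putf[where a = "if g j = 0 then 1 else g j"]) (auto simp: rd_def tm write_tape_def g1_def)
 let ?m2 = "upd v (g1, hi' + 1) m"
 have "run w \<pi> (scanr (\<lambda>a. a \<noteq> 0) v) (nat (hi' + 1 - j) * 2 + 1) ?m1 (upd v (g1, hi' + 1) ?m1)"
  by (rule run_scanr) (use j g1 in auto)
 then have r2: "run w \<pi> (scanr (\<lambda>a. a \<noteq> 0) v) (nat (hi' + 1 - j) * 2 + 1) ?m1 ?m2" by simp
 let ?m3 = "upd v (g1, hi') m"
 have r3: "run w \<pi> (go v MoveLeft) 1 ?m2 ?m3"
  using run_go[of ?m2 v g1 "hi' + 1" w \<pi> MoveLeft] by simp
 let ?n = "nat (hi' - lo' + 1)"
 let ?M = "\<lambda>i. upd v (\<lambda>x. if x \<le> hi' - int i then g1 x else 0, hi' - int i) m"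
 have r4: "run w \<pi> (Loop (nz v) (put v 0 MoveLeft)) (?n * Suc 1 + 1) ?m3 (?M ?n)"
 proof (rule run_for[where M = ?M])
  have "(\<lambda>x. if x \<le> hi' then g1 x else 0) = g1" using g1 by fastforce
  then show "?m3 = ?M 0" by simp
  fix i assume i: "i < ?n"
  then show "observe w \<pi> (?M i) c (nz v)" for c using g1[of "hi' - int i"] by (simp add: rd_def)
  have "write_tape (0, MoveLeft) (tp (?M i) v) = (\<lambda>x. if x \<le> hi' - int (Suc i) then g1 x else 0, hi' - int (Suc i))"
   by (auto simp: write_tape_def fun_eq_iff)
  with run_put[of w \<pi> v 0 MoveLeft "?M i"] show "run w \<pi> (put v 0 MoveLeft) 1 (?M i) (?M (Suc i))" by simp
 next
  show "\<not> observe w \<pi> (?M ?n) c (nz v)" for c using g1[of "hi' - int ?n"] j by (simp add: rd_def)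
 qed simp
 have "(\<lambda>x. if x \<le> hi' - int ?n then g1 x else 0) = (\<lambda>_. 0)"
 proof
  show "(if x \<le> hi' - int ?n then g1 x else 0) = 0" for x using g1[of x] j by auto
 qed
 then have e: "?M ?n = upd v (\<lambda>_. 0, hi' - int ?n) m" by simp
 have "run w \<pi> (clean v) (1 + ((nat (hi' + 1 - j) * 2 + 1) + (1 + (?n * Suc 1 + 1)))) m (upd v (\<lambda>_. 0, hi' - int ?n) m)"
  unfolding clean_def e[symmetric] by (rule run_Seq[OF r1 run_Seq[OF r2 run_Seq[OF r3 r4]]])
 moreover have "1 + ((nat (hi' + 1 - j) * 2 + 1) + (1 + (?n * Suc 1 + 1))) \<le> 8 * s + 12"
 proof -
  have "nat (hi' + 1 - j) \<le> 2 * s + 1" "?n \<le> 2 * s + 1" using b nr(1) by (auto simp: nat_le_iff)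
  then show ?thesis by simp
 qed
 ultimately show ?thesis by (blast intro: run_mono)
qed

primrec cleanall :: "nat \<Rightarrow> nat \<Rightarrow> prog" where
 "cleanall off 0 = skip"
| "cleanall off (Suc n) = cleanall off n ;; clean (Suc off + n)"

lemma run_cleanall:
 assumes "\<And>i. i < n \<Longrightarrow> (\<exists>t. wrel t (tp m (Suc off + i))) \<and> near (tp m (Suc off + i)) (x0 i) s"
 shows "\<exists>m'. run w \<pi> (cleanall off n) (n * (8 * s + 12) + 1) m m' \<and> ot m' = ot m \<and>
  (\<forall>i<n. \<exists>x. tp m' (Suc off + i) = (\<lambda>_. 0, x)) \<and> (\<forall>j. j \<le> off \<or> off + n < j \<longrightarrow> tp m' j = tp m j)"
 using assms
proof (induction n)
 case 0
 then show ?case using run_skip[of w \<pi> m] by auto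
next
 case (Suc n)
 from Suc.IH[OF Suc.prems] obtain m1 where m1: "run w \<pi> (cleanall off n) (n * (8 * s + 12) + 1) m m1" "ot m1 = ot m"
  "\<forall>i<n. \<exists>x. tp m1 (Suc off + i) = (\<lambda>_. 0, x)" "\<forall>j. j \<le> off \<or> off + n < j \<longrightarrow> tp m1 j = tp m j" by auto
 then have "tp m1 (Suc off + n) = tp m (Suc off + n)" by simp
 with Suc.prems[of n] obtain t where "wrel t (tp m1 (Suc off + n))" "near (tp m1 (Suc off + n)) (x0 n) s" by auto
 from run_clean[OF this, of w \<pi>] obtain x where
  x: "run w \<pi> (clean (Suc off + n)) (8 * s + 12) m1 (upd (Suc off + n) (\<lambda>_. 0, x) m1)" by blast
 have "run w \<pi> (cleanall off (Suc n)) ((n * (8 * s + 12) + 1) + (8 * s + 12)) m (upd (Suc off + n) (\<lambda>_. 0, x) m1)"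
  unfolding cleanall.simps by (rule run_Seq[OF m1(1) x])
 then have "run w \<pi> (cleanall off (Suc n)) (Suc n * (8 * s + 12) + 1) m (upd (Suc off + n) (\<lambda>_. 0, x) m1)"
  by (rule run_mono) simp
 moreover have "\<exists>y. tp (upd (Suc off + n) (\<lambda>_. 0, x) m1) (Suc off + i) = (\<lambda>_. 0, y)" if "i < Suc n" for i
  using m1(3) that by (cases "i = n") auto
 ultimately show ?case using m1(2,4) by (intro exI[of _ "upd (Suc off + n) (\<lambda>_. 0, x) m1"]) auto
qed

text \<open>
 Tape 0 holds the query: bits that are fixed (1, 2), padding (3, read as \<^term>\<open>False\<close>) and the
 bits of the current node of the search (4, 5); 6 marks blank cells visited by the input head.
\<close>

definition qbit :: "nat \<Rightarrow> bool option" where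
 "qbit a = (if a = 0 \<or> a = 6 then None else Some (a = 2 \<or> a = 5))"

abbreviation qbits :: "nat list \<Rightarrow> bits" where
 "qbits \<equiv> map (\<lambda>a. a = 2 \<or> a = 5)"

text \<open>\<open>s\<close> bounds how far the marks 6 extend beyond the query on either side, and
  with it the time of \<open>cleanq\<close>.\<close>

definition qrel :: "nat list \<Rightarrow> int \<Rightarrow> nat \<Rightarrow> tape \<Rightarrow> bool" where
 "qrel qs p s t \<longleftrightarrow> snd t = 1 + p \<and> (\<exists>lo hi. 1 - int s \<le> lo \<and> lo \<le> 1 \<and> int (length qs) \<le> hi \<and> hi \<le> int (length qs) + int s \<and>
   lo - 1 \<le> 1 + p \<and> 1 + p \<le> hi + 1 \<and>
   (\<forall>x. fst t x = (if 1 \<le> x \<and> x \<le> int (length qs) then cells qs x else if lo \<le> x \<and> x \<le> hi then 6 else 0)))"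

lemma qrel_init: "qrel qs 0 0 (cells qs, 1)" unfolding qrel_def
 by (rule conjI, simp, rule exI[of _ 1], rule exI[of _ "int (length qs)"]) (auto simp: cells_def)

lemma qrel_scan:
 assumes "qrel qs p s t" "set qs \<subseteq> {1..5}"
 shows "qbit (fst t (snd t)) = cell (qbits qs) p"
proof -
 from assms(1) obtain lo hi where *: "snd t = 1 + p"
  "\<And>x. fst t x = (if 1 \<le> x \<and> x \<le> int (length qs) then cells qs x else if lo \<le> x \<and> x \<le> hi then 6 else 0)"
  unfolding qrel_def by blast
 show ?thesis
 proof (cases "0 \<le> p \<and> p < int (length qs)")
  case True
  then have "qs ! nat p \<in> {1..5}" using assms(2) by (auto simp: subset_iff)
  with True * show ?thesis by (auto simp: qbit_def cell_def cells_def)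
 next
  case False
  then have "qbit (fst t (snd t)) = None" using * by (auto simp: qbit_def)
  with False show ?thesis by (auto simp: cell_def)
 qed
qed

lemma qrel_write:
 assumes "qrel qs p s t" "set qs \<subseteq> {1..5}"
 shows "qrel qs (p + offset mv) (Suc s) (write_tape (if fst t (snd t) = 0 then 6 else fst t (snd t), mv) t)"
proof -
 from assms(1) obtain lo hi where *: "snd t = 1 + p" "1 - int s \<le> lo" "lo \<le> 1" "int (length qs) \<le> hi"
  "hi \<le> int (length qs) + int s" "lo - 1 \<le> 1 + p" "1 + p \<le> hi + 1"
  "\<And>x. fst t x = (if 1 \<le> x \<and> x \<le> int (length qs) then cells qs x else if lo \<le> x \<and> x \<le> hi then 6 else 0)"
  unfolding qrel_def by blast
 have o: "- 1 \<le> offset mv" "offset mv \<le> 1" by (cases mv; simp)+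
 have nz: "cells qs x \<noteq> 0" if "1 \<le> x" "x \<le> int (length qs)" for x
  using assms(2) that by (intro cells_nz) auto
 show ?thesis unfolding qrel_def
 proof (rule conjI, use *(1) in \<open>simp add: write_tape_def\<close>, rule exI[of _ "min lo (1 + p)"], rule exI[of _ "max hi (1 + p)"],
   intro conjI allI)
  fix x
  show "fst (write_tape (if fst t (snd t) = 0 then 6 else fst t (snd t), mv) t) x =
   (if 1 \<le> x \<and> x \<le> int (length qs) then cells qs x
    else if min lo (1 + p) \<le> x \<and> x \<le> max hi (1 + p) then 6 else 0)"
   using *(1) *(3,4,6,7) *(8)[of x] nz[of x] by (auto simp: write_tape_def)
 qed (use * o in \<open>auto simp: write_tape_def\<close>)
qed

text \<open>On the way to the left the marks become blanks again; afterwards all cells before cell 1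
  are blank, so scanning to the right finds the start of the query.\<close>

definition cleanq :: prog where
 "cleanq = putf 0 (\<lambda>c i m s. if s 0 = 0 then 6 else s 0) Stay ;; scanr (\<lambda>a. a \<noteq> 0) 0 ;; go 0 MoveLeft ;;
   Loop (nz 0) (putf 0 (\<lambda>c i m s. if s 0 = 6 then 0 else s 0) MoveLeft) ;; go 0 MoveRight ;; scanr (\<lambda>a. a = 0) 0"

lemma run_cleanq:
 assumes "qrel qs p s (tp m 0)" "set qs \<subseteq> {1..5}" "qs \<noteq> []"
 shows "run w \<pi> cleanq (12 * (length qs + s) + 40) m (upd 0 (cells qs, 1) m)"
proof -
 let ?l = "int (length qs)"
 let ?wt = "write_tape (if rd m 0 = 0 then 6 else rd m 0, Stay) (tp m 0)"
 define g where "g = fst ?wt"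
 have q0: "qrel qs (p + offset Stay) (Suc s) ?wt"
  unfolding rd_def by (rule qrel_write[OF assms(1,2)])
 then have t1: "?wt = (g, 1 + p)" by (simp add: qrel_def g_def prod_eq_iff)
 have q1: "qrel qs p (Suc s) (g, 1 + p)" using q0 t1 by simp
 from q1 obtain lo hi where *: "1 - int (Suc s) \<le> lo" "lo \<le> 1" "?l \<le> hi"
  "hi \<le> ?l + int (Suc s)" "lo - 1 \<le> 1 + p" "1 + p \<le> hi + 1"
  "\<And>x. g x = (if 1 \<le> x \<and> x \<le> ?l then cells qs x else if lo \<le> x \<and> x \<le> hi then 6 else 0)"
  unfolding qrel_def fst_conv snd_conv by blast
 have nz: "cells qs x \<noteq> 0" "cells qs x \<noteq> 6" if "1 \<le> x" "x \<le> ?l" for x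
 proof -
  have "cells qs x \<in> set qs" using that by (auto simp: cells_def)
  then show "cells qs x \<noteq> 0" "cells qs x \<noteq> 6" using assms(2) by auto
 qed
 have gnz: "g x \<noteq> 0 \<longleftrightarrow> lo \<le> x \<and> x \<le> hi" for x using *(2,3,7) nz by auto
 have "g (1 + p) \<noteq> 0" using t1 by (auto simp: write_tape_def split: if_splits)
 then have p: "lo \<le> 1 + p" "1 + p \<le> hi" using gnz by auto
 let ?m1 = "upd 0 (g, 1 + p) m"
 have r1: "run w \<pi> (putf 0 (\<lambda>c i m s. if s 0 = 0 then 6 else s 0) Stay) 1 m ?m1"
  by (rule run_putf[where a = "if rd m 0 = 0 then 6 else rd m 0"]) (simp_all add: t1)
 let ?m2 = "upd 0 (g, hi + 1) m"
 have "run w \<pi> (scanr (\<lambda>a. a \<noteq> 0) 0) (nat (hi + 1 - (1 + p)) * 2 + 1) ?m1 (upd 0 (g, hi + 1) ?m1)"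
  by (rule run_scanr) (use p gnz in auto)
 then have r2: "run w \<pi> (scanr (\<lambda>a. a \<noteq> 0) 0) (nat (hi + 1 - (1 + p)) * 2 + 1) ?m1 ?m2" by simp
 let ?m3 = "upd 0 (g, hi) m"
 have r3: "run w \<pi> (go 0 MoveLeft) 1 ?m2 ?m3"
  using run_go[of ?m2 0 g "hi + 1" w \<pi> MoveLeft] by simp
 let ?n = "nat (hi - lo + 1)"
 let ?M = "\<lambda>i. upd 0 (\<lambda>x. if x \<le> hi - int i then g x else cells qs x, hi - int i) m"
 have r4: "run w \<pi> (Loop (nz 0) (putf 0 (\<lambda>c i m s. if s 0 = 6 then 0 else s 0) MoveLeft)) (?n * Suc 1 + 1) ?m3 (?M ?n)"
 proof (rule run_for[where M = ?M])
  have "(\<lambda>x. if x \<le> hi then g x else cells qs x) = g" using *(3,7) by (auto simp: cells_def fun_eq_iff)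
  then show "?m3 = ?M 0" by simp
  fix i assume i: "i < ?n"
  then show "observe w \<pi> (?M i) c (nz 0)" for c using gnz[of "hi - int i"] by (simp add: rd_def)
  let ?a = "if g (hi - int i) = 6 then 0 else g (hi - int i)"
  have a: "?a = cells qs (hi - int i)" using *(7)[of "hi - int i"] nz by (auto simp: cells_def)
  have "write_tape (?a, MoveLeft) (tp (?M i) 0) = (\<lambda>x. if x \<le> hi - int (Suc i) then g x else cells qs x, hi - int (Suc i))"
   unfolding a by (auto simp: write_tape_def fun_eq_iff)
  then show "run w \<pi> (putf 0 (\<lambda>c i m s. if s 0 = 6 then 0 else s 0) MoveLeft) 1 (?M i) (?M (Suc i))"
   by (intro run_putf[where a = ?a]) (simp_all add: rd_def)
 next
  show "\<not> observe w \<pi> (?M ?n) c (nz 0)" for c using gnz[of "hi - int ?n"] p by (simp add: rd_def)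
 qed simp
 have "(\<lambda>x. if x \<le> hi - int ?n then g x else cells qs x) = cells qs"
  using *(2,7) p by (auto simp: fun_eq_iff cells_def)
 then have e: "?M ?n = upd 0 (cells qs, lo - 1) m" using p by simp
 let ?m5 = "upd 0 (cells qs, lo) m"
 have r5: "run w \<pi> (go 0 MoveRight) 1 (upd 0 (cells qs, lo - 1) m) ?m5"
  using run_go[of "upd 0 (cells qs, lo - 1) m" 0 "cells qs" "lo - 1" w \<pi> MoveRight] by simp
 have "cells qs 1 \<noteq> 0" using assms(3) by (intro nz) (auto simp: Suc_le_eq)
 then have r6: "run w \<pi> (scanr (\<lambda>a. a = 0) 0) (nat (1 - lo) * 2 + 1) ?m5 (upd 0 (cells qs, 1) m)"
  using run_scanr[of ?m5 0 "cells qs" lo 1 "\<lambda>a. a = 0" w \<pi>] *(2) by (simp add: cells_def)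
 have "run w \<pi> cleanq (1 + ((nat (hi + 1 - (1 + p)) * 2 + 1) + (1 + ((?n * Suc 1 + 1) + (1 + (nat (1 - lo) * 2 + 1)))))) m (upd 0 (cells qs, 1) m)"
  unfolding cleanq_def by (rule run_Seq[OF r1 run_Seq[OF r2 run_Seq[OF r3 run_Seq[OF r4[unfolded e] run_Seq[OF r5 r6]]]]])
 moreover have "1 + ((nat (hi + 1 - (1 + p)) * 2 + 1) + (1 + ((?n * Suc 1 + 1) + (1 + (nat (1 - lo) * 2 + 1)))))
  \<le> 12 * (length qs + s) + 40" using *(1-6) p by simp
 ultimately show ?thesis by (rule run_mono)
qed

section \<open>The search machine\<close>

text \<open>Tape 4 records the output of a simulated run: 2 stands for \<^term>\<open>[True]\<close>.\<close>

definition outcode :: "bits \<Rightarrow> nat" where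
 "outcode z = (case z of [] \<Rightarrow> 0 | [b] \<Rightarrow> sym b | _ \<Rightarrow> 3)"

lemma outcode_eq_2: "outcode z = 2 \<longleftrightarrow> z = [True]" by (auto simp: outcode_def split: list.split)

definition addcode :: "nat \<Rightarrow> bool option \<Rightarrow> nat" where
 "addcode a e = (case e of None \<Rightarrow> a | Some b \<Rightarrow> if a = 0 then sym b else 3)"

lemma addcode_outcode: "addcode (outcode z) e = outcode (z @ (case e of None \<Rightarrow> [] | Some b \<Rightarrow> [b]))"
 by (auto simp: addcode_def outcode_def split: list.split option.split)

abbreviation qext :: "action \<Rightarrow> instr obs" where
 "qext \<equiv> \<lambda>act c i m s. nop\<lparr>wr := [0 \<mapsto> (if s 0 = 0 then 6 else s 0, input_move act), 2 \<mapsto> (s 2, MoveRight),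
     4 \<mapsto> (addcode (s 4) (emit act), Stay)]\<rparr>"

abbreviation qstep :: "tm \<Rightarrow> prog" where
 "qstep N \<equiv> simact N 10 (sees 2 2) (\<lambda>c i m s. qbit (s 0)) (\<lambda>_ _ _ _. None) qext"

definition simquery :: "tm \<Rightarrow> prog" where
 "simquery N = Loop (\<lambda>c i m s. s 10 \<noteq> 1) (qstep N)"

definition qrun :: "tm \<Rightarrow> nat list \<Rightarrow> nat list \<Rightarrow> int \<Rightarrow> (nat \<Rightarrow> int) \<Rightarrow> conf \<Rightarrow> mem \<Rightarrow> bool" where
 "qrun N qs ks p0 x0 cf m \<longleftrightarrow> wfc N cf \<and> simrel N 10 m cf \<and> qrel qs (input_pos cf) (steps cf) (tp m 0) \<and>
   tp m 2 = (cells ks, p0 + int (steps cf)) \<and> rd m 4 = outcode (out_tape cf) \<and>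
   (\<forall>i<num_work N. near (tp m (11 + i)) (x0 i) (steps cf))"

lemma qrun_step:
 assumes N: "wf_tm N" and R: "qrun N qs ks p0 x0 cf m" and nh: "\<not> halted cf"
  and coin: "(cells ks (p0 + int (steps cf)) = 2) = r (steps cf)" and qs: "set qs \<subseteq> {1..5}"
 shows "\<exists>m'. run w [] (qstep N) 1 m m' \<and>
   qrun N qs ks p0 x0 (solo_step N r (qbits qs) cf) m' \<and> ot m' = ot m \<and>
   (\<forall>j. j \<notin> {0, 2, 4} \<longrightarrow> j < 10 \<or> 10 + num_work N < j \<longrightarrow> tp m' j = tp m j)"
proof -
 note R' = R[unfolded qrun_def]
 let ?q = "qbits qs"
 let ?act = "current_action N r ?q [] cf"
 let ?ext = qext
 define ins where "ins = observe w [] m True (?ext ?act)"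
 have act: "?act = delta N (state cf) (r (steps cf)) (cell ?q (input_pos cf)) None (map (\<lambda>(tp, i). tp i) (work cf))"
  by (simp add: current_action_def)
 have o1: "observe w [] m c (sees 2 2) = r (steps cf)" for c using R' coin by (simp add: rd_def)
 have o2: "observe w [] m c (\<lambda>c i m s. qbit (s 0)) = cell ?q (input_pos cf)" for c
  using qrel_scan[of qs "input_pos cf" "steps cf" "tp m 0"] R' qs by (simp add: rd_def)
 have o4: "observe w [] m c (?ext ?act) = ins" for c by (simp add: ins_def)
 have wf: "wfc N cf" and sr: "simrel N 10 m cf" using R' by simp_all
 have "can_send [] ins m" by (simp add: ins_def can_send_def)
 then obtain m' where m': "run w [] (qstep N) 1 m m'"
  "simrel N 10 m' (perform ?act cf)" "wfc N (perform ?act cf)"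
  "\<And>j. j < 10 \<or> 10 + num_work N < j \<Longrightarrow> tp m' j = tp (exec_instr [] ins m) j" "ot m' = ot (exec_instr [] ins m)"
  "\<And>i. i < num_work N \<Longrightarrow> \<exists>a. tp m' (Suc 10 + i) = write_tape a (tp m (Suc 10 + i))"
  using run_simact[where w = w and coin = "\<lambda>c i m s. s 2 = 2" and inp = "\<lambda>c i m s. qbit (s 0)"
    and com = "\<lambda>_ _ _ _. None" and ext = ?ext, OF N wf sr act o1 o2 refl o4] by blast
 have st: "steps (perform ?act cf) = Suc (steps cf)" by (simp add: perform_def)
 have e0: "tp m' 0 = write_tape (if rd m 0 = 0 then 6 else rd m 0, input_move ?act) (tp m 0)"
  using m'(4)[of 0] by (simp add: exec_instr_def ins_def)
 have "qrel qs (input_pos cf + offset (input_move ?act)) (Suc (steps cf)) (tp m' 0)"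
  unfolding e0 rd_def by (rule qrel_write) (use R' qs in auto)
 then have t0: "qrel qs (input_pos (perform ?act cf)) (Suc (steps cf)) (tp m' 0)"
  by (simp add: perform_def)
 have t2: "tp m' 2 = (cells ks, p0 + int (Suc (steps cf)))"
  using m'(4)[of 2] R' write_tape_rd[of m 2 MoveRight] by (simp add: exec_instr_def ins_def)
 have t4: "rd m' 4 = outcode (out_tape (perform ?act cf))"
  using m'(4)[of 4] R' addcode_outcode[of "out_tape cf" "emit ?act"]
  by (simp add: exec_instr_def ins_def rd_def write_tape_def perform_def)
 have nr: "near (tp m' (11 + i)) (x0 i) (Suc (steps cf))" if "i < num_work N" for i
 proof -
  from m'(6)[OF that] obtain a mv where "tp m' (11 + i) = write_tape (a, mv) (tp m (11 + i))" by auto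
  moreover have "near (tp m (11 + i)) (x0 i) (steps cf)" using R' that by simp
  ultimately show ?thesis using near_write by simp
 qed
 have "solo_step N r ?q cf = perform ?act cf" using nh by (simp add: solo_step_def)
 then have "qrun N qs ks p0 x0 (solo_step N r ?q cf) m'"
  unfolding qrun_def using m'(2,3) t0 t2 t4 nr st by simp
 moreover have "ot m' = ot m" using m'(5) by (simp add: exec_instr_def ins_def)
 moreover have "tp m' j = tp m j" if "j \<notin> {0, 2, 4}" "j < 10 \<or> 10 + num_work N < j" for j
  using m'(4)[of j] that by (simp add: exec_instr_def ins_def)
 ultimately show ?thesis using m'(1) by blast
qed

lemma run_simquery:
 assumes N: "wf_tm N" and qs: "set qs \<subseteq> {1..5}"
  and coins: "\<And>k. k < B \<Longrightarrow> (cells ks (p0 + int k) = 2) = r k"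
 shows "qrun N qs ks p0 x0 cf m \<Longrightarrow> steps cf + k \<le> B \<Longrightarrow> halted ((solo_step N r (qbits qs) ^^ k) cf) \<Longrightarrow>
  \<exists>m'. run w [] (simquery N) (2 * k + 1) m m' \<and>
   qrun N qs ks p0 x0 ((solo_step N r (qbits qs) ^^ k) cf) m' \<and> ot m' = ot m \<and>
   steps ((solo_step N r (qbits qs) ^^ k) cf) \<le> steps cf + k \<and>
   (\<forall>j. j \<notin> {0, 2, 4} \<longrightarrow> j < 10 \<or> 10 + num_work N < j \<longrightarrow> tp m' j = tp m j)"
proof (induction k arbitrary: cf m)
 case 0
 then have "rd m 10 = 1" by (auto simp: qrun_def simrel_def halted_def)
 then have "run w [] (simquery N) 1 m m" unfolding simquery_def by (intro run_LoopF) simp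
 then show ?case using 0 by auto
next
 case (Suc k)
 let ?q = "qbits qs"
 have h: "rd m 10 = 1 \<longleftrightarrow> halted cf" using Suc.prems(1) by (auto simp: qrun_def simrel_def halted_def)
 show ?case
 proof (cases "halted cf")
  case True
  have "run w [] (simquery N) (2 * Suc k + 1) m m" unfolding simquery_def
   by (rule run_mono[OF run_LoopF]) (use True h in auto)
  then show ?thesis using Suc.prems True solo_step_halted[OF True, where M = N and coins = r and w = ?q and k = "Suc k"]
   by (intro exI[of _ m]) (simp del: funpow.simps)
 next
  case False
  have "steps cf < B" using Suc.prems(2) by simp
  from qrun_step[where r = r and w = w, OF N Suc.prems(1) False coins[OF this] qs] obtain m1 where
   m1: "run w [] (qstep N) 1 m m1"
   "qrun N qs ks p0 x0 (solo_step N r ?q cf) m1" "ot m1 = ot m"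
   "\<forall>j. j \<notin> {0, 2, 4} \<longrightarrow> j < 10 \<or> 10 + num_work N < j \<longrightarrow> tp m1 j = tp m j" by blast
  have st: "steps (solo_step N r ?q cf) = Suc (steps cf)"
   using False by (simp add: solo_step_def perform_def)
  have "steps (solo_step N r ?q cf) + k \<le> B" "halted ((solo_step N r ?q ^^ k) (solo_step N r ?q cf))"
   using Suc.prems(2,3) st by (simp_all add: funpow_swap1)
  from Suc.IH[OF m1(2) this] obtain m' where m': "run w [] (simquery N) (2 * k + 1) m1 m'"
   "qrun N qs ks p0 x0 ((solo_step N r ?q ^^ k) (solo_step N r ?q cf)) m'" "ot m' = ot m1"
   "steps ((solo_step N r ?q ^^ k) (solo_step N r ?q cf)) \<le> steps (solo_step N r ?q cf) + k"
   "\<forall>j. j \<notin> {0, 2, 4} \<longrightarrow> j < 10 \<or> 10 + num_work N < j \<longrightarrow> tp m' j = tp m1 j" by blast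
  have "run w [] (simquery N) (Suc (1 + (2 * k + 1))) m m'" unfolding simquery_def
   by (rule run_LoopT[OF _ m1(1) m'(1)[unfolded simquery_def]]) (use False h in simp)
  then have "run w [] (simquery N) (2 * Suc k + 1) m m'" by simp
  then show ?thesis using m'(2-5) m1(3,4) st by (intro exI[of _ m']) (simp add: funpow_swap1)
 qed
qed

text \<open>A run may halt before its coins are used up, so the head is moved on to the separator 3
  before the next vote.\<close>

definition qblock :: "tm \<Rightarrow> prog" where
 "qblock N = simquery N ;; Cond (sees 4 2) (inc 1) (dec 1) ;; put 10 0 Stay ;; put 4 0 Stay ;; cleanq ;;
   cleanall 10 (num_work N) ;; scanr (\<lambda>a. a \<noteq> 3) 2 ;; go 2 MoveRight"

definition ready :: "tm \<Rightarrow> mem \<Rightarrow> bool" where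
 "ready N m \<longleftrightarrow> rd m 10 = 0 \<and> (\<forall>i<num_work N. \<exists>x. tp m (11 + i) = (\<lambda>_. 0, x))"

lemma run_qblock:
 assumes N: "wf_tm N" and qs: "set qs \<subseteq> {1..5}" "qs \<noteq> []"
  and ks: "\<forall>k<B. cells ks (p0 + int k) = sym (blk ! k)" "cells ks (p0 + int B) = 3"
  and out: "runs N ((!) blk) (qbits qs) B z"
  and m: "ready N m" "tp m 0 = (cells qs, 1)" "tp m 1 = signed v" "rd m 4 = 0" "tp m 2 = (cells ks, p0)"
 shows "\<exists>m'. run w [] (qblock N) ((16 + 8 * num_work N) * (length qs + B) + 12 * num_work N + 60) m m' \<and>
   ready N m' \<and> tp m' 0 = (cells qs, 1) \<and> tp m' 1 = signed (v + (if z = [True] then 1 else - 1)) \<and>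
   rd m' 4 = 0 \<and> tp m' 2 = (cells ks, p0 + int B + 1) \<and> ot m' = ot m \<and>
   (\<forall>j. j \<notin> {0, 1, 2, 4} \<longrightarrow> j < 10 \<longrightarrow> tp m' j = tp m j)"
proof -
 let ?q = "qbits qs" and ?nw = "num_work N"
 define x0 where "x0 i = snd (tp m (11 + i))" for i
 have "simrel N 10 m (init_conf N)"
 proof (rule simrel_init)
  show "tp m 10 = (fst (tp m 10), snd (tp m 10))" by simp
  show "fst (tp m 10) (snd (tp m 10)) = 0" using m(1) by (simp add: ready_def rd_def)
  fix j assume j: "10 < j" "j \<le> 10 + ?nw"
  then have "j - 11 < ?nw" "11 + (j - 11) = j" by auto
  with m(1) show "\<exists>i. tp m j = (\<lambda>_. 0, i)" unfolding ready_def by metis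
 qed
 moreover have "near (tp m (11 + i)) (x0 i) 0" if "i < ?nw" for i
  using m(1) that by (auto simp: ready_def near_def x0_def)
 ultimately have Q: "qrun N qs ks p0 x0 (init_conf N) m"
  using wfc_init[OF N] qrel_init[of qs] m by (simp add: qrun_def init_conf_def outcode_def)
 define cf where "cf = (solo_step N ((!) blk) ?q ^^ B) (init_conf N)"
 have cf: "halted cf" "out_tape cf = z" using out by (simp_all add: runs_def cf_def Let_def)
 have "(cells ks (p0 + int k) = 2) = blk ! k" if "k < B" for k using ks(1) that by simp
 from run_simquery[where B = B and r = "(!) blk" and k = B and w = w, OF N qs(1) this Q] cf(1) obtain m1 where
  r1: "run w [] (simquery N) (2 * B + 1) m m1" and Q1: "qrun N qs ks p0 x0 cf m1" and o1: "ot m1 = ot m"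
  and s: "steps cf \<le> B" and f1: "\<And>j. j \<notin> {0, 2, 4} \<Longrightarrow> j < 10 \<Longrightarrow> tp m1 j = tp m j"
  by (auto simp: cf_def init_conf_def)
 note Q1' = Q1[unfolded qrun_def]
 let ?v = "v + (if z = [True] then 1 else - 1)"
 let ?m2 = "upd 1 (signed ?v) m1"
 have t1: "tp m1 1 = signed v" using f1[of 1] m(3) by simp
 have rd4: "rd m1 4 = 2 \<longleftrightarrow> z = [True]" using Q1' cf(2) outcode_eq_2 by simp
 have r2: "run w [] (Cond (sees 4 2) (inc 1) (dec 1)) (Suc 3) m1 ?m2"
 proof (cases "z = [True]")
  case True
  then show ?thesis using run_inc[OF t1] rd4 by (intro run_CondT) auto
 next
  case False
  then show ?thesis using run_dec[OF t1] rd4 by (intro run_CondF) auto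
 qed
 let ?m3 = "upd 10 (write_tape (0, Stay) (tp ?m2 10)) ?m2"
 let ?m4 = "upd 4 (write_tape (0, Stay) (tp ?m3 4)) ?m3"
 have r3: "run w [] (put 10 0 Stay) 1 ?m2 ?m3" by (rule run_put)
 have r4: "run w [] (put 4 0 Stay) 1 ?m3 ?m4" by (rule run_put)
 let ?m5 = "upd 0 (cells qs, 1) ?m4"
 have r5: "run w [] cleanq (12 * (length qs + steps cf) + 40) ?m4 ?m5"
  by (rule run_cleanq) (use Q1' qs in auto)
 have "(\<exists>t. wrel t (tp ?m5 (Suc 10 + i))) \<and> near (tp ?m5 (Suc 10 + i)) (x0 i) (steps cf)" if "i < ?nw" for i
 proof -
  have "wrel (work cf ! i) (tp m1 (Suc 10 + i))" using Q1' that by (simp add: simrel_def)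
  moreover have "tp ?m5 (Suc 10 + i) = tp m1 (Suc 10 + i)" by simp
  moreover have "near (tp m1 (Suc 10 + i)) (x0 i) (steps cf)" using Q1' that by simp
  ultimately show ?thesis by (simp only:) blast
 qed
 from run_cleanall[OF this, of ?nw w "[]"] obtain m6 where
  r6: "run w [] (cleanall 10 ?nw) (?nw * (8 * steps cf + 12) + 1) ?m5 m6" and o6: "ot m6 = ot ?m5"
  and w6: "\<forall>i<?nw. \<exists>x. tp m6 (Suc 10 + i) = (\<lambda>_. 0, x)" and f6: "\<forall>j. j \<le> 10 \<or> 10 + ?nw < j \<longrightarrow> tp m6 j = tp ?m5 j"
  by auto
 have t2: "tp m6 2 = (cells ks, p0 + int (steps cf))" using f6 Q1' by simp
 let ?m7 = "upd 2 (cells ks, p0 + int B) m6"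
 have r7: "run w [] (scanr (\<lambda>a. a \<noteq> 3) 2) (nat ((p0 + int B) - (p0 + int (steps cf))) * 2 + 1) m6 ?m7"
 proof (rule run_scanr[OF t2])
  show "cells ks k \<noteq> 3" if "p0 + int (steps cf) \<le> k" "k < p0 + int B" for k
   using ks(1)[rule_format, of "nat (k - p0)"] that by (auto simp: sym_def)
 qed (use s ks in auto)
 let ?m8 = "upd 2 (cells ks, p0 + int B + 1) m6"
 have r8: "run w [] (go 2 MoveRight) 1 ?m7 ?m8"
  using run_go[of ?m7 2 "cells ks" "p0 + int B" w "[]" MoveRight] by simp
 have "run w [] (qblock N) ((2 * B + 1) + (Suc 3 + (1 + (1 + ((12 * (length qs + steps cf) + 40) +
  ((?nw * (8 * steps cf + 12) + 1) + ((nat ((p0 + int B) - (p0 + int (steps cf))) * 2 + 1) + 1))))))) m ?m8"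
  unfolding qblock_def
  by (rule run_Seq[OF r1 run_Seq[OF r2 run_Seq[OF r3 run_Seq[OF r4 run_Seq[OF r5 run_Seq[OF r6 run_Seq[OF r7 r8]]]]]]])
 moreover obtain d where d: "B = steps cf + d" using s le_Suc_ex by blast
 then have "nat ((p0 + int B) - (p0 + int (steps cf))) = d" by simp
 ultimately have run: "run w [] (qblock N) ((16 + 8 * ?nw) * (length qs + B) + 12 * ?nw + 60) m ?m8"
  unfolding d by (elim run_mono) (simp add: algebra_simps)
 have "rd ?m8 10 = 0" "rd ?m8 4 = 0" using f6 by (simp_all add: rd_def write_tape_def)
 moreover have "tp ?m8 0 = (cells qs, 1)" "tp ?m8 1 = signed ?v" using f6 by simp_all
 moreover have "\<forall>j. j \<notin> {0, 1, 2, 4} \<longrightarrow> j < 10 \<longrightarrow> tp ?m8 j = tp m j" using f6 f1 by simp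
 ultimately show ?thesis using run w6 o6 o1 by (intro exI[of _ ?m8]) (simp add: ready_def)
qed

definition askall :: "tm \<Rightarrow> prog" where
 "askall N = put 4 0 Stay ;; rewind 0 ;; rewind 2 ;; go 2 MoveRight ;; Loop (nz 2) (qblock N) ;; go 2 MoveLeft ;;
   Cond (sees 1 2) (put 4 1 Stay) (put 4 0 Stay) ;; Loop (nz 1) (pop 1)"

text \<open>The separator at the end closes the last block, so that every block is followed by a
  3.\<close>

definition blocks :: "bits list \<Rightarrow> nat list" where
 "blocks bs = concat (map (\<lambda>b. 3 # map sym b) bs) @ [3]"

lemma blocks_props:
 assumes "\<forall>b\<in>set bs. length b = B"
 shows "length (blocks bs) = length bs * Suc B + 1" "0 \<notin> set (blocks bs)"
  "j < length bs \<Longrightarrow> k < B \<Longrightarrow> cells (blocks bs) (2 + int (j * Suc B) + int k) = sym (bs ! j ! k)"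
  "j < length bs \<Longrightarrow> cells (blocks bs) (2 + int (j * Suc B) + int B) = 3"
proof -
 let ?r = "map (\<lambda>b. 3 # map sym b) bs"
 have r: "\<forall>v\<in>set ?r. length v = Suc B" using assms by auto
 note lc = length_concat_rows[OF r]
 show l: "length (blocks bs) = length bs * Suc B + 1" using lc by (simp add: blocks_def)
 show "0 \<notin> set (blocks bs)" by (auto simp: blocks_def sym_def)
 have n: "blocks bs ! (j * Suc B + i) = ?r ! j ! i" if "j < length bs" "i < Suc B" for i j
 proof -
  have "j * Suc B + i < length bs * Suc B"
   using mult_le_mono1[of "Suc j" "length bs" "Suc B"] that by simp
  then show ?thesis using nth_concat_rows[OF r that(2), of j] lc that by (simp add: blocks_def nth_append)
 qed
 have le: "j * Suc B + Suc B \<le> length bs * Suc B" if "j < length bs" for j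
  using mult_le_mono1[of "Suc j" "length bs" "Suc B"] that by simp
 show "cells (blocks bs) (2 + int (j * Suc B) + int k) = sym (bs ! j ! k)" if "j < length bs" "k < B"
 proof -
  have "cells (blocks bs) (1 + int (j * Suc B + Suc k)) = blocks bs ! (j * Suc B + Suc k)"
   using le[OF that(1)] that(2) l by (intro cells_nth) linarith
  moreover have "1 + int (j * Suc B + Suc k) = 2 + int (j * Suc B) + int k" by simp
  ultimately have "cells (blocks bs) (2 + int (j * Suc B) + int k) = blocks bs ! (j * Suc B + Suc k)"
   by (simp only:)
  then show ?thesis using n[OF that(1), of "Suc k"] that assms by (simp del: of_nat_mult)
 qed
 show "cells (blocks bs) (2 + int (j * Suc B) + int B) = 3" if "j < length bs"
 proof -
  have b: "1 + int (j * Suc B + Suc B) = 2 + int (j * Suc B) + int B" by simp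
  have c: "cells (blocks bs) (1 + int (j * Suc B + Suc B)) = blocks bs ! (j * Suc B + Suc B)"
   using le[OF that(1)] l by (intro cells_nth) linarith
  show ?thesis
  proof (cases "Suc j = length bs")
   case True
   then have "j * Suc B + Suc B = length bs * Suc B" by (metis add.commute mult_Suc)
   then have "blocks bs ! (j * Suc B + Suc B) = 3" using lc by (simp add: blocks_def nth_append)
   then show ?thesis using b c by (simp only:)
  next
   case False
   then have "Suc j < length bs" using that by simp
   have "Suc j * Suc B + 0 = j * Suc B + Suc B" by simp
   with n[OF \<open>Suc j < length bs\<close>, of 0] have "blocks bs ! (j * Suc B + Suc B) = ?r ! Suc j ! 0"
    by (simp only: zero_less_Suc)
   then have "blocks bs ! (j * Suc B + Suc B) = 3" using \<open>Suc j < length bs\<close> by simp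
   then show ?thesis using b c by (simp only:)
  qed
 qed
qed

definition votes :: "(bits \<Rightarrow> bits) \<Rightarrow> bits list \<Rightarrow> int" where
 "votes out bs = (\<Sum>b\<leftarrow>bs. if out b = [True] then 1 else - 1)"

definition block_time :: "tm \<Rightarrow> nat \<Rightarrow> nat" where
 "block_time N k = (16 + 8 * num_work N) * k + 12 * num_work N + 60"

lemma run_askall:
 assumes N: "wf_tm N" and qs: "set qs \<subseteq> {1..5}" "qs \<noteq> []"
  and bs: "\<forall>b\<in>set bs. length b = B" "0 < B"
  and out: "\<And>b. b \<in> set bs \<Longrightarrow> runs N ((!) b) (qbits qs) B (out b)"
  and m: "ready N m" "tp m 0 = stk qs" "tp m 1 = un 0" "tp m 2 = stk (blocks bs)"
 shows "\<exists>m'. run w [] (askall N) (length bs * (block_time N (length qs + B) + 2 * B + 5) + 2 * length qs + 20) m m' \<and>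
   ready N m' \<and> tp m' 0 = (cells qs, 1) \<and> tp m' 1 = un 0 \<and> (rd m' 4 = 1 \<longleftrightarrow> votes out bs > 0) \<and>
   tp m' 2 = stk (blocks bs) \<and> ot m' = ot m \<and> tp m' 3 = tp m 3"
proof -
 note bp = blocks_props[OF bs(1)]
 let ?ks = "blocks bs" and ?n = "length bs"
 have nz: "0 \<notin> set qs" using qs(1) by auto
 let ?m0 = "upd 4 (write_tape (0, Stay) (tp m 4)) m"
 have r0: "run w [] (put 4 0 Stay) 1 m ?m0" by (rule run_put)
 let ?m1 = "upd 0 (cells qs, 1) ?m0"
 have r1: "run w [] (rewind 0) (2 * length qs + 2) ?m0 ?m1"
  using run_rewind[of ?m0 0 qs "int (length qs)" w "[]"] nz m by (simp add: stk_def)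
 let ?m2 = "upd 2 (cells ?ks, 1) ?m1"
 have r2: "run w [] (rewind 2) (2 * length ?ks + 2) ?m1 ?m2"
  using run_rewind[of ?m1 2 ?ks "int (length ?ks)" w "[]"] bp(2) m by (simp add: stk_def)
 let ?m3 = "upd 2 (cells ?ks, 2) ?m2"
 have r3: "run w [] (go 2 MoveRight) 1 ?m2 ?m3"
  using run_go[of ?m2 2 "cells ?ks" 1 w "[]" MoveRight] by simp
 define I where "I i m' \<longleftrightarrow> ready N m' \<and> tp m' 0 = (cells qs, 1) \<and> tp m' 1 = signed (votes out (take i bs)) \<and>
   rd m' 4 = 0 \<and> tp m' 2 = (cells ?ks, 2 + int (i * Suc B)) \<and> ot m' = ot m \<and> tp m' 3 = tp m 3" for i m'
 have I0: "I 0 ?m3"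
  using m by (auto simp: I_def votes_def signed_0 ready_def rd_def write_tape_def)
 have step: "(\<forall>c. observe w [] m' c (nz 2)) \<and> (\<exists>m''. run w [] (qblock N) (block_time N (length qs + B)) m' m'' \<and> I (Suc i) m'')"
  if i: "i < ?n" and I: "I i m'" for i m'
 proof -
  have "cells ?ks (2 + int (i * Suc B)) \<noteq> 0" using bp(3)[OF i bs(2)] by simp
  moreover have "\<exists>m''. run w [] (qblock N) (block_time N (length qs + B)) m' m'' \<and> I (Suc i) m''"
  proof -
   have b: "bs ! i \<in> set bs" using i by simp
   have bi: "\<forall>k<B. cells ?ks (2 + int (i * Suc B) + int k) = sym (bs ! i ! k)" using bp(3)[OF i] by blast
   have r: "ready N m'" "tp m' 0 = (cells qs, 1)" "tp m' 1 = signed (votes out (take i bs))" "rd m' 4 = 0"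
    "tp m' 2 = (cells ?ks, 2 + int (i * Suc B))" using I by (simp_all only: I_def)
   obtain m'' where m'': "run w [] (qblock N) (block_time N (length qs + B)) m' m''"
     "ready N m''" "tp m'' 0 = (cells qs, 1)" "tp m'' 1 = signed (votes out (take i bs) + (if out (bs ! i) = [True] then 1 else - 1))"
     "rd m'' 4 = 0" "tp m'' 2 = (cells ?ks, 2 + int (i * Suc B) + int B + 1)" "ot m'' = ot m'"
     "\<forall>j. j \<notin> {0, 1, 2, 4} \<longrightarrow> j < 10 \<longrightarrow> tp m'' j = tp m' j"
    using run_qblock[where w = w, OF N qs bi bp(4)[OF i] out[OF b] r, folded block_time_def] by (elim exE conjE) (rule that)
   moreover have "votes out (take (Suc i) bs) = votes out (take i bs) + (if out (bs ! i) = [True] then 1 else - 1)"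
    using i by (simp add: votes_def take_Suc_conv_app_nth)
   moreover have "2 + int (i * Suc B) + int B + 1 = 2 + int (Suc i * Suc B)" by simp
   ultimately have "I (Suc i) m''" using I unfolding I_def by simp
   with m''(1) show ?thesis by blast
  qed
  ultimately show ?thesis using I by (simp add: I_def rd_def)
 qed
 have fin': "\<not> observe w [] m' c (nz 2)" if "I ?n m'" for m' c
 proof -
  have e: "2 + int (?n * Suc B) = int (length ?ks) + 1" using bp(1) by simp
  have "tp m' 2 = (cells ?ks, int (length ?ks) + 1)" using that unfolding I_def e take_all_iff[THEN iffD2, OF order_refl] by blast
  then show ?thesis by (simp add: rd_def)
 qed
 have loop: "\<exists>m4. run w [] (Loop (nz 2) (qblock N)) (?n * Suc (block_time N (length qs + B)) + 1) ?m3 m4 \<and> I ?n m4"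
 proof (rule run_loop_rel[where I = I])
  show "I (?n - ?n) ?m3" using I0 by simp
 qed (fact step, fact fin', simp)
 obtain m4 where r4: "run w [] (Loop (nz 2) (qblock N)) (?n * Suc (block_time N (length qs + B)) + 1) ?m3 m4" and I4: "I ?n m4"
  using loop by blast
 note I4' = I4[unfolded I_def]
 let ?v = "votes out bs"
 let ?m5 = "upd 2 (stk ?ks) m4"
 have r5: "run w [] (go 2 MoveLeft) 1 m4 ?m5"
  using run_go[of m4 2 "cells ?ks" "2 + int (?n * Suc B)" w "[]" MoveLeft] I4' bp(1) by (simp add: stk_def)
 have t1: "tp ?m5 1 = signed ?v" using I4' by simp
 have rd1: "rd ?m5 1 = 2 \<longleftrightarrow> ?v > 0" using rd_signed[OF t1] by auto
 let ?a = "if ?v > 0 then 1 else 0 :: nat"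
 let ?m6 = "upd 4 (write_tape (?a, Stay) (tp ?m5 4)) ?m5"
 have r6: "run w [] (Cond (sees 1 2) (put 4 1 Stay) (put 4 0 Stay)) (Suc 1) ?m5 ?m6"
 proof (cases "?v > 0")
  case True
  then show ?thesis using run_put[of w "[]" 4 1 Stay ?m5] rd1 by (intro run_CondT) auto
 next
  case False
  then show ?thesis using run_put[of w "[]" 4 0 Stay ?m5] rd1 by (intro run_CondF) auto
 qed
 let ?b = "if ?v > 0 then 2 else 1 :: nat" and ?k = "nat \<bar>?v\<bar>"
 let ?M = "\<lambda>i. upd 1 (stk (replicate (?k - i) ?b)) ?m6"
 have r7: "run w [] (Loop (nz 1) (pop 1)) (?k * Suc 1 + 1) ?m6 (?M ?k)"
 proof (rule run_for[where M = ?M])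
  show "?m6 = ?M 0" by (rule upd_same[symmetric]) (use I4' in \<open>simp add: signed_def\<close>)
  fix i assume i: "i < ?k"
  have "replicate (?k - i) ?b = replicate (?k - Suc i) ?b @ [?b]"
   unfolding Suc_diff_Suc[OF i, symmetric] replicate_append_same by simp
  then have t: "tp (?M i) 1 = stk (replicate (?k - Suc i) ?b @ [?b])" by simp
  show "observe w [] (?M i) c (nz 1)" for c by (subst rd_stk[OF t]) simp
  show "run w [] (pop 1) 1 (?M i) (?M (Suc i))" using run_pop[OF t] by simp
 next
  have t: "tp (?M ?k) 1 = stk []" by simp
  show "\<not> observe w [] (?M ?k) c (nz 1)" for c by (subst rd_stk[OF t]) simp
 qed simp
 have "\<bar>votes out cs\<bar> \<le> int (length cs)" for cs unfolding votes_def by (induction cs) auto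
 then have "\<bar>?v\<bar> \<le> int ?n" .
 then have k: "?k \<le> ?n" by simp
 have "run w [] (askall N) (1 + ((2 * length qs + 2) + ((2 * length ?ks + 2) + (1 +
  ((?n * Suc (block_time N (length qs + B)) + 1) + (1 + (Suc 1 + (?k * Suc 1 + 1)))))))) m (?M ?k)"
  unfolding askall_def
  by (rule run_Seq[OF r0 run_Seq[OF r1 run_Seq[OF r2 run_Seq[OF r3 run_Seq[OF r4 run_Seq[OF r5 run_Seq[OF r6 r7]]]]]]])
 then have run: "run w [] (askall N) (?n * (block_time N (length qs + B) + 2 * B + 5) + 2 * length qs + 20) m (?M ?k)"
 proof (rule run_mono)
  have "1 + ((2 * l + 2) + ((2 * (n * Suc B + 1) + 2) + (1 + ((n * Suc b + 1) + (1 + (Suc 1 + (i * Suc 1 + 1)))))))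
   \<le> n * (b + 2 * B + 5) + 2 * l + 20" if "i \<le> n" for l n i b :: nat
   using that by (simp add: algebra_simps)
  from this[OF k] show "1 + ((2 * length qs + 2) + ((2 * length ?ks + 2) + (1 +
  ((?n * Suc (block_time N (length qs + B)) + 1) + (1 + (Suc 1 + (?k * Suc 1 + 1)))))))
   \<le> ?n * (block_time N (length qs + B) + 2 * B + 5) + 2 * length qs + 20" unfolding bp(1) .
 qed
 have "ready N (?M ?k)" using I4' by (simp add: ready_def rd_def)
 moreover have "rd (?M ?k) 4 = 1 \<longleftrightarrow> ?v > 0" by (simp add: rd_def write_tape_def)
 moreover have "tp (?M ?k) 0 = (cells qs, 1)" "tp (?M ?k) 1 = un 0" "tp (?M ?k) 2 = stk ?ks" "ot (?M ?k) = ot m"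
  "tp (?M ?k) 3 = tp m 3" using I4' by (simp_all add: un_0 del: upd_same)
 ultimately show ?thesis using run by blast
qed

text \<open>
 Nodes of the binary tree are paths from the root; the search is in preorder, and \<open>backtrack\<close> is
 the next node outside the subtree.
\<close>

definition strip :: "bits \<Rightarrow> bits" where
 "strip z = rev (dropWhile id (rev z))"

lemma strip_simps [simp]: "strip [] = []" "strip (z @ [True]) = strip z" "strip (z @ [False]) = z @ [False]"
 by (simp_all add: strip_def)

definition backtrack :: "bits \<Rightarrow> bits" where
 "backtrack z = (if strip z = [] then [] else butlast (strip z) @ [True])"

lemma backtrack_simps [simp]:
 "backtrack [] = []" "backtrack (z @ [True]) = backtrack z" "backtrack (z @ [False]) = z @ [True]"
 by (simp_all add: backtrack_def)

lemma strip_cases: "strip z = [] \<or> (\<exists>y. strip z = y @ [False])"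
proof (induction z rule: rev_induct)
 case (snoc b z)
 then show ?case by (cases b) auto
qed simp

lemma length_strip: "length (strip z) \<le> length z"
proof (induction z rule: rev_induct)
 case (snoc b z)
 then show ?case by (cases b) auto
qed simp

lemma length_backtrack: "length (backtrack z) = length (strip z)"
 using strip_cases[of z] by (auto simp: backtrack_def)

definition dfs_step :: "(bits \<Rightarrow> bool) \<Rightarrow> nat \<Rightarrow> bits \<Rightarrow> bits" where
 "dfs_step acc L z = (if acc z \<and> length z < L then z @ [False] else backtrack z)"

lemma length_dfs_step: "length z \<le> L \<Longrightarrow> length (dfs_step acc L z) \<le> L"
 using length_backtrack[of z] length_strip[of z] by (auto simp: dfs_step_def)

definition nsym :: "bool \<Rightarrow> nat" where
 "nsym b = (if b then 5 else 4)"

text \<open>The padding is room in which the node grows in place. As it is read as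
  \<open>False\<close>, the tape always shows the query of the current node.\<close>

definition qtape :: "nat list \<Rightarrow> nat \<Rightarrow> bits \<Rightarrow> nat list" where
 "qtape bs L z = bs @ map nsym z @ replicate (L - length z) 3"

definition node_pos :: "nat list \<Rightarrow> nat \<Rightarrow> bits \<Rightarrow> tape" where
 "node_pos bs L z = (cells (qtape bs L z), int (length bs + length z))"

lemma qtape_props:
 assumes "set bs \<subseteq> {1, 2}" "length z \<le> L"
 shows "set (qtape bs L z) \<subseteq> {1..5}" "0 \<notin> set (qtape bs L z)" "length (qtape bs L z) = length bs + L"
 using assms by (auto simp: qtape_def nsym_def)

definition retreat :: prog where
 "retreat = Loop (sees 0 5) (put 0 3 MoveLeft) ;; Cond (sees 0 4) (put 0 5 Stay) skip"

text \<open>The machine does not know the depth: the cell behind the node holds padding exactly if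
  the node is above the last level.\<close>

definition dfs :: prog where
 "dfs = unwind 0 ;; scanl (\<lambda>a. a = 3) 0 ;;
   Cond (sees 4 1) (go 0 MoveRight ;; Cond (sees 0 3) (put 0 4 Stay) (go 0 MoveLeft ;; retreat)) retreat ;; unwind 0"

lemma cells_qtape:
 assumes "length z \<le> L"
 shows "0 < length bs \<Longrightarrow> cells (qtape bs L z) (int (length bs + length z)) = (if z = [] then last bs else nsym (last z))"
  "cells (qtape bs L z) (int (length bs + length z) + 1) = (if length z < L then 3 else 0)"
  "int (length bs + length z) < k \<Longrightarrow> k \<le> int (length bs + L) \<Longrightarrow> cells (qtape bs L z) k = 3"
proof -
 show "cells (qtape bs L z) (int (length bs + length z)) = (if z = [] then last bs else nsym (last z))" if "0 < length bs"
  using cells_nth[of "length bs + length z - 1" "qtape bs L z"] that assms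
  by (cases z rule: rev_cases) (auto simp: qtape_def nth_append last_conv_nth algebra_simps trans_less_add2)
 show 3: "int (length bs + length z) < k \<Longrightarrow> k \<le> int (length bs + L) \<Longrightarrow> cells (qtape bs L z) k = 3" for k
  using assms by (auto simp: cells_def qtape_def nth_append)
 show "cells (qtape bs L z) (int (length bs + length z) + 1) = (if length z < L then 3 else 0)"
  using 3[of "int (length bs + length z) + 1"] assms by (cases "length z < L") (simp_all add: cells_def qtape_def)
qed

lemma qtape_snoc:
 assumes "length z < L"
 shows "(cells (qtape bs L (z @ [b])))(int (length bs + Suc (length z)) := nsym b') = cells (qtape bs L (z @ [b']))"
  "(cells (qtape bs L (z @ [b])))(int (length bs + Suc (length z)) := 3) = cells (qtape bs L z)"
  "(cells (qtape bs L z))(int (length bs + Suc (length z)) := nsym b') = cells (qtape bs L (z @ [b']))"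
proof -
 have r: "replicate (L - length z) (3::nat) = 3 # replicate (L - Suc (length z)) 3"
  using assms by (simp flip: replicate_Suc add: Suc_diff_Suc)
 have u: "(cells (qtape bs L y))(int (length bs + Suc (length z)) := a) = cells ((qtape bs L y)[length bs + length z := a])"
  if "length y \<le> L" for y a
  using cells_update[of "length bs + length z" "qtape bs L y" a] that assms by (simp add: qtape_def algebra_simps)
 show "(cells (qtape bs L (z @ [b])))(int (length bs + Suc (length z)) := nsym b') = cells (qtape bs L (z @ [b']))"
  "(cells (qtape bs L (z @ [b])))(int (length bs + Suc (length z)) := 3) = cells (qtape bs L z)"
  "(cells (qtape bs L z))(int (length bs + Suc (length z)) := nsym b') = cells (qtape bs L (z @ [b']))"
  using assms by (subst u; simp add: qtape_def list_update_append r)+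
qed

lemma run_retreat:
 assumes "tp m 0 = node_pos bs L z" "length z \<le> L" "set bs \<subseteq> {1, 2}" "bs \<noteq> []"
 shows "run w \<pi> retreat (2 * L + 3) m (upd 0 (node_pos bs L (backtrack z)) m)"
proof -
 have "last bs \<in> {1, 2}" using assms(3,4) last_in_set[of bs] by blast
 then have bl: "last bs \<noteq> 5" "last bs \<noteq> 4" by auto
 have "run w \<pi> (Loop (sees 0 5) (put 0 3 MoveLeft)) (2 * length z + 1) m (upd 0 (node_pos bs L (strip z)) m)"
  using assms(1,2)
 proof (induction z arbitrary: m rule: rev_induct)
  case Nil
  then have "rd m 0 = last bs" using cells_qtape(1)[of "[]" L bs] assms(4) by (simp add: rd_def node_pos_def)
  then have "run w \<pi> (Loop (sees 0 5) (put 0 3 MoveLeft)) 1 m m" using bl by (intro run_LoopF) simp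
  moreover have "upd 0 (node_pos bs L []) m = m" by (rule upd_same) (fact Nil(1))
  ultimately show ?case by (simp only: strip_simps) simp
 next
  case (snoc b z)
  then have r: "rd m 0 = nsym b" using cells_qtape(1)[of "z @ [b]" L bs] assms(4) by (simp add: rd_def node_pos_def)
  show ?case
  proof (cases b)
   case True
   have "write_tape (3, MoveLeft) (tp m 0) = node_pos bs L z"
    using snoc.prems qtape_snoc(2)[of z L bs b] by (simp add: node_pos_def write_tape_def)
   then have 1: "run w \<pi> (put 0 3 MoveLeft) 1 m (upd 0 (node_pos bs L z) m)" using run_put[of w \<pi> 0 3 MoveLeft m] by simp
   have "run w \<pi> (Loop (sees 0 5) (put 0 3 MoveLeft)) (2 * length z + 1)
    (upd 0 (node_pos bs L z) m) (upd 0 (node_pos bs L (strip z)) (upd 0 (node_pos bs L z) m))"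
    by (rule snoc.IH) (use snoc.prems in simp_all)
   from run_LoopT[OF _ 1 this] show ?thesis using True r by (simp add: nsym_def fun_upd_def cong: if_cong)
  next
   case False
   then have "run w \<pi> (Loop (sees 0 5) (put 0 3 MoveLeft)) (2 * length (z @ [b]) + 1) m m"
    using r by (intro run_mono[OF run_LoopF]) (simp_all add: nsym_def)
   moreover have "upd 0 (node_pos bs L (strip (z @ [b]))) m = m" by (rule upd_same) (use False snoc.prems in simp)
   ultimately show ?thesis by (simp only:)
  qed
 qed
 moreover let ?m1 = "upd 0 (node_pos bs L (strip z)) m"
 have ls: "length (strip z) \<le> L" using length_strip[of z] assms(2) by simp
 have "run w \<pi> (Cond (sees 0 4) (put 0 5 Stay) skip) (Suc 1) ?m1 (upd 0 (node_pos bs L (backtrack z)) m)"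
 proof (cases "strip z = []")
  case True
  then have "rd ?m1 0 \<noteq> 4" using cells_qtape(1)[of "[]" L bs] assms(4) bl by (simp add: rd_def node_pos_def)
  then show ?thesis using True run_skip[of w \<pi> ?m1] by (intro run_CondF) (simp_all add: backtrack_def)
 next
  case False
  then obtain y where y: "strip z = y @ [False]" using strip_cases by blast
  have "rd ?m1 0 = 4" using cells_qtape(1)[OF ls, of bs] y assms(4) by (simp add: rd_def node_pos_def nsym_def)
  moreover have "write_tape (5, Stay) (node_pos bs L (strip z)) = node_pos bs L (backtrack z)"
   using qtape_snoc(1)[of y L bs False True] ls y by (simp add: backtrack_def node_pos_def write_tape_def nsym_def)
  ultimately show ?thesis using run_put[of w \<pi> 0 5 Stay ?m1] by (intro run_CondT) simp_all
 qed
 ultimately show ?thesis unfolding retreat_def by (intro run_mono[OF run_Seq]) (use assms(2) in auto)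
qed

lemma run_dfs:
 assumes "tp m 0 = (cells (qtape bs L z), 1)" "length z \<le> L" "set bs \<subseteq> {1, 2}" "bs \<noteq> []" "rd m 4 = 1 \<longleftrightarrow> acc z"
 shows "run w \<pi> dfs (4 * length bs + 8 * L + 20) m (upd 0 (stk (qtape bs L (dfs_step acc L z))) m)"
proof -
 note q = qtape_props[OF assms(3,2)] and c = cells_qtape[OF assms(2), of bs]
 let ?n = "int (length bs + length z)" and ?z = "dfs_step acc L z"
 let ?m1 = "upd 0 (stk (qtape bs L z)) m"
 have r1: "run w \<pi> (unwind 0) (2 * length (qtape bs L z) + 2) m ?m1"
  by (rule run_unwind) (use assms q in auto)
 let ?m2 = "upd 0 (node_pos bs L z) m"
 have nl: "cells (qtape bs L z) ?n \<noteq> 3"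
 proof -
  have "last bs \<in> {1, 2}" using assms(3,4) last_in_set[of bs] by blast
  then show ?thesis using c(1) assms(4) by (auto simp: nsym_def)
 qed
 have r2: "run w \<pi> (scanl (\<lambda>a. a = 3) 0) (nat (int (length bs + L) - ?n) * 2 + 1) ?m1 ?m2"
  using run_scanl[of ?m1 0 "cells (qtape bs L z)" "int (length bs + L)" ?n "\<lambda>a. a = 3" w \<pi>] c(3) nl q(3) assms(2)
  by (simp add: stk_def node_pos_def)
 have t2: "tp ?m2 0 = node_pos bs L z" by simp
 let ?m3 = "upd 0 (node_pos bs L ?z) m"
 have bk: "run w \<pi> retreat (2 * L + 3) ?m2 (upd 0 (node_pos bs L (backtrack z)) m)"
  using run_retreat[OF t2 assms(2-4)] by simp
 have r3: "run w \<pi> (Cond (sees 4 1) (go 0 MoveRight ;; Cond (sees 0 3) (put 0 4 Stay) (go 0 MoveLeft ;; retreat)) retreat)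
  (Suc (1 + Suc (1 + (2 * L + 3)))) ?m2 ?m3"
 proof (cases "acc z")
  case False
  then have "run w \<pi> retreat (1 + Suc (1 + (2 * L + 3))) ?m2 ?m3" by (intro run_mono[OF bk[THEN back_subst[of "run w \<pi> retreat _ _"]]]) (simp_all add: dfs_step_def)
  then show ?thesis by (intro run_CondF) (use False assms(5) in \<open>simp add: rd_def\<close>)
 next
  case True
  let ?m4 = "upd 0 (cells (qtape bs L z), ?n + 1) m"
  have a: "run w \<pi> (go 0 MoveRight) 1 ?m2 ?m4" using run_go[of ?m2 0 "cells (qtape bs L z)" ?n w \<pi> MoveRight] by (simp add: node_pos_def)
  have "run w \<pi> (Cond (sees 0 3) (put 0 4 Stay) (go 0 MoveLeft ;; retreat)) (Suc (1 + (2 * L + 3))) ?m4 ?m3"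
  proof (cases "length z < L")
   case lt: True
   have "write_tape (4, Stay) (tp ?m4 0) = node_pos bs L ?z"
    using qtape_snoc(3)[OF lt, of bs False] lt True by (simp add: dfs_step_def node_pos_def write_tape_def nsym_def ac_simps)
   then have "run w \<pi> (put 0 4 Stay) 1 ?m4 ?m3" using run_put[of w \<pi> 0 4 Stay ?m4] by simp
   then have "run w \<pi> (put 0 4 Stay) (1 + (2 * L + 3)) ?m4 ?m3" by (rule run_mono) simp
   then show ?thesis by (intro run_CondT) (use c(2) lt in \<open>simp add: rd_def\<close>)
  next
   case False
   have "run w \<pi> (go 0 MoveLeft) 1 ?m4 ?m2" using run_go[of ?m4 0 "cells (qtape bs L z)" "?n + 1" w \<pi> MoveLeft] by (simp add: node_pos_def)
   moreover have "?m3 = upd 0 (node_pos bs L (backtrack z)) m" using False by (simp add: dfs_step_def)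
   ultimately have "run w \<pi> (go 0 MoveLeft ;; retreat) (1 + (2 * L + 3)) ?m4 ?m3" using bk by (simp only: run_Seq)
   then show ?thesis by (intro run_CondF) (use c(2) False in \<open>simp add: rd_def\<close>)
  qed
  from run_Seq[OF a this] show ?thesis by (intro run_CondT) (use True assms(5) in \<open>simp_all add: rd_def\<close>)
 qed
 have lz: "length ?z \<le> L" using length_dfs_step[OF assms(2)] .
 note q' = qtape_props[OF assms(3) lz]
 have "1 \<le> int (length bs + length ?z)" using assms(4) by (cases bs) auto
 then have r4: "run w \<pi> (unwind 0) (2 * length (qtape bs L ?z) + 2) ?m3 (upd 0 (stk (qtape bs L ?z)) m)"
  using run_unwind[of ?m3 0 "qtape bs L ?z" "int (length bs + length ?z)" w \<pi>] q' assms(4) lz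
  by (simp add: node_pos_def)
 show ?thesis unfolding dfs_def
  by (rule run_mono[OF run_Seq[OF r1 run_Seq[OF r2 run_Seq[OF r3 r4]]]]) (use q(3) q'(3) assms(2) in simp)
qed

lemma inpseq_concat:
 assumes "inpseq w d p (concat bs)" "\<forall>b\<in>set bs. length b = B" "i < length bs"
 shows "inpseq w d (p + int (d * (i * B))) (bs ! i)"
proof -
 have "concat bs = concat (take i bs) @ bs ! i @ concat (drop (Suc i) bs)"
  by (metis assms(3) concat.simps(2) concat_append id_take_nth_drop)
 moreover have "length (concat (take i bs)) = i * B"
  using length_concat_rows[of "take i bs" B] assms(2,3) by (auto dest: in_set_takeD)
 ultimately show ?thesis using assms(1) by (simp add: inpseq_append)
qed

definition loadblock :: prog where
 "loadblock = push 2 3 ;; Loop (nz 9) (pop 9 ;; push 6 1 ;; pushf 2 bitsym ;; adv 2) ;; Loop (nz 6) (pop 6 ;; push 9 1)"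

lemma run_loadblock:
 assumes "tp m 2 = stk ks" "tp m 9 = un (length ys)" "tp m 6 = un 0" "inpseq w 2 (pin m) ys"
 shows "run w \<pi> loadblock (12 * length ys + 4) m
  (m\<lparr>pin := pin m + int (2 * length ys), tp := (tp m)(2 := stk (ks @ 3 # map sym ys))\<rparr>)"
proof -
 let ?n = "length ys"
 let ?m1 = "upd 2 (stk (ks @ [3])) m"
 have r1: "run w \<pi> (push 2 3) 2 m ?m1" by (rule run_push) (fact assms(1))
 let ?M = "\<lambda>i. m\<lparr>pin := pin m + int (2 * i), tp := (tp m)(9 := un (?n - i), 6 := un i, 2 := stk ((ks @ [3]) @ map sym (take i ys)))\<rparr>"
 have r2: "run w \<pi> (Loop (nz 9) (pop 9 ;; push 6 1 ;; pushf 2 bitsym ;; adv 2)) (?n * ((2 + (2 + 2)) + 2) + 1) ?m1 (?M ?n)"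
 proof (rule run_countdown[where M = ?M])
  show "?m1 = ?M 0" using assms by (cases m) (auto simp: fun_eq_iff)
  fix i assume i: "i < ?n"
  let ?a = "upd 9 (un (?n - Suc i)) (?M i)"
  let ?b = "upd 6 (un (Suc i)) ?a"
  let ?c = "upd 2 (stk (((ks @ [3]) @ map sym (take i ys)) @ [sym (ys ! i)])) ?b"
  have 1: "run w \<pi> (push 6 1) 2 ?a ?b" by (rule run_push_un) simp
  have 2: "run w \<pi> (pushf 2 bitsym) 2 ?b ?c"
  proof (rule run_pushf)
   show "observe w \<pi> (upd 2 t ?b) c' bitsym = sym (ys ! i)" for c' t
    using inpseq_nth[OF assms(4) i] by simp
  qed simp
  have "?c\<lparr>pin := pin ?c + int 2\<rparr> = ?M (Suc i)"
   using i by (auto simp: take_Suc_conv_app_nth fun_eq_iff)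
  with run_adv[of 2 w \<pi> ?c] have 3: "run w \<pi> (adv 2) 2 ?c (?M (Suc i))" by simp
  show "run w \<pi> (push 6 1 ;; pushf 2 bitsym ;; adv 2) (2 + (2 + 2)) ?a (?M (Suc i))"
   by (rule run_Seq[OF 1 run_Seq[OF 2 3]])
 qed simp_all
 let ?m4 = "m\<lparr>pin := pin m + int (2 * ?n), tp := (tp m)(2 := stk (ks @ 3 # map sym ys))\<rparr>"
 let ?N = "\<lambda>i. ?m4\<lparr>tp := (tp ?m4)(6 := un (?n - i), 9 := un i)\<rparr>"
 have r3: "run w \<pi> (Loop (nz 6) (pop 6 ;; push 9 1)) (?n * (2 + 2) + 1) (?M ?n) ?m4"
 proof (rule run_countdown[where M = ?N])
  fix i assume i: "i < ?n"
  have "run w \<pi> (push 9 1) 2 (upd 6 (un (?n - Suc i)) (?N i)) (upd 9 (un (Suc i)) (upd 6 (un (?n - Suc i)) (?N i)))"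
   by (rule run_push_un) simp
  moreover have "upd 9 (un (Suc i)) (upd 6 (un (?n - Suc i)) (?N i)) = ?N (Suc i)" by (auto simp: fun_eq_iff)
  ultimately show "run w \<pi> (push 9 1) 2 (upd 6 (un (?n - Suc i)) (?N i)) (?N (Suc i))" by (simp only:)
 next
  show "?M ?n = ?N 0" by (auto simp: fun_eq_iff)
  show "?m4 = ?N ?n" using assms by (auto simp: fun_eq_iff)
 qed simp
 show ?thesis unfolding loadblock_def by (rule run_mono[OF run_Seq[OF r1 run_Seq[OF r2 r3]]]) simp
qed

lemma run_loadblocks:
 assumes "tp m 2 = stk []" "tp m 8 = un (length bs)" "tp m 9 = un B" "tp m 6 = un 0" "inpseq w 2 (pin m) (concat bs)"
  "\<forall>b\<in>set bs. length b = B"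
 shows "run w \<pi> (Loop (nz 8) (pop 8 ;; loadblock) ;; push 2 3) (length bs * (12 * B + 6) + 3) m
  (m\<lparr>pin := pin m + int (2 * length (concat bs)), tp := (tp m)(2 := stk (blocks bs), 8 := un 0)\<rparr>)"
proof -
 let ?ks = "\<lambda>i. concat (map (\<lambda>b. 3 # map sym b) (take i bs))"
 let ?M = "\<lambda>i. m\<lparr>pin := pin m + int (2 * (i * B)), tp := (tp m)(2 := stk (?ks i), 8 := un (length bs - i))\<rparr>"
 have r1: "run w \<pi> (Loop (nz 8) (pop 8 ;; loadblock)) (length bs * ((12 * B + 4) + 2) + 1) m (?M (length bs))"
 proof (rule run_countdown[where M = ?M])
  show "m = ?M 0" using assms by (cases m) (auto simp: fun_eq_iff)
  fix i assume i: "i < length bs"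
  let ?a = "upd 8 (un (length bs - Suc i)) (?M i)"
  have b: "length (bs ! i) = B" using assms(6) i by simp
  have iq: "inpseq w 2 (pin ?a) (bs ! i)" using inpseq_concat[OF assms(5,6) i] by simp
  have "run w \<pi> loadblock (12 * length (bs ! i) + 4) ?a
   (?a\<lparr>pin := pin ?a + int (2 * length (bs ! i)), tp := (tp ?a)(2 := stk (?ks i @ 3 # map sym (bs ! i)))\<rparr>)"
   by (rule run_loadblock[OF _ _ _ iq]) (use assms b in simp_all)
  moreover have "?a\<lparr>pin := pin ?a + int (2 * length (bs ! i)), tp := (tp ?a)(2 := stk (?ks i @ 3 # map sym (bs ! i)))\<rparr> = ?M (Suc i)"
   using i b by (auto simp: take_Suc_conv_app_nth algebra_simps fun_eq_iff)
  ultimately show "run w \<pi> loadblock (12 * B + 4) ?a (?M (Suc i))" using b by (simp only:)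
 qed simp_all
 have l: "length (concat bs) = length bs * B" using length_concat_rows assms(6) .
 have "run w \<pi> (push 2 3) 2 (?M (length bs)) (upd 2 (stk (?ks (length bs) @ [3])) (?M (length bs)))"
  by (rule run_push) simp
 moreover have "upd 2 (stk (?ks (length bs) @ [3])) (?M (length bs)) =
  m\<lparr>pin := pin m + int (2 * length (concat bs)), tp := (tp m)(2 := stk (blocks bs), 8 := un 0)\<rparr>"
  unfolding l by (auto simp: blocks_def fun_eq_iff)
 ultimately show ?thesis using run_Seq[OF r1] by (intro run_mono[OF run_Seq[OF r1]]) auto
qed

lemma run_find:
 assumes "d = 1 \<or> d = 2" "\<And>k. k < n \<Longrightarrow> cell w (pin m + int (d * k)) = Some False" "cell w (pin m + int (d * n)) = Some True"
 shows "run w \<pi> (Loop unmarked (adv d)) (3 * n + 1) m (m\<lparr>pin := pin m + int (d * n)\<rparr>)"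
proof -
 let ?M = "\<lambda>i. m\<lparr>pin := pin m + int (d * i)\<rparr>"
 have "run w \<pi> (Loop unmarked (adv d)) (n * Suc 2 + 1) m (?M n)"
 proof (rule run_for[where M = ?M])
  fix i assume "i < n"
  show "run w \<pi> (adv d) 2 (?M i) (?M (Suc i))" using run_adv[OF assms(1), of w \<pi> "?M i"] by (simp add: algebra_simps)
 qed (use assms in auto)
 from run_mono[OF this] show ?thesis by simp
qed

definition pairing :: prog where
 "pairing = Loop (nz 4) (push 0 1 ;; pushf 0 (\<lambda>c i m s. s 4) ;; go 4 MoveRight) ;; push 0 2"

lemma run_pairing:
 assumes "tp m 0 = stk []" "tp m 4 = (cells (map sym v), 1)"
 shows "\<exists>x. run w \<pi> pairing (6 * length v + 3) m (m\<lparr>tp := (tp m)(0 := stk (map sym (encode_pair v [])), 4 := x)\<rparr>)"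
proof -
 let ?q = "\<lambda>i. concat (map (\<lambda>b. [1, sym b]) (take i v))"
 let ?M = "\<lambda>i. m\<lparr>tp := (tp m)(0 := stk (?q i), 4 := (cells (map sym v), 1 + int i))\<rparr>"
 have r1: "run w \<pi> (Loop (nz 4) (push 0 1 ;; pushf 0 (\<lambda>c i m s. s 4) ;; go 4 MoveRight)) (length v * Suc (2 + (2 + 1)) + 1) m (?M (length v))"
 proof (rule run_for[where M = ?M])
  show "m = ?M 0" using assms by (cases m) (auto simp: fun_eq_iff)
  fix i assume i: "i < length v"
  have c: "cells (map sym v) (1 + int i) = sym (v ! i)" using cells_nth[of i "map sym v"] i by simp
  show "observe w \<pi> (?M i) c' (nz 4)" for c' using c by (simp add: rd_def sym_def)
  let ?a = "upd 0 (stk (?q i @ [1])) (?M i)"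
  let ?b = "upd 0 (stk ((?q i @ [1]) @ [sym (v ! i)])) ?a"
  have 1: "run w \<pi> (push 0 1) 2 (?M i) ?a" by (rule run_push) simp
  have 2: "run w \<pi> (pushf 0 (\<lambda>c i m s. s 4)) 2 ?a ?b" by (rule run_pushf) (use c in \<open>simp_all add: rd_def\<close>)
  have "upd 4 (cells (map sym v), 1 + int i + 1) ?b = ?M (Suc i)"
   using i by (auto simp: take_Suc_conv_app_nth fun_eq_iff)
  with run_go[of ?b 4 "cells (map sym v)" "1 + int i" w \<pi> MoveRight]
  have 3: "run w \<pi> (go 4 MoveRight) 1 ?b (?M (Suc i))" by simp
  show "run w \<pi> (push 0 1 ;; pushf 0 (\<lambda>c i m s. s 4) ;; go 4 MoveRight) (2 + (2 + 1)) (?M i) (?M (Suc i))"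
   by (rule run_Seq[OF 1 run_Seq[OF 2 3]])
 next
  show "\<not> observe w \<pi> (?M (length v)) c' (nz 4)" for c' by (simp add: rd_def cells_def)
 qed simp
 have e: "?q (length v) @ [2] = map sym (encode_pair v [])"
  by (simp add: encode_pair_def map_concat comp_def sym_def)
 have "run w \<pi> (push 0 2) 2 (?M (length v)) (upd 0 (stk (?q (length v) @ [2])) (?M (length v)))" by (rule run_push) simp
 from run_Seq[OF r1 this, unfolded e] have "run w \<pi> pairing (length v * Suc (2 + (2 + 1)) + 1 + 2) m
  (m\<lparr>tp := (tp m)(0 := stk (map sym (encode_pair v [])), 4 := (cells (map sym v), 1 + int (length v)))\<rparr>)"
  unfolding pairing_def by (simp add: fun_upd_twist)
 then have "run w \<pi> pairing (6 * length v + 3) m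
  (m\<lparr>tp := (tp m)(0 := stk (map sym (encode_pair v [])), 4 := (cells (map sym v), 1 + int (length v)))\<rparr>)"
  by (rule run_mono) simp
 then show ?thesis by blast
qed

lemma run_pads:
 assumes "tp m 0 = stk qs" "tp m 7 = un n"
 shows "run w \<pi> (Loop (nz 7) (pop 7 ;; push 0 3)) (4 * n + 1) m
  (m\<lparr>tp := (tp m)(0 := stk (qs @ replicate n 3), 7 := un 0)\<rparr>)"
proof -
 let ?M = "\<lambda>i. m\<lparr>tp := (tp m)(0 := stk (qs @ replicate i 3), 7 := un (n - i))\<rparr>"
 have "run w \<pi> (Loop (nz 7) (pop 7 ;; push 0 3)) (n * (2 + 2) + 1) m (?M n)"
 proof (rule run_countdown[where M = ?M])
  show "m = ?M 0" using assms by (cases m) (auto simp: fun_eq_iff)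
  fix i assume i: "i < n"
  have "run w \<pi> (push 0 3) 2 (upd 7 (un (n - Suc i)) (?M i)) (upd 0 (stk ((qs @ replicate i 3) @ [3])) (upd 7 (un (n - Suc i)) (?M i)))"
   by (rule run_push) simp
  moreover have "upd 0 (stk ((qs @ replicate i 3) @ [3])) (upd 7 (un (n - Suc i)) (?M i)) = ?M (Suc i)"
   by (auto simp: fun_eq_iff replicate_append_same)
  ultimately show "run w \<pi> (push 0 3) 2 (upd 7 (un (n - Suc i)) (?M i)) (?M (Suc i))" by (simp only:)
 qed simp_all
 from run_mono[OF this] show ?thesis by simp
qed

definition report :: prog where
 "report = Loop (nz 0) (Cond (\<lambda>c i m s. 4 \<le> s 0) (emitf (sees 0 5)) skip ;; go 0 MoveRight)"

lemma run_report:
 assumes "tp m 0 = (cells qs, 1)" "0 \<notin> set qs"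
 shows "\<exists>m'. run w \<pi> report (4 * length qs + 1) m m' \<and> ot m' = ot m @ map (\<lambda>a. a = 5) (filter (\<lambda>a. 4 \<le> a) qs)"
proof -
 let ?M = "\<lambda>i. m\<lparr>ot := ot m @ map (\<lambda>a. a = 5) (filter (\<lambda>a. 4 \<le> a) (take i qs)), tp := (tp m)(0 := (cells qs, 1 + int i))\<rparr>"
 have "run w \<pi> report (length qs * Suc (2 + 1) + 1) m (?M (length qs))" unfolding report_def
 proof (rule run_for[where M = ?M])
  show "m = ?M 0" using assms by (cases m) (auto simp: fun_eq_iff)
  fix i assume i: "i < length qs"
  have c: "cells qs (1 + int i) = qs ! i" using cells_nth[OF i] .
  have "qs ! i \<noteq> 0" using assms(2) i by (metis nth_mem)
  then show "observe w \<pi> (?M i) c' (nz 0)" for c' using c by (simp add: rd_def)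
  let ?a = "(?M (Suc i))\<lparr>tp := tp (?M i)\<rparr>"
  have 1: "run w \<pi> (Cond (\<lambda>c i m s. 4 \<le> s 0) (emitf (sees 0 5)) skip) (Suc 1) (?M i) ?a"
  proof (cases "4 \<le> qs ! i")
   case True
   have "run w \<pi> (emitf (sees 0 5)) 1 (?M i) ?a"
    by (rule run_emitf[where b = "qs ! i = 5"]) (use i True c in \<open>simp_all add: rd_def take_Suc_conv_app_nth\<close>)
   then show ?thesis using True c by (intro run_CondT) (simp_all add: rd_def)
  next
   case False
   then have "?a = ?M i" using i by (simp add: take_Suc_conv_app_nth)
   then have "run w \<pi> skip 1 (?M i) ?a" using run_skip by simp
   then show ?thesis using False c by (intro run_CondF) (simp_all add: rd_def)
  qed
  have "upd 0 (cells qs, 1 + int i + 1) ?a = ?M (Suc i)" by (auto simp: fun_eq_iff)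
  with run_go[of ?a 0 "cells qs" "1 + int i" w \<pi> MoveRight]
  have 2: "run w \<pi> (go 0 MoveRight) 1 ?a (?M (Suc i))" by simp
  have "run w \<pi> (Cond (\<lambda>c i m s. 4 \<le> s 0) (emitf (sees 0 5)) skip ;; go 0 MoveRight) (Suc 1 + 1) (?M i) (?M (Suc i))"
   by (rule run_Seq[OF 1 2])
  then show "run w \<pi> (Cond (\<lambda>c i m s. 4 \<le> s 0) (emitf (sees 0 5)) skip ;; go 0 MoveRight) (2 + 1) (?M i) (?M (Suc i))"
   by (simp add: numeral_2_eq_2)
 next
  show "\<not> observe w \<pi> (?M (length qs)) c' (nz 0)" for c' by (simp add: rd_def)
 qed simp
 then have "run w \<pi> report (4 * length qs + 1) m (?M (length qs))" by (rule run_mono) simp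
 then show ?thesis by (intro exI[of _ "?M (length qs)"]) simp
qed

definition searchall :: "tm \<Rightarrow> prog" where
 "searchall N = Loop (nz 3) (pop 3 ;; askall N ;; dfs)"

lemma okp_askall:
 assumes "num_states N + num_symbols N + 7 < S" "num_work N + 10 < k"
 shows "okp k S (askall N)"
proof -
 have "okp k S (clean v)" if "v < k" for v using that assms by (simp add: clean_def)
 then have "okp k S (cleanall 10 n)" if "n \<le> num_work N" for n
  using that assms by (induction n) simp_all
 moreover have "addcode a e < S" if "a < S" for a e
  using that assms(1) by (simp add: addcode_def sym_def split: option.split)
 then have "okp k S (simquery N)"
  using assms unfolding simquery_def okp.simps by (intro okp_simact) (simp_all split: if_splits)
 moreover have "okp k S cleanq" using assms by (simp add: cleanq_def)
 ultimately show ?thesis using assms by (simp add: askall_def qblock_def)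
qed

lemma okp_dfs: "5 < S \<Longrightarrow> 0 < k \<Longrightarrow> okp k S dfs" by (auto simp: dfs_def retreat_def)

lemma run_searchall:
 assumes N: "wf_tm N" and v: "set bse \<subseteq> {1, 2}" "bse \<noteq> []"
  and bs: "\<forall>b\<in>set bs. length b = B" "0 < B"
  and out: "\<And>z b. length z \<le> L \<Longrightarrow> b \<in> set bs \<Longrightarrow>
   runs N ((!) b) (map (\<lambda>a. a = 2) bse @ z @ replicate (L - length z) False) B (out z b)"
  and m: "ready N m" "tp m 0 = stk (qtape bse L [])" "tp m 1 = un 0" "tp m 2 = stk (blocks bs)" "tp m 3 = un k"
 shows "\<exists>m'. run w [] (searchall N)
   (k * (length bs * (block_time N (length bse + L + B) + 2 * B + 5) + 6 * length bse + 10 * L + 42) + 1) m m' \<and>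
  tp m' 0 = stk (qtape bse L ((dfs_step (\<lambda>z. votes (out z) bs > 0) L ^^ k) [])) \<and> ot m' = ot m"
proof -
 let ?acc = "\<lambda>z. votes (out z) bs > 0" and ?Q = "length bs * (block_time N (length bse + L + B) + 2 * B + 5)"
 let ?z = "\<lambda>i. (dfs_step ?acc L ^^ i) []"
 have lz: "length (?z i) \<le> L" for i by (induction i) (auto intro: length_dfs_step)
 define I where "I i m' \<longleftrightarrow> ready N m' \<and> tp m' 0 = stk (qtape bse L (?z i)) \<and> tp m' 1 = un 0 \<and>
  tp m' 2 = stk (blocks bs) \<and> tp m' 3 = un (k - i) \<and> ot m' = ot m" for i m'
 have step: "(\<forall>c. observe w [] m1 c (nz 3)) \<and> (\<exists>m'. run w [] (pop 3 ;; askall N ;; dfs)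
  (1 + ((?Q + 2 * (length bse + L) + 20) + (4 * length bse + 8 * L + 20))) m1 m' \<and> I (Suc i) m')"
  if i: "i < k" and I: "I i m1" for i m1
 proof -
  have t3: "tp m1 3 = un (Suc (k - Suc i))" using I i by (simp add: I_def Suc_diff_Suc)
  let ?m2 = "upd 3 (un (k - Suc i)) m1"
  have r1: "run w [] (pop 3) 1 m1 ?m2" using run_pop_un[OF t3] .
  note q = qtape_props[OF v(1) lz[of i]]
  have ne: "qtape bse L (?z i) \<noteq> []" using v(2) by (simp add: qtape_def)
  have "qbits bse = map (\<lambda>a. a = 2) bse" using v(1) by auto
  then have mp: "qbits (qtape bse L (?z i)) = map (\<lambda>a. a = 2) bse @ ?z i @ replicate (L - length (?z i)) False"
   by (simp add: qtape_def nsym_def comp_def)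
  have rn: "runs N ((!) b) (qbits (qtape bse L (?z i))) B (out (?z i) b)" if "b \<in> set bs" for b
   unfolding mp by (rule out[OF lz that])
  have rdy: "ready N ?m2" "tp ?m2 0 = stk (qtape bse L (?z i))" "tp ?m2 1 = un 0" "tp ?m2 2 = stk (blocks bs)"
   using I by (simp_all add: I_def ready_def rd_def)
  obtain m3 where m3: "run w [] (askall N) (?Q + 2 * (length bse + L) + 20) ?m2 m3"
   "ready N m3" "tp m3 0 = (cells (qtape bse L (?z i)), 1)" "tp m3 1 = un 0" "rd m3 4 = 1 \<longleftrightarrow> ?acc (?z i)"
   "tp m3 2 = stk (blocks bs)" "ot m3 = ot ?m2" "tp m3 3 = tp ?m2 3"
   using run_askall[where w = w, OF N q(1) ne bs rn rdy] unfolding q(3) by blast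
  let ?m4 = "upd 0 (stk (qtape bse L (dfs_step ?acc L (?z i)))) m3"
  have r3: "run w [] dfs (4 * length bse + 8 * L + 20) m3 ?m4"
   by (rule run_dfs[where acc = ?acc and z = "?z i", OF m3(3) lz v m3(5)])
  have "I (Suc i) ?m4" using m3 I by (simp add: I_def ready_def rd_def)
  moreover have "observe w [] m1 c (nz 3)" for c using rd_un[OF t3] by simp
  ultimately show ?thesis using run_Seq[OF r1 run_Seq[OF m3(1) r3]] by blast
 qed
 have fin': "\<not> observe w [] m' c (nz 3)" if "I k m'" for m' c
  using rd_un[of m' 3 0] that by (simp add: I_def)
 have "I 0 m" using m by (simp add: I_def)
 have "\<exists>m'. run w [] (Loop (nz 3) (pop 3 ;; askall N ;; dfs))
  (k * Suc (1 + ((?Q + 2 * (length bse + L) + 20) + (4 * length bse + 8 * L + 20))) + 1) m m' \<and> I k m'"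
 proof (rule run_loop_rel[where I = I])
  show "I (k - k) m" using \<open>I 0 m\<close> by simp
 qed (fact step, fact fin', simp)
 then obtain m' where "run w [] (Loop (nz 3) (pop 3 ;; askall N ;; dfs))
  (k * Suc (1 + ((?Q + 2 * (length bse + L) + 20) + (4 * length bse + 8 * L + 20))) + 1) m m'" "I k m'" by blast
 moreover have "Suc (1 + ((?Q + 2 * (length bse + L) + 20) + (4 * length bse + 8 * L + 20))) = ?Q + 6 * length bse + 10 * L + 42"
  by presburger
 ultimately show ?thesis unfolding searchall_def by (intro exI[of _ m']) (simp only: I_def simp_thms)
qed

text \<open>The input is the pair of the coins and the attacker's own input. The coins supply five
  numbers, the mask, which is put in front of the transcript, and the blocks for the votes. The
  number on tape 3 is the step at which the search stops, so success requires the right guess of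
  it.\<close>

definition search :: "tm \<Rightarrow> prog" where
 "search N = imove MoveRight ;; nums 2 6 [5, 7, 8, 9, 3] ;; readbits 2 5 4 ;; (Loop (nz 8) (pop 8 ;; loadblock) ;; push 2 3) ;;
   imove MoveLeft ;; Loop unmarked (adv 2) ;; imove MoveRight ;;
   Loop unmarked (adv 1) ;; imove MoveRight ;;
   Loop moreinput (pushf 4 bitsym ;; adv 1) ;; rewind 4 ;; pairing ;;
   Loop (nz 7) (pop 7 ;; push 0 3) ;; searchall N ;; rewind 0 ;; report"

definition search_tm :: "tm \<Rightarrow> tm" where
 "search_tm N = compile (num_work N + 11) (num_states N + num_symbols N + 8) (search N)"

lemma okp_searchtm: "okp (num_work N + 11) (num_states N + num_symbols N + 8) (search N)"
 by (auto simp: search_def searchall_def loadblock_def sym_def pairing_def report_def intro!: okp_askall okp_dfs)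

lemma wf_search: "wf_tm (search_tm N)"
 unfolding search_tm_def by (rule wf_compile[OF okp_searchtm]) simp

text \<open>Cubic because at most \<open>Z\<close> nodes are visited, with at most \<open>Z\<close>
  votes for each and time linear in \<open>Z\<close> for a vote.\<close>

lemma runs_search:
 assumes N: "wf_tm N" and bs: "\<forall>b\<in>set bs. length b = B" "0 < B"
  and D: "D = header [length u, L, length bs, B, k] @ u @ concat bs @ rest"
  and w: "w = encode_pair (replicate n False) \<pi>"
  and out: "\<And>z b. length z \<le> L \<Longrightarrow> b \<in> set bs \<Longrightarrow>
   runs N ((!) b) (encode_pair (u @ \<pi>) (z @ replicate (L - length z) False)) B (out z b)"
  and Z: "length D \<le> Z" "length w \<le> Z" "length u \<le> Z" "L \<le> Z" "length bs \<le> Z" "B \<le> Z" "k \<le> Z"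
 shows "runs (search_tm N) no_coins (encode_pair D w) (1000 * (num_work N + 5) * (Z + 1) ^ 3)
  ((dfs_step (\<lambda>z. votes (out z) bs > 0) L ^^ k) [])"
proof -
 let ?w = "encode_pair D w" and ?hd = "header [length u, L, length bs, B, k]"
 let ?z = "(dfs_step (\<lambda>z. votes (out z) bs > 0) L ^^ k) []"
 have Dq: "inpseq ?w 2 1 D" by (rule inpseq_encode_pair)
 have iq: "inpseq ?w 2 1 ?hd" "inpseq ?w 2 (1 + int (2 * length ?hd)) u"
  "inpseq ?w 2 (1 + int (2 * length ?hd) + int (2 * length u)) (concat bs)"
  using Dq unfolding D inpseq_append by (simp_all only:)
 define p3 where "p3 = length ?hd + length u + length (concat bs)"
 have p3: "p3 + length rest = length D" by (simp only: D p3_def length_append)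
 have w2: "cell ?w (int (Suc (2 * length D + i))) = cell w (int i)" for i by (rule cell_encode_pair(4))
 let ?m0 = "start 0"
 let ?m1 = "?m0\<lparr>pin := 1\<rparr>"
 have r1: "run ?w [] (imove MoveRight) 1 ?m0 ?m1"
  using run_imove[of ?w "[]" MoveRight ?m0] by (simp add: start_def)
 let ?m2 = "?m1\<lparr>pin := pin ?m1 + int (2 * length ?hd),
   tp := loaded [5, 7, 8, 9, 3] [length u, L, length bs, B, k] (tp ?m1)\<rparr>"
 have s: "tp ?m0 j = un 0" for j by (simp add: start_def un_0 stk_Nil)
 have r2: "run ?w [] (nums 2 6 [5, 7, 8, 9, 3]) (14 * sum_list [length u, L, length bs, B, k] + 6 * length ?hd + 1) ?m1 ?m2"
  by (rule run_nums) (use iq s in simp_all)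
 have t2: "tp ?m2 j = (if j = 5 then un (length u) else if j = 7 then un L else if j = 8 then un (length bs)
  else if j = 9 then un B else if j = 3 then un k else un 0)" for j by (simp add: s)
 let ?m3 = "?m2\<lparr>pin := pin ?m2 + int (2 * length u), tp := (tp ?m2)(5 := un 0, 4 := stk ([] @ map sym u))\<rparr>"
 have r3: "run ?w [] (readbits 2 5 4) (6 * length u + 1) ?m2 ?m3"
  by (rule run_readbits) (use iq t2 un_0 in simp_all)
 let ?m4 = "?m3\<lparr>pin := pin ?m3 + int (2 * length (concat bs)), tp := (tp ?m3)(2 := stk (blocks bs), 8 := un 0)\<rparr>"
 have r4: "run ?w [] (Loop (nz 8) (pop 8 ;; loadblock) ;; push 2 3) (length bs * (12 * B + 6) + 3) ?m3 ?m4"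
  by (rule run_loadblocks) (use iq t2 un_0 bs in simp_all)
 define T where "T = tp ?m4"
 have T: "T 0 = stk []" "T 1 = un 0" "T 2 = stk (blocks bs)" "T 3 = un k" "T 4 = stk (map sym u)" "T 7 = un L"
  "\<And>j. 9 < j \<Longrightarrow> T j = un 0" unfolding T_def using t2 by (simp_all add: un_0)
 have p4: "pin ?m4 = 1 + int (2 * p3)" by (simp add: p3_def)
 define m4 where "m4 = ?m0\<lparr>tp := T\<rparr>"
 have m4: "?m4 = m4\<lparr>pin := 1 + int (2 * p3)\<rparr>" using p4 by (simp add: m4_def T_def)
 let ?P = "\<lambda>p. m4\<lparr>pin := p\<rparr>"
 have r5: "run ?w [] (imove MoveLeft) 1 ?m4 (?P (int (2 * p3)))"
  unfolding m4 using run_imove[of ?w "[]" MoveLeft "?P (1 + int (2 * p3))"] by simp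
 have r6: "run ?w [] (Loop unmarked (adv 2)) (3 * length rest + 1) (?P (int (2 * p3))) (?P (int (2 * length D)))"
 proof -
  have "run ?w [] (Loop unmarked (adv 2)) (3 * length rest + 1) (?P (int (2 * p3)))
   ((?P (int (2 * p3)))\<lparr>pin := pin (?P (int (2 * p3))) + int (2 * length rest)\<rparr>)"
  proof (rule run_find)
   fix i assume "i < length rest"
   then show "cell ?w (pin (?P (int (2 * p3))) + int (2 * i)) = Some False"
    using cell_encode_pair(1)[of "p3 + i" D w] p3 by (simp add: algebra_simps)
  next
   show "cell ?w (pin (?P (int (2 * p3))) + int (2 * length rest)) = Some True"
    using cell_encode_pair(3)[of D w] p3[symmetric] by (simp add: algebra_simps)
  qed simp
  then show ?thesis using p3[symmetric] by (simp add: algebra_simps)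
 qed
 have r7: "run ?w [] (imove MoveRight) 1 (?P (int (2 * length D))) (?P (int (Suc (2 * length D + 0))))"
  using run_imove[of ?w "[]" MoveRight "?P (int (2 * length D))"] by (simp add: algebra_simps)
 have r8: "run ?w [] (Loop unmarked (adv 1)) (3 * (2 * n) + 1) (?P (int (Suc (2 * length D + 0)))) (?P (int (Suc (2 * length D + 2 * n))))"
 proof -
  have z: "cell w (int i) = Some False" if "i < 2 * n" for i
  proof (cases "even i")
   case True
   then obtain j where "i = 2 * j" by blast
   then show ?thesis using cell_encode_pair(1)[of j "replicate n False" \<pi>] that w by simp
  next
   case False
   then obtain j where "i = Suc (2 * j)" by (metis oddE Suc_eq_plus1)
   then show ?thesis using cell_encode_pair(2)[of j "replicate n False" \<pi>] that w by simp
  qed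
  have "run ?w [] (Loop unmarked (adv 1)) (3 * (2 * n) + 1) (?P (int (Suc (2 * length D + 0))))
   ((?P (int (Suc (2 * length D + 0))))\<lparr>pin := pin (?P (int (Suc (2 * length D + 0)))) + int (1 * (2 * n))\<rparr>)"
  proof (rule run_find)
   fix i assume i: "i < 2 * n"
   have "pin (?P (int (Suc (2 * length D + 0)))) + int (1 * i) = int (Suc (2 * length D + i))" by simp
   then show "cell ?w (pin (?P (int (Suc (2 * length D + 0)))) + int (1 * i)) = Some False"
    using w2 z[OF i] by (simp only:)
  next
   have "pin (?P (int (Suc (2 * length D + 0)))) + int (1 * (2 * n)) = int (Suc (2 * length D + 2 * n))" by simp
   moreover have "cell w (int (2 * n)) = Some True" using cell_encode_pair(3)[of "replicate n False" \<pi>] w by simp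
   ultimately show "cell ?w (pin (?P (int (Suc (2 * length D + 0)))) + int (1 * (2 * n))) = Some True"
    using w2 by (simp only:)
  qed simp
  then show ?thesis by (simp add: algebra_simps)
 qed
 let ?p = "int (Suc (2 * length D + (2 * n + 1)))"
 have r9: "run ?w [] (imove MoveRight) 1 (?P (int (Suc (2 * length D + 2 * n)))) (?P ?p)"
  using run_imove[of ?w "[]" MoveRight "?P (int (Suc (2 * length D + 2 * n)))"] by (simp add: algebra_simps)
 have cp: "cell ?w (?p + int (1 * i)) = cell \<pi> (int i)" for i
 proof -
  have "?p + int (1 * i) = int (Suc (2 * length D + Suc (2 * n + i)))" by simp
  moreover have "cell w (int (Suc (2 * n + i))) = cell \<pi> (int i)"
   using cell_encode_pair(4)[of "replicate n False" \<pi> i] w by simp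
  ultimately show ?thesis using w2 by (simp only:)
 qed
 let ?m10 = "(?P ?p)\<lparr>pin := pin (?P ?p) + int (1 * length \<pi>), tp := (tp (?P ?p))(4 := stk (map sym u @ map sym \<pi>))\<rparr>"
 have r10: "run ?w [] (Loop moreinput (pushf 4 bitsym ;; adv 1)) (5 * length \<pi> + 1) (?P ?p) ?m10"
 proof (rule run_readall)
  show "inpseq ?w 1 (pin (?P ?p)) \<pi>" unfolding inpseq_def using cp by (simp add: cell_nat)
  show "cell ?w (pin (?P ?p) + int (1 * length \<pi>)) = None" using cp[of "length \<pi>"] by (simp add: cell_nat)
 qed (use T in \<open>simp_all add: m4_def\<close>)
 define v where "v = u @ \<pi>"
 let ?m11 = "upd 4 (cells (map sym v), 1) ?m10"
 have r11: "run ?w [] (rewind 4) (2 * length (map sym v) + 2) ?m10 ?m11"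
  by (rule run_rewind[where i = "int (length (map sym v))"]) (auto simp: v_def stk_def sym_def)
 let ?bs = "map sym (encode_pair v [])"
 obtain x where r12: "run ?w [] pairing (6 * length v + 3) ?m11 (?m11\<lparr>tp := (tp ?m11)(0 := stk ?bs, 4 := x)\<rparr>)" (is "run _ _ _ _ _ ?m12")
  using run_pairing[of ?m11 v ?w "[]"] T(1) by (auto simp: m4_def)
 let ?m13 = "?m12\<lparr>tp := (tp ?m12)(0 := stk (?bs @ replicate L 3), 7 := un 0)\<rparr>"
 have r13: "run ?w [] (Loop (nz 7) (pop 7 ;; push 0 3)) (4 * L + 1) ?m12 ?m13"
  by (rule run_pads) (use T(6) in \<open>simp_all add: m4_def\<close>)
 have lb: "length ?bs = 2 * length v + 1" by (simp add: length_encode_pair)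
 have bs1: "set ?bs \<subseteq> {1, 2}" "?bs \<noteq> []" by (auto simp: sym_def encode_pair_def)
 have mb: "map (\<lambda>a. a = 2) ?bs = encode_pair v []" by (simp add: comp_def sym_def)
 have ap: "encode_pair v [] @ y = encode_pair v y" for y by (simp add: encode_pair_def)
 have out': "runs N ((!) b) (map (\<lambda>a. a = 2) ?bs @ z @ replicate (L - length z) False) B (out z b)"
  if "length z \<le> L" "b \<in> set bs" for z b unfolding mb ap unfolding v_def by (rule out[OF that])
 have rdy: "ready N ?m13" unfolding ready_def using T(7) by (auto simp: m4_def rd_def un_0 stk_Nil)
 have t13: "tp ?m13 0 = stk (qtape ?bs L [])" "tp ?m13 1 = un 0" "tp ?m13 2 = stk (blocks bs)" "tp ?m13 3 = un k"
  using T by (simp_all add: m4_def qtape_def)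
 define Y where "Y = k * (length bs * (block_time N (length ?bs + L + B) + 2 * B + 5) + 6 * length ?bs + 10 * L + 42) + 1"
 obtain m14 where r14: "run ?w [] (searchall N) Y ?m13 m14"
  and t14: "tp m14 0 = stk (qtape ?bs L ?z)" "ot m14 = ot ?m13"
  using run_searchall[where w = ?w, OF N bs1 bs out' rdy t13] unfolding Y_def by blast
 have lz: "length ?z \<le> L"
 proof (induction k)
  case (Suc k)
  then show ?case by (simp add: length_dfs_step)
 qed simp
 note q = qtape_props[OF bs1(1) lz]
 let ?m15 = "upd 0 (cells (qtape ?bs L ?z), 1) m14"
 have r15: "run ?w [] (rewind 0) (2 * length (qtape ?bs L ?z) + 2) m14 ?m15"
  by (rule run_rewind[where i = "int (length (qtape ?bs L ?z))"]) (use q t14 in \<open>auto simp: stk_def\<close>)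
 obtain m16 where r16: "run ?w [] report (4 * length (qtape ?bs L ?z) + 1) ?m15 m16"
  and o16: "ot m16 = ot ?m15 @ map (\<lambda>a. a = 5) (filter (\<lambda>a. 4 \<le> a) (qtape ?bs L ?z))"
  using run_report[of ?m15 "qtape ?bs L ?z" ?w "[]"] q(2) by auto
 have "filter (\<lambda>a. 4 \<le> a) (qtape ?bs L ?z) = map nsym ?z"
  by (simp add: qtape_def nsym_def sym_def comp_def filter_map)
 then have o: "ot m16 = ?z" using o16 t14(2) by (simp add: nsym_def comp_def m4_def start_def)
 define Tt where "Tt = 1 + ((14 * sum_list [length u, L, length bs, B, k] + 6 * length ?hd + 1) + ((6 * length u + 1) +
  ((length bs * (12 * B + 6) + 3) + (1 + ((3 * length rest + 1) + (1 + ((3 * (2 * n) + 1) + (1 + ((5 * length \<pi> + 1) +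
  ((2 * length (map sym v) + 2) + ((6 * length v + 3) + ((4 * L + 1) + (Y + ((2 * length (qtape ?bs L ?z) + 2) +
  (4 * length (qtape ?bs L ?z) + 1)))))))))))))))"
 have run: "run ?w [] (search N) Tt ?m0 m16" unfolding search_def Tt_def
  by (rule run_Seq[OF r1 run_Seq[OF r2 run_Seq[OF r3 run_Seq[OF r4 run_Seq[OF r5 run_Seq[OF r6 run_Seq[OF r7 run_Seq[OF r8
   run_Seq[OF r9 run_Seq[OF r10 run_Seq[OF r11 run_Seq[OF r12 run_Seq[OF r13 run_Seq[OF r14 run_Seq[OF r15 r16]]]]]]]]]]]]]]])
 have Tb: "Tt + 2 \<le> 1000 * (num_work N + 5) * (Z + 1) ^ 3"
 proof -
  define q where "q = Z + 1"
  define c where "c = num_work N"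
  have q1: "1 \<le> q" by (simp add: q_def)
  have q3: "1 \<le> q ^ 3" "q \<le> q ^ 3" "q * q \<le> q ^ 3"
   using q1 by (simp_all add: power3_eq_cube Suc_le_eq)
  have lw: "2 * n + length \<pi> + 1 \<le> Z" using Z(2) unfolding w length_encode_pair by simp
  have lD: "length ?hd + length u + length (concat bs) + length rest \<le> Z" using p3 Z(1) by (simp only: p3_def)
  have lv: "length v \<le> 2 * Z" using lw lD by (simp add: v_def)
  have "block_time N (length ?bs + L + B) + 2 * B + 5 \<le> (170 + 60 * c) * q"
  proof -
   have "length ?bs + L + B \<le> 6 * q" using lb lv Z by (simp add: q_def)
   then have "(16 + 8 * c) * (length ?bs + L + B) \<le> (16 + 8 * c) * (6 * q)" by (rule mult_le_mono2)
   moreover have "c \<le> c * q" using q1 by simp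
   ultimately show ?thesis using q1 Z(6) unfolding block_time_def c_def[symmetric] by (simp add: algebra_simps q_def)
  qed
  then have "length bs * (block_time N (length ?bs + L + B) + 2 * B + 5) \<le> q * ((170 + 60 * c) * q)"
   using Z(5) by (intro mult_le_mono) (simp_all add: q_def)
  moreover have "6 * length ?bs + 10 * L + 42 \<le> 60 * q" using lb lv Z by (simp add: q_def)
  moreover have "60 * q \<le> q * (60 * q)" using q1 by simp
  ultimately have "length bs * (block_time N (length ?bs + L + B) + 2 * B + 5) + 6 * length ?bs + 10 * L + 42
   \<le> q * ((170 + 60 * c) * q) + q * (60 * q)" by linarith
  also have "\<dots> = q * ((230 + 60 * c) * q)" by (simp add: algebra_simps)
  finally have "length bs * (block_time N (length ?bs + L + B) + 2 * B + 5) + 6 * length ?bs + 10 * L + 42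
   \<le> q * ((230 + 60 * c) * q)" .
  then have "Y - 1 \<le> q * (q * ((230 + 60 * c) * q))"
   unfolding Y_def using Z(7) by (simp only: diff_add_inverse2, intro mult_le_mono) (simp_all add: q_def)
  then have Yb: "Y \<le> 230 * q ^ 3 + 60 * (c * q ^ 3) + 1" by (simp add: algebra_simps power3_eq_cube)
  have "length bs * (12 * B + 6) \<le> q * (18 * q)"
   using Z(5,6) by (intro mult_le_mono) (simp_all add: q_def)
  moreover have "length (qtape ?bs L ?z) \<le> 6 * q" using q(3) lb lv Z by (simp add: q_def)
  moreover have "sum_list [length u, L, length bs, B, k] \<le> 5 * q" using Z by (simp add: q_def)
  moreover have "length u \<le> q" "length rest \<le> q" "length ?hd \<le> q" "L \<le> q" "n \<le> q" "length \<pi> \<le> q"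
   unfolding q_def by (insert lD lw Z, linarith+)
  moreover have "length v \<le> 2 * q" using lv by (simp add: q_def)
  ultimately have "Tt + 2 \<le> 18 * (q * q) + 250 * q + 50 + Y"
   unfolding Tt_def length_map by linarith
  also have "\<dots> \<le> 1000 * (c * q ^ 3) + 5000 * q ^ 3" using Yb q3 by linarith
  finally show ?thesis unfolding q_def[symmetric] c_def[symmetric] by (simp add: algebra_simps)
 qed
 obtain t where t: "t \<le> Tt" "exec ?w [] (\<lambda>n. no_coins (Suc n)) (search N) t ?m0 m16"
  using run unfolding run_def by blast
 from exec_runs[OF t(2) okp_searchtm _ order_trans[OF _ Tb]] t(1) show ?thesis unfolding o search_tm_def by simp
qed

section \<open>Size of the search tree\<close>

text \<open>Number of steps that the traversal spends in the subtree of \<open>z\<close> when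
  \<open>d\<close> levels are left, as \<open>dfs_subtree\<close> shows.\<close>

fun dfs_size :: "(bits \<Rightarrow> bool) \<Rightarrow> nat \<Rightarrow> bits \<Rightarrow> nat" where
 "dfs_size acc 0 z = 1"
| "dfs_size acc (Suc d) z = (if acc z then Suc (dfs_size acc d (z @ [False]) + dfs_size acc d (z @ [True])) else 1)"

lemma dfs_subtree:
 "length z + d = L \<Longrightarrow> (dfs_step acc L ^^ dfs_size acc d z) z = backtrack z"
proof (induction d arbitrary: z)
 case 0
 then show ?case by (simp add: dfs_step_def)
next
 case (Suc d)
 show ?case
 proof (cases "acc z")
  case True
  then have "dfs_step acc L z = z @ [False]" using Suc.prems by (simp add: dfs_step_def)
  moreover have "(dfs_step acc L ^^ dfs_size acc d (z @ [False])) (z @ [False]) = z @ [True]"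
   using Suc.IH[of "z @ [False]"] Suc.prems by simp
  moreover have "(dfs_step acc L ^^ dfs_size acc d (z @ [True])) (z @ [True]) = backtrack z"
   using Suc.IH[of "z @ [True]"] Suc.prems by simp
  moreover have "dfs_size acc (Suc d) z = dfs_size acc d (z @ [True]) + (dfs_size acc d (z @ [False]) + 1)"
   using True by simp
  moreover have "(f ^^ 1) y = f y" for f :: "bits \<Rightarrow> bits" and y by simp
  ultimately show ?thesis by (simp only: funpow_add o_apply)
 qed (simp add: dfs_step_def)
qed

lemma dfs_size_pos: "0 < dfs_size acc d z" by (cases d) auto

lemma dfs_reaches:
 assumes "length x \<le> L" "\<And>i. i < length x \<Longrightarrow> acc (take i x)"
 shows "\<exists>k<dfs_size acc L []. (dfs_step acc L ^^ k) [] = x"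
proof -
 \<comment> \<open>Arrival time plus the size of the subtree still ahead never exceeds the total,
   which bounds the time at which \<open>x\<close> is met.\<close>
 have "\<exists>k. (dfs_step acc L ^^ k) [] = take i x \<and> k + dfs_size acc (L - i) (take i x) \<le> dfs_size acc L []"
  if "i \<le> length x" for i using that
 proof (induction i)
  case 0
  then show ?case by (intro exI[of _ 0]) simp
 next
  case (Suc i)
  then obtain k where k: "(dfs_step acc L ^^ k) [] = take i x"
   "k + dfs_size acc (L - i) (take i x) \<le> dfs_size acc L []" by auto
  have i: "i < length x" "acc (take i x)" using Suc.prems assms(2) by auto
  define d where "d = L - Suc i"
  then have d: "L - i = Suc d" "L - Suc i = d" using i assms(1) by simp_all
  have sz: "dfs_size acc (L - i) (take i x) = Suc (dfs_size acc d (take i x @ [False]) + dfs_size acc d (take i x @ [True]))"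
   using d i by simp
  have step: "dfs_step acc L (take i x) = take i x @ [False]" using i assms(1) by (simp add: dfs_step_def)
  have tk: "take (Suc i) x = take i x @ [x ! i]" using i by (simp add: take_Suc_conv_app_nth)
  show ?case
  proof (cases "x ! i")
   case False
   have "(dfs_step acc L ^^ Suc k) [] = take (Suc i) x" using k(1) step tk False by simp
   moreover have "Suc k + dfs_size acc (L - Suc i) (take (Suc i) x) \<le> dfs_size acc L []"
    using k(2) unfolding sz d(2) tk using False by simp
   ultimately show ?thesis by blast
  next
   case True
   have "(dfs_step acc L ^^ dfs_size acc d (take i x @ [False])) (take i x @ [False]) = take i x @ [True]"
    using dfs_subtree[of "take i x @ [False]" d L acc] i d assms(1) by simp
   moreover have "(dfs_step acc L ^^ Suc k) [] = take i x @ [False]" using k(1) step by simp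
   ultimately have "(dfs_step acc L ^^ (dfs_size acc d (take i x @ [False]) + Suc k)) [] = take i x @ [True]"
    by (simp only: funpow_add o_apply)
   moreover have "dfs_size acc d (take i x @ [False]) + Suc k + dfs_size acc (L - Suc i) (take (Suc i) x) \<le> dfs_size acc L []"
    using k(2) unfolding sz d(2) tk using True by simp
   ultimately show ?thesis unfolding tk using True by metis
  qed
 qed
 from this[of "length x"] obtain k where
  "(dfs_step acc L ^^ k) [] = x" "k + dfs_size acc (L - length x) x \<le> dfs_size acc L []"
  by (metis order_refl take_all)
 then show ?thesis using dfs_size_pos[of acc "L - length x" x] by (intro exI[of _ k]) simp
qed

text \<open>Accepted nodes of one level have different paddings in \<open>S\<close>. So the inner
  nodes are at most \<open>d\<close> times as many as the elements of \<open>S\<close> below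
  \<open>z\<close>, and a binary tree with \<open>i\<close> inner nodes has \<open>2 * i + 1\<close>
  nodes.\<close>

lemma dfs_size_bound:
 assumes "\<And>z. length z \<le> L \<Longrightarrow> acc z \<Longrightarrow> z @ replicate (L - length z) False \<in> S" "finite S"
 shows "length z + d = L \<Longrightarrow> dfs_size acc d z \<le> 1 + 2 * d * card {s \<in> S. length s = L \<and> take (length z) s = z}"
proof (induction d arbitrary: z)
 case (Suc d)
 define C where "C z = {s \<in> S. length s = L \<and> take (length z) s = z}" for z
 show ?case
 proof (cases "acc z")
  case True
  have fin: "finite (C z)" for z unfolding C_def by (rule finite_subset[OF _ assms(2)]) blast
  have disj: "C (z @ [False]) \<inter> C (z @ [True]) = {}"
  proof (rule equals0I)
   fix s assume "s \<in> C (z @ [False]) \<inter> C (z @ [True])"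
   then have "take (length (z @ [False])) s = z @ [False]" "take (length (z @ [True])) s = z @ [True]"
    unfolding C_def by blast+
   then have "z @ [False] = z @ [True]" by (metis length_append_singleton)
   then show False by simp
  qed
  have "C (z @ [b]) \<subseteq> C z" for b
  proof
   fix s assume s: "s \<in> C (z @ [b])"
   then have "take (length (z @ [b])) s = z @ [b]" unfolding C_def by blast
   then have "take (length z) (take (length (z @ [b])) s) = z" by (simp only:) simp
   then have "take (length z) s = z" by (simp add: take_take min_def del: take_all)
   then show "s \<in> C z" using s unfolding C_def by blast
  qed
  then have sub: "card (C (z @ [False])) + card (C (z @ [True])) \<le> card (C z)"
   using card_Un_disjoint[OF fin fin disj] card_mono[OF fin, of "C (z @ [False]) \<union> C (z @ [True])" z]
   by (simp only: Un_subset_iff)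
  moreover have "z @ replicate (L - length z) False \<in> C z"
   using assms(1)[of z] True Suc.prems unfolding C_def by simp
  then have "1 \<le> card (C z)" using card_mono[OF fin[of z], of "{z @ replicate (L - length z) False}"] by simp
  moreover have "dfs_size acc d (z @ [b]) \<le> 1 + 2 * d * card (C (z @ [b]))" for b
   unfolding C_def by (rule Suc.IH) (use Suc.prems in simp)
  from add_mono[OF this[of False] this[of True]]
  have "dfs_size acc (Suc d) z \<le> 3 + 2 * d * (card (C (z @ [False])) + card (C (z @ [True])))"
   using True by (simp add: distrib_left)
  moreover have "2 * d * (card (C (z @ [False])) + card (C (z @ [True]))) \<le> 2 * d * card (C z)"
   using sub by (rule mult_le_mono2)
  moreover have "2 * Suc d * card (C z) = 2 * card (C z) + 2 * d * card (C z)" by simp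
  ultimately show ?thesis unfolding C_def[symmetric] by linarith
 qed simp
qed simp

section \<open>Counting: majority votes, random rows, frequent keys, simple strings\<close>

section \<open>Counting strings\<close>

abbreviation strs :: "nat \<Rightarrow> bits set" where
 "strs n \<equiv> {w. length w = n}"

lemma strs_props: "finite (strs n)" "card (strs n) = 2 ^ n"
 using finite_lists_length_eq[of "UNIV :: bool set" n] card_lists_length_eq[of "UNIV :: bool set" n] by auto

definition lsts :: "'a set \<Rightarrow> nat \<Rightarrow> 'a list set" where
 "lsts V s = {xs. set xs \<subseteq> V \<and> length xs = s}"

lemma lsts_Suc: "lsts V (Suc s) = (\<lambda>(y, ys). y # ys) ` (V \<times> lsts V s)"
 by (auto simp: lsts_def length_Suc_conv image_iff)

lemma lsts_0 [simp]: "lsts V 0 = {[]}" by (auto simp: lsts_def)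

lemma lsts_card: "finite V \<Longrightarrow> finite (lsts V s)" "finite V \<Longrightarrow> card (lsts V s) = card V ^ s"
 unfolding lsts_def by (simp_all add: finite_lists_length_eq card_lists_length_eq)

lemma sum_lsts_Suc: "sum f (lsts V (Suc s)) = (\<Sum>y\<in>V. \<Sum>ys\<in>lsts V s. f (y # ys))"
 unfolding lsts_Suc by (subst sum.reindex) (auto simp: inj_on_def sum.cartesian_product intro!: sum.cong)

lemma sum_lsts_prod:
 fixes f :: "'a \<Rightarrow> 'b::comm_semiring_1"
 shows "(\<Sum>ys\<in>lsts V s. \<Prod>y\<leftarrow>ys. f y) = sum f V ^ s"
 by (induction s) (simp_all add: sum_lsts_Suc sum_distrib_left[symmetric] sum_distrib_right)

section \<open>Amplification by majority\<close>

text \<open>Exponential moments with base 2/3: the two kinds of votes get the weights 2/3 and 3/2,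
  so a lost majority has product at least 1, while the mean weight of a vote is at most 2/3 * 2/3 +
  1/3 * 3/2 = 17/18.\<close>

lemma majority_fails_rarely:
 fixes v :: "'a \<Rightarrow> int"
 assumes "finite V" "\<And>b. b \<in> V \<Longrightarrow> v b = 1 \<or> v b = - 1" "3 * card {b \<in> V. v b = 1} \<ge> 2 * card V"
 shows "real (card {bs \<in> lsts V R. (\<Sum>b\<leftarrow>bs. v b) \<le> 0}) \<le> (17 / 18) ^ R * real (card (lsts V R))"
proof -
 let ?f = "\<lambda>b. if v b = 1 then 2 / 3 else 3 / 2 :: real"
 have ge1: "1 \<le> (\<Prod>b\<leftarrow>bs. ?f b)" if "bs \<in> lsts V R" "(\<Sum>b\<leftarrow>bs. v b) \<le> 0" for bs
 proof -
  have "(\<Prod>b\<leftarrow>bs. ?f b) = (2 / 3) powi (\<Sum>b\<leftarrow>bs. v b)" if "set bs \<subseteq> V" for bs using that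
  proof (induction bs)
   case (Cons b bs)
   then have "?f b = (2 / 3) powi v b" using assms(2)[of b] by auto
   with Cons show ?case by (simp add: power_int_add)
  qed simp
  moreover have "1 \<le> (2 / 3 :: real) powi n" if "n \<le> 0" for n
   using that one_le_power[of "3 / 2 :: real" "nat (- n)"] by (auto simp: power_int_def power_divide field_simps)
  ultimately show ?thesis using that by (auto simp: lsts_def)
 qed
 have fin: "finite (lsts V R)" using lsts_card assms(1) by blast
 have "real (card {bs \<in> lsts V R. (\<Sum>b\<leftarrow>bs. v b) \<le> 0}) = (\<Sum>bs | bs \<in> lsts V R \<and> (\<Sum>b\<leftarrow>bs. v b) \<le> 0. 1)" by simp
 also have "\<dots> \<le> (\<Sum>bs | bs \<in> lsts V R \<and> (\<Sum>b\<leftarrow>bs. v b) \<le> 0. \<Prod>b\<leftarrow>bs. ?f b)"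
  using ge1 by (intro sum_mono) auto
 also have "\<dots> \<le> (\<Sum>bs\<in>lsts V R. \<Prod>b\<leftarrow>bs. ?f b)"
  using fin by (intro sum_mono2) (auto intro!: prod_list_nonneg)
 also have "\<dots> = sum ?f V ^ R" by (rule sum_lsts_prod)
 also have "\<dots> \<le> (17 / 18 * real (card V)) ^ R"
 proof (intro power_mono)
  have "sum ?f V = (2 / 3) * real (card {b \<in> V. v b = 1}) + (3 / 2) * real (card {b \<in> V. v b \<noteq> 1})"
   using assms(1) by (simp add: sum.If_cases Int_def Collect_neg_eq[symmetric])
  moreover have "card V = card {b \<in> V. v b = 1} + card {b \<in> V. v b \<noteq> 1}"
   using assms(1) by (subst card_Un_disjoint[symmetric]) (auto intro!: arg_cong[where f = card])
  ultimately show "sum ?f V \<le> 17 / 18 * real (card V)" using assms(3) by simp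
 qed (simp add: sum_nonneg)
 finally show ?thesis using assms(1) unfolding power_mult_distrib by (simp add: lsts_card)
qed

section \<open>Hitting a set by combinations of random rows\<close>

text \<open>The sum of \<open>g\<close> over the translate by \<open>y\<close> of all subset sums of
  the rows, with multiplicity; for an indicator, the number of selections that hit the set.\<close>

fun hits :: "(bits \<Rightarrow> real) \<Rightarrow> bits list \<Rightarrow> bits \<Rightarrow> real" where
 "hits g [] y = g y"
| "hits g (r # rws) y = hits g rws y + hits g rws (xorv True r y)"

lemma hits_shift: "hits (\<lambda>y. g y - c) rws y = hits g rws y - 2 ^ length rws * c"
proof (induction rws arbitrary: y)
 case (Cons r rws)
 show ?case unfolding hits.simps Cons.IH by (simp add: algebra_simps)
qed simp

lemma hits_pos: "hits g rws y \<noteq> 0 \<Longrightarrow> \<exists>fs. length fs = length rws \<and> g (foldl (\<lambda>r (f, v). xorv f v r) y (zip fs rws)) \<noteq> 0"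
proof (induction rws arbitrary: y)
 case (Cons r rws)
 then consider "hits g rws y \<noteq> 0" | "hits g rws (xorv True r y) \<noteq> 0" by fastforce
 then show ?case
 proof cases
  case 1
  from Cons.IH[OF this] obtain fs where "length fs = length rws \<and> g (foldl (\<lambda>r (f, v). xorv f v r) y (zip fs rws)) \<noteq> 0" ..
  then show ?thesis by (intro exI[of _ "False # fs"]) (simp add: xorv_def)
 next
  case 2
  from Cons.IH[OF this] obtain fs where "length fs = length rws \<and> g (foldl (\<lambda>r (f, v). xorv f v r) (xorv True r y) (zip fs rws)) \<noteq> 0" ..
  then show ?thesis by (intro exI[of _ "True # fs"]) simp
 qed
qed auto

lemma xor_involution: "length y = length r \<Longrightarrow> map2 (\<noteq>) (map2 (\<noteq>) y r) r = y"
 by (induction y r rule: list_induct2) auto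

lemma xor_comm: "map2 (\<noteq>) (y :: bits) r = map2 (\<noteq>) r y" by (induction y r rule: list_induct2') auto

lemma bij_xor: "length r = T \<Longrightarrow> bij_betw (\<lambda>y. map2 (\<noteq>) y r) (strs T) (strs T)"
 by (rule bij_betwI[where g = "\<lambda>y. map2 (\<noteq>) y r"]) (auto simp: xor_involution[simplified])

lemma hits_mean:
 assumes "rws \<in> lsts (strs T) s" "(\<Sum>y\<in>strs T. g y) = 0"
 shows "(\<Sum>y\<in>strs T. hits g rws y) = 0" using assms(1)
proof (induction rws arbitrary: s)
 case (Cons r rws)
 then have "length r = T" "rws \<in> lsts (strs T) (s - 1)" by (auto simp: lsts_def)
 then show ?case
  using Cons.IH sum.reindex_bij_betw[OF bij_xor, of r T "hits g rws"] by (simp add: sum.distrib xorv_def)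
qed (use assms(2) in simp)

text \<open>The sum over \<open>r\<close> of the mixed term factors into two vanishing means.\<close>

lemma hits_second_moment:
 assumes "(\<Sum>y\<in>strs T. g y) = 0"
 shows "(\<Sum>rws\<in>lsts (strs T) s. \<Sum>y\<in>strs T. (hits g rws y)\<^sup>2) = 2 ^ s * (2 ^ T) ^ s * (\<Sum>y\<in>strs T. (g y)\<^sup>2)"
proof (induction s)
 case (Suc s)
 let ?h = "hits g"
 have "(\<Sum>r\<in>strs T. \<Sum>y\<in>strs T. (?h (r # rws) y)\<^sup>2) = 2 * 2 ^ T * (\<Sum>y\<in>strs T. (?h rws y)\<^sup>2)"
  if rws: "rws \<in> lsts (strs T) s" for rws
 proof -
  have m: "(\<Sum>y\<in>strs T. ?h rws y) = 0" by (rule hits_mean[OF rws assms])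
  have a: "(\<Sum>r\<in>strs T. \<Sum>y\<in>strs T. (?h rws (xorv True r y))\<^sup>2) = 2 ^ T * (\<Sum>y\<in>strs T. (?h rws y)\<^sup>2)"
   using sum.reindex_bij_betw[OF bij_xor, of _ T "\<lambda>y. (?h rws y)\<^sup>2"] by (simp add: xorv_def strs_props)
  have "(\<Sum>r\<in>strs T. \<Sum>y\<in>strs T. ?h rws y * ?h rws (xorv True r y)) = (\<Sum>y\<in>strs T. ?h rws y * (\<Sum>r\<in>strs T. ?h rws (map2 (\<noteq>) r y)))"
   unfolding xorv_def if_True sum_distrib_left by (subst sum.swap) (subst xor_comm, rule refl)
  also have "\<dots> = 0" using sum.reindex_bij_betw[OF bij_xor, of _ T "?h rws"] m by simp
  finally have b: "(\<Sum>r\<in>strs T. \<Sum>y\<in>strs T. ?h rws y * ?h rws (xorv True r y)) = 0" .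
  have "(\<Sum>r\<in>strs T. \<Sum>y\<in>strs T. (?h (r # rws) y)\<^sup>2) = (\<Sum>r\<in>strs T. \<Sum>y\<in>strs T. (?h rws y)\<^sup>2) +
   (\<Sum>r\<in>strs T. \<Sum>y\<in>strs T. (?h rws (xorv True r y))\<^sup>2) + 2 * (\<Sum>r\<in>strs T. \<Sum>y\<in>strs T. ?h rws y * ?h rws (xorv True r y))"
   by (simp add: power2_sum sum.distrib sum_distrib_left mult.assoc)
  then show ?thesis using a b by (simp add: strs_props)
 qed
 then have "(\<Sum>rws\<in>lsts (strs T) (Suc s). \<Sum>y\<in>strs T. (?h rws y)\<^sup>2) = (\<Sum>rws\<in>lsts (strs T) s. 2 * 2 ^ T * (\<Sum>y\<in>strs T. (?h rws y)\<^sup>2))"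
  unfolding sum_lsts_Suc by (subst sum.swap) simp
 also have "\<dots> = 2 * 2 ^ T * (2 ^ s * (2 ^ T) ^ s * (\<Sum>y\<in>strs T. (g y)\<^sup>2))"
  unfolding sum_distrib_left[symmetric] Suc.IH ..
 finally show ?case by simp
qed simp

lemma combine_Cons: "length y = T \<Longrightarrow> combine T (True # fs) (y # rws) = foldl (\<lambda>r (f, v). xorv f v r) y (zip fs rws)"
proof -
 assume "length y = T"
 then have "map2 (\<noteq>) (replicate T False) y = y" by (induction y arbitrary: T) auto
 then show ?thesis by (simp add: combine_def xorv_def)
qed

text \<open>Chebyshev's inequality for subset sums, which are pairwise independent and, thanks to
  the first row that is always selected, uniform. If no selection hits \<open>R\<close>, the centred
  count is exactly \<open>- (2 ^ s * \<mu>)\<close>, while the mean of its square is at most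
  \<open>2 ^ s * \<mu>\<close>, where \<open>\<mu>\<close> is the density of
  \<open>R\<close>.\<close>

lemma few_rows_miss:
 assumes "R \<subseteq> strs T"
 shows "real (card {rws \<in> lsts (strs T) (Suc s). \<forall>fs. length fs = s \<longrightarrow> combine T (True # fs) rws \<notin> R}) * (2 ^ s * real (card R))
  \<le> 2 ^ T * (2 ^ T) ^ Suc s"
proof -
 let ?bad = "{rws \<in> lsts (strs T) (Suc s). \<forall>fs. length fs = s \<longrightarrow> combine T (True # fs) rws \<notin> R}"
 have fR: "finite R" using assms strs_props finite_subset by blast
 define \<mu> where "\<mu> = real (card R) / 2 ^ T"
 define g where "g y = indicator R y - \<mu>" for y
 have gs: "(\<Sum>y\<in>strs T. indicator R y) = real (card R)"
  using assms strs_props[of T] by (simp add: indicator_def sum.If_cases Int_absorb2 Int_commute)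
 have g0: "(\<Sum>y\<in>strs T. g y) = 0" by (simp add: g_def sum_subtractf gs strs_props \<mu>_def)
 have "(\<Sum>y\<in>strs T. (g y)\<^sup>2) = (\<Sum>y\<in>strs T. indicator R y - 2 * \<mu> * indicator R y + \<mu>\<^sup>2)"
  by (intro sum.cong) (auto simp: g_def indicator_def power2_eq_square algebra_simps)
 also have "\<dots> = real (card R) - 2 * \<mu> * real (card R) + 2 ^ T * \<mu>\<^sup>2"
  by (simp only: sum.distrib sum_subtractf sum_distrib_left[symmetric] gs) (simp add: strs_props)
 also have "\<dots> \<le> real (card R)"
 proof -
  have "2 ^ T * \<mu>\<^sup>2 = \<mu> * real (card R)" by (simp add: \<mu>_def power2_eq_square)
  moreover have "0 \<le> \<mu> * real (card R)" by (simp add: \<mu>_def)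
  ultimately show ?thesis by linarith
 qed
 finally have v: "(\<Sum>y\<in>strs T. (g y)\<^sup>2) \<le> real (card R)" .
 have fin: "finite (lsts (strs T) n)" for n using lsts_card strs_props by blast
 have bad: "(2 ^ s * \<mu>)\<^sup>2 \<le> (hits g (tl rws) (hd rws))\<^sup>2" if "rws \<in> ?bad" for rws
 proof -
  obtain y ys where y: "rws = y # ys" "length y = T" "length ys = s"
   using \<open>rws \<in> ?bad\<close> by (auto simp: lsts_def length_Suc_conv)
  have "hits (indicator R) ys y = 0"
  proof (rule ccontr)
   assume "\<not> ?thesis"
   from hits_pos[OF this] obtain fs where "length fs = s" "foldl (\<lambda>r (f, v). xorv f v r) y (zip fs ys) \<in> R"
    using y by (auto simp: indicator_def split: if_splits)
   then show False using \<open>rws \<in> ?bad\<close> y combine_Cons[OF y(2), of fs ys] by auto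
  qed
  moreover have "hits g ys y = hits (indicator R) ys y - 2 ^ s * \<mu>"
   using hits_shift[of "indicator R" \<mu> ys y] y(3) by (simp add: g_def[abs_def])
  ultimately show ?thesis using y by simp
 qed
 have "real (card ?bad) * (2 ^ s * \<mu>)\<^sup>2 = (\<Sum>rws\<in>?bad. (2 ^ s * \<mu>)\<^sup>2)" by simp
 also have "\<dots> \<le> (\<Sum>rws\<in>?bad. (hits g (tl rws) (hd rws))\<^sup>2)" using bad by (intro sum_mono)
 also have "\<dots> \<le> (\<Sum>rws\<in>lsts (strs T) (Suc s). (hits g (tl rws) (hd rws))\<^sup>2)" using fin by (intro sum_mono2) auto
 also have "\<dots> = (\<Sum>rws\<in>lsts (strs T) s. \<Sum>y\<in>strs T. (hits g rws y)\<^sup>2)"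
  unfolding sum_lsts_Suc by (subst sum.swap) simp
 also have "\<dots> \<le> 2 ^ s * (2 ^ T) ^ s * real (card R)"
  unfolding hits_second_moment[OF g0] using v by (intro mult_left_mono) auto
 finally have main: "real (card ?bad) * (2 ^ s * \<mu>)\<^sup>2 \<le> 2 ^ s * (2 ^ T) ^ s * real (card R)" .
 show ?thesis
 proof (cases "card R = 0")
  case False
  have "real (card ?bad) * (2 ^ s * real (card R)) * (2 ^ s * real (card R)) \<le> 2 ^ s * (2 ^ T) ^ s * real (card R) * (2 ^ T)\<^sup>2"
   using main by (simp add: \<mu>_def field_simps power2_eq_square)
  also have "\<dots> = 2 ^ T * (2 ^ T) ^ Suc s * (2 ^ s * real (card R))" by (simp add: power2_eq_square)
  finally show ?thesis using False by (simp only: mult_le_cancel_right) simp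
 qed simp
qed

lemma split_rows: "n * T \<le> length w \<Longrightarrow> \<exists>rws rest. w = concat rws @ rest \<and> rws \<in> lsts (strs T) n"
proof (induction n arbitrary: w)
 case (Suc n)
 then have "n * T \<le> length (drop T w)" by simp
 from Suc.IH[OF this] obtain rws rest where "drop T w = concat rws @ rest" "rws \<in> lsts (strs T) n" by blast
 then have "w = concat (take T w # rws) @ rest" "take T w # rws \<in> lsts (strs T) (Suc n)"
  using Suc.prems by (auto simp: lsts_def) (metis append_take_drop_id)
 then show ?case by blast
qed auto

definition reaches :: "nat \<Rightarrow> nat \<Rightarrow> bits set \<Rightarrow> bits \<Rightarrow> bool" where
 "reaches T s R w \<longleftrightarrow> (\<exists>rws rest fs. w = concat rws @ rest \<and> rws \<in> lsts (strs T) (Suc s) \<and> length fs = s \<and>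
   combine T (True # fs) rws \<in> R)"

text \<open>Take the least \<open>s\<close> with \<open>64 * 2 ^ T \<le> 2 ^ s * card R\<close>.
  Failure then has probability at most 1/64, and minimality, or the size of \<open>R\<close> if
  \<open>s = 0\<close>, gives the upper bound with 128. As \<open>R\<close> is nonempty,
  \<open>s \<le> T + 6\<close>, so \<open>T + 7\<close> rows have to fit into the mask.\<close>

lemma few_strings_miss:
 assumes "R \<subseteq> strs T" "R \<noteq> {}" "(T + 7) * T \<le> W"
 shows "\<exists>s\<le>T + 6. 2 ^ s * real (card R) \<le> 128 * 2 ^ T \<and> 64 * real (card {w \<in> strs W. \<not> reaches T s R w}) \<le> 2 ^ W"
proof -
 have fR: "finite R" using assms strs_props finite_subset by blast
 then have R1: "1 \<le> card R" using assms(2) by (simp add: Suc_le_eq card_gt_0_iff)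
 define P where "P s \<longleftrightarrow> 64 * 2 ^ T \<le> 2 ^ s * card R" for s :: nat
 have P6: "P (T + 6)" using R1 by (simp add: P_def power_add)
 define s where "s = (LEAST s. P s)"
 have Ps: "P s" and s: "s \<le> T + 6" unfolding s_def by (rule LeastI[of P, OF P6], rule Least_le[of P, OF P6])
 have "2 ^ s * card R \<le> 128 * 2 ^ T"
 proof (cases s)
  case 0
  have "card R \<le> 2 ^ T" using card_mono[OF strs_props(1) assms(1)] strs_props by simp
  then show ?thesis using 0 by simp
 next
  case (Suc k)
  then have "\<not> P k" using not_less_Least[of k P] by (simp add: s_def)
  moreover have "2 ^ s * card R = 2 * (2 ^ k * card R)" using Suc by simp
  ultimately show ?thesis unfolding P_def by linarith
 qed
 from of_nat_mono[OF this, where 'a = real] have a: "2 ^ s * real (card R) \<le> 128 * 2 ^ T" by simp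
 let ?rb = "{rws \<in> lsts (strs T) (Suc s). \<forall>fs. length fs = s \<longrightarrow> combine T (True # fs) rws \<notin> R}"
 let ?n = "W - Suc s * T"
 have "Suc s * T \<le> (T + 7) * T" using s by (intro mult_le_mono1) simp
 then have le: "Suc s * T \<le> W" using assms(3) by simp
 have "{w \<in> strs W. \<not> reaches T s R w} \<subseteq> (\<lambda>(rws, rest). concat rws @ rest) ` (?rb \<times> strs ?n)"
 proof clarify
  fix w assume w: "\<not> reaches T s R w" "W = length w"
  obtain rws rest where r: "w = concat rws @ rest" "rws \<in> lsts (strs T) (Suc s)"
   using split_rows[of "Suc s" T w] le w by auto
  have "length (concat rws) = Suc s * T"
   using length_concat_rows[of rws T] r(2) by (auto simp: lsts_def)
  then have "rest \<in> strs (length w - Suc s * T)" using r(1) by simp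
  moreover have "rws \<in> ?rb" using w(1) r unfolding reaches_def by blast
  ultimately show "w \<in> (\<lambda>(rws, rest). concat rws @ rest) ` (?rb \<times> strs (length w - Suc s * T))" using r(1) by force
 qed
 moreover have frb: "finite ?rb" using lsts_card(1)[OF strs_props(1)] by simp
 ultimately have "card {w \<in> strs W. \<not> reaches T s R w} \<le> card ?rb * 2 ^ ?n"
  using surj_card_le[of "?rb \<times> strs ?n"] strs_props by (simp add: card_cartesian_product)
 from of_nat_mono[OF this, where 'a = real]
 have "real (card {w \<in> strs W. \<not> reaches T s R w}) \<le> real (card ?rb) * 2 ^ ?n" by simp
 then have "64 * 2 ^ T * real (card {w \<in> strs W. \<not> reaches T s R w}) \<le> real (card ?rb) * (64 * 2 ^ T) * 2 ^ ?n" by simp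
 also have "\<dots> \<le> real (card ?rb) * (2 ^ s * real (card R)) * 2 ^ ?n"
  using of_nat_mono[OF Ps[unfolded P_def], where 'a = real] by (intro mult_right_mono mult_left_mono) simp_all
 also have "\<dots> \<le> 2 ^ T * (2 ^ T) ^ Suc s * 2 ^ ?n" by (intro mult_right_mono few_rows_miss assms) simp
 also have "\<dots> = 2 ^ T * 2 ^ W" using le by (simp flip: power_mult power_add add: mult.commute)
 finally show ?thesis using a s by (intro exI[of _ s]) simp
qed

section \<open>Most agreeing outcomes are frequent given the transcript\<close>

text \<open>For p = a / A and q = b / B: if pq \<le> 1/4, then pq \<le> sqrt (pq) / 2 \<le> (p + q)
  / 4.\<close>

lemma four_prod_le:
 fixes a b A B :: nat
 assumes "4 * (a * b) \<le> A * B"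
 shows "4 * (a * b) \<le> a * B + b * A"
proof (rule power2_le_imp_le)
 have "(4 * (a * b))\<^sup>2 \<le> 4 * (a * b) * (A * B)"
  unfolding power2_eq_square using assms by (rule mult_le_mono2)
 also have "\<dots> = 4 * (a * B) * (b * A)" by simp
 also have "\<dots> \<le> (a * B + b * A)\<^sup>2"
 proof -
  have "4 * x * y \<le> (x + y)\<^sup>2" for x y :: nat
  proof -
   have "0 \<le> (int x - int y)\<^sup>2" by simp
   then have "int (4 * x * y) \<le> int ((x + y)\<^sup>2)" by (simp add: power2_eq_square algebra_simps)
   then show ?thesis by (simp only: of_nat_le_iff)
  qed
  then show ?thesis .
 qed
 finally show "(4 * (a * b))\<^sup>2 \<le> (a * B + b * A)\<^sup>2" .
qed simp

lemma sum_card_fibres: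
 assumes "finite A"
 shows "finite X \<Longrightarrow> (\<Sum>x\<in>X. card {a \<in> A. g a = x}) = card {a \<in> A. g a \<in> X}"
proof (induction X rule: finite_induct)
 case (insert x X)
 have "{a \<in> A. g a \<in> insert x X} = {a \<in> A. g a = x} \<union> {a \<in> A. g a \<in> X}" by auto
 moreover have "{a \<in> A. g a = x} \<inter> {a \<in> A. g a \<in> X} = {}" using insert by auto
 ultimately show ?case using insert assms by (simp add: card_Un_disjoint)
qed simp

text \<open>Given the transcript, the coin pairs form a rectangle on which each key is a function of
  one coordinate, so the keys are independent. A key that is agreed upon with conditional
  probability below 1/4 contributes at most a quarter of the sum of its two marginal probabilities.
  All marginals add up to 2, so agreement on such keys has probability at most 1/2.\<close>

lemma light_pairs:
 fixes F :: "'r \<times> 's \<Rightarrow> 'p \<times> 'x \<times> 'x"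
 assumes fin: "finite V1" "finite V2"
  and rect: "\<And>r s r' s' \<pi> x y x' y'. F (r, s) = (\<pi>, x, y) \<Longrightarrow> F (r', s') = (\<pi>, x', y') \<Longrightarrow>
   {r, r'} \<subseteq> V1 \<Longrightarrow> {s, s'} \<subseteq> V2 \<Longrightarrow> F (r, s') = (\<pi>, x, y')"
 defines "light q \<equiv> (\<exists>\<pi> x. F q = (\<pi>, x, x) \<and> 4 * card {q' \<in> V1 \<times> V2. F q' = (\<pi>, x, x)} < card {q' \<in> V1 \<times> V2. fst (F q') = \<pi>})"
 shows "2 * card {q \<in> V1 \<times> V2. light q} \<le> card (V1 \<times> V2)"
proof -
 let ?V = "V1 \<times> V2"
 have fV: "finite ?V" using fin by simp
 define cl where "cl \<pi> = {q \<in> ?V. fst (F q) = \<pi>}" for \<pi>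
 have one: "2 * card {q \<in> cl \<pi>. light q} \<le> card (cl \<pi>)" for \<pi>
 proof (cases "cl \<pi> = {}")
  case False
  then obtain r0 s0 where q0: "(r0, s0) \<in> cl \<pi>" by auto
  define A where "A = fst ` cl \<pi>"
  define B where "B = snd ` cl \<pi>"
  \<comment> \<open>Evaluated at a fixed coin string of the other party; the rectangle property
    makes its choice immaterial.\<close>
  define \<alpha> where "\<alpha> r = fst (snd (F (r, s0)))" for r
  define \<beta> where "\<beta> s = snd (snd (F (r0, s)))" for s
  have fAB: "finite A" "finite B" using fV by (auto simp: A_def B_def cl_def)
  have F: "F (r, s) = (\<pi>, \<alpha> r, \<beta> s) \<and> (r, s) \<in> cl \<pi>" if "r \<in> A" "s \<in> B" for r s
  proof -
   from that(1) obtain s' where 11: "(r, s') \<in> cl \<pi>" unfolding A_def by force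
   from that(2) obtain r' where 12: "(r', s) \<in> cl \<pi>" unfolding B_def by force
   note 1 = 11 12
   obtain x y x' y' x0 y0 where 2: "F (r, s') = (\<pi>, x, y)" "F (r', s) = (\<pi>, x', y')" "F (r0, s0) = (\<pi>, x0, y0)"
    using 1 q0 by (cases "F (r, s')"; cases "F (r', s)"; cases "F (r0, s0)") (auto simp: cl_def)
   have V: "{r, r', r0} \<subseteq> V1" "{s, s', s0} \<subseteq> V2" using 1 q0 by (auto simp: cl_def)
   have "F (r, s) = (\<pi>, x, y')" "F (r, s0) = (\<pi>, x, y0)" "F (r0, s) = (\<pi>, x0, y')"
    using rect[OF 2(1,2)] rect[OF 2(1,3)] rect[OF 2(3,2)] V by auto
   then show ?thesis using V by (simp add: \<alpha>_def \<beta>_def cl_def)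
  qed
  have AB: "cl \<pi> = A \<times> B"
  proof (intro equalityI subsetI)
   fix q assume "q \<in> cl \<pi>"
   then show "q \<in> A \<times> B" by (cases q) (force simp: A_def B_def)
  qed (use F in auto)
  define a where "a x = card {r \<in> A. \<alpha> r = x}" for x
  define b where "b x = card {s \<in> B. \<beta> s = x}" for x
  have cx: "{q' \<in> ?V. F q' = (\<pi>, x, x)} = {r \<in> A. \<alpha> r = x} \<times> {s \<in> B. \<beta> s = x}" for x
  proof -
   have "{q' \<in> ?V. F q' = (\<pi>, x, x)} = {q' \<in> A \<times> B. F q' = (\<pi>, x, x)}" unfolding AB[symmetric] cl_def by auto
   then show ?thesis using F by auto
  qed
  define X where "X = {x \<in> \<alpha> ` A. 4 * (a x * b x) \<le> card A * card B}"
  have fX: "finite X" using fAB by (simp add: X_def)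
  have "{q \<in> cl \<pi>. light q} \<subseteq> (\<Union>x\<in>X. {r \<in> A. \<alpha> r = x} \<times> {s \<in> B. \<beta> s = x})"
  proof clarify
   fix r s assume rs: "(r, s) \<in> cl \<pi>" "light (r, s)"
   then have m: "r \<in> A" "s \<in> B" by (simp_all add: AB)
   then have "\<beta> s = \<alpha> r" "4 * (a (\<alpha> r) * b (\<alpha> r)) < card (cl \<pi>)"
    using rs(2) F[OF m] cx[of "\<alpha> r"] unfolding light_def a_def b_def cl_def[symmetric] by (auto simp: card_cartesian_product)
   then show "(r, s) \<in> (\<Union>x\<in>X. {r \<in> A. \<alpha> r = x} \<times> {s \<in> B. \<beta> s = x})"
    using m by (auto simp: X_def AB card_cartesian_product)
  qed
  then have "card {q \<in> cl \<pi>. light q} \<le> card (\<Union>x\<in>X. {r \<in> A. \<alpha> r = x} \<times> {s \<in> B. \<beta> s = x})"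
   using fX fAB by (intro card_mono) auto
  also have "\<dots> \<le> (\<Sum>x\<in>X. a x * b x)"
   unfolding a_def b_def card_cartesian_product[symmetric] by (rule card_UN_le[OF fX])
  finally have "4 * card {q \<in> cl \<pi>. light q} \<le> (\<Sum>x\<in>X. 4 * (a x * b x))" by (simp flip: sum_distrib_left)
  also have "\<dots> \<le> (\<Sum>x\<in>X. a x * card B + b x * card A)"
   by (intro sum_mono four_prod_le) (simp add: X_def)
  also have "\<dots> = card {r \<in> A. \<alpha> r \<in> X} * card B + card {s \<in> B. \<beta> s \<in> X} * card A"
   using sum_card_fibres[OF fAB(1) fX] sum_card_fibres[OF fAB(2) fX] by (simp add: sum.distrib a_def b_def flip: sum_distrib_right)
  also have "\<dots> \<le> card A * card B + card B * card A"
   using fAB by (intro add_mono mult_le_mono1 card_mono) auto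
  finally have "4 * card {q \<in> cl \<pi>. light q} \<le> card A * card B + card A * card B" by (simp only: mult.commute)
  then show ?thesis unfolding AB card_cartesian_product by linarith
 qed simp
 let ?P = "(\<lambda>q. fst (F q)) ` ?V"
 have e: "{a \<in> {q \<in> ?V. light q}. fst (F a) = \<pi>} = {q \<in> cl \<pi>. light q}"
  "{a \<in> {q \<in> ?V. light q}. fst (F a) \<in> ?P} = {q \<in> ?V. light q}" "{a \<in> ?V. fst (F a) \<in> ?P} = ?V" for \<pi>
  unfolding cl_def by blast+
 have "2 * card {q \<in> ?V. light q} = (\<Sum>\<pi>\<in>?P. 2 * card {q \<in> cl \<pi>. light q})"
  using sum_card_fibres[of "{q \<in> ?V. light q}" ?P "\<lambda>q. fst (F q)"] fV
  unfolding e sum_distrib_left[symmetric] by simp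
 also have "\<dots> \<le> (\<Sum>\<pi>\<in>?P. card (cl \<pi>))" by (intro sum_mono one)
 also have "\<dots> = card ?V" using sum_card_fibres[OF fV, of ?P "\<lambda>q. fst (F q)"] fV
  unfolding e(3) cl_def by simp
 finally show ?thesis .
qed

section \<open>Few strings are simple\<close>

lemma computes_unique: "computes M w z \<Longrightarrow> computes M w z' \<Longrightarrow> z = z'" unfolding computes_def
proof (elim exE)
 fix T T' assume "runs M (\<lambda>_. False) w T z" "runs M (\<lambda>_. False) w T' z'"
 from this[THEN runs_mono, of "max T T'"] show "z = z'" by (simp add: runs_def Let_def)
qed

lemma C_plain_le: "computes M (encode_pair p []) x \<Longrightarrow> C_plain M x \<le> enat (length p)"
 unfolding C_cond_def by (rule Inf_lower) blast

lemma C_plain_attained: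
 assumes "C_plain M x = enat l"
 shows "\<exists>p. length p = l \<and> computes M (encode_pair p []) x"
proof -
 let ?A = "{enat (length p) |p. computes M (encode_pair p []) x}"
 have ne: "?A \<noteq> {}"
 proof
  assume "?A = {}"
  then have "C_plain M x = \<infinity>" unfolding C_cond_def by (simp add: Inf_enat_def)
  then show False using assms by simp
 qed
 then obtain a where "a \<in> ?A" by blast
 then have "(LEAST a. a \<in> ?A) \<in> ?A" by (rule LeastI)
 moreover have "C_plain M x = (LEAST a. a \<in> ?A)" using ne unfolding C_cond_def by (simp only: Inf_enat_def if_False)
 ultimately have "enat l \<in> ?A" using assms by (simp only:)
 then show ?thesis by auto
qed

lemma card_simple:
 assumes "finite \<Omega>" "inj_on f \<Omega>"
 shows "card {\<omega> \<in> \<Omega>. C_plain M (f \<omega>) = enat l} \<le> 2 ^ l"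
proof -
 let ?S = "{\<omega> \<in> \<Omega>. C_plain M (f \<omega>) = enat l}"
 define p where "p \<omega> = (SOME p. length p = l \<and> computes M (encode_pair p []) (f \<omega>))" for \<omega>
 have p: "length (p \<omega>) = l" "computes M (encode_pair (p \<omega>) []) (f \<omega>)" if "\<omega> \<in> ?S" for \<omega>
  using someI_ex[OF C_plain_attained, of M "f \<omega>" l] that unfolding p_def by auto
 have "inj_on p ?S"
 proof (rule inj_onI)
  fix \<omega> \<omega>' assume "\<omega> \<in> ?S" "\<omega>' \<in> ?S" "p \<omega> = p \<omega>'"
  then show "\<omega> = \<omega>'"
   using computes_unique[OF p(2)[of \<omega>]] p(2)[of \<omega>'] by (intro inj_onD[OF assms(2)]) auto
 qed
 moreover have "p ` ?S \<subseteq> {w. length w = l}" using p(1) by auto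
 ultimately show ?thesis
  using card_inj_on_le[of p ?S "{w. length w = l}"] finite_lists_length_eq[of "UNIV :: bool set" l]
   card_lists_length_eq[of "UNIV :: bool set" l] by simp
qed

text \<open>Little mass lies on strings whose complexity is below - log \<mu> + log \<theta>: at
  most \<open>2 ^ l\<close> strings have complexity \<open>l\<close>, each of weight at most
  \<open>\<theta> / 2 ^ l\<close>, so each of the \<open>K + 1\<close> values of \<open>l\<close>
  contributes at most \<open>\<theta>\<close>.\<close>

lemma simple_weight:
 assumes "finite \<Omega>" "inj_on f \<Omega>" "\<And>\<omega>. \<omega> \<in> \<Omega> \<Longrightarrow> 0 \<le> \<mu> \<omega>" "0 \<le> \<theta>"
 shows "(\<Sum>\<omega> | \<omega> \<in> \<Omega> \<and> (\<exists>l\<le>K. C_plain M (f \<omega>) = enat l \<and> \<mu> \<omega> * 2 ^ l \<le> \<theta>). \<mu> \<omega>) \<le> real (Suc K) * \<theta>"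
proof -
 let ?S = "{\<omega>. \<omega> \<in> \<Omega> \<and> (\<exists>l\<le>K. C_plain M (f \<omega>) = enat l \<and> \<mu> \<omega> * 2 ^ l \<le> \<theta>)}"
 let ?g = "\<lambda>\<omega>. the_enat (C_plain M (f \<omega>))"
 have "sum \<mu> ?S = (\<Sum>l\<le>K. sum \<mu> {\<omega> \<in> ?S. ?g \<omega> = l})"
  by (rule sum.group[symmetric]) (use assms(1) in auto)
 also have "\<dots> \<le> (\<Sum>l\<le>K. \<theta>)"
 proof (rule sum_mono)
  fix l
  let ?T = "{\<omega> \<in> ?S. ?g \<omega> = l}"
  have T: "C_plain M (f \<omega>) = enat l \<and> \<mu> \<omega> * 2 ^ l \<le> \<theta>" if "\<omega> \<in> ?T" for \<omega> using that by auto
  have "sum \<mu> ?T \<le> (\<Sum>\<omega>\<in>?T. \<theta> / 2 ^ l)" using T by (intro sum_mono) (auto simp: field_simps)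
  also have "\<dots> = real (card ?T) * (\<theta> / 2 ^ l)" by simp
  also have "\<dots> \<le> 2 ^ l * (\<theta> / 2 ^ l)"
  proof (rule mult_right_mono)
   have "card ?T \<le> card {\<omega> \<in> \<Omega>. C_plain M (f \<omega>) = enat l}"
    using assms(1) T by (intro card_mono) auto
   also have "\<dots> \<le> 2 ^ l" by (rule card_simple[OF assms(1,2)])
   finally have "card ?T \<le> 2 ^ l" .
   from of_nat_mono[OF this, where 'a = real] show "real (card ?T) \<le> 2 ^ l" by simp
  qed (use assms(4) in simp)
  finally show "sum \<mu> ?T \<le> \<theta>" by simp
 qed
 finally show ?thesis by simp
qed

section \<open>Short descriptions of typical executions\<close>

section \<open>Lengths and complexities of the parties' inputs\<close>

lemma digits_bounds: "0 < n \<Longrightarrow> 2 ^ length (digits n) \<le> 4 * n\<^sup>2 \<and> length (digits n) \<le> 2 * n"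
proof (induction n rule: less_induct)
 case (less n)
 have d: "length (digits n) = length (digits (n div 2)) + 2" using less.prems by (subst digits.simps) simp
 show ?case
 proof (cases "n div 2 = 0")
  case True
  then have "digits (n div 2) = []" by (simp add: digits.simps)
  moreover have "1 \<le> n\<^sup>2" using less.prems by (simp add: Suc_le_eq)
  ultimately show ?thesis unfolding d using less.prems by simp
 next
  case False
  then have IH: "2 ^ length (digits (n div 2)) \<le> 4 * (n div 2)\<^sup>2 \<and> length (digits (n div 2)) \<le> 2 * (n div 2)"
   using less.prems by (intro less.IH) auto
  have "4 * (n div 2)\<^sup>2 \<le> n\<^sup>2" using power_mono[of "2 * (n div 2)" n 2] by (simp add: power_mult_distrib)
  moreover have "2 * (n div 2) + 2 \<le> 2 * n" using False by presburger
  ultimately show ?thesis using IH unfolding d power_add by simp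
 qed
qed

lemma numcode_bounds: "2 ^ length (numcode n) \<le> 8 * (n + 1)\<^sup>2" "length (numcode n) \<le> 2 * n + 1"
proof -
 show "2 ^ length (numcode n) \<le> 8 * (n + 1)\<^sup>2"
 proof (cases "n = 0")
  case False
  then have "2 ^ length (numcode n) \<le> 2 * (4 * n\<^sup>2)" using digits_bounds[of n] by (simp add: numcode_def)
  also have "\<dots> \<le> 8 * (n + 1)\<^sup>2" using power_mono[of n "n + 1" 2] by simp
  finally show ?thesis .
 qed (simp add: numcode_def digits.simps)
 show "length (numcode n) \<le> 2 * n + 1" using digits_bounds[of n] by (cases "n = 0") (auto simp: numcode_def digits.simps)
qed

text \<open>Code lengths matter as powers of 2, both as an overhead of descriptions and as the cost
  of guessing. In this form a header is a factor polynomial in \<open>Q\<close>; the linear bound is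
  for running times.\<close>

lemma header_bounds:
 assumes "\<forall>n\<in>set ns. n \<le> Q"
 shows "2 ^ length (header ns) \<le> (8 * (Q + 1)\<^sup>2) ^ length ns" "length (header ns) \<le> (2 * Q + 1) * length ns"
proof -
 show "2 ^ length (header ns) \<le> (8 * (Q + 1)\<^sup>2) ^ length ns" using assms
 proof (induction ns)
  case (Cons n ns)
  have "2 ^ length (numcode n) \<le> 8 * (n + 1)\<^sup>2" by (rule numcode_bounds)
  also have "\<dots> \<le> 8 * (Q + 1)\<^sup>2" using Cons.prems by (intro mult_le_mono2 power_mono) auto
  finally have "2 ^ length (numcode n) \<le> 8 * (Q + 1)\<^sup>2" .
  with Cons show ?case by (simp add: power_add mult_le_mono del: One_nat_def)
 qed simp
 show "length (header ns) \<le> (2 * Q + 1) * length ns" using assms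
 proof (induction ns)
  case (Cons n ns)
  then show ?case using numcode_bounds(2)[of n] by simp
 qed simp
qed

lemma side_mono: "side M f w coins T \<pi> x \<Longrightarrow> T \<le> T' \<Longrightarrow> side M f w coins T' \<pi> x"
 unfolding side_def by force

lemma interaction_mono: "interaction U V a b r s T res \<Longrightarrow> T \<le> T' \<Longrightarrow> interaction U V a b r s T' res"
 by (cases res) (auto simp only: interaction_iff_sides intro: side_mono)

lemma interaction_unique:
 assumes "interaction U V a b r s T res" "interaction U V a b r s T' res'"
 shows "res = res'"
proof -
 let ?J = "joint_step U V a b r s" and ?i = "(True, [], init_conf U, init_conf V)"
 obtain \<pi> x y \<pi>' x' y' where e: "res = (\<pi>, x, y)" "res' = (\<pi>', x', y')" by (metis surj_pair)
 obtain k f u v where 1: "(?J ^^ k) ?i = (f, \<pi>, u, v)" "halted u" "halted v" "out_tape u = x" "out_tape v = y"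
  using assms(1) unfolding e by auto
 obtain k' f' u' v' where 2: "(?J ^^ k') ?i = (f', \<pi>', u', v')" "halted u'" "halted v'" "out_tape u' = x'" "out_tape v' = y'"
  using assms(2) unfolding e by auto
 have "(?J ^^ (k' + k)) ?i = (f, \<pi>, u, v)"
  using funpow_fixpoint[of ?J "(f, \<pi>, u, v)"] 1 by (simp add: funpow_add)
 moreover have "(?J ^^ (k + k')) ?i = (f', \<pi>', u', v')"
  using funpow_fixpoint[of ?J "(f', \<pi>', u', v')"] 2 by (simp add: funpow_add)
 ultimately show ?thesis using 1 2 by (simp add: e add.commute)
qed

lemma interaction_lengths:
 assumes "interaction U V a b r s (real T) (\<pi>, x, y)"
 shows "length \<pi> \<le> 2 * T" "length x \<le> T"
proof -
 let ?J = "joint_step U V a b r s"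
 have inv: "case (?J ^^ k) (True, [], init_conf U, init_conf V) of (f, \<pi>, u, v) \<Rightarrow>
  length \<pi> \<le> steps u + steps v \<and> length (out_tape u) \<le> steps u" for k
 proof (induction k)
  case (Suc k)
  obtain f \<rho> u v where c: "(?J ^^ k) (True, [], init_conf U, init_conf V) = (f, \<rho>, u, v)" by (metis surj_pair)
  then show ?case using Suc by (auto simp: perform_def Let_def split: option.splits)
 qed (simp add: init_conf_def)
 from assms obtain k f u v where "(?J ^^ k) (True, [], init_conf U, init_conf V) = (f, \<pi>, u, v)"
  "steps u \<le> T" "steps v \<le> T" "out_tape u = x" by auto
 with inv[of k] show "length \<pi> \<le> 2 * T" "length x \<le> T" by auto
qed

text \<open>The constant of optimality enters the time as well. That \<open>t\<close> absorbs it
  will hold for large lengths only and so remains a premise.\<close>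

lemma CI_le_party:
 assumes "optimal_pair U V" "wf_tm U'" "deterministic U'" "wf_tm V'" "deterministic V'" "\<And>n. 2 \<le> f n"
 shows "\<exists>c. \<forall>\<pi> x a b. interaction U' V' a b no_coins no_coins (real (f (length (\<pi> @ x)))) (\<pi>, x, x) \<longrightarrow>
  real c * real (f (length (\<pi> @ x))) * log 2 (real (f (length (\<pi> @ x)))) \<le> real (t (length (\<pi> @ x))) \<longrightarrow>
  CI U V (\<lambda>n. real (t n)) \<pi> x \<le> enat (length a + length b + c)"
proof -
 obtain c :: nat where c: "\<And>\<pi> x. CI U V (\<lambda>n. real c * real (f n) * log 2 (real (f n))) \<pi> x \<le> CI U' V' (\<lambda>n. real (f n)) \<pi> x + enat c"
  using assms unfolding optimal_pair_def by meson
 show ?thesis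
 proof (intro exI[of _ c] allI impI)
  fix \<pi> x a b :: bits
  let ?N = "length (\<pi> @ x)"
  assume 1: "interaction U' V' a b no_coins no_coins (real (f ?N)) (\<pi>, x, x)"
   "real c * real (f ?N) * log 2 (real (f ?N)) \<le> real (t ?N)"
  have "CI U V (\<lambda>n. real (t n)) \<pi> x \<le> CI U V (\<lambda>n. real c * real (f n) * log 2 (real (f n))) \<pi> x"
   unfolding CI_def by (rule Inf_superset_mono) (use interaction_mono[OF _ 1(2)] in blast)
  also have "\<dots> \<le> CI U' V' (\<lambda>n. real (f n)) \<pi> x + enat c" by (rule c)
  also have "\<dots> \<le> enat (length a + length b) + enat c"
   unfolding CI_def by (intro add_right_mono Inf_lower) (use 1(1) in blast)
  finally show "CI U V (\<lambda>n. real (t n)) \<pi> x \<le> enat (length a + length b + c)" by simp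
 qed
qed

text \<open>The code of \<open>length a\<close> is the price for separating the two inputs inside
  one program.\<close>

lemma C_le_party:
 assumes "optimal_machine M" "wf_tm U'" "wf_tm V'"
 shows "\<exists>c. \<forall>a b T \<pi> x y. interaction U' V' a b no_coins no_coins T (\<pi>, x, y) \<longrightarrow>
  C_plain M \<pi> \<le> enat (length (numcode (length a)) + length a + length b + c)"
proof -
 obtain c :: nat where c: "\<And>x y. C_cond M x y \<le> C_cond (joint_tm U' V') x y + enat c"
  using assms(1) wf_joint unfolding optimal_machine_def by meson
 have "C_plain M \<pi> \<le> enat (length (numcode (length a)) + length a + length b + c)"
  if "interaction U' V' a b no_coins no_coins T (\<pi>, x, y)" for a b T \<pi> x y
 proof -
  note c[of \<pi> "[]"]
  also have "C_plain (joint_tm U' V') \<pi> + enat c \<le> enat (length (numcode (length a) @ a @ b)) + enat c"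
   by (intro add_right_mono C_plain_le computes_joint[OF assms(2,3) that])
  finally show ?thesis by (simp add: add.assoc)
 qed
 then show ?thesis by blast
qed

text \<open>The masks of the two parties alternate in \<open>u\<close>; the first party's occupies
  the even positions.\<close>

definition evens :: "nat \<Rightarrow> bits \<Rightarrow> bits" where
 "evens W u = map (\<lambda>k. u ! (2 * k)) [0..<W]"

definition odds :: "nat \<Rightarrow> bits \<Rightarrow> bits" where
 "odds W u = map (\<lambda>k. u ! (2 * k + 1)) [0..<W]"

lemma card_evens_odds:
 assumes "X \<subseteq> strs W"
 shows "card {u \<in> strs (2 * W). evens W u \<in> X} \<le> card X * 2 ^ W" "card {u \<in> strs (2 * W). odds W u \<in> X} \<le> card X * 2 ^ W"
proof -
 have inj: "inj_on (\<lambda>u. (evens W u, odds W u)) (strs (2 * W))"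
 proof (rule inj_onI)
  fix u v assume a: "u \<in> strs (2 * W)" "v \<in> strs (2 * W)" "(evens W u, odds W u) = (evens W v, odds W v)"
  show "u = v"
  proof (rule nth_equalityI)
   fix i assume "i < length u"
   then have i: "i div 2 < W" using a(1) by simp
   have "u ! (2 * k) = v ! (2 * k)" "u ! (2 * k + 1) = v ! (2 * k + 1)" if "k < W" for k
    using a(3) that by (simp_all add: evens_def odds_def)
   from this[OF i] show "u ! i = v ! i" by (cases "even i") auto
  qed (use a in simp)
 qed
 have l: "evens W u \<in> strs W" "odds W u \<in> strs W" for u by (simp_all add: evens_def odds_def)
 have fX: "finite X" using assms strs_props finite_subset by blast
 have "card {u \<in> strs (2 * W). evens W u \<in> X} \<le> card (X \<times> strs W)"
  by (rule card_inj_on_le[OF inj_on_subset[OF inj]]) (use l fX strs_props in auto)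
 moreover have "card {u \<in> strs (2 * W). odds W u \<in> X} \<le> card (strs W \<times> X)"
  by (rule card_inj_on_le[OF inj_on_subset[OF inj]]) (use l fX strs_props in auto)
 ultimately show "card {u \<in> strs (2 * W). evens W u \<in> X} \<le> card X * 2 ^ W" "card {u \<in> strs (2 * W). odds W u \<in> X} \<le> card X * 2 ^ W"
  unfolding card_cartesian_product strs_props by (simp_all only: mult.commute)
qed

definition coinset :: "tm \<Rightarrow> bool \<Rightarrow> nat \<Rightarrow> nat \<Rightarrow> bits \<Rightarrow> bits \<Rightarrow> bits set" where
 "coinset A first m T \<pi> x = {r \<in> strs T. side A first (replicate m False) ((!) r) (real T) \<pi> x}"

text \<open>The bound of \<open>run_party\<close> for five numbers at most \<open>Q\<close> and an
  input of length at most \<open>11 * Q + 5 + W\<close>: 66 and 30 are six times 11 and 5, and 10 is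
  6 + 4.\<close>

abbreviation party_time :: "nat \<Rightarrow> nat \<Rightarrow> real" where
 "party_time Q W \<equiv> real (20 * (5 * Q + 3)\<^sup>2 + 66 * Q + 30 + 10 * W)"

text \<open>The input spells out the mask but has only \<open>s\<close> bits about the coins. The
  numbers \<open>i\<close> and \<open>p\<close> let the same coins yield any padded prefix of the
  key, at no more than the cost of the header.\<close>

lemma masked_side:
 assumes A: "wf_tm A" and T: "0 < T" and r: "reaches T s (coinset A first m T \<pi> x) v"
  and u: "length u = 2 * W" "v = (if first then evens W u else odds W u)"
  and Q: "m \<le> Q" "T \<le> Q" "s \<le> Q" "i \<le> Q" "p \<le> Q"
 shows "\<exists>a. side (party_tm A) first a coins (party_time Q W) (u @ \<pi>) (take i x @ replicate p False) \<and>
  length a \<le> 11 * Q + 5 + W \<and> 2 ^ length a \<le> (8 * (Q + 1)\<^sup>2) ^ 5 * 2 ^ (s + W)"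
proof -
 from r obtain rws rest fs where *: "v = concat rws @ rest" "rws \<in> lsts (strs T) (Suc s)" "length fs = s"
  "combine T (True # fs) rws \<in> coinset A first m T \<pi> x" unfolding reaches_def by blast
 let ?a = "header [m, T, length fs, i, p] @ fs @ concat rws @ rest"
 have lv: "length v = W" using u by (simp add: evens_def odds_def)
 have sd: "side (party_tm A) first ?a coins
  (real (20 * (m + T + length fs + i + p + 3) ^ 2 + 6 * length ?a + 4 * length (concat rws @ rest)))
  (u @ \<pi>) (take i x @ replicate p False)"
 proof (rule run_party[OF A T])
  show "length rws = Suc (length fs)" "\<forall>v\<in>set rws. length v = T" using *(2,3) by (auto simp: lsts_def)
  show "length u = 2 * length (concat rws @ rest)" using u(1) lv *(1) by simp
  show "u ! (2 * k + (if first then 0 else 1)) = (concat rws @ rest) ! k" if "k < length (concat rws @ rest)" for k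
   using that u(2) lv unfolding *(1)[symmetric] by (simp add: evens_def odds_def)
  show "side A first (replicate m False) ((!) (combine T (True # fs) rws)) (real T) \<pi> x" using *(4) by (simp add: coinset_def)
 qed
 have ml: "\<forall>n\<in>set [m, T, length fs, i, p]. n \<le> Q" using Q *(3) by simp
 have lh: "length (header [m, T, length fs, i, p]) \<le> 10 * Q + 5" using header_bounds(2)[OF ml] by simp
 have la: "length ?a = length (header [m, T, length fs, i, p]) + s + W" using *(1,3) lv by simp
 have "(m + T + length fs + i + p + 3)\<^sup>2 \<le> (5 * Q + 3)\<^sup>2" using Q *(3) by (intro power_mono) auto
 then have "20 * (m + T + length fs + i + p + 3) ^ 2 + 6 * length ?a + 4 * length (concat rws @ rest) \<le> 20 * (5 * Q + 3)\<^sup>2 + 66 * Q + 30 + 10 * W"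
 proof -
  have "20 * X + 6 * (h + s + W) + 4 * W \<le> 20 * Y + 66 * Q + 30 + 10 * W" if "X \<le> Y" "h \<le> 10 * Q + 5" for X Y h :: nat
   using that Q(3) by simp
  from this[OF _ lh] show ?thesis if "(m + T + length fs + i + p + 3)\<^sup>2 \<le> (5 * Q + 3)\<^sup>2"
   using that unfolding *(1)[symmetric] lv la[unfolded *(1)[symmetric]] by blast
 qed
 then have "side (party_tm A) first ?a coins (party_time Q W) (u @ \<pi>) (take i x @ replicate p False)"
  by (intro side_mono[OF sd]) (simp only: of_nat_le_iff)
 moreover have "2 ^ length ?a \<le> (8 * (Q + 1)\<^sup>2) ^ 5 * 2 ^ (s + W)"
  using header_bounds(1)[OF ml] unfolding la by (simp add: power_add mult.assoc)
 ultimately show ?thesis using la lh Q(3) by (intro exI[of _ ?a]) simp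
qed

section \<open>Typical executions of a protocol\<close>

locale protocol_run =
 fixes A B :: tm and m T :: nat and F :: "bits \<times> bits \<Rightarrow> bits \<times> bits \<times> bits"
 assumes wf: "wf_tm A" "wf_tm B"
  and run: "\<And>r s. r \<in> strs T \<Longrightarrow> s \<in> strs T \<Longrightarrow>
   interaction A B (replicate m False) (replicate m False) ((!) r) ((!) s) (real T) (F (r, s))"
begin

abbreviation "coin_pairs \<equiv> strs T \<times> strs T"

lemma coin_pairs: "finite coin_pairs" "card coin_pairs = 4 ^ T"
 using strs_props[of T] by (simp_all add: card_cartesian_product flip: power_mult_distrib)

lemma F_iff:
 assumes "r \<in> strs T" "s \<in> strs T"
 shows "F (r, s) = (\<pi>, x, y) \<longleftrightarrow> r \<in> coinset A True m T \<pi> x \<and> s \<in> coinset B False m T \<pi> y"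
proof -
 have "F (r, s) = (\<pi>, x, y) \<longleftrightarrow> interaction A B (replicate m False) (replicate m False) ((!) r) ((!) s) (real T) (\<pi>, x, y)"
  using run[OF assms] interaction_unique by metis
 then show ?thesis unfolding interaction_iff_sides using assms by (simp add: coinset_def)
qed

lemma F_lengths:
 assumes "q \<in> coin_pairs" "F q = (\<pi>, x, y)"
 shows "length \<pi> \<le> 2 * T" "length x \<le> T"
proof -
 from assms(1) obtain r s where q: "q = (r, s)" "r \<in> strs T" "s \<in> strs T" by blast
 have "interaction A B (replicate m False) (replicate m False) ((!) r) ((!) s) (real T) (\<pi>, x, y)"
  using run[OF q(2,3)] unfolding q(1)[symmetric] assms(2) .
 from interaction_lengths[OF this] show "length \<pi> \<le> 2 * T" "length x \<le> T" .
qed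

lemma T_pos: "0 < T"
proof (rule ccontr)
 assume "\<not> 0 < T"
 then have "interaction A B (replicate m False) (replicate m False) ((!) []) ((!) []) 0 (F ([], []))"
  using run[of "[]" "[]"] by simp
 then obtain k f \<pi> u v where J: "(joint_step A B (replicate m False) (replicate m False) ((!) []) ((!) []) ^^ k) (True, [], init_conf A, init_conf B) = (f, \<pi>, u, v)"
  "halted u" "steps u = 0" by (cases "F ([], [])") auto
 have "case (joint_step A B (replicate m False) (replicate m False) ((!) []) ((!) []) ^^ k) (True, [], init_conf A, init_conf B) of
  (f, \<pi>, u, v) \<Rightarrow> steps u = 0 \<longrightarrow> \<not> halted u" for k
 proof (induction k)
  case (Suc k)
  then show ?case
   by (cases "(joint_step A B (replicate m False) (replicate m False) ((!) []) ((!) []) ^^ k) (True, [], init_conf A, init_conf B)")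
    (auto simp: perform_def Let_def split: option.splits)
 qed (simp add: init_conf_def halted_def)
 from this[of k] J show False by simp
qed

definition count :: "bits \<Rightarrow> nat" where
 "count \<pi> = card {q \<in> coin_pairs. fst (F q) = \<pi>}"

text \<open>By the rectangle property the product counts the coin pairs with outcome
  \<open>(\<pi>, x, x)\<close>; hence the agreed key has conditional probability at least 1/4 given
  the transcript.\<close>

definition heavy :: "bits \<times> bits \<Rightarrow> bool" where
 "heavy q \<longleftrightarrow> (\<exists>\<pi> x. F q = (\<pi>, x, x) \<and> count \<pi> \<le> 4 * (card (coinset A True m T \<pi> x) * card (coinset B False m T \<pi> x)))"

lemma heavy_frequent: "2 * card {q \<in> coin_pairs. fst (snd (F q)) = snd (snd (F q))} \<le> 2 * card {q \<in> coin_pairs. heavy q} + 4 ^ T"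
proof -
 define light where "light q \<longleftrightarrow> (\<exists>\<pi> x. F q = (\<pi>, x, x) \<and> 4 * card {q' \<in> coin_pairs. F q' = (\<pi>, x, x)} < card {q' \<in> coin_pairs. fst (F q') = \<pi>})" for q
 have l: "2 * card {q \<in> coin_pairs. light q} \<le> card coin_pairs" unfolding light_def
 proof (rule light_pairs)
  fix r s r' s' \<pi> x y x' y'
  assume "F (r, s) = (\<pi>, x, y)" "F (r', s') = (\<pi>, x', y')" "{r, r'} \<subseteq> strs T" "{s, s'} \<subseteq> strs T"
  then show "F (r, s') = (\<pi>, x, y')"
   using F_iff[of r s \<pi> x y] F_iff[of r' s' \<pi> x' y'] F_iff[of r s' \<pi> x y'] by simp
 qed (rule strs_props)+
 have c: "card {q' \<in> coin_pairs. F q' = (\<pi>, x, x)} = card (coinset A True m T \<pi> x) * card (coinset B False m T \<pi> x)" for \<pi> x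
 proof -
  have "{q' \<in> coin_pairs. F q' = (\<pi>, x, x)} = coinset A True m T \<pi> x \<times> coinset B False m T \<pi> x"
   using F_iff by (auto simp: coinset_def)
  then show ?thesis by (simp add: card_cartesian_product)
 qed
 have "{q \<in> coin_pairs. fst (snd (F q)) = snd (snd (F q))} \<subseteq> {q \<in> coin_pairs. light q} \<union> {q \<in> coin_pairs. heavy q}"
 proof
  fix q assume q: "q \<in> {q \<in> coin_pairs. fst (snd (F q)) = snd (snd (F q))}"
  obtain \<pi> x y where F: "F q = (\<pi>, x, y)" by (cases "F q")
  with q have "y = x" by simp
  with F have "heavy q \<or> light q" unfolding heavy_def light_def c count_def by force
  then show "q \<in> {q \<in> coin_pairs. light q} \<union> {q \<in> coin_pairs. heavy q}" using q by blast
 qed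
 then have "card {q \<in> coin_pairs. fst (snd (F q)) = snd (snd (F q))} \<le> card ({q \<in> coin_pairs. light q} \<union> {q \<in> coin_pairs. heavy q})"
  using coin_pairs(1) by (intro card_mono) auto
 with l show ?thesis
  using card_Un_le[of "{q \<in> coin_pairs. light q}" "{q \<in> coin_pairs. heavy q}"] unfolding coin_pairs(2) by linarith
qed

text \<open>The choice depends on \<open>R\<close> and \<open>W\<close> alone: the number of rows
  has to be fixed before the mask is drawn, in order to count the masks that fail.\<close>

definition depth :: "nat \<Rightarrow> bits set \<Rightarrow> nat" where
 "depth W R = (SOME s. s \<le> T + 6 \<and> 2 ^ s * real (card R) \<le> 128 * 2 ^ T \<and>
   64 * real (card {w \<in> strs W. \<not> reaches T s R w}) \<le> 2 ^ W)"

lemma depth: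
 assumes "R \<subseteq> strs T" "R \<noteq> {}" "(T + 7) * T \<le> W"
 shows "depth W R \<le> T + 6" "2 ^ depth W R * real (card R) \<le> 128 * 2 ^ T"
  "64 * real (card {w \<in> strs W. \<not> reaches T (depth W R) R w}) \<le> 2 ^ W"
proof -
 have "\<exists>s. s \<le> T + 6 \<and> 2 ^ s * real (card R) \<le> 128 * 2 ^ T \<and> 64 * real (card {w \<in> strs W. \<not> reaches T s R w}) \<le> 2 ^ W"
  using few_strings_miss[OF assms] by blast
 from someI_ex[OF this, folded depth_def] show "depth W R \<le> T + 6" "2 ^ depth W R * real (card R) \<le> 128 * 2 ^ T"
  "64 * real (card {w \<in> strs W. \<not> reaches T (depth W R) R w}) \<le> 2 ^ W" by simp_all
qed

text \<open>Bob's coins are looked up for Alice's key, as only agreeing outcomes are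
  considered.\<close>

definition reached :: "nat \<Rightarrow> (bits \<times> bits) \<Rightarrow> bits \<Rightarrow> bool" where
 "reached W q u \<longleftrightarrow> (case F q of (\<pi>, x, y) \<Rightarrow>
   reaches T (depth W (coinset A True m T \<pi> x)) (coinset A True m T \<pi> x) (evens W u) \<and>
   reaches T (depth W (coinset B False m T \<pi> x)) (coinset B False m T \<pi> x) (odds W u))"

lemma few_unreached:
 assumes q: "q \<in> coin_pairs" "heavy q" and W: "(T + 7) * T \<le> W"
 shows "32 * card {u \<in> strs (2 * W). \<not> reached W q u} \<le> 4 ^ W"
proof -
 obtain r s where rs: "q = (r, s)" "r \<in> strs T" "s \<in> strs T" using q(1) by blast
 obtain \<pi> x where F: "F q = (\<pi>, x, x)" using q(2) by (auto simp: heavy_def)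
 let ?a = "coinset A True m T \<pi> x" and ?b = "coinset B False m T \<pi> x"
 have ne: "?a \<noteq> {}" "?b \<noteq> {}" using F_iff[OF rs(2,3), of \<pi> x x] F rs(1) by auto
 have sub: "?a \<subseteq> strs T" "?b \<subseteq> strs T" by (auto simp: coinset_def)
 let ?X = "{w \<in> strs W. \<not> reaches T (depth W ?a) ?a w}" and ?Y = "{w \<in> strs W. \<not> reaches T (depth W ?b) ?b w}"
 have l: "evens W u \<in> strs W" "odds W u \<in> strs W" for u by (simp_all add: evens_def odds_def)
 have "64 * real (card ?X) \<le> 2 ^ W" "64 * real (card ?Y) \<le> 2 ^ W"
  using depth(3)[OF sub(1) ne(1) W] depth(3)[OF sub(2) ne(2) W] .
 then have XY: "64 * card ?X \<le> 2 ^ W" "64 * card ?Y \<le> 2 ^ W"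
  by (simp_all only: flip: of_nat_le_iff[where 'a = real]) simp_all
 have "{u \<in> strs (2 * W). \<not> reached W q u} \<subseteq> {u \<in> strs (2 * W). evens W u \<in> ?X} \<union> {u \<in> strs (2 * W). odds W u \<in> ?Y}"
  using l by (auto simp: reached_def F)
 then have "card {u \<in> strs (2 * W). \<not> reached W q u} \<le> card ({u \<in> strs (2 * W). evens W u \<in> ?X} \<union> {u \<in> strs (2 * W). odds W u \<in> ?Y})"
  using strs_props by (intro card_mono) simp_all
 also have "\<dots> \<le> card ?X * 2 ^ W + card ?Y * 2 ^ W"
  by (rule order_trans[OF card_Un_le add_mono]) (rule card_evens_odds; blast)+
 finally have "64 * card {u \<in> strs (2 * W). \<not> reached W q u} \<le> (64 * card ?X + 64 * card ?Y) * 2 ^ W" by (simp add: algebra_simps)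
 also have "\<dots> \<le> (2 ^ W + 2 ^ W) * 2 ^ W" using XY by (intro mult_le_mono1 add_mono)
 also have "\<dots> = 2 * 4 ^ W" by (simp add: mult_2[symmetric] flip: power_mult_distrib)
 finally show ?thesis by simp
qed

text \<open>The probability of a transcript preceded by given masks.\<close>

definition weight :: "nat \<Rightarrow> bits \<Rightarrow> real" where
 "weight W \<pi> = real (count \<pi>) / (4 ^ T * 4 ^ W)"

abbreviation "transcripts \<equiv> (\<lambda>q. fst (F q)) ` coin_pairs"

text \<open>Passes from coins to masked transcripts: complexity depends on the latter only, and the
  counting of simple strings requires distinct strings.\<close>

lemma sum_outcomes:
 "(\<Sum>q\<in>coin_pairs. \<Sum>u\<in>strs (2 * W). g (fst (F q)) u) = 4 ^ T * 4 ^ W * (\<Sum>(\<pi>, u)\<in>transcripts \<times> strs (2 * W). weight W \<pi> * g \<pi> u)"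
proof -
 have "(\<Sum>q\<in>coin_pairs. \<Sum>u\<in>strs (2 * W). g (fst (F q)) u) =
  (\<Sum>\<pi>\<in>transcripts. \<Sum>q | q \<in> coin_pairs \<and> fst (F q) = \<pi>. \<Sum>u\<in>strs (2 * W). g (fst (F q)) u)"
  by (rule sum.image_gen[OF coin_pairs(1)])
 also have "\<dots> = (\<Sum>\<pi>\<in>transcripts. real (count \<pi>) * (\<Sum>u\<in>strs (2 * W). g \<pi> u))"
  by (intro sum.cong) (simp_all add: count_def)
 also have "\<dots> = 4 ^ T * 4 ^ W * (\<Sum>(\<pi>, u)\<in>transcripts \<times> strs (2 * W). weight W \<pi> * g \<pi> u)"
  by (simp add: sum.cartesian_product[symmetric] sum_distrib_left weight_def)
 finally show ?thesis .
qed

text \<open>The inequality says that the complexity is at most \<lambda> + log \<theta>, where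
  \<lambda> is - log of \<open>weight W \<pi>\<close>, the information content of the masked
  transcript. The cap \<open>K\<close> leaves finitely many values of \<open>l\<close> to sum
  over.\<close>

definition simple :: "tm \<Rightarrow> nat \<Rightarrow> nat \<Rightarrow> real \<Rightarrow> bits \<Rightarrow> bits \<Rightarrow> bool" where
 "simple M K W \<theta> \<pi> z \<longleftrightarrow> (\<exists>l\<le>K. C_plain M z = enat l \<and> weight W \<pi> * 2 ^ l \<le> \<theta>)"

text \<open>Used twice: with \<open>L = 0\<close> for the masked transcripts themselves, and with
  the length of padded keys for the queries. Injectivity in \<open>z\<close> is asked for strings of
  the same prescribed length only, so that \<open>f\<close> may ignore \<open>z\<close> in the first
  case.\<close>

lemma few_simple_masked:
 assumes "0 \<le> \<theta>" and f: "\<And>v z v' z'. f v z = f v' z' \<Longrightarrow> v = v' \<and> (\<forall>\<pi>. z \<in> strs (L \<pi>) \<longrightarrow> z' \<in> strs (L \<pi>) \<longrightarrow> z = z')"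
 shows "(\<Sum>q\<in>coin_pairs. \<Sum>u\<in>strs (2 * W). real (card {z \<in> strs (L (fst (F q))). simple M K W \<theta> (fst (F q)) (f (u @ fst (F q)) z)}))
  \<le> 4 ^ T * 4 ^ W * (real (Suc K) * \<theta>)"
proof -
 define \<Omega> where "\<Omega> = Sigma (transcripts \<times> strs (2 * W)) (\<lambda>(\<pi>, u). strs (L \<pi>))"
 have fin: "finite transcripts" using coin_pairs(1) by blast
 have f\<Omega>: "finite \<Omega>" unfolding \<Omega>_def by (intro finite_SigmaI finite_cartesian_product fin strs_props(1)) (auto simp: strs_props)
 let ?f = "\<lambda>((\<pi>, u), z). f (u @ \<pi>) z" and ?\<mu> = "\<lambda>((\<pi>, u :: bits), z :: bits). weight W \<pi>"
 have inj: "inj_on ?f \<Omega>"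
 proof (rule inj_onI)
  fix a b assume "a \<in> \<Omega>" "b \<in> \<Omega>" "?f a = ?f b"
  moreover obtain \<pi> u z \<pi>' u' z' where "a = ((\<pi>, u), z)" "b = ((\<pi>', u'), z')" by (metis surj_pair)
  ultimately show "a = b" using f[of "u @ \<pi>" z "u' @ \<pi>'" z'] by (auto simp: \<Omega>_def)
 qed
 have "(\<Sum>q\<in>coin_pairs. \<Sum>u\<in>strs (2 * W). real (card {z \<in> strs (L (fst (F q))). simple M K W \<theta> (fst (F q)) (f (u @ fst (F q)) z)})) =
  4 ^ T * 4 ^ W * (\<Sum>(\<pi>, u)\<in>transcripts \<times> strs (2 * W). weight W \<pi> * real (card {z \<in> strs (L \<pi>). simple M K W \<theta> \<pi> (f (u @ \<pi>) z)}))"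
  by (rule sum_outcomes)
 also have "(\<Sum>(\<pi>, u)\<in>transcripts \<times> strs (2 * W). weight W \<pi> * real (card {z \<in> strs (L \<pi>). simple M K W \<theta> \<pi> (f (u @ \<pi>) z)})) =
  (\<Sum>p\<in>transcripts \<times> strs (2 * W). \<Sum>z | z \<in> strs (L (fst p)) \<and> simple M K W \<theta> (fst p) (f (snd p @ fst p) z). weight W (fst p))"
  by (intro sum.cong) auto
 also have "\<dots> = sum ?\<mu> (Sigma (transcripts \<times> strs (2 * W)) (\<lambda>p. {z \<in> strs (L (fst p)). simple M K W \<theta> (fst p) (f (snd p @ fst p) z)}))"
  using fin strs_props by (subst sum.Sigma) (auto intro!: sum.cong)
 also have "Sigma (transcripts \<times> strs (2 * W)) (\<lambda>p. {z \<in> strs (L (fst p)). simple M K W \<theta> (fst p) (f (snd p @ fst p) z)}) =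
  {\<omega>. \<omega> \<in> \<Omega> \<and> (\<exists>l\<le>K. C_plain M (?f \<omega>) = enat l \<and> ?\<mu> \<omega> * 2 ^ l \<le> \<theta>)}"
  unfolding \<Omega>_def simple_def by fastforce
 also have "sum ?\<mu> \<dots> \<le> real (Suc K) * \<theta>"
  by (rule simple_weight[OF f\<Omega> inj]) (use assms(1) in \<open>auto simp: weight_def\<close>)
 finally show ?thesis by (simp add: mult_left_mono)
qed

end

abbreviation masked_run :: "tm \<Rightarrow> tm \<Rightarrow> bits \<Rightarrow> bits \<Rightarrow> real \<Rightarrow> bits \<times> bits \<times> bits \<Rightarrow> bool" where
 "masked_run A B a b \<equiv> interaction (party_tm A) (party_tm B) a b no_coins no_coins"

text \<open>A query has length \<open>4 * W + 2 * length \<pi> + length z + 1\<close>. With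
  \<open>length \<pi> \<le> 2 * T\<close> the bounds on \<open>n\<close> leave at least
  \<open>T\<close> and at most \<open>6 * T + 11\<close> bits for the padded key; they admit four
  values of \<open>n\<close> because \<open>W\<close> is rounded. \<open>Q\<close> bounds all
  numbers in a party's header. In \<open>small\<close>, 22 is the 16 of \<open>good_inputs\<close>
  plus 6 for the factor 64 in \<open>good\<close>; in \<open>big\<close>, 19 is the same 16 plus 3
  for the factor 8 of \<open>numcode_bounds\<close>.\<close>

locale attack = protocol_run +
 fixes M U V :: tm and t :: "nat \<Rightarrow> nat" and c e :: real and n W Q c0 c1 E D :: nat
 assumes n: "4 * W + 6 * T + 9 \<le> n" "n \<le> 4 * W + 6 * T + 12"
  and W: "(T + 7) * T \<le> W"
  and Q: "m \<le> Q" "7 * T + 12 \<le> Q" "11 * Q + 5 + W \<le> n"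
  and c: "3 < c" and e: "e \<le> real E"
  and CI: "\<And>\<pi> x a b. masked_run A B a b (party_time Q W) (\<pi>, x, x) \<Longrightarrow>
   n \<le> 2 * length (\<pi> @ x) \<Longrightarrow> length (\<pi> @ x) \<le> n \<Longrightarrow>
   CI U V (\<lambda>n. real (t n)) \<pi> x \<le> enat (length a + length b + c0)"
  and C: "\<And>a b T' \<pi> x y. masked_run A B a b T' (\<pi>, x, y) \<Longrightarrow>
   C_plain M \<pi> \<le> enat (length (numcode (length a)) + length a + length b + c1)"
  and small: "real ((8 * (Q + 1)\<^sup>2) ^ 10 * 2 ^ (22 + c0) * (2 * n + 1)) \<le> (real n / 2) ^ 3"
  and big: "2 ^ (19 + c1) * (8 * (Q + 1)\<^sup>2) ^ 10 * (n + 1)\<^sup>2 * n ^ E \<le> n ^ D" "n ^ D \<le> 2 ^ n"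
begin

definition keylen :: "bits \<Rightarrow> nat" where
 "keylen \<pi> = n - 1 - 4 * W - 2 * length \<pi>"

text \<open>64 times the bound that \<open>few_simple_masked\<close> gives for the mean number of
  simple queries, for an application of Markov's inequality.\<close>

definition bound :: nat where
 "bound = 64 * n ^ D * (2 * n + 1)"

definition good :: "bits \<times> bits \<Rightarrow> bits \<Rightarrow> bool" where
 "good q u \<longleftrightarrow> u \<in> strs (2 * W) \<and> heavy q \<and> reached W q u \<and>
   \<not> simple M (2 * n) W (1 / (64 * (2 * n + 1))) (fst (F q)) (u @ fst (F q)) \<and>
   card {z \<in> strs (keylen (fst (F q))). simple M (2 * n) W (n ^ D) (fst (F q)) (encode_pair (u @ fst (F q)) z)} \<le> bound"

lemma n_pos: "0 < n" using n(1) by simp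

text \<open>Agreement 7/8 leaves 7/8 - 1/2 = 3/8 for heavy outcomes. Masks that miss a set of coins
  cost 1/32, simple masked transcripts 1/64, and those with too many simple queries 1/64; more than
  1/4 remains.\<close>

lemma good_frequent:
 assumes "7 * 4 ^ T \<le> 8 * card {q \<in> coin_pairs. fst (snd (F q)) = snd (snd (F q))}"
 shows "4 ^ T * 4 ^ W \<le> 4 * (\<Sum>q\<in>coin_pairs. card {u. good q u})"
proof -
 let ?\<theta> = "1 / (64 * (2 * n + 1)) :: real" and ?U = "strs (2 * W)"
 let ?S = "\<lambda>q u. {z \<in> strs (keylen (fst (F q))). simple M (2 * n) W (n ^ D) (fst (F q)) (encode_pair (u @ fst (F q)) z)}"
 let ?h = "{q \<in> coin_pairs. heavy q}"
 have fU: "finite ?U" "card ?U = 4 ^ W" using strs_props[of "2 * W"] by (simp_all add: power_mult)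
 define b1 where "b1 q = {u \<in> ?U. \<not> reached W q u}" for q
 define b2 where "b2 q = {u \<in> ?U. simple M (2 * n) W ?\<theta> (fst (F q)) (u @ fst (F q))}" for q
 define b3 where "b3 q = {u \<in> ?U. bound < card (?S q u)}" for q
 have h: "3 * 4 ^ T \<le> 8 * card ?h" using heavy_frequent assms by linarith
 have "(\<Sum>q\<in>?h. 32 * card (b1 q)) \<le> (\<Sum>q\<in>?h. 4 ^ W)"
  unfolding b1_def by (intro sum_mono few_unreached W) auto
 also have "\<dots> \<le> 4 ^ T * 4 ^ W" using card_mono[OF coin_pairs(1), of ?h] unfolding coin_pairs(2) by simp
 finally have 1: "32 * (\<Sum>q\<in>?h. card (b1 q)) \<le> 4 ^ T * 4 ^ W" by (simp add: sum_distrib_left)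
 have 2: "64 * (\<Sum>q\<in>coin_pairs. card (b2 q)) \<le> 4 ^ T * 4 ^ W"
 proof -
  have "(\<Sum>q\<in>coin_pairs. \<Sum>u\<in>?U. real (card {z \<in> strs 0. simple M (2 * n) W ?\<theta> (fst (F q)) (u @ fst (F q))}))
   \<le> 4 ^ T * 4 ^ W * (real (Suc (2 * n)) * ?\<theta>)"
   by (rule few_simple_masked[where f = "\<lambda>v z. v" and L = "\<lambda>_. 0"]) auto
  moreover have "real (card {z \<in> strs 0. P}) = (if P then 1 else 0)" for P by simp
  moreover have "(\<Sum>u\<in>?U. if simple M (2 * n) W ?\<theta> (fst (F q)) (u @ fst (F q)) then 1 else 0 :: real) = real (card (b2 q))" for q
   unfolding b2_def using fU(1) by (simp add: sum.If_cases Int_def)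
  ultimately have "(\<Sum>q\<in>coin_pairs. real (card (b2 q))) \<le> 4 ^ T * 4 ^ W * (real (Suc (2 * n)) * ?\<theta>)" by (simp only:)
  also have "real (Suc (2 * n)) * ?\<theta> = 1 / 64" by (simp add: field_simps)
  finally have "real (64 * (\<Sum>q\<in>coin_pairs. card (b2 q))) \<le> real (4 ^ T * 4 ^ W)" by simp
  then show ?thesis by (simp only: of_nat_le_iff)
 qed
 have 3: "64 * (\<Sum>q\<in>coin_pairs. card (b3 q)) \<le> 4 ^ T * 4 ^ W"
 proof -
  have "real bound * real (card (b3 q)) \<le> (\<Sum>u\<in>?U. real (card (?S q u)))" for q
  proof -
   have "real bound * real (card (b3 q)) = (\<Sum>u\<in>b3 q. real bound)" by simp
   also have "\<dots> \<le> (\<Sum>u\<in>b3 q. real (card (?S q u)))" by (intro sum_mono) (simp add: b3_def)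
   also have "\<dots> \<le> (\<Sum>u\<in>?U. real (card (?S q u)))" using fU(1) by (intro sum_mono2) (auto simp: b3_def)
   finally show ?thesis .
  qed
  then have "(\<Sum>q\<in>coin_pairs. real bound * real (card (b3 q))) \<le> (\<Sum>q\<in>coin_pairs. \<Sum>u\<in>?U. real (card (?S q u)))"
   by (intro sum_mono)
  also have "\<dots> \<le> 4 ^ T * 4 ^ W * (real (Suc (2 * n)) * real (n ^ D))"
   by (rule few_simple_masked[where f = encode_pair]) (auto simp: encode_pair_inject)
  finally have "real bound * (\<Sum>q\<in>coin_pairs. real (card (b3 q))) \<le> 4 ^ T * 4 ^ W * (real (Suc (2 * n)) * real (n ^ D))"
   by (simp only: sum_distrib_left)
  moreover have "real bound = 64 * (real (Suc (2 * n)) * real (n ^ D))" by (simp add: bound_def algebra_simps)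
  moreover have "0 < real (Suc (2 * n)) * real (n ^ D)" using n_pos by simp
  ultimately have "64 * (\<Sum>q\<in>coin_pairs. real (card (b3 q))) * (real (Suc (2 * n)) * real (n ^ D)) \<le> 4 ^ T * 4 ^ W * (real (Suc (2 * n)) * real (n ^ D))"
   "0 < real (Suc (2 * n)) * real (n ^ D)" by (simp_all only: ac_simps)
  then have "64 * (\<Sum>q\<in>coin_pairs. real (card (b3 q))) \<le> 4 ^ T * 4 ^ W" by (simp only: mult_le_cancel_right_pos)
  then have "real (64 * (\<Sum>q\<in>coin_pairs. card (b3 q))) \<le> real (4 ^ T * 4 ^ W)" by simp
  then show ?thesis by (simp only: of_nat_le_iff)
 qed
 have "4 ^ W \<le> card {u. good q u} + (card (b1 q) + (card (b2 q) + card (b3 q)))" if "q \<in> ?h" for q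
 proof -
  have "?U \<subseteq> {u. good q u} \<union> (b1 q \<union> (b2 q \<union> b3 q))"
   using that by (auto simp: good_def b1_def b2_def b3_def not_less)
  moreover have "finite {u. good q u}" by (rule finite_subset[OF _ fU(1)]) (auto simp: good_def)
  ultimately have "card ?U \<le> card ({u. good q u} \<union> (b1 q \<union> (b2 q \<union> b3 q)))"
   using fU(1) by (intro card_mono) (simp_all add: b1_def b2_def b3_def)
  also have "\<dots> \<le> card {u. good q u} + (card (b1 q) + (card (b2 q) + card (b3 q)))"
   by (meson card_Un_le add_left_mono order_trans)
  finally show ?thesis unfolding fU(2) .
 qed
 then have "(\<Sum>q\<in>?h. 4 ^ W) \<le> (\<Sum>q\<in>?h. card {u. good q u} + (card (b1 q) + (card (b2 q) + card (b3 q))))"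
  by (rule sum_mono)
 then have "card ?h * 4 ^ W \<le> (\<Sum>q\<in>?h. card {u. good q u}) + ((\<Sum>q\<in>?h. card (b1 q)) + ((\<Sum>q\<in>?h. card (b2 q)) + (\<Sum>q\<in>?h. card (b3 q))))"
  by (simp add: sum.distrib)
 moreover have "sum f ?h \<le> sum f coin_pairs" for f :: "_ \<Rightarrow> nat"
  using coin_pairs(1) by (intro sum_mono2) auto
 note this[of "\<lambda>q. card {u. good q u}"] this[of "\<lambda>q. card (b2 q)"] this[of "\<lambda>q. card (b3 q)"]
 moreover have "3 * (4 ^ T * 4 ^ W) \<le> 8 * (card ?h * 4 ^ W)" using mult_le_mono1[OF h, of "4 ^ W"] by (simp only: mult.assoc)
 ultimately show ?thesis using 1 2 3 by linarith
qed

context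
 fixes q u \<pi> x
 assumes q: "q \<in> coin_pairs" and gd: "good q u" and Fq: "F q = (\<pi>, x, x)"
begin

lemma keylen: "keylen \<pi> \<le> 6 * T + 11" "T \<le> keylen \<pi>" "4 * W + 2 * length \<pi> + keylen \<pi> + 1 = n"
 using F_lengths(1)[OF q Fq] n by (simp_all add: keylen_def)

text \<open>For each party \<open>depth\<close> bounds \<open>2 ^ s * card R\<close> by
  \<open>128 * 2 ^ T\<close>, which makes the selection bits pay exactly for the rarity of its
  coins. With the factor 4 of \<open>heavy\<close> this gives 2^16 = 128 * 128 * 4; the tenth power
  is that of ten header numbers, and the masks, \<open>4 ^ W\<close>, cancel against the
  weight.\<close>

lemma good_inputs:
 assumes "i \<le> T"
 shows "\<exists>a b. masked_run A B a b (party_time Q W)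
   (u @ \<pi>, take i x @ replicate (keylen \<pi> - i) False, take i x @ replicate (keylen \<pi> - i) False) \<and>
  length a \<le> n \<and> 2 ^ (length a + length b) * weight W \<pi> \<le> real ((8 * (Q + 1)\<^sup>2) ^ 10 * 2 ^ 16)"
proof -
 let ?a = "coinset A True m T \<pi> x" and ?b = "coinset B False m T \<pi> x"
 let ?sa = "depth W ?a" and ?sb = "depth W ?b" and ?H = "8 * (Q + 1)\<^sup>2"
 obtain r s where rs: "q = (r, s)" "r \<in> strs T" "s \<in> strs T" using q by blast
 have ne: "?a \<noteq> {}" "?b \<noteq> {}" using F_iff[OF rs(2,3), of \<pi> x x] Fq rs(1) by auto
 have sub: "?a \<subseteq> strs T" "?b \<subseteq> strs T" by (auto simp: coinset_def)
 note da = depth[OF sub(1) ne(1) W] and db = depth[OF sub(2) ne(2) W]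
 have u: "length u = 2 * W" and re: "reaches T ?sa ?a (evens W u)" "reaches T ?sb ?b (odds W u)"
  using gd by (simp_all add: good_def reached_def Fq)
 have Qs: "T \<le> Q" "?sa \<le> Q" "?sb \<le> Q" "i \<le> Q" "keylen \<pi> - i \<le> Q"
  using Q(2) da(1) db(1) assms keylen(1) by simp_all
 obtain a where a: "side (party_tm A) True a no_coins (party_time Q W) (u @ \<pi>) (take i x @ replicate (keylen \<pi> - i) False)"
  "length a \<le> 11 * Q + 5 + W" "2 ^ length a \<le> ?H ^ 5 * 2 ^ (?sa + W)"
  using masked_side[OF wf(1) T_pos re(1) u _ Q(1) Qs(1,2,4,5)] by (auto simp only: if_True)
 obtain b where b: "side (party_tm B) False b no_coins (party_time Q W) (u @ \<pi>) (take i x @ replicate (keylen \<pi> - i) False)"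
  "2 ^ length b \<le> ?H ^ 5 * 2 ^ (?sb + W)"
  using masked_side[OF wf(2) T_pos re(2) u _ Q(1) Qs(1,3,4,5)] by (auto simp only: if_False)
 have hv: "count \<pi> \<le> 4 * (card ?a * card ?b)" using gd Fq by (auto simp: good_def heavy_def)
 have "2 ^ (length a + length b) \<le> (?H ^ 5 * 2 ^ (?sa + W)) * (?H ^ 5 * 2 ^ (?sb + W))"
  unfolding power_add using a(3) b(2) by (intro mult_le_mono) (simp_all only: power_add)
 also have "\<dots> = ?H ^ 10 * (2 ^ ?sa * 2 ^ ?sb * 4 ^ W)"
 proof -
  have "(4 :: nat) ^ W = 2 ^ W * 2 ^ W" "?H ^ 10 = ?H ^ 5 * ?H ^ 5"
   by (simp flip: power_mult_distrib) (simp only: power_add[symmetric], simp)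
  then show ?thesis by (simp only: power_add ac_simps)
 qed
 finally have "2 ^ (length a + length b) * count \<pi> \<le> (?H ^ 10 * (2 ^ ?sa * 2 ^ ?sb * 4 ^ W)) * (4 * (card ?a * card ?b))"
  using hv by (rule mult_le_mono)
 from of_nat_mono[OF this, where 'a = real]
 have "2 ^ (length a + length b) * real (count \<pi>) \<le> real (?H ^ 10) * 4 * 4 ^ W * ((2 ^ ?sa * real (card ?a)) * (2 ^ ?sb * real (card ?b)))"
  by (simp add: ac_simps)
 also have "\<dots> \<le> real (?H ^ 10) * 4 * 4 ^ W * ((128 * 2 ^ T) * (128 * 2 ^ T))"
  by (rule mult_left_mono[OF mult_mono[OF da(2) db(2)]]) simp_all
 also have "\<dots> = real (?H ^ 10 * 2 ^ 16) * (4 ^ T * 4 ^ W)" by (simp add: ac_simps flip: power_mult_distrib)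
 finally have "2 ^ (length a + length b) * weight W \<pi> \<le> real (?H ^ 10 * 2 ^ 16)" by (simp add: weight_def field_simps)
 then show ?thesis using a(1,2) b(1) Q(3) unfolding interaction_iff_sides by (intro exI[of _ a] exI[of _ b]) simp
qed

lemma weight_lower: "1 \<le> weight W \<pi> * 2 ^ (2 * T + 2 * W)"
proof -
 have "card {q} \<le> count \<pi>" unfolding count_def using q Fq coin_pairs(1) by (intro card_mono) auto
 then have "1 \<le> real (count \<pi>)" by simp
 then show ?thesis by (simp add: weight_def power_add power_mult)
qed

text \<open>The interactive complexity exceeds \<lambda> by at most the logarithm of the factor in
  \<open>good_inputs\<close> plus \<open>c0\<close>. As the masked transcript is not
  \<open>simple\<close>, its plain complexity is above \<lambda> - log (64 (2n + 1)). By
  \<open>small\<close> the gap is at most 3 log (n / 2), and \<open>n \<le> 2 * N\<close>.\<close>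

lemma prefix_query:
 assumes "i \<le> length x"
 shows "encode_pair (u @ \<pi>) (take i x @ replicate (keylen \<pi> - i) False) \<in> Y_set M U V t c"
proof -
 let ?x = "take i x @ replicate (keylen \<pi> - i) False" and ?H = "8 * (Q + 1)\<^sup>2"
 have iT: "i \<le> T" using assms F_lengths(2)[OF q Fq] by simp
 have u: "length u = 2 * W" using gd by (simp add: good_def)
 define N where "N = length ((u @ \<pi>) @ ?x)"
 have "length ?x = keylen \<pi>" using iT keylen(2) assms by simp
 then have N: "n \<le> 2 * N" "N \<le> n" "1 \<le> N" using keylen u n T_pos by (simp_all add: N_def)
 obtain a b where ab: "masked_run A B a b (party_time Q W) (u @ \<pi>, ?x, ?x)"
  "2 ^ (length a + length b) * weight W \<pi> \<le> real (?H ^ 10 * 2 ^ 16)" using good_inputs[OF iT] by blast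
 let ?k = "length a + length b + c0"
 have ci: "CI U V (\<lambda>n. real (t n)) (u @ \<pi>) ?x \<le> enat ?k"
  by (rule CI[OF ab(1)]) (use N in \<open>simp_all only: N_def\<close>)
 have "ereal_of_enat (CI U V (\<lambda>n. real (t n)) (u @ \<pi>) ?x) \<le> ereal_of_enat (C_plain M (u @ \<pi>)) + ereal (c * log 2 (real N))"
 proof (cases "C_plain M (u @ \<pi>)")
  case (enat l)
  have th: "1 / (64 * (2 * n + 1)) < weight W \<pi> * 2 ^ l"
  \<comment> \<open>Above \<open>2 * n\<close> the failure of \<open>simple\<close> says nothing,
    but there the trivial bound \<open>weight_lower\<close> is enough.\<close>
  proof (cases "l \<le> 2 * n")
   case True
   then show ?thesis using gd enat by (auto simp: good_def simple_def Fq not_le)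
  next
   case False
   then have "2 * T + 2 * W \<le> l" using n(1) by simp
   then have "weight W \<pi> * 2 ^ (2 * T + 2 * W) \<le> weight W \<pi> * 2 ^ l"
    by (intro mult_left_mono power_increasing) (simp_all add: weight_def)
   then have "1 \<le> weight W \<pi> * 2 ^ l" using weight_lower by linarith
   moreover have "1 / (64 * (2 * n + 1)) < (1 :: real)" by simp
   ultimately show ?thesis by linarith
  qed
  have "2 ^ ?k * (1 / (64 * (2 * n + 1))) \<le> 2 ^ ?k * (weight W \<pi> * 2 ^ l)"
   using th by (intro mult_left_mono) simp_all
  also have "\<dots> = 2 ^ (length a + length b) * weight W \<pi> * (2 ^ c0 * 2 ^ l)" by (simp add: power_add)
  also have "\<dots> \<le> real (?H ^ 10 * 2 ^ 16) * (2 ^ c0 * 2 ^ l)" by (rule mult_right_mono[OF ab(2)]) simp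
  finally have "2 ^ ?k \<le> real (?H ^ 10 * 2 ^ 16) * (2 ^ c0 * 2 ^ l) * (64 * (2 * n + 1))" by (simp add: field_simps)
  also have "\<dots> = real (?H ^ 10 * 2 ^ (22 + c0) * (2 * n + 1)) * 2 ^ l" by (simp add: power_add algebra_simps)
  also have "\<dots> \<le> (real n / 2) ^ 3 * 2 ^ l" by (rule mult_right_mono[OF small]) simp
  also have "\<dots> \<le> real N ^ 3 * 2 ^ l" using N(1) by (intro mult_right_mono power_mono) simp_all
  finally have "log 2 (2 ^ ?k) \<le> log 2 (real N ^ 3 * 2 ^ l)" using N(3) by (subst log_le_cancel_iff) simp_all
  then have "real ?k \<le> 3 * log 2 (real N) + real l" using N(3) by (simp add: log_mult log_nat_power)
  also have "\<dots> \<le> real l + c * log 2 (real N)" using mult_right_mono[of 3 c "log 2 (real N)"] c N(3) by simp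
  finally have "ereal (real ?k) \<le> ereal (real l) + ereal (c * log 2 (real N))" by simp
  moreover have "ereal_of_enat (CI U V (\<lambda>n. real (t n)) (u @ \<pi>) ?x) \<le> ereal (real ?k)"
   using ci by (metis ereal_of_enat_le_iff ereal_of_enat_simps(1))
  ultimately show ?thesis unfolding enat ereal_of_enat_simps by (rule order_trans[rotated])
 qed simp
 then show ?thesis unfolding Y_set_def N_def by blast
qed

text \<open>\<open>good\<close> bounds the number of simple queries, so it suffices that every query
  that is not a no instance is simple. Its complexity is less than that of the masked transcript
  plus e log N, and a joint simulation bounds the latter by \<lambda> plus a logarithm;
  \<open>big\<close> collects these terms.\<close>

lemma few_unspecific: "card {z \<in> strs (keylen \<pi>). encode_pair (u @ \<pi>) z \<notin> N_set M e} \<le> bound"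
proof -
 let ?S = "{z \<in> strs (keylen \<pi>). simple M (2 * n) W (n ^ D) \<pi> (encode_pair (u @ \<pi>) z)}" and ?H = "8 * (Q + 1)\<^sup>2"
 \<comment> \<open>Only the transcript is to be described, so any key will do: a prefix of length 0
   gives the all-zero one.\<close>
 obtain a b where ab: "masked_run A B a b (party_time Q W)
   (u @ \<pi>, replicate (keylen \<pi>) False, replicate (keylen \<pi>) False)"
  "length a \<le> n" "2 ^ (length a + length b) * weight W \<pi> \<le> real (?H ^ 10 * 2 ^ 16)"
  using good_inputs[of 0, unfolded take_0 append_Nil diff_zero] by blast
 let ?d = "length (numcode (length a)) + length a + length b + c1"
 have Cd: "C_plain M (u @ \<pi>) \<le> enat ?d" by (rule C[OF ab(1)])
 have u: "length u = 2 * W" using gd by (simp add: good_def)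
 have "simple M (2 * n) W (n ^ D) \<pi> (encode_pair (u @ \<pi>) z)" if z: "length z = keylen \<pi>" "encode_pair (u @ \<pi>) z \<notin> N_set M e" for z
 proof -
  let ?v = "encode_pair (u @ \<pi>) z"
  define N where "N = length ((u @ \<pi>) @ z)"
  have N: "1 \<le> N" "N \<le> n" using keylen u n T_pos z(1) by (simp_all add: N_def)
  have lN: "0 \<le> log 2 (real N)" using N(1) by simp
  have "ereal_of_enat (C_plain M ?v) < ereal_of_enat (C_plain M (u @ \<pi>)) + ereal (e * log 2 (real N))"
   using z(2) unfolding N_set_def N_def by (simp only: mem_Collect_eq) (metis not_le)
  also have "\<dots> \<le> ereal (real ?d) + ereal (real E * log 2 (real N))"
   using Cd e lN by (intro add_mono) (metis ereal_of_enat_le_iff ereal_of_enat_simps(1), simp add: mult_right_mono)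
  finally have lt: "ereal_of_enat (C_plain M ?v) < ereal (real ?d + real E * log 2 (real N))" by simp
  then obtain l where l: "C_plain M ?v = enat l" by (cases "C_plain M ?v") auto
  have "real l \<le> real ?d + real E * log 2 (real N)" using lt unfolding l by simp
  then have "2 powr (real l) \<le> 2 powr (real ?d + real E * log 2 (real N))" by simp
  also have "\<dots> = 2 ^ ?d * real N ^ E"
   using N(1) by (simp only: powr_add powr_realpow zero_less_numeral) (simp add: powr_realpow mult.commute[of "real E"] powr_powr[symmetric])
  finally have l2: "2 ^ l \<le> 2 ^ ?d * real N ^ E" by (simp add: powr_realpow)
  have nc: "2 ^ length (numcode (length a)) \<le> 8 * (n + 1)\<^sup>2"
   using numcode_bounds(1)[of "length a"] power_mono[of "length a + 1" "n + 1" 2] ab(2) by linarith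
  have "weight W \<pi> * 2 ^ l \<le> weight W \<pi> * (2 ^ ?d * real N ^ E)" using l2 by (intro mult_left_mono) (simp_all add: weight_def)
  also have "\<dots> = (2 ^ (length a + length b) * weight W \<pi>) * (2 ^ length (numcode (length a)) * 2 ^ c1 * real N ^ E)"
   by (simp add: power_add)
  also have "\<dots> \<le> real (?H ^ 10 * 2 ^ 16) * (real (8 * (n + 1)\<^sup>2) * 2 ^ c1 * real n ^ E)"
   using ab(3) of_nat_mono[OF nc, where 'a = real] N by (intro mult_mono power_mono) (simp_all add: weight_def)
  also have "\<dots> = real (2 ^ (19 + c1) * ?H ^ 10 * (n + 1)\<^sup>2 * n ^ E)" by (simp add: power_add)
  also have "\<dots> \<le> real (n ^ D)" by (simp only: of_nat_le_iff big(1))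
  finally have th: "weight W \<pi> * 2 ^ l \<le> real (n ^ D)" .
  \<comment> \<open>This part serves the cap \<open>l \<le> 2 * n\<close> in
    \<open>simple\<close>.\<close>
  have "2 ^ l \<le> weight W \<pi> * 2 ^ (2 * T + 2 * W) * 2 ^ l" using weight_lower by simp
  also have "\<dots> \<le> real (n ^ D) * 2 ^ (2 * T + 2 * W)" using mult_right_mono[OF th, of "2 ^ (2 * T + 2 * W)"] by (simp add: ac_simps)
  also have "\<dots> \<le> real (2 ^ n) * 2 ^ n"
   using n(1) of_nat_mono[OF big(2), where 'a = real] by (intro mult_mono power_increasing) simp_all
  finally have "(2 :: real) ^ l \<le> 2 ^ (2 * n)" by (simp add: mult_2 power_add)
  then have "l \<le> 2 * n" by simp
  then show ?thesis using th l unfolding simple_def by auto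
 qed
 then have "card {z \<in> strs (keylen \<pi>). encode_pair (u @ \<pi>) z \<notin> N_set M e} \<le> card ?S"
  using strs_props(1) by (intro card_mono) auto
 then show ?thesis using gd by (simp add: good_def Fq)
qed

end

end

section \<open>The attack and its success probability\<close>

section \<open>The attacker\<close>

lemma pmf_coin_flips: "pmf (map_pmf G (coin_flips Z)) x = real (card {D \<in> strs Z. G D = x}) / 2 ^ Z"
proof -
 have "pmf (map_pmf G (coin_flips Z)) x = measure (pmf_of_set (strs Z)) (G -` {x})"
  by (simp add: pmf_map coin_flips_def)
 also have "\<dots> = real (card (strs Z \<inter> G -` {x})) / real (card (strs Z))"
  by (rule measure_pmf_of_set) (auto simp: strs_props intro: exI[of _ "replicate Z False"])
 also have "strs Z \<inter> G -` {x} = {D \<in> strs Z. G D = x}" by auto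
 finally show ?thesis by (simp add: strs_props)
qed

text \<open>The lengths, the number of votes and the stopping time \<open>k\<close> are not inputs
  of \<open>A\<close>: it reads them from its coins, so that one algorithm serves all parameters, at
  the price of guessing the header \<open>h\<close>. \<open>X\<close> collects the continuations,
  mask and vote coins, on which the search stops at \<open>x\<close>.\<close>

definition searches :: "tm \<Rightarrow> nat \<Rightarrow> nat \<Rightarrow> (bits \<Rightarrow> bits pmf) \<Rightarrow> bool" where
 "searches N d e A \<longleftrightarrow> (\<forall>m \<pi> L U R B k x X out w h. w = encode_pair (replicate m False) \<pi> \<longrightarrow> h = header [U, L, R, B, k] \<longrightarrow>
  X \<subseteq> strs U \<times> lsts (strs B) R \<longrightarrow> 0 < B \<longrightarrow>
  (\<forall>u bs. (u, bs) \<in> X \<longrightarrow> (dfs_step (\<lambda>z. votes (out u z) bs > 0) L ^^ k) [] = x) \<longrightarrow>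
  (\<forall>u z b. u \<in> strs U \<longrightarrow> length z \<le> L \<longrightarrow> b \<in> strs B \<longrightarrow>
   runs N ((!) b) (encode_pair (u @ \<pi>) (z @ replicate (L - length z) False)) B (out u z b)) \<longrightarrow>
  length h + U + R * B \<le> length w ^ d \<longrightarrow> length w \<le> length w ^ d \<longrightarrow> (\<forall>v\<in>{U, L, R, B, k}. v \<le> length w ^ d) \<longrightarrow>
  1000 * (num_work N + 5) * (length w ^ d + 1) ^ 3 \<le> length w ^ e \<longrightarrow>
  real (card X) \<le> 2 ^ (length h + U + R * B) * pmf (A w) x)"

lemma ppt_search:
 assumes N: "wf_tm N"
 shows "\<exists>A. ppt A \<and> searches N d e A"
proof -
 obtain A where A: "ppt A" "\<And>w. \<exists>G. A w = map_pmf G (coin_flips (length w ^ d)) \<and>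
  (\<forall>D t z. length D = length w ^ d \<longrightarrow> t \<le> length w ^ e \<longrightarrow> runs (search_tm N) no_coins (encode_pair D w) t z \<longrightarrow> G D = z)"
  using ppt_clocked[OF wf_search[of N], of d e] by blast
 show ?thesis unfolding searches_def
 proof (intro exI[of _ A] conjI A(1) allI impI)
  fix m \<pi> L U R B k x X out w h
  assume w: "w = encode_pair (replicate m False) \<pi>" and h: "h = header [U, L, R, B, k]"
   and X: "X \<subseteq> strs U \<times> lsts (strs B) R" and B: "0 < B"
   and f: "\<forall>u bs. (u, bs) \<in> X \<longrightarrow> (dfs_step (\<lambda>z. votes (out u z) bs > 0) L ^^ k) [] = x"
   and out: "\<forall>u z b. u \<in> strs U \<longrightarrow> length z \<le> L \<longrightarrow> b \<in> strs B \<longrightarrow>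
    runs N ((!) b) (encode_pair (u @ \<pi>) (z @ replicate (L - length z) False)) B (out u z b)"
   and Z: "length h + U + R * B \<le> length w ^ d" "length w \<le> length w ^ d" "\<forall>v\<in>{U, L, R, B, k}. v \<le> length w ^ d"
    "1000 * (num_work N + 5) * (length w ^ d + 1) ^ 3 \<le> length w ^ e"
  let ?Z = "length w ^ d" and ?s = "length h + U + R * B"
  obtain G where G: "A w = map_pmf G (coin_flips ?Z)"
   "\<And>D t z. length D = ?Z \<Longrightarrow> t \<le> length w ^ e \<Longrightarrow> runs (search_tm N) no_coins (encode_pair D w) t z \<Longrightarrow> G D = z"
   using A(2)[of w] by blast
  \<comment> \<open>Favourable coins: the right header, an element of \<open>X\<close>, and
    arbitrary remaining bits.\<close>
  let ?f = "\<lambda>((u, bs), rest). h @ u @ concat bs @ rest"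
  have lc: "length (concat bs) = R * B" if "bs \<in> lsts (strs B) R" for bs
   using length_concat_rows[of bs B] that by (auto simp: lsts_def)
  have inj: "inj_on ?f (X \<times> strs (?Z - ?s))"
  proof (rule inj_onI)
   fix a b assume "a \<in> X \<times> strs (?Z - ?s)" "b \<in> X \<times> strs (?Z - ?s)" and e: "?f a = ?f b"
   moreover obtain u bs r u' bs' r' where ab: "a = ((u, bs), r)" "b = ((u', bs'), r')" by (metis surj_pair)
   ultimately have i: "u \<in> strs U" "u' \<in> strs U" "bs \<in> lsts (strs B) R" "bs' \<in> lsts (strs B) R" using X by auto
   have 1: "u = u'" "concat bs = concat bs'" "r = r'" using e i lc[OF i(3)] lc[OF i(4)] by (auto simp: ab)
   have "bs = bs'"
   proof (rule concat_injective[OF 1(2)])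
    have "length a = B" "length b = B" if "(a, b) \<in> set (zip bs bs')" for a b
     using set_zip_leftD[OF that] set_zip_rightD[OF that] i(3,4) by (auto simp: lsts_def)
    then show "\<forall>(a, b)\<in>set (zip bs bs'). length a = length b" by auto
   qed (use i(3,4) in \<open>simp add: lsts_def\<close>)
   with 1 show "a = b" by (simp add: ab)
  qed
  have "?f ` (X \<times> strs (?Z - ?s)) \<subseteq> {D \<in> strs ?Z. G D = x}"
  proof
   fix D assume "D \<in> ?f ` (X \<times> strs (?Z - ?s))"
   then obtain u bs r where D: "D = h @ u @ concat bs @ r" "(u, bs) \<in> X" "length r = ?Z - ?s" by auto
   then have i: "u \<in> strs U" "bs \<in> lsts (strs B) R" using X by auto
   have lD: "length D = ?Z" using D(1,3) lc[OF i(2)] i(1) Z(1) by simp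
   have b: "\<forall>b\<in>set bs. length b = B" "length bs = R" using i(2) by (auto simp: lsts_def)
   have "runs (search_tm N) no_coins (encode_pair D w) (1000 * (num_work N + 5) * (?Z + 1) ^ 3)
    ((dfs_step (\<lambda>z. votes (out u z) bs > 0) L ^^ k) [])"
   proof (rule runs_search[where rest = r and u = u and D = D, OF N b(1) B _ w])
    show "D = header [length u, L, length bs, B, k] @ u @ concat bs @ r" using D(1) h i(1) b(2) by simp
    show "runs N ((!) b') (encode_pair (u @ \<pi>) (z @ replicate (L - length z) False)) B (out u z b')"
     if "length z \<le> L" "b' \<in> set bs" for z b' using out that i(1) b(1) by simp
   qed (use i(1) b(2) lD Z in simp_all)
   then have "G D = (dfs_step (\<lambda>z. votes (out u z) bs > 0) L ^^ k) []" by (rule G(2)[OF lD Z(4)])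
   then show "D \<in> {D \<in> strs ?Z. G D = x}" using f D(2) lD by simp
  qed
  then have "card (X \<times> strs (?Z - ?s)) \<le> card {D \<in> strs ?Z. G D = x}"
   by (rule card_inj_on_le[OF inj]) (simp add: strs_props)
  from of_nat_mono[OF this, where 'a = real] have c: "real (card X) * 2 ^ (?Z - ?s) \<le> real (card {D \<in> strs ?Z. G D = x})"
   by (simp add: card_cartesian_product strs_props)
  have "2 ^ ?Z = (2 :: real) ^ ?s * 2 ^ (?Z - ?s)" using Z(1) by (simp flip: power_add)
  then have "pmf (A w) x = real (card {D \<in> strs ?Z. G D = x}) / (2 ^ ?s * 2 ^ (?Z - ?s))"
   unfolding G(1) pmf_coin_flips by simp
  then have "2 ^ ?s * pmf (A w) x = real (card {D \<in> strs ?Z. G D = x}) / 2 ^ (?Z - ?s)" by simp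
  then show "real (card X) \<le> 2 ^ ?s * pmf (A w) x" using c by (simp only: pos_le_divide_eq zero_less_power zero_less_numeral)
 qed
qed

locale io_attack = attack +
 fixes N0 :: tm and Bl :: nat and out :: "bits \<Rightarrow> bits \<Rightarrow> bits"
 assumes N0: "wf_tm N0" and Bl: "0 < Bl"
  and out: "\<And>y b. length y = n \<Longrightarrow> b \<in> strs Bl \<Longrightarrow> runs N0 ((!) b) y Bl (out y b)"
  and yes: "\<And>y. length y = n \<Longrightarrow> y \<in> Y_set M U V t c \<Longrightarrow> 2 * 2 ^ Bl \<le> 3 * card {b \<in> strs Bl. out y b = [True]}"
  and no: "\<And>y. length y = n \<Longrightarrow> y \<in> N_set M e \<Longrightarrow> 2 * 2 ^ Bl \<le> 3 * card {b \<in> strs Bl. out y b = [False]}"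
begin

definition query :: "bits \<Rightarrow> bits \<Rightarrow> bits \<Rightarrow> bits" where
 "query u \<pi> z = encode_pair (u @ \<pi>) (z @ replicate (keylen \<pi> - length z) False)"

text \<open>13 votes halve the error, as (17/18)^13 < 1/2. Halving it
  \<open>keylen \<pi> + 2\<close> times outweighs all \<open>2 ^ keylen \<pi>\<close> padded keys
  and both kinds of instances, and leaves failure 1/2.\<close>

definition reps :: "bits \<Rightarrow> nat" where
 "reps \<pi> = 13 * (keylen \<pi> + 2)"

definition nodes :: "bits \<Rightarrow> nat" where
 "nodes \<pi> = 2 + 2 * keylen \<pi> * bound"

definition finds :: "bits \<Rightarrow> bits \<Rightarrow> bits \<Rightarrow> nat \<Rightarrow> bits list \<Rightarrow> bool" where
 "finds u \<pi> x k bs \<longleftrightarrow> (dfs_step (\<lambda>z. votes (out (query u \<pi> z)) bs > 0) (keylen \<pi>) ^^ k) [] = x"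

lemma majority_errs_rarely:
 assumes "length y = n" "y \<in> Y_set M U V t c \<and> v = [True] \<or> y \<in> N_set M e \<and> v = [False]"
 shows "real (card {bs \<in> lsts (strs Bl) R. (votes (out y) bs > 0) \<noteq> (v = [True])}) \<le> (17 / 18) ^ R * real (card (lsts (strs Bl) R))"
proof -
 \<comment> \<open>The sign treats both kinds of instances at once. For no instances, ties are
   counted as failures too, which only enlarges the set.\<close>
 let ?s = "if v = [True] then 1 else - 1 :: int"
 let ?v = "\<lambda>b. ?s * (if out y b = [True] then 1 else - 1)"
 have f: "finite (lsts (strs Bl) R)" by (intro lsts_card strs_props)
 have "(\<Sum>b\<leftarrow>bs. ?v b) = ?s * votes (out y) bs" for bs unfolding votes_def by (rule sum_list_const_mult)
 then have "{bs \<in> lsts (strs Bl) R. (votes (out y) bs > 0) \<noteq> (v = [True])} \<subseteq> {bs \<in> lsts (strs Bl) R. (\<Sum>b\<leftarrow>bs. ?v b) \<le> 0}"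
  by (auto split: if_splits)
 then have "real (card {bs \<in> lsts (strs Bl) R. (votes (out y) bs > 0) \<noteq> (v = [True])}) \<le> real (card {bs \<in> lsts (strs Bl) R. (\<Sum>b\<leftarrow>bs. ?v b) \<le> 0})"
  using f by (intro of_nat_mono card_mono) auto
 also have "\<dots> \<le> (17 / 18) ^ R * real (card (lsts (strs Bl) R))"
 proof (rule majority_fails_rarely)
  have "2 * 2 ^ Bl \<le> 3 * card {b \<in> strs Bl. out y b = v}" using yes[OF assms(1)] no[OF assms(1)] assms(2) by auto
  also have "\<dots> \<le> 3 * card {b \<in> strs Bl. ?v b = 1}"
   using assms(2) strs_props[of Bl] by (intro mult_le_mono2 card_mono) auto
  finally show "2 * card (strs Bl) \<le> 3 * card {b \<in> strs Bl. ?v b = 1}" by (simp add: strs_props)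
 qed (auto simp: strs_props)
 finally show ?thesis .
qed

text \<open>The union bound runs over all padded keys, because the nodes that the search visits
  depend on the votes. If no vote is wrong, the path to \<open>x\<close> is accepted, and accepted
  nodes are not no instances, which bounds the tree.\<close>

lemma usually_found:
 assumes q: "q \<in> coin_pairs" and gd: "good q u" and Fq: "F q = (\<pi>, x, x)"
 shows "card (lsts (strs Bl) (reps \<pi>)) \<le> 2 * card {bs \<in> lsts (strs Bl) (reps \<pi>). \<exists>k<nodes \<pi>. finds u \<pi> x k bs}"
proof -
 note kl = keylen[OF q gd Fq]
 let ?L = "keylen \<pi>" and ?\<Omega> = "lsts (strs Bl) (reps \<pi>)" and ?q = "\<lambda>y. encode_pair (u @ \<pi>) y"
 have f: "finite ?\<Omega>" by (intro lsts_card strs_props)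
 have ln: "length (?q y) = n" if "y \<in> strs ?L" for y
  using that kl gd by (simp add: length_encode_pair good_def)
 \<comment> \<open>Outside the promise no answer counts as wrong; the votes there may be
   arbitrary.\<close>
 define err where "err y v = (if ?q y \<in> Y_set M U V t c \<and> v = [True] \<or> ?q y \<in> N_set M e \<and> v = [False]
  then {bs \<in> ?\<Omega>. (votes (out (?q y)) bs > 0) \<noteq> (v = [True])} else {})" for y v
 let ?E = "\<Union>y\<in>strs ?L. err y [True] \<union> err y [False]"
 have e: "real (card (err y v)) \<le> (17 / 18) ^ reps \<pi> * real (card ?\<Omega>)" if "y \<in> strs ?L" for y v
  using majority_errs_rarely[OF ln[OF that]] by (simp add: err_def)
 have "real (card ?E) \<le> (\<Sum>y\<in>strs ?L. real (card (err y [True] \<union> err y [False])))"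
  using of_nat_mono[OF card_UN_le[OF strs_props(1)], where 'a = real] by simp
 also have "\<dots> \<le> (\<Sum>y\<in>strs ?L. 2 * ((17 / 18) ^ reps \<pi> * real (card ?\<Omega>)))"
 proof (rule sum_mono)
  fix y assume y: "y \<in> strs ?L"
  have "real (card (err y [True] \<union> err y [False])) \<le> real (card (err y [True])) + real (card (err y [False]))"
   using of_nat_mono[OF card_Un_le, where 'a = real] by simp
  then show "real (card (err y [True] \<union> err y [False])) \<le> 2 * ((17 / 18) ^ reps \<pi> * real (card ?\<Omega>))"
   using e[OF y, of "[True]"] e[OF y, of "[False]"] by linarith
 qed
 also have "\<dots> = 2 * 2 ^ ?L * (17 / 18) ^ reps \<pi> * real (card ?\<Omega>)" by (simp add: strs_props)
 also have "\<dots> \<le> 1 / 2 * real (card ?\<Omega>)"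
 proof (rule mult_right_mono)
  have "(17 / 18 :: real) ^ reps \<pi> = ((17 / 18) ^ 13) ^ (?L + 2)" by (simp only: reps_def power_mult)
  also have "\<dots> \<le> (1 / 2) ^ (?L + 2)" by (intro power_mono) (simp_all add: power_divide)
  finally have "2 * 2 ^ ?L * (17 / 18 :: real) ^ reps \<pi> \<le> 2 * 2 ^ ?L * (1 / 2) ^ (?L + 2)" by (intro mult_left_mono) simp_all
  then show "2 * 2 ^ ?L * (17 / 18 :: real) ^ reps \<pi> \<le> 1 / 2" by (simp add: power_divide)
 qed simp
 finally have E: "2 * card ?E \<le> card ?\<Omega>" by simp
 have "\<exists>k<nodes \<pi>. finds u \<pi> x k bs" if bs: "bs \<in> ?\<Omega>" "bs \<notin> ?E" for bs
 proof -
  let ?acc = "\<lambda>z. votes (out (query u \<pi> z)) bs > 0" and ?S = "{y \<in> strs ?L. ?q y \<notin> N_set M e}"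
  have pad: "z @ replicate (?L - length z) False \<in> strs ?L" if "length z \<le> ?L" for z using that by simp
  have lx: "length x \<le> ?L" using F_lengths(2)[OF q Fq] kl(2) by simp
  have "?acc (take i x)" if "i < length x" for i
  proof -
   have "query u \<pi> (take i x) \<in> Y_set M U V t c" "length (take i x) \<le> ?L"
    using prefix_query[OF q gd Fq, of i] that lx by (simp_all add: query_def)
   then show ?thesis using bs pad[of "take i x"] by (fastforce simp: err_def query_def)
  qed
  from dfs_reaches[of x ?L ?acc, OF lx this] obtain k where
   k: "k < dfs_size ?acc ?L []" "(dfs_step ?acc ?L ^^ k) [] = x" by blast
  have "z @ replicate (?L - length z) False \<in> ?S" if "length z \<le> ?L" "?acc z" for z
   using bs pad[OF that(1)] that(2) by (fastforce simp: err_def query_def)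
  from dfs_size_bound[of ?L ?acc ?S "[]" ?L, OF this]
  have "dfs_size ?acc ?L [] \<le> 1 + 2 * ?L * card {s \<in> ?S. length s = ?L}" using strs_props(1) by simp
  also have "\<dots> \<le> 1 + 2 * ?L * bound"
   using few_unspecific[OF q gd Fq] by (simp add: conj_commute conj_left_commute)
  finally show ?thesis using k by (intro exI[of _ k]) (simp add: nodes_def finds_def)
 qed
 then have "?\<Omega> \<subseteq> ?E \<union> {bs \<in> ?\<Omega>. \<exists>k<nodes \<pi>. finds u \<pi> x k bs}" by blast
 then have "card ?\<Omega> \<le> card (?E \<union> {bs \<in> ?\<Omega>. \<exists>k<nodes \<pi>. finds u \<pi> x k bs})"
  using f strs_props(1) by (intro card_mono) (auto simp: err_def)
 then show ?thesis using E card_Un_le[of ?E "{bs \<in> ?\<Omega>. \<exists>k<nodes \<pi>. finds u \<pi> x k bs}"] by linarith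
qed

end

context io_attack
begin

text \<open>The attacker is given a transcript without masks and supplies the mask from its own
  coins, as masks are independent of the run of the protocol. This is why the good masks are
  counted. For each of them half of the vote coins succeed at some stopping time, and fixing this
  time costs a factor of at most \<open>Z\<close>.\<close>

lemma success_at:
 assumes A: "searches N0 d d' E'"
  and Z: "2 * W \<le> Z" "6 * T + 11 \<le> Z" "13 * (6 * T + 13) \<le> Z" "Bl \<le> Z" "2 + 2 * (6 * T + 11) * bound \<le> Z"
  and d: "Z\<^sup>2 + 20 * Z + 10 \<le> (2 * m + 1) ^ d" "0 < d"
  and d': "\<And>l. 2 * m + 1 \<le> l \<Longrightarrow> 1000 * (num_work N0 + 5) * (l ^ d + 1) ^ 3 \<le> l ^ d'"
  and q: "q \<in> coin_pairs"
 shows "real (card {u. good q u}) \<le> real (2 * Z * (8 * (Z + 1)\<^sup>2) ^ 5) * 4 ^ W *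
  pmf (E' (encode_pair (replicate m False) (fst (F q)))) (fst (snd (F q)))"
proof (cases "{u. good q u} = {}")
 case True
 then show ?thesis by simp
next
 case False
 then obtain u0 where u0: "good q u0" by blast
 then obtain \<pi> x where Fq: "F q = (\<pi>, x, x)" by (auto simp: good_def heavy_def)
 let ?w = "encode_pair (replicate m False) \<pi>" and ?R = "reps \<pi>" and ?L = "keylen \<pi>"
 let ?p = "pmf (E' ?w) x" and ?\<Omega> = "lsts (strs Bl) ?R" and ?H = "(8 * (Z + 1)\<^sup>2) ^ 5"
 note kl = keylen[OF q u0 Fq]
 have lw: "2 * m + 1 \<le> length ?w" by (simp add: length_encode_pair)
 have wd: "Z\<^sup>2 + 20 * Z + 10 \<le> length ?w ^ d" using d(1) power_mono[OF lw, of d] by simp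
 have L: "?L \<le> Z" "?R \<le> Z" using kl(1) Z(2,3) by (simp_all add: reps_def)
 have nd: "nodes \<pi> \<le> Z"
  unfolding nodes_def using Z(5) mult_le_mono1[OF mult_le_mono2[OF kl(1), of 2], of bound] by linarith
 have f\<Omega>: "finite ?\<Omega>" "card ?\<Omega> = 2 ^ (?R * Bl)" using lsts_card[OF strs_props(1)[of Bl], of ?R]
  by (simp_all add: strs_props mult.commute flip: power_mult)
 have fg: "finite {u. good q u}" by (rule finite_subset[OF _ strs_props(1)[of "2 * W"]]) (auto simp: good_def)
 define X where "X k = {(u, bs). good q u \<and> bs \<in> ?\<Omega> \<and> finds u \<pi> x k bs}" for k
 have fX: "finite (X k)" for k
  by (rule finite_subset[of _ "{u. good q u} \<times> ?\<Omega>"]) (use fg f\<Omega> in \<open>auto simp: X_def\<close>)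
 have Xk: "real (card (X k)) \<le> real ?H * 4 ^ W * 2 ^ (?R * Bl) * ?p" if k: "k < nodes \<pi>" for k
 proof -
  let ?h = "header [2 * W, ?L, ?R, Bl, k]"
  have ms: "\<forall>v\<in>set [2 * W, ?L, ?R, Bl, k]. v \<le> Z" using Z L nd k by simp
  have "real (card (X k)) \<le> 2 ^ (length ?h + 2 * W + ?R * Bl) * ?p"
  proof (rule A[unfolded searches_def, rule_format, where out = "\<lambda>u z. out (query u \<pi> z)" and X = "X k" and L = ?L and k = k])
   show "X k \<subseteq> strs (2 * W) \<times> ?\<Omega>" by (auto simp: X_def good_def)
   show "(dfs_step (\<lambda>z. votes (out (query u \<pi> z)) bs > 0) ?L ^^ k) [] = x" if "(u, bs) \<in> X k" for u bs
    using that by (simp add: X_def finds_def)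
   show "runs N0 ((!) b) (encode_pair (u @ \<pi>) (z @ replicate (?L - length z) False)) Bl (out (query u \<pi> z) b)"
    if "u \<in> strs (2 * W)" "length z \<le> ?L" "b \<in> strs Bl" for u z b
    unfolding query_def by (rule out) (use that kl in \<open>simp_all add: length_encode_pair\<close>)
   have "?R * Bl \<le> Z * Z" using L(2) Z(4) by (rule mult_le_mono)
   then show "length ?h + 2 * W + ?R * Bl \<le> length ?w ^ d"
    using header_bounds(2)[OF ms] wd Z(1) by (simp add: power2_eq_square)
   show "length ?w \<le> length ?w ^ d" using d(2) lw by (intro self_le_power) simp_all
   show "v \<le> length ?w ^ d" if "v \<in> {2 * W, ?L, ?R, Bl, k}" for v using ms wd that by auto
   show "1000 * (num_work N0 + 5) * (length ?w ^ d + 1) ^ 3 \<le> length ?w ^ d'" by (rule d'[OF lw])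
  qed (use Bl in simp_all)
  also have "(2 :: real) ^ (length ?h + 2 * W + ?R * Bl) \<le> real ?H * 4 ^ W * 2 ^ (?R * Bl)"
   using of_nat_mono[OF header_bounds(1)[OF ms], where 'a = real] by (simp add: power_add power_mult)
  finally show ?thesis by (simp add: mult_right_mono)
 qed
 have "card {u. good q u} * card ?\<Omega> = (\<Sum>u | good q u. card ?\<Omega>)" by simp
 also have "\<dots> \<le> (\<Sum>u | good q u. 2 * card {bs \<in> ?\<Omega>. \<exists>k<nodes \<pi>. finds u \<pi> x k bs})"
  by (intro sum_mono usually_found[OF q _ Fq]) simp
 also have "\<dots> = 2 * card (SIGMA u:{u. good q u}. {bs \<in> ?\<Omega>. \<exists>k<nodes \<pi>. finds u \<pi> x k bs})"
  using fg f\<Omega> by (simp add: sum_distrib_left)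
 also have "\<dots> \<le> 2 * card (\<Union>k<nodes \<pi>. X k)"
  using fX by (intro mult_le_mono2 card_mono) (auto simp: X_def)
 also have "\<dots> \<le> 2 * (\<Sum>k<nodes \<pi>. card (X k))" by (intro mult_le_mono2 card_UN_le) simp
 finally have "card {u. good q u} * 2 ^ (?R * Bl) \<le> 2 * (\<Sum>k<nodes \<pi>. card (X k))" unfolding f\<Omega>(2) .
 from of_nat_mono[OF this, where 'a = real]
 have "real (card {u. good q u}) * 2 ^ (?R * Bl) \<le> 2 * (\<Sum>k<nodes \<pi>. real (card (X k)))" by simp
 also have "\<dots> \<le> 2 * (\<Sum>k<nodes \<pi>. real ?H * 4 ^ W * 2 ^ (?R * Bl) * ?p)" using Xk by (intro mult_left_mono sum_mono) simp_all
 also have "\<dots> = real (nodes \<pi>) * (2 * (real ?H * 4 ^ W * 2 ^ (?R * Bl) * ?p))" by simp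
 also have "\<dots> \<le> real Z * (2 * (real ?H * 4 ^ W * 2 ^ (?R * Bl) * ?p))" using nd by (intro mult_right_mono) simp_all
 finally have "real (card {u. good q u}) * 2 ^ (?R * Bl) \<le> (real (2 * Z * ?H) * 4 ^ W * ?p) * 2 ^ (?R * Bl)"
  by (simp add: ac_simps)
 then show ?thesis unfolding Fq fst_conv snd_conv by (simp only: mult_le_cancel_right_pos zero_less_power zero_less_numeral)
qed

lemma success:
 assumes A: "searches N0 d d' E'"
  and Z: "2 * W \<le> Z" "6 * T + 11 \<le> Z" "13 * (6 * T + 13) \<le> Z" "Bl \<le> Z" "2 + 2 * (6 * T + 11) * bound \<le> Z"
  and d: "Z\<^sup>2 + 20 * Z + 10 \<le> (2 * m + 1) ^ d" "0 < d"
  and d': "\<And>l. 2 * m + 1 \<le> l \<Longrightarrow> 1000 * (num_work N0 + 5) * (l ^ d + 1) ^ 3 \<le> l ^ d'"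
  and agree: "7 * 4 ^ T \<le> 8 * card {q \<in> coin_pairs. fst (snd (F q)) = snd (snd (F q))}"
 shows "4 ^ T \<le> real (8 * Z * (8 * (Z + 1)\<^sup>2) ^ 5) *
  (\<Sum>q\<in>coin_pairs. pmf (E' (encode_pair (replicate m False) (fst (F q)))) (fst (snd (F q))))"
proof -
 let ?p = "\<lambda>q. pmf (E' (encode_pair (replicate m False) (fst (F q)))) (fst (snd (F q)))"
 have "real (4 ^ T * 4 ^ W) \<le> real (4 * (\<Sum>q\<in>coin_pairs. card {u. good q u}))"
  by (rule of_nat_mono[OF good_frequent[OF agree]])
 also have "\<dots> = 4 * (\<Sum>q\<in>coin_pairs. real (card {u. good q u}))" by simp
 also have "\<dots> \<le> 4 * (\<Sum>q\<in>coin_pairs. real (2 * Z * (8 * (Z + 1)\<^sup>2) ^ 5) * 4 ^ W * ?p q)"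
  by (intro mult_left_mono sum_mono success_at[OF A Z d d']) simp_all
 also have "\<dots> = (real (8 * Z * (8 * (Z + 1)\<^sup>2) ^ 5) * (\<Sum>q\<in>coin_pairs. ?p q)) * 4 ^ W"
  by (simp only: sum_distrib_left[symmetric]) simp
 finally show ?thesis by (simp only: of_nat_mult of_nat_power of_nat_numeral mult_le_cancel_right_pos zero_less_power zero_less_numeral)
qed

end

section \<open>Choice of the parameters\<close>

text \<open>77 = 50 + 22 + 5: the tenth power of the header factor is at most 2^50 Q^20, 22 comes
  from \<open>small\<close>, and 2^5 is 8 from the cube of n / 2 times 4 from 2n + 1 \<le> 4n. So
  all header costs together amount to less than one factor n.\<close>

lemma attack_parameters:
 fixes T Q n m c0 c1 E :: nat
 assumes T: "7 * T + 12 \<le> Q" and n: "2 ^ (77 + c0 + c1) * Q ^ 20 \<le> n"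
 defines "W \<equiv> (n - 6 * T - 9) div 4"
 shows "4 * W + 6 * T + 9 \<le> n" "n \<le> 4 * W + 6 * T + 12" "(T + 7) * T \<le> W" "11 * Q + 5 + W \<le> n"
  "20 * (5 * Q + 3)\<^sup>2 + 66 * Q + 30 + 10 * W \<le> 20 * n"
  "real ((8 * (Q + 1)\<^sup>2) ^ 10 * 2 ^ (22 + c0) * (2 * n + 1)) \<le> (real n / 2) ^ 3"
  "2 ^ (19 + c1) * (8 * (Q + 1)\<^sup>2) ^ 10 * (n + 1)\<^sup>2 * n ^ E \<le> n ^ (E + 3)"
proof -
 define P where "P = Q ^ 20"
 have Q1: "1 \<le> Q" using T by simp
 have P: "1 \<le> P" "Q \<le> P" "Q * Q \<le> P"
  unfolding P_def using Q1 power_increasing[of 2 20 Q] by (simp_all add: self_le_power power2_eq_square)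
 have nP: "2 ^ 77 * P \<le> n"
 proof -
  have "(2 :: nat) ^ 77 \<le> 2 ^ (77 + c0 + c1)" by (intro power_increasing) simp_all
  then have "2 ^ 77 * P \<le> 2 ^ (77 + c0 + c1) * P" by (rule mult_le_mono1)
  then show ?thesis using n unfolding P_def by (rule order_trans)
 qed
 have n1: "1 \<le> n" using nP P by simp
 have ln: "6 * T + 9 \<le> n" using T P nP by simp
 show w: "4 * W + 6 * T + 9 \<le> n" "n \<le> 4 * W + 6 * T + 12" using ln unfolding W_def by presburger+
 have "(T + 7) * T \<le> Q * Q" using T by (intro mult_le_mono) simp_all
 then show "(T + 7) * T \<le> W" using w(2) T P nP by simp
 show "11 * Q + 5 + W \<le> n" using w(1) P nP by simp
 have "20 * (5 * Q + 3)\<^sup>2 + 66 * Q + 30 \<le> 2000 * P" using P by (simp add: power2_eq_square algebra_simps)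
 then show "20 * (5 * Q + 3)\<^sup>2 + 66 * Q + 30 + 10 * W \<le> 20 * n" using w(1) nP by simp
 have "8 * (Q + 1)\<^sup>2 \<le> 8 * (2 * Q)\<^sup>2" using Q1 by (intro mult_le_mono2 power_mono) simp_all
 then have "(8 * (Q + 1)\<^sup>2) ^ 10 \<le> (8 * (2 * Q)\<^sup>2) ^ 10" by (intro power_mono) simp_all
 also have "\<dots> = 2 ^ 50 * P" by (simp add: P_def power_mult_distrib)
 finally have H: "(8 * (Q + 1)\<^sup>2) ^ 10 \<le> 2 ^ 50 * P" .
 have nc: "2 ^ (77 + c0) * P \<le> n" "2 ^ (77 + c1) * P \<le> n"
 proof -
  have "(2 :: nat) ^ (77 + c0) \<le> 2 ^ (77 + c0 + c1)" "(2 :: nat) ^ (77 + c1) \<le> 2 ^ (77 + c0 + c1)" by (intro power_increasing; simp)+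
  from this[THEN mult_le_mono1, of P] show "2 ^ (77 + c0) * P \<le> n" "2 ^ (77 + c1) * P \<le> n" using n unfolding P_def by linarith+
 qed
 have "8 * ((8 * (Q + 1)\<^sup>2) ^ 10 * 2 ^ (22 + c0) * (2 * n + 1)) \<le> 8 * ((2 ^ 50 * P) * 2 ^ (22 + c0) * (4 * n))"
  using H n1 by (intro mult_le_mono) simp_all
 also have "\<dots> = (2 ^ (77 + c0) * P) * n" by (simp add: power_add)
 also have "\<dots> \<le> n * n" using nc(1) by (rule mult_le_mono1)
 also have "\<dots> \<le> n ^ 3" using n1 by (simp add: power3_eq_cube)
 finally have "real (8 * ((8 * (Q + 1)\<^sup>2) ^ 10 * 2 ^ (22 + c0) * (2 * n + 1))) \<le> real (n ^ 3)" by (rule of_nat_mono)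
 then show "real ((8 * (Q + 1)\<^sup>2) ^ 10 * 2 ^ (22 + c0) * (2 * n + 1)) \<le> (real n / 2) ^ 3"
  by (simp only: of_nat_mult of_nat_power power_divide) simp
 have "(n + 1)\<^sup>2 \<le> 4 * n\<^sup>2" using n1 power_mono[of "n + 1" "2 * n" 2] by (simp add: power_mult_distrib)
 then have "2 ^ (19 + c1) * (8 * (Q + 1)\<^sup>2) ^ 10 * (n + 1)\<^sup>2 * n ^ E \<le> 2 ^ (19 + c1) * (2 ^ 50 * P) * (4 * n\<^sup>2) * n ^ E"
  using H by (intro mult_le_mono order_refl)
 also have "\<dots> = (2 ^ (71 + c1) * P) * (n\<^sup>2 * n ^ E)" by (simp add: power_add)
 also have "\<dots> \<le> n * (n\<^sup>2 * n ^ E)"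
 proof (rule mult_le_mono1)
  have "(2 :: nat) ^ (71 + c1) \<le> 2 ^ (77 + c1)" by (intro power_increasing) simp_all
  from mult_le_mono1[OF this, of P] show "2 ^ (71 + c1) * P \<le> n" using nc(2) by linarith
 qed
 also have "\<dots> = n ^ (E + 3)" by (simp add: power_add power3_eq_cube power2_eq_square ac_simps)
 finally show "2 ^ (19 + c1) * (8 * (Q + 1)\<^sup>2) ^ 10 * (n + 1)\<^sup>2 * n ^ E \<le> n ^ (E + 3)" .
qed

lemma pair_coin_flips: "pair_pmf (coin_flips T) (coin_flips T) = pmf_of_set (strs T \<times> strs T)"
proof -
 have ne: "strs T \<noteq> {}" using strs_props[of T] by force
 have "pmf (pair_pmf (coin_flips T) (coin_flips T)) p = pmf (pmf_of_set (strs T \<times> strs T)) p" for p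
  using ne strs_props(1)[of T]
  by (cases p) (simp add: pmf_pair coin_flips_def card_cartesian_product indicator_def)
 then show ?thesis by (rule pmf_eqI)
qed

lemma coin_pairs_prob:
 assumes "P = map_pmf F (pair_pmf (coin_flips T) (coin_flips T))"
 shows "measure_pmf.prob P S = real (card {q \<in> strs T \<times> strs T. F q \<in> S}) / 4 ^ T"
  "measure_pmf.prob (bind_pmf P (\<lambda>(\<pi>, x, y). map_pmf (\<lambda>g. (g, x)) (A \<pi>))) {(g, x). g = x} =
   (\<Sum>q\<in>strs T \<times> strs T. pmf (A (fst (F q))) (fst (snd (F q)))) / 4 ^ T"
proof -
 let ?V = "strs T \<times> strs T"
 have V: "finite ?V" "card ?V = 4 ^ T" "?V \<noteq> {}"
  using strs_props[of T] by (force simp: card_cartesian_product simp flip: power_mult_distrib)+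
 have P: "P = map_pmf F (pmf_of_set ?V)" using assms pair_coin_flips by simp
 have "?V \<inter> F -` S = {q \<in> ?V. F q \<in> S}" by blast
 then show "measure_pmf.prob P S = real (card {q \<in> ?V. F q \<in> S}) / 4 ^ T"
  unfolding P measure_map_pmf measure_pmf_of_set[OF V(3,1)] V(2) by simp
 let ?D = "bind_pmf P (\<lambda>(\<pi>, x, y). map_pmf (\<lambda>g. (g, x)) (A \<pi>))"
 have "measure_pmf.prob ?D {(g, x). g = x} = pmf (map_pmf (\<lambda>(g, x). g = x) ?D) True"
  unfolding pmf_map by (intro arg_cong[where f = "measure_pmf.prob ?D"]) auto
 also have "map_pmf (\<lambda>(g, x). g = x) ?D = bind_pmf (pmf_of_set ?V) (\<lambda>q. map_pmf (\<lambda>g. g = fst (snd (F q))) (A (fst (F q))))"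
  unfolding P bind_map_pmf map_bind_pmf by (intro bind_pmf_cong refl) (simp add: map_pmf_comp split: prod.split)
 also have "pmf \<dots> True = (\<Sum>q\<in>?V. pmf (map_pmf (\<lambda>g. g = fst (snd (F q))) (A (fst (F q)))) True) / 4 ^ T"
  unfolding pmf_bind integral_pmf_of_set[OF V(3,1)] V(2) by simp
 also have "\<dots> = (\<Sum>q\<in>?V. pmf (A (fst (F q))) (fst (snd (F q)))) / 4 ^ T"
  by (simp add: pmf_map measure_pmf_single vimage_def)
 finally show "measure_pmf.prob ?D {(g, x). g = x} = (\<Sum>q\<in>?V. pmf (A (fst (F q))) (fst (snd (F q)))) / 4 ^ T" .
qed

text \<open>The parties will run for at most \<open>20 * n \<le> 40 * N\<close> steps, and the 2
  keeps the bound at least 2 as optimality requires. For \<open>N \<ge> 2\<close> it is at most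
  \<open>42 * N \<le> N ^ 7\<close>, whence 294 = 42 * 7.\<close>

lemma time_condition:
 assumes "(\<lambda>n. real (t n)) \<in> \<omega>(\<lambda>n. real n * log 2 (real n))"
 shows "\<forall>\<^sub>F N in sequentially. real c * real (40 * N + 2) * log 2 (real (40 * N + 2)) \<le> real (t N)"
proof -
 have "\<forall>\<^sub>F N in sequentially. (294 * real c + 1) * norm (real N * log 2 (real N)) \<le> norm (real (t N))"
  by (rule landau_omega.smallD[OF assms]) simp
 moreover have "\<forall>\<^sub>F N :: nat in sequentially. 2 \<le> N" by (rule eventually_ge_at_top)
 ultimately show ?thesis
 proof eventually_elim
  case (elim N)
  have l: "0 \<le> real N * log 2 (real N)" using elim(2) by simp
  have "42 * N \<le> N ^ 6 * N" using elim(2) power_mono[of 2 N 6] by (intro mult_le_mono1) simp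
  then have "42 * N \<le> N ^ 7" using power_add[of N 6 1] by simp
  then have "real (40 * N + 2) \<le> real (N ^ 7)" using elim(2) by (intro of_nat_mono) linarith
  then have "log 2 (real (40 * N + 2)) \<le> log 2 (real N ^ 7)" using elim(2) by (subst log_le_cancel_iff) simp_all
  also have "\<dots> = 7 * log 2 (real N)" using elim(2) by (simp add: log_nat_power)
  finally have "real c * real (40 * N + 2) * log 2 (real (40 * N + 2)) \<le> real c * (42 * real N) * (7 * log 2 (real N))"
   using elim(2) by (intro mult_mono) simp_all
  also have "\<dots> \<le> (294 * real c + 1) * (real N * log 2 (real N))" using l by (simp add: algebra_simps)
  also have "\<dots> \<le> real (t N)" using elim(1) l by simp
  finally show ?case .
 qed
qed

lemma poly_bound:
 assumes "(\<lambda>n. real (T n)) \<in> O(\<lambda>n. real n ^ k)"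
 shows "\<forall>\<^sub>F n in sequentially. T n \<le> n ^ Suc k"
proof -
 obtain C where C: "\<forall>\<^sub>F n in sequentially. norm (real (T n)) \<le> C * norm (real n ^ k)"
  using assms by (auto elim: landau_o.bigE)
 moreover have "\<forall>\<^sub>F n in sequentially. C \<le> real n" by real_asymp
 ultimately show ?thesis
 proof eventually_elim
  case (elim n)
  have "real (T n) \<le> C * real n ^ k" using elim(1) by simp
  also have "\<dots> \<le> real n * real n ^ k" using elim(2) by (intro mult_right_mono) simp_all
  finally have "real (T n) \<le> real (n ^ Suc k)" by simp
  then show ?case by (simp only: of_nat_le_iff)
 qed
qed

lemma power_floor:
 fixes n K a :: nat
 assumes "0 < K" "a ^ K \<le> n"
 shows "\<exists>m\<ge>a. m ^ K \<le> n \<and> n < (m + 1) ^ K"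
proof -
 have ex: "n < (n + 1) ^ K" using self_le_power[of "n + 1" K] assms(1) by simp
 define m where "m = (LEAST m. n < (m + 1) ^ K)"
 have m: "n < (m + 1) ^ K" unfolding m_def by (rule LeastI[of "\<lambda>m. n < (m + 1) ^ K", OF ex])
 have "m ^ K \<le> n"
 proof (cases m)
  case 0
  then show ?thesis using assms(1) by (simp add: zero_power)
 next
  case (Suc j)
  then show ?thesis using not_less_Least[of j "\<lambda>m. n < (m + 1) ^ K"] by (simp add: m_def)
 qed
 moreover have "a \<le> m"
 proof (rule ccontr)
  assume "\<not> a \<le> m"
  then have "(m + 1) ^ K \<le> a ^ K" by (intro power_mono) simp_all
  then show False using m assms(2) by simp
 qed
 ultimately show ?thesis using m by blast
qed

text \<open>\<open>Z\<close> is to bound every number that the attacker's coins have to name; of its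
  exponent, \<open>D + 3\<close> is for the nodes of the tree and \<open>k0 + 1\<close> for the
  coins of a vote.\<close>

lemma attack_size:
 fixes n D T' Bl k0 bd :: nat
 assumes "200 \<le> n" "12 * T' + 24 \<le> n" "13 * (6 * T' + 13) \<le> n" "Bl \<le> n ^ (k0 + 1)"
 defines "Z \<equiv> n ^ (D + k0 + 5)"
 shows "n \<le> Z" "13 * (6 * T' + 13) \<le> Z" "Bl \<le> Z" "2 + 2 * (6 * T' + 11) * (64 * n ^ D * (2 * n + 1)) \<le> Z"
proof -
 show nZ: "n \<le> Z" unfolding Z_def using assms(1) by (intro self_le_power) simp_all
 then show "13 * (6 * T' + 13) \<le> Z" using assms(3) by simp
 have "n ^ (k0 + 1) \<le> Z" unfolding Z_def using assms(1) by (intro power_increasing) simp_all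
 then show "Bl \<le> Z" using assms(4) by simp
 have h: "64 * n ^ D * (2 * n + 1) \<le> n ^ D * (n * n)"
  using mult_le_mono2[of "64 * (2 * n + 1)" "n * n" "n ^ D"] mult_le_mono1[OF assms(1), of n] assms(1) by (simp add: algebra_simps)
 have "2 * (6 * T' + 11) \<le> n - 2" using assms(2) by simp
 from mult_le_mono[OF this h] have "2 * (6 * T' + 11) * (64 * n ^ D * (2 * n + 1)) \<le> (n - 2) * (n ^ D * (n * n))" .
 moreover have "2 \<le> 2 * (n ^ D * (n * n))" using assms(1) by (simp add: Suc_le_eq)
 moreover have "(n - 2) * (n ^ D * (n * n)) + 2 * (n ^ D * (n * n)) = n * (n ^ D * (n * n))"
 proof -
  have "n - 2 + 2 = n" using assms(1) by simp
  then show ?thesis by (simp only: add_mult_distrib[symmetric])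
 qed
 ultimately have "2 + 2 * (6 * T' + 11) * (64 * n ^ D * (2 * n + 1)) \<le> n * (n ^ D * (n * n))" by linarith
 also have "\<dots> = n ^ (D + 3)" by (simp add: power_add power3_eq_cube)
 also have "\<dots> \<le> Z" unfolding Z_def using assms(1) by (intro power_increasing) simp_all
 finally show "2 + 2 * (6 * T' + 11) * (64 * n ^ D * (2 * n + 1)) \<le> Z" .
qed

text \<open>The powers of \<open>m\<close> absorb constants: \<open>2 ^ 5\<close> in the number of
  coins, and 2^28 = 8 * 8^5 * 4^5 in the loss of probability, which also contains Z^11.\<close>

lemma attack_cost:
 fixes m Z g :: nat
 assumes "2 \<le> m" "1 \<le> Z" "Z \<le> m ^ g"
 shows "Z\<^sup>2 + 20 * Z + 10 \<le> (2 * m + 1) ^ (2 * g + 5)" "8 * Z * (8 * (Z + 1)\<^sup>2) ^ 5 \<le> m ^ (28 + 11 * g)"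
proof -
 have m5: "2 ^ j \<le> m ^ j" for j using assms(1) by (rule power_mono) simp
 have Z1: "Z \<le> Z\<^sup>2" "1 \<le> Z\<^sup>2" using assms(2) by (simp_all add: power2_eq_square)
 have "Z\<^sup>2 + 20 * Z + 10 \<le> 2 ^ 5 * Z\<^sup>2" using Z1 by simp
 also have "\<dots> \<le> m ^ 5 * (m ^ g)\<^sup>2" using m5[of 5] assms(1,3) by (intro mult_le_mono power_mono) simp_all
 also have "\<dots> = m ^ (2 * g + 5)" by (simp add: power_add power_mult mult.commute)
 also have "\<dots> \<le> (2 * m + 1) ^ (2 * g + 5)" by (intro power_mono) simp_all
 finally show "Z\<^sup>2 + 20 * Z + 10 \<le> (2 * m + 1) ^ (2 * g + 5)" .
 have "8 * (Z + 1)\<^sup>2 \<le> 8 * (2 * Z)\<^sup>2" using assms(2) by (intro mult_le_mono2 power_mono) simp_all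
 from power_mono[OF this, of 5] have "8 * Z * (8 * (Z + 1)\<^sup>2) ^ 5 \<le> 8 * Z * (8 * (2 * Z)\<^sup>2) ^ 5" by (intro mult_le_mono2) simp
 also have "\<dots> = 2 ^ 28 * Z ^ 11" using power_Suc[of Z 10] by (simp add: power_mult_distrib flip: power_mult)
 also have "\<dots> \<le> m ^ 28 * (m ^ g) ^ 11" using m5[of 28] assms(1,3) by (intro mult_le_mono power_mono) simp_all
 also have "\<dots> = m ^ (28 + 11 * g)" by (simp only: power_add power_mult[symmetric] mult.commute)
 finally show "8 * Z * (8 * (Z + 1)\<^sup>2) ^ 5 \<le> m ^ (28 + 11 * g)" .
qed

lemma clock_suffices:
 fixes l w d :: nat
 assumes "8000 * w \<le> l" "1 \<le> l"
 shows "1000 * w * (l ^ d + 1) ^ 3 \<le> l ^ (3 * d + 1)"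
proof -
 have "l ^ d + 1 \<le> 2 * l ^ d" using assms(2) by (simp add: Suc_le_eq)
 then have "1000 * w * (l ^ d + 1) ^ 3 \<le> 1000 * w * (2 * l ^ d) ^ 3" by (intro mult_le_mono2 power_mono) simp_all
 also have "\<dots> = 8000 * w * (l ^ d) ^ 3" by (simp add: power_mult_distrib)
 also have "\<dots> \<le> l * (l ^ d) ^ 3" using assms(1) by (rule mult_le_mono1)
 also have "\<dots> = l ^ (3 * d + 1)" by (simp add: power_mult[symmetric] mult.commute)
 finally show ?thesis .
qed

lemma power_le_exp: "\<forall>\<^sub>F n :: nat in sequentially. n ^ D \<le> 2 ^ n"
proof -
 have "\<forall>\<^sub>F n :: nat in sequentially. real n ^ D \<le> 2 ^ n" by real_asymp
 then show ?thesis
 proof eventually_elim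
  case (elim n)
  then have "real (n ^ D) \<le> real (2 ^ n)" by simp
  then show ?case by (simp only: of_nat_le_iff)
 qed
qed

theorem proposition2p1:
  fixes M U V :: tm and c e :: real and t :: "nat \<Rightarrow> nat"
  assumes "optimal_machine M"
    and "optimal_pair U V"
    and "c > 3"
    and "(\<lambda>n. real (t n)) \<in> \<omega>(\<lambda>n. real n * log 2 (real n))"
    and "(Y_set M U V t c, N_set M e) \<in> ioBPP"
  shows "\<not> (\<exists>P. key_agreement P)"
proof
 assume "\<exists>P. key_agreement P"
 then obtain P k where tb: "time_bounded (\<lambda>n. n ^ k) P"
  and ka: "\<And>c :: real. c > 0 \<Longrightarrow> has_agreement (\<lambda>n. 1 - 1 / real n powr c) P"
   "\<And>c :: real. c > 0 \<Longrightarrow> secure (\<lambda>n. 1 / real n powr c) P" unfolding key_agreement_def by blast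
 obtain A B and T :: "nat \<Rightarrow> nat" and F where AB: "wf_tm A" "wf_tm B" and T: "(\<lambda>n. real (T n)) \<in> O(\<lambda>n. real n ^ k)"
  and F: "\<And>n r s. length r = T n \<Longrightarrow> length s = T n \<Longrightarrow>
    interaction A B (replicate n False) (replicate n False) ((!) r) ((!) s) (real (T n)) (F n (r, s))"
   "\<And>n. P n = map_pmf (F n) (pair_pmf (coin_flips (T n)) (coin_flips (T n)))"
  using tb unfolding time_bounded_def of_nat_power by metis
 obtain A0 where A0: "ppt A0" and io: "\<exists>\<^sub>\<infinity> n. (\<forall>z\<in>Y_set M U V t c. length z = n \<longrightarrow> pmf (A0 z) [True] \<ge> 2 / 3) \<and>
   (\<forall>z\<in>N_set M e. length z = n \<longrightarrow> pmf (A0 z) [False] \<ge> 2 / 3)"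
  using assms(5) unfolding ioBPP_def by blast
 obtain N0 and T0 :: "nat \<Rightarrow> nat" and k0 out where N0: "wf_tm N0" and T0: "(\<lambda>n. real (T0 n)) \<in> O(\<lambda>n. real n ^ k0)"
  and out: "\<And>w r. length r = T0 (length w) \<Longrightarrow> runs N0 ((!) r) w (T0 (length w)) (out w r)"
   "\<And>w. A0 w = map_pmf (out w) (coin_flips (T0 (length w)))" using A0 unfolding ppt_def by metis
 obtain E :: nat where E: "e \<le> real E" using real_arch_simple by blast
 obtain c0 where c0: "\<And>\<pi> x a b. masked_run A B a b (real (40 * length (\<pi> @ x) + 2)) (\<pi>, x, x) \<Longrightarrow>
  real c0 * real (40 * length (\<pi> @ x) + 2) * log 2 (real (40 * length (\<pi> @ x) + 2)) \<le> real (t (length (\<pi> @ x))) \<Longrightarrow>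
  CI U V (\<lambda>n. real (t n)) \<pi> x \<le> enat (length a + length b + c0)"
  using CI_le_party[OF assms(2) wf_party[of A] wf_party[of B], of "\<lambda>N. 40 * N + 2" t] by auto
 obtain c1 where c1: "\<And>a b T \<pi> x y. masked_run A B a b T (\<pi>, x, y) \<Longrightarrow>
  C_plain M \<pi> \<le> enat (length (numcode (length a)) + length a + length b + c1)"
  using C_le_party[OF assms(1) wf_party(1)[of A] wf_party(1)[of B]] by blast
 \<comment> \<open>With Q = m^(k + 2), \<open>m ^ K\<close> is m Q^20, and the spare factor m
   absorbs the constant 2^(77 + c0 + c1). As n < (m + 1)^K \<le> m^(2K), the bound n^z on the
   attacker's numbers is at most m^g.\<close>
 define K D z g d where "K = 20 * (k + 2) + 1" and "D = E + 3" and "z = D + k0 + 5" and "g = 2 * K * z" and "d = 2 * g + 5"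
 \<comment> \<open>The attacker is fixed before \<open>m\<close> and \<open>n\<close>: it depends on
   the decider and the exponents only, so security applies to it.\<close>
 obtain Att where Att: "ppt Att" "searches N0 d (3 * d + 1) Att" using ppt_search[OF N0] by blast
 \<comment> \<open>One more than the exponent 28 + 11g in the success probability, which leads to
   the contradiction 1 \<le> 1 / m.\<close>
 let ?c = "real (29 + 11 * g)"
 have "\<forall>\<^sub>F m in sequentially. T m \<le> m ^ Suc k \<and> measure_pmf.prob (P m) {(\<pi>, x, y). x = y} \<ge> 1 - 1 / real m powr 1 \<and>
   measure_pmf.prob (bind_pmf (P m) (\<lambda>(\<pi>, x, y).
     map_pmf (\<lambda>g. (g, x)) (Att (encode_pair (replicate m False) \<pi>)))) {(g, x). g = x} \<le> 1 / real m powr ?c"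
  using poly_bound[OF T] ka(1)[of 1] ka(2)[of ?c] Att(1) unfolding has_agreement_def secure_def
  by (intro eventually_conj) simp_all
 then obtain m1 where m1: "\<And>m. m1 \<le> m \<Longrightarrow> T m \<le> m ^ Suc k"
  "\<And>m. m1 \<le> m \<Longrightarrow> measure_pmf.prob (P m) {(\<pi>, x, y). x = y} \<ge> 1 - 1 / real m powr 1"
  "\<And>m. m1 \<le> m \<Longrightarrow> measure_pmf.prob (bind_pmf (P m) (\<lambda>(\<pi>, x, y).
     map_pmf (\<lambda>g. (g, x)) (Att (encode_pair (replicate m False) \<pi>)))) {(g, x). g = x} \<le> 1 / real m powr ?c"
  unfolding eventually_sequentially by blast
 have "\<forall>\<^sub>F n in sequentially. T0 n \<le> n ^ Suc k0 \<and> n ^ D \<le> 2 ^ n"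
  using poly_bound[OF T0] power_le_exp by (rule eventually_conj)
 then obtain n1 where n1: "\<And>n. n1 \<le> n \<Longrightarrow> T0 n \<le> n ^ Suc k0 \<and> n ^ D \<le> 2 ^ n"
  unfolding eventually_sequentially by blast
 obtain n2 where n2: "\<And>N. n2 \<le> N \<Longrightarrow> real c0 * real (40 * N + 2) * log 2 (real (40 * N + 2)) \<le> real (t N)"
  using time_condition[OF assms(4), of c0] unfolding eventually_sequentially by blast
 define m0 where "m0 = Max {m1, n1, 2 * n2, 2 ^ (77 + c0 + c1), 8000 * (num_work N0 + 5), 200}"
 have m0: "m1 \<le> m0" "n1 \<le> m0" "2 * n2 \<le> m0" "2 ^ (77 + c0 + c1) \<le> m0" "8000 * (num_work N0 + 5) \<le> m0" "200 \<le> m0"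
  unfolding m0_def by (simp_all del: Max_insert)
 obtain n where nm0: "m0 ^ K \<le> n" and n:
  "\<And>y. y \<in> Y_set M U V t c \<Longrightarrow> length y = n \<Longrightarrow> pmf (A0 y) [True] \<ge> 2 / 3"
  "\<And>y. y \<in> N_set M e \<Longrightarrow> length y = n \<Longrightarrow> pmf (A0 y) [False] \<ge> 2 / 3"
  using io unfolding INFM_nat_le by blast
 \<comment> \<open>The decider is reliable at length \<open>n\<close>, so the security parameter
   follows \<open>n\<close>: it is the largest \<open>m\<close> with
   \<open>m ^ K \<le> n\<close>.\<close>
 obtain m where m: "m0 \<le> m" "m ^ K \<le> n" "n < (m + 1) ^ K" using power_floor[OF _ nm0] by (auto simp: K_def)
 have mg: "200 \<le> m" using m0(6) m(1) by simp
 have mn: "m \<le> n" using self_le_power[of m K] mg m(2) by (simp add: K_def)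
 define Q where "Q = m ^ (k + 2)"
 have TQ: "7 * T m + 12 \<le> Q"
 proof -
  have "1 \<le> m ^ Suc k" using mg by (simp add: Suc_le_eq)
  then have "7 * m ^ Suc k + 12 \<le> 19 * m ^ Suc k" by linarith
  also have "\<dots> \<le> m * m ^ Suc k" using mg by (intro mult_le_mono1) simp
  finally show ?thesis using m1(1)[of m] m0(1) m(1) by (simp add: Q_def)
 qed
 have "2 ^ (77 + c0 + c1) * Q ^ 20 \<le> m * m ^ (20 * (k + 2))"
  unfolding Q_def power_mult[symmetric] using m0(4) m(1) by (intro mult_le_mono) (simp_all add: mult.commute)
 also have "\<dots> \<le> n" using m(2) by (simp only: K_def Suc_eq_plus1[symmetric] power_Suc)
 finally have nQ: "2 ^ (77 + c0 + c1) * Q ^ 20 \<le> n" .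
 note par = attack_parameters[OF TQ nQ]
 define W where "W = (n - 6 * T m - 9) div 4"
 have majority: "2 * 2 ^ T0 n \<le> 3 * card {b \<in> strs (T0 n). out y b = v}" if "2 / 3 \<le> pmf (A0 y) v" "length y = n" for y v
 proof -
  have "2 / 3 \<le> real (card {b \<in> strs (T0 n). out y b = v}) / 2 ^ T0 n"
   using that unfolding out(2) pmf_coin_flips by simp
  then have "real (2 * 2 ^ T0 n) \<le> real (3 * card {b \<in> strs (T0 n). out y b = v})" by (simp add: field_simps)
  then show ?thesis by (simp only: of_nat_le_iff)
 qed
 interpret att: io_attack A B m "T m" "F m" M U V t c e n W Q c0 c1 E D N0 "T0 n" out
 proof unfold_locales
  show "wf_tm A" "wf_tm B" "wf_tm N0" "3 < c" "e \<le> real E" "7 * T m + 12 \<le> Q" by fact+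
  show "interaction A B (replicate m False) (replicate m False) ((!) r) ((!) s) (real (T m)) (F m (r, s))"
   if "r \<in> strs (T m)" "s \<in> strs (T m)" for r s using F(1) that by simp
  show "m \<le> Q" unfolding Q_def using mg by (intro self_le_power) simp_all
  show "CI U V (\<lambda>n. real (t n)) \<pi> x \<le> enat (length a + length b + c0)"
   if "masked_run A B a b (party_time Q W) (\<pi>, x, x)"
    "n \<le> 2 * length (\<pi> @ x)" "length (\<pi> @ x) \<le> n" for \<pi> x a b
  proof (rule c0)
   show "masked_run A B a b (real (40 * length (\<pi> @ x) + 2)) (\<pi>, x, x)"
    by (rule interaction_mono[OF that(1)], rule of_nat_mono) (use par(5) that(2) in \<open>unfold W_def, linarith\<close>)
   show "real c0 * real (40 * length (\<pi> @ x) + 2) * log 2 (real (40 * length (\<pi> @ x) + 2)) \<le> real (t (length (\<pi> @ x)))"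
    by (rule n2) (use that(2) m0(3) m(1) mn in linarith)
  qed
  show "0 < T0 n"
  proof (rule ccontr)
   assume "\<not> 0 < T0 n"
   then have "runs N0 ((!) []) (replicate n False) 0 (out (replicate n False) [])" using out(1)[of "[]" "replicate n False"] by simp
   then show False by (simp add: runs_def init_conf_def halted_def)
  qed
  show "runs N0 ((!) b) y (T0 n) (out y b)" if "length y = n" "b \<in> strs (T0 n)" for y b
   using out(1)[of b y] that by simp
  show "n ^ D \<le> 2 ^ n" using n1[of n] m0(2) m(1) mn by simp
 qed (use par c1 majority n in \<open>simp_all only: W_def D_def mem_Collect_eq\<close>)
 define Z where "Z = n ^ z"
 have n200: "200 \<le> n" using mg mn by simp
 have "1000 * Q \<le> n"
 proof -
  have "1 \<le> Q" using TQ by simp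
  then have "2 ^ 10 * Q \<le> 2 ^ (77 + c0 + c1) * Q ^ 20" by (intro mult_le_mono power_increasing self_le_power) simp_all
  then show ?thesis using nQ by simp
 qed
 then have sz: "12 * T m + 24 \<le> n" "13 * (6 * T m + 13) \<le> n" using TQ by simp_all
 have "T0 n \<le> n ^ (k0 + 1)" using n1[of n] m0(2) m(1) mn by simp
 note size = attack_size[OF n200 sz this, of D, folded z_def Z_def]
 have Zg: "Z \<le> m ^ g"
 proof -
  have "m + 1 \<le> m\<^sup>2" using mg mult_le_mono1[of 2 m m] unfolding power2_eq_square by linarith
  then have "(m + 1) ^ K \<le> (m\<^sup>2) ^ K" by (rule power_mono) simp
  then have "n \<le> m ^ (2 * K)" using m(3) by (simp add: power_mult)
  then have "Z \<le> (m ^ (2 * K)) ^ z" unfolding Z_def by (rule power_mono) simp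
  then show ?thesis by (simp add: g_def power_mult)
 qed
 have Z1: "1 \<le> Z" using size(1) n200 by simp
 note cost = attack_cost[OF _ Z1 Zg]
 note prob = coin_pairs_prob[OF F(2)[of m]]
 let ?good = "\<Sum>q\<in>att.coin_pairs. pmf (Att (encode_pair (replicate m False) (fst (F m q)))) (fst (snd (F m q)))"
 have agree: "7 * 4 ^ T m \<le> 8 * card {q \<in> att.coin_pairs. fst (snd (F m q)) = snd (snd (F m q))}"
 proof -
  have e1: "1 - 1 / real m \<le> real (card {q \<in> att.coin_pairs. F m q \<in> {(\<pi>, x, y). x = y}}) / 4 ^ T m"
   using m1(2)[of m] m0(1) m(1) mg unfolding prob(1) by simp
  have e2: "7 / 8 \<le> 1 - 1 / real m" using mg by (simp add: field_simps)
  have e3: "{q \<in> att.coin_pairs. F m q \<in> {(\<pi>, x, y). x = y}} = {q \<in> att.coin_pairs. fst (snd (F m q)) = snd (snd (F m q))}"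
   by (simp add: case_prod_beta)
  from order_trans[OF e2 e1[unfolded e3]]
  have "7 / 8 \<le> real (card {q \<in> att.coin_pairs. fst (snd (F m q)) = snd (snd (F m q))}) / 4 ^ T m" .
  then have "real (7 * 4 ^ T m) \<le> real (8 * card {q \<in> att.coin_pairs. fst (snd (F m q)) = snd (snd (F m q))})" by (simp add: field_simps)
  then show ?thesis by (simp only: of_nat_le_iff)
 qed
 have "4 ^ T m \<le> real (8 * Z * (8 * (Z + 1)\<^sup>2) ^ 5) * ?good"
 proof (rule att.success[OF Att(2) _ _ size(2,3) _ _ _ _ agree])
  show "2 * W \<le> Z" "6 * T m + 11 \<le> Z" using par(1) size(1,2) by (simp_all add: W_def)
  show "2 + 2 * (6 * T m + 11) * att.bound \<le> Z" using size(4) by (simp only: att.bound_def)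
  show "Z\<^sup>2 + 20 * Z + 10 \<le> (2 * m + 1) ^ d" unfolding d_def by (rule cost(1)) (use mg in simp)
  show "0 < d" by (simp add: d_def)
  show "1000 * (num_work N0 + 5) * (l ^ d + 1) ^ 3 \<le> l ^ (3 * d + 1)" if "2 * m + 1 \<le> l" for l
   by (rule clock_suffices) (use that m0(5) m(1) in simp_all)
 qed
 also have "\<dots> \<le> real (m ^ (28 + 11 * g)) * ?good"
  using cost(2) mg by (intro mult_right_mono of_nat_mono sum_nonneg) simp_all
 finally have "1 \<le> real m ^ (28 + 11 * g) * (?good / 4 ^ T m)" by (simp add: field_simps)
 also have "\<dots> \<le> real m ^ (28 + 11 * g) * (1 / real m powr ?c)"
  using m1(3)[of m] m0(1) m(1) unfolding prob(2) by (intro mult_left_mono) simp_all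
 also have "\<dots> = 1 / real m"
  using mg powr_realpow[of "real m" "29 + 11 * g"] by (simp add: power_add eval_nat_numeral)
 finally show False using mg by simp
qed

end
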